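(* One has $$H_3=C_3+\tilde C_3+\bar C_{3,\{1\}\{2,3\}}+\bar C_{3,\{2\}\{1,3\}}+\bar C_{3,\{3\}\{1,2\}},$$ where $$\bar C_{3,\{1\}\{2,3\}}(Y_1,Y_2,Y_3)=Y_2Y_3\frac{\partial}{\partial Y_2}\frac{\partial}{\partial Y_3}\left[\frac{Y_3C_2(Y_1,Y_2)-Y_2C_2(Y_1,Y_3)}{Y_2C_1(Y_3)-Y_3C_1(Y_2)}\right],$$ and similarly (by permuting the indices) for $\bar C_{3,\{2\}\{1,3\}}$ and $\bar C_{3,\{3\}\{1,2\}}$, and $$\tilde C_3(Y_1,Y_2,Y_3)=Y_1Y_2Y_3\frac{\partial}{\partial Y_1}\frac{\partial}{\partial Y_2}\frac{\partial}{\partial Y_3}\Biggl[\frac{(1+\hat C(Y_1,Y_2,Y_3))^2+\hat C(Y_1,Y_2)\hat C(Y_1,Y_3)\hat C(Y_2,Y_3)-1}{(1-\hat C(Y_1,Y_2))(1-\hat C(Y_1,Y_3))(1-\hat C(Y_2,Y_3))}+\sum_{(a;b,c)}\frac{Y_a^2\frac{\partial}{\partial Y_a}\bigl(\frac1{Y_a}\hat C(Y_1,Y_2,Y_3)\bigr)}{(1-\hat C(Y_a,Y_b))(1-\hat C(Y_a,Y_c))}\Biggr],$$ where the last sum has three terms, $(a;b,c)\in\{(1;2,3),(2;1,3),(3;2,1)\}$, and $$\hat C(Y_1,Y_2)=1+\frac{Y_1}{Y_2-Y_1}C_1(Y_2)+\frac{Y_2}{Y_1-Y_2}C_1(Y_1),$$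 $$\hat C(Y_1,Y_2,Y_3)=\frac{Y_3}{Y_2-Y_3}\hat C(Y_1,Y_2)+\frac{Y_2}{Y_3-Y_2}\hat C(Y_1,Y_3).$$
   Context: $\kappa_{k_1,\dots,k_d}$ ($d\ge1$, $k_i\ge1$) denote the order-$d$ free cumulants, symmetric in their indices, which may be regarded as commuting indeterminates. $C_1(Y)=1+\sum_{a\ge1}\kappa_aY^a$, and $C_d(Y_1,\dots,Y_d)=\sum_{a_1,\dots,a_d\ge1}\kappa_{a_1,\dots,a_d}Y_1^{a_1}\cdots Y_d^{a_d}$ for $d\ge2$. For permutations $\sigma_1,\sigma_2$ of a finite set with $m$ elements, $\#$ is the number of cycles (or of blocks of a partition), $\Pi(\sigma)$ the partition into cycles, $\vee$ the join of partitions, and the genus is given by $\#(\sigma_1)+\#(\sigma_2)+\#(\sigma_1\sigma_2)-m=2\#(\Pi(\sigma_1)\vee\Pi(\sigma_2))-2g(\sigma_1,\sigma_2)$. For a permutation $\tau$ of a finite set $E$, $\mathrm{NS}(\tau)$ is the set of permutations $\nu$ of $E$ with $g(\nu,\tau)=0$, $\Pi(\tau)\vee\Pi(\nu)$ the one-block partition of $E$, and such that for any two distinct elements $b,d$ of the same cycle of $\tau$, $\Pi(\tau\circ(b\,d))\vee\Pi(\nu)$ is still the one-block partition (no white cut-vertex). For positive integers $\mu_G=(\mu_i)_{i\in G}$, $\mathrm{NS}(\mu_G)=\mathrm{NS}(\gamma_{\mu_G})$ where $\gamma_{\mu_G}$ is a permutation with exactly one cycle per $i\in G$, of length $\mu_i$.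 For $I=\{1,\dots,p\}$, $\mathcal P^*(I)$ is the set of partitions $\bar\pi$ of $I$ other than the partition into singletons. $\mathcal G_{\bar\pi}$ is the set of bipartite trees $T$ whose white vertices are the blocks of $\bar\pi$ and whose other ("blue") vertices have valency at least 2 and form the set $\mathcal I(T)$, each $K\in\mathcal I(T)$ being identified with the set of blocks of $\bar\pi$ adjacent to it (if $\bar\pi$ has one block, the only tree has no blue vertex). $\mathcal I_G(T)=\{K\in\mathcal I(T):G\in K\}$. Define $$\bar C_{p,\bar\pi,T}(Y_1,\dots,Y_p)=\sum_{\mu_1,\dots,\mu_p\ge1}\prod_iY_i^{\mu_i}\sum_{\{\nu_G\in\mathrm{NS}(\mu_G)\}_{G\in\bar\pi}}\ \sum_{\{\mathcal L_G\}_{G\in\bar\pi}}\ \prod_{K\in\mathcal I(T)}\kappa_{\{|\mathcal L_G(K)|\}_{G\in K}}\prod_{G\in\bar\pi}\ \prod_{V\in\Pi(\nu_G)\setminus\mathcal L_G(\mathcal I_G(T))}\kappa_{|V|},$$ where each $\mathcal L_G$ runs over injective maps $\mathcal I_G(T)\to\Pi(\nu_G)$. When $T$ has exactly one blue vertex this is denoted $\bar C_{p,\bar\pi}$; when $\bar\pi$ has a single block it is denoted $\tilde C_p$, that is $\tilde C_p=\sum_{\mu}\prod_iY_i^{\mu_i}\sum_{\nu\in\mathrm{NS}(\mu_1,\dots,\mu_p)}\prod_{V\in\Pi(\nu)}\kappa_{|V|}$. Finally $$H_p=C_p+\sum_{\bar\pi\in\mathcal P^*(\{1,\dots,p\})}\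 \sum_{T\in\mathcal G_{\bar\pi}}\bar C_{p,\bar\pi,T}.$$ *)

theory Defs
  imports
    "HOL-Computational_Algebra.Computational_Algebra"
    "HOL-Combinatorics.Combinatorics"
    "HOL-Library.Multiset"
    "HOL-Library.FuncSet"
    "HOL-Library.Disjoint_Sets"
begin

section \<open>Permutations, genus and non-separable permutations\<close>

definition cycle_partition :: "'b set \<Rightarrow> ('b \<Rightarrow> 'b) \<Rightarrow> 'b set set" where
  "cycle_partition E \<sigma> = orbit \<sigma> ` E"

text \<open>The join of two partitions of the same set.  The lemma \<open>join_is_lub\<close> below states that this
  is the least upper bound for refinement.\<close>

definition partition_join :: "'b set set \<Rightarrow> 'b set set \<Rightarrow> 'b set set" where
  "partition_join P Q = \<Union>(P \<union> Q) // (\<Union>X\<in>P \<union> Q. X \<times> X)\<^sup>+"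

lemma join_is_lub:
  assumes P: "partition_on E P" and Q: "partition_on E Q"
  shows "refines E P (partition_join P Q)" and "refines E Q (partition_join P Q)"
    and "\<And>R. refines E P R \<Longrightarrow> refines E Q R \<Longrightarrow> refines E (partition_join P Q) R"
proof -
  let ?r = "\<Union>X\<in>P \<union> Q. X \<times> X"
  have UE: "\<Union>(P \<union> Q) = E" using P Q by (auto simp: partition_on_def)
  have rE: "?r \<subseteq> E \<times> E" using UE by blast
  have sym: "sym (?r\<^sup>+)" by (rule sym_trancl) (auto simp: sym_def)
  have refl: "refl_on E (?r\<^sup>+)"
    using UE by (auto simp: refl_on_def intro: r_into_trancl)
  have sub: "?r\<^sup>+ \<subseteq> E \<times> E" using trancl_subset_Sigma[OF rE] .
  have eq: "equiv E (?r\<^sup>+)"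
    using sym refl sub by (auto intro!: equivI simp: trans_trancl)
  have part: "partition_on E (partition_join P Q)"
    unfolding partition_join_def UE by (rule partition_on_quotient[OF eq])
  have up: "\<exists>Y\<in>partition_join P Q. X \<subseteq> Y" if X: "X \<in> P \<union> Q" for X
  proof -
    have "X \<noteq> {}" using X P Q by (auto simp: partition_on_def)
    then obtain x where x: "x \<in> X" by blast
    have "x \<in> E" using x X UE by blast
    moreover have "X \<subseteq> ?r\<^sup>+ `` {x}" using x X by (auto intro!: r_into_trancl)
    ultimately show ?thesis unfolding partition_join_def UE by (auto simp: quotient_def)
  qed
  show "refines E P (partition_join P Q)" "refines E Q (partition_join P Q)"
    using part up P Q by (auto simp: refines_def)
  fix R assume R1: "refines E P R" and R2: "refines E Q R"
  have pR: "partition_on E R" using R1 by (simp add: refines_def)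
  have step: "b \<in> Z \<longleftrightarrow> a \<in> Z" if "(a, b) \<in> ?r" "Z \<in> R" for a b Z
  proof -
    obtain X where X: "X \<in> P \<union> Q" "a \<in> X" "b \<in> X" using \<open>(a, b) \<in> ?r\<close> by auto
    obtain W where W: "W \<in> R" "X \<subseteq> W" using X(1) R1 R2 by (auto simp: refines_def)
    have "W = Z \<or> disjnt W Z" using pR W(1) \<open>Z \<in> R\<close>
      by (auto simp: partition_on_def pairwise_def)
    then show ?thesis using X W by (auto simp: disjnt_def)
  qed
  have steps: "b \<in> Z \<longleftrightarrow> a \<in> Z" if "(a, b) \<in> ?r\<^sup>+" "Z \<in> R" for a b Z
    using that by (induction rule: trancl_induct) (use step in blast)+
  show "refines E (partition_join P Q) R"
    unfolding refines_def
  proof (intro conjI part pR ballI)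
    fix X assume "X \<in> partition_join P Q"
    then obtain x where x: "x \<in> E" "X = ?r\<^sup>+ `` {x}"
      unfolding partition_join_def UE by (auto simp: quotient_def)
    then obtain Z where "Z \<in> R" "x \<in> Z" using pR by (auto simp: partition_on_def)
    then show "\<exists>Y\<in>R. X \<subseteq> Y" using steps x(2) by blast
  qed
qed

text \<open>Rational-valued, so that the defining relation
  \<open>#\<sigma>\<^sub>1 + #\<sigma>\<^sub>2 + #(\<sigma>\<^sub>1\<sigma>\<^sub>2) - m = 2 #(\<Pi>(\<sigma>\<^sub>1) \<or> \<Pi>(\<sigma>\<^sub>2)) - 2g\<close> can be solved for \<open>g\<close> without
  truncation.\<close>

definition genus :: "'b set \<Rightarrow> ('b \<Rightarrow> 'b) \<Rightarrow> ('b \<Rightarrow> 'b) \<Rightarrow> rat" where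
  "genus E \<sigma>1 \<sigma>2 =
     of_nat (card (partition_join (cycle_partition E \<sigma>1) (cycle_partition E \<sigma>2)))
     - (of_nat (card (cycle_partition E \<sigma>1)) + of_nat (card (cycle_partition E \<sigma>2))
        + of_nat (card (cycle_partition E (\<sigma>1 \<circ> \<sigma>2))) - of_nat (card E)) / 2"

definition NS :: "'b set \<Rightarrow> ('b \<Rightarrow> 'b) \<Rightarrow> ('b \<Rightarrow> 'b) set" where
  "NS E \<tau> = {\<nu>. \<nu> permutes E \<and> genus E \<nu> \<tau> = 0
     \<and> partition_join (cycle_partition E \<tau>) (cycle_partition E \<nu>) = {E}
     \<and> (\<forall>Z\<in>cycle_partition E \<tau>. \<forall>b\<in>Z. \<forall>d\<in>Z. b \<noteq> d \<longrightarrow>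
          partition_join (cycle_partition E (\<tau> \<circ> transpose b d)) (cycle_partition E \<nu>) = {E})}"

text \<open>The chosen permutation \<open>\<gamma>\<close> with one cycle of length \<open>\<mu> i\<close> for each \<open>i \<in> G\<close>: the cycle of
  \<open>i\<close> is \<open>(i,0) \<mapsto> (i,1) \<mapsto> \<dots> \<mapsto> (i, \<mu> i - 1) \<mapsto> (i,0)\<close>.\<close>

definition ground :: "nat set \<Rightarrow> (nat \<Rightarrow> nat) \<Rightarrow> (nat \<times> nat) set" where
  "ground G \<mu> = (SIGMA i:G. {..<\<mu> i})"

definition gamma_perm :: "nat set \<Rightarrow> (nat \<Rightarrow> nat) \<Rightarrow> nat \<times> nat \<Rightarrow> nat \<times> nat" where
  "gamma_perm G \<mu> x =
     (if x \<in> ground G \<mu> then (fst x, Suc (snd x) mod \<mu> (fst x)) else x)"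

definition NS_mu :: "nat set \<Rightarrow> (nat \<Rightarrow> nat) \<Rightarrow> (nat \<times> nat \<Rightarrow> nat \<times> nat) set" where
  "NS_mu G \<mu> = NS (ground G \<mu>) (gamma_perm G \<mu>)"

abbreviation cycles_of :: "nat set \<Rightarrow> (nat \<Rightarrow> nat) \<Rightarrow> (nat \<times> nat \<Rightarrow> nat \<times> nat) \<Rightarrow> (nat \<times> nat) set set"
  where "cycles_of G \<mu> \<nu> \<equiv> cycle_partition (ground G \<mu>) \<nu>"


section \<open>Bipartite trees over the blocks of a partition\<close>

text \<open>Undirected simple graphs, edges being two-element sets of vertices.  (The constant
  \<open>tree\<close> of AFP Graph-Theory only excludes directed cycles and is therefore not used.)\<close>

definition is_tree :: "'v set \<Rightarrow> 'v set set \<Rightarrow> bool" where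
  "is_tree V E \<longleftrightarrow> V \<noteq> {}
     \<and> (\<forall>u\<in>V. \<forall>v\<in>V. (u, v) \<in> {(x, y). {x, y} \<in> E}\<^sup>*)
     \<and> (\<nexists>xs. 3 \<le> length xs \<and> distinct xs \<and> successively (\<lambda>x y. {x, y} \<in> E) xs
            \<and> {last xs, hd xs} \<in> E)"

text \<open>A blue vertex is identified with its set of neighbours, so a tree is given by its set \<open>T\<close> of
  blue vertices.  White vertices are tagged \<open>Inl\<close>, blue ones \<open>Inr\<close>.\<close>

definition bip_vertices :: "'b set \<Rightarrow> 'b set set \<Rightarrow> ('b + 'b set) set" where
  "bip_vertices \<pi> T = Inl ` \<pi> \<union> Inr ` T"

definition bip_edges :: "'b set set \<Rightarrow> ('b + 'b set) set set" where
  "bip_edges T = {{Inl G, Inr K} |G K. K \<in> T \<and> G \<in> K}"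

definition bip_trees :: "'b set \<Rightarrow> 'b set set set" where
  "bip_trees \<pi> = {T. (\<forall>K\<in>T. K \<subseteq> \<pi> \<and> 2 \<le> card K)
                     \<and> is_tree (bip_vertices \<pi> T) (bip_edges T)}"

definition nontrivial_partitions :: "nat \<Rightarrow> nat set set set" where
  "nontrivial_partitions p =
     {\<pi>. partition_on {1..p} \<pi> \<and> \<pi> \<noteq> (\<lambda>i. {i}) ` {1..p}}"


section \<open>The coefficients of the series\<close>

text \<open>A series is first given by its coefficients, as a function of the exponent vector \<open>\<mu>\<close>
  of \<open>\<Prod>i. Y\<^sub>i ^ \<mu> i\<close>.  The cumulants are symmetric in their indices, i.e. a function
  \<open>\<kappa>\<close> of the multiset of indices; they are arbitrary elements of an integral domain, for instance
  indeterminates.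

  \<open>C_coeff \<kappa> S\<close> describes \<open>C\<^sub>d\<close> in the \<open>d\<close> variables \<open>Y\<^sub>i\<close>, \<open>i \<in> S\<close>.\<close>

definition C_coeff :: "(nat multiset \<Rightarrow> 'a::comm_ring_1) \<Rightarrow> nat set \<Rightarrow> (nat \<Rightarrow> nat) \<Rightarrow> 'a" where
  "C_coeff \<kappa> S \<mu> =
     (if {i. \<mu> i \<noteq> 0} = S then \<kappa> (image_mset \<mu> (mset_set S))
      else if card S = 1 \<and> \<mu> = (\<lambda>_. 0) then 1 else 0)"

definition blues_at :: "nat set \<Rightarrow> nat set set set \<Rightarrow> nat set set set" where
  "blues_at G T = {K\<in>T. G \<in> K}"

definition Cbar_coeff ::
  "(nat multiset \<Rightarrow> 'a::comm_ring_1) \<Rightarrow> nat \<Rightarrow> nat set set \<Rightarrow> nat set set set \<Rightarrow> (nat \<Rightarrow> nat) \<Rightarrow> 'a" where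
  "Cbar_coeff \<kappa> p \<pi> T \<mu> =
     (if {i. \<mu> i \<noteq> 0} = {1..p} then
        \<Sum>\<nu>\<in>(\<Pi>\<^sub>E G\<in>\<pi>. NS_mu G \<mu>).
          \<Sum>L\<in>(\<Pi>\<^sub>E G\<in>\<pi>. {l \<in> blues_at G T \<rightarrow>\<^sub>E cycles_of G \<mu> (\<nu> G). inj_on l (blues_at G T)}).
            (\<Prod>K\<in>T. \<kappa> (image_mset (\<lambda>G. card (L G K)) (mset_set K)))
            * (\<Prod>G\<in>\<pi>. \<Prod>V\<in>cycles_of G \<mu> (\<nu> G) - L G ` blues_at G T. \<kappa> {#card V#})
      else 0)"

text \<open>In a tree with exactly one blue vertex, that vertex is adjacent to every block.\<close>

definition Cbar1_coeff ::
  "(nat multiset \<Rightarrow> 'a::comm_ring_1) \<Rightarrow> nat \<Rightarrow> nat set set \<Rightarrow> (nat \<Rightarrow> nat) \<Rightarrow> 'a" where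
  "Cbar1_coeff \<kappa> p \<pi> = Cbar_coeff \<kappa> p \<pi> {\<pi>}"

definition Ctilde_coeff :: "(nat multiset \<Rightarrow> 'a::comm_ring_1) \<Rightarrow> nat \<Rightarrow> (nat \<Rightarrow> nat) \<Rightarrow> 'a" where
  "Ctilde_coeff \<kappa> p = Cbar_coeff \<kappa> p {{1..p}} {}"

definition H_coeff :: "(nat multiset \<Rightarrow> 'a::comm_ring_1) \<Rightarrow> nat \<Rightarrow> (nat \<Rightarrow> nat) \<Rightarrow> 'a" where
  "H_coeff \<kappa> p \<mu> =
     C_coeff \<kappa> {1..p} \<mu>
     + (\<Sum>\<pi>\<in>nontrivial_partitions p. \<Sum>T\<in>bip_trees \<pi>. Cbar_coeff \<kappa> p \<pi> T \<mu>)"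


section \<open>Power series in three variables and their fractions\<close>

text \<open>The variables are \<open>Y\<^sub>1\<close> (outermost), \<open>Y\<^sub>2\<close>, \<open>Y\<^sub>3\<close> (innermost).  Expressions with
  denominators such as \<open>Y\<^sub>2 - Y\<^sub>3\<close> live in the fraction field of the ring of power series.\<close>

type_synonym 'a fps3 = "'a fps fps fps"

definition ser :: "((nat \<Rightarrow> nat) \<Rightarrow> 'a::idom) \<Rightarrow> 'a fps3 fract" where
  "ser f = to_fract (Abs_fps (\<lambda>a. Abs_fps (\<lambda>b. Abs_fps (\<lambda>c. f ((\<lambda>_. 0)(1 := a, 2 := b, 3 := c))))))"

definition Y :: "nat \<Rightarrow> 'a::idom fps3 fract" where
  "Y i = ser (\<lambda>\<mu>. if \<mu> = (\<lambda>_. 0)(i := 1) then 1 else 0)"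

definition fps3_deriv :: "nat \<Rightarrow> 'a::comm_ring_1 fps3 \<Rightarrow> 'a fps3" where
  "fps3_deriv i F =
     (if i = 1 then fps_deriv F
      else if i = 2 then Abs_fps (\<lambda>a. fps_deriv (fps_nth F a))
      else Abs_fps (\<lambda>a. Abs_fps (\<lambda>b. fps_deriv (fps_nth (fps_nth F a) b))))"

text \<open>The extension of \<open>\<partial>/\<partial>Y\<^sub>i\<close> to fractions by the quotient rule; by \<open>partial_Fract\<close> below it
  does not depend on the chosen representation of the fraction.\<close>

definition partial :: "nat \<Rightarrow> 'a::idom fps3 fract \<Rightarrow> 'a fps3 fract" where
  "partial i x =
     (case SOME (F, G). G \<noteq> 0 \<and> x = Fraction_Field.Fract F G of
        (F, G) \<Rightarrow> Fraction_Field.Fract (fps3_deriv i F * G - F * fps3_deriv i G) (G * G))"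

lemma fps3_deriv_mult:
  "fps3_deriv i (F * G) = fps3_deriv i F * G + F * fps3_deriv i (G :: 'a::comm_ring_1 fps3)"
proof -
  have d1: "fps_deriv (f * g) = fps_deriv f * g + f * fps_deriv g" for f g :: "'b::comm_ring_1 fps"
    by (simp add: add.commute)
  consider "i = 1" | "i = 2" | "i \<noteq> 1" "i \<noteq> 2" by blast
  then show ?thesis
  proof cases
    case 1
    then show ?thesis by (simp add: fps3_deriv_def d1)
  next
    case 2
    then show ?thesis
      by (auto simp: fps3_deriv_def fps_eq_iff[of "Abs_fps _"] fps_mult_nth fps_deriv_sum d1
          sum.distrib simp del: fps_deriv_mult)
  next
    case 3
    have "Abs_fps (\<lambda>a. Abs_fps (\<lambda>b. fps_deriv (fps_nth (fps_nth (F * G) a) b)))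
        = Abs_fps (\<lambda>a. Abs_fps (\<lambda>b. fps_deriv (fps_nth (fps_nth F a) b))) * G
          + F * Abs_fps (\<lambda>a. Abs_fps (\<lambda>b. fps_deriv (fps_nth (fps_nth G a) b)))"
    proof (intro fps_ext)
      fix a b n
      have "fps_deriv (fps_nth (fps_nth (F * G) a) b)
          = fps_nth (fps_nth (Abs_fps (\<lambda>a. Abs_fps (\<lambda>b. fps_deriv (fps_nth (fps_nth F a) b))) * G
          + F * Abs_fps (\<lambda>a. Abs_fps (\<lambda>b. fps_deriv (fps_nth (fps_nth G a) b)))) a) b"
        by (simp add: fps_mult_nth fps_sum_nth fps_deriv_sum d1 sum.distrib del: fps_deriv_mult)
      then show "fps_nth (fps_nth (fps_nth (Abs_fps (\<lambda>a. Abs_fps (\<lambda>b.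
            fps_deriv (fps_nth (fps_nth (F * G) a) b)))) a) b) n
          = fps_nth (fps_nth (fps_nth (Abs_fps (\<lambda>a. Abs_fps (\<lambda>b. fps_deriv (fps_nth (fps_nth F a) b))) * G
          + F * Abs_fps (\<lambda>a. Abs_fps (\<lambda>b. fps_deriv (fps_nth (fps_nth G a) b)))) a) b) n"
        by simp
    qed
    then show ?thesis using 3 by (simp add: fps3_deriv_def)
  qed
qed

lemma partial_Fract:
  fixes F G :: "'a::idom fps3"
  assumes "G \<noteq> 0"
  shows "partial i (Fraction_Field.Fract F G)
         = Fraction_Field.Fract (fps3_deriv i F * G - F * fps3_deriv i G) (G * G)"
proof -
  define P where "P = (\<lambda>(A, B). B \<noteq> 0 \<and> Fraction_Field.Fract F G = Fraction_Field.Fract A B)"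
  obtain A B where AB: "(SOME x. P x) = (A, B)" by (cases "SOME x. P x")
  have "P (F, G)" using assms by (simp add: P_def)
  then have "P (A, B)" using someI[of P] AB by metis
  then have B: "B \<noteq> 0" and e: "F * B = A * G" using assms by (auto simp: P_def eq_fract)
  let ?d = "fps3_deriv i"
  have d: "?d F * B + F * ?d B = ?d A * G + A * ?d G"
    using arg_cong[OF e, of ?d] by (simp add: fps3_deriv_mult)
  have "(?d A * B - A * ?d B) * (G * G) = (?d F * G - F * ?d G) * (B * B)"
    using e d by algebra
  then have "Fraction_Field.Fract (?d A * B - A * ?d B) (B * B)
           = Fraction_Field.Fract (?d F * G - F * ?d G) (G * G)"
    using assms B by (simp add: eq_fract)
  then show ?thesis using AB by (simp add: partial_def P_def)
qed

definition C1 :: "(nat multiset \<Rightarrow> 'a::idom) \<Rightarrow> nat \<Rightarrow> 'a fps3 fract" where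
  "C1 \<kappa> i = ser (C_coeff \<kappa> {i})"

definition C2 :: "(nat multiset \<Rightarrow> 'a::idom) \<Rightarrow> nat \<Rightarrow> nat \<Rightarrow> 'a fps3 fract" where
  "C2 \<kappa> i j = ser (C_coeff \<kappa> {i, j})"

definition Chat2 :: "(nat multiset \<Rightarrow> 'a::idom) \<Rightarrow> nat \<Rightarrow> nat \<Rightarrow> 'a fps3 fract" where
  "Chat2 \<kappa> i j = 1 + Y i / (Y j - Y i) * C1 \<kappa> j + Y j / (Y i - Y j) * C1 \<kappa> i"

definition Chat3 :: "(nat multiset \<Rightarrow> 'a::idom) \<Rightarrow> nat \<Rightarrow> nat \<Rightarrow> nat \<Rightarrow> 'a fps3 fract" where
  "Chat3 \<kappa> i j k = Y k / (Y j - Y k) * Chat2 \<kappa> i j + Y j / (Y k - Y j) * Chat2 \<kappa> i k"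

end

theory Submission
  imports Defs
begin

text \<open>Put \<open>\<psi> = inv \<nu>\<close>.  Then \<open>\<nu>\<close> is non-separable for \<open>\<tau>\<close> iff \<open>\<tau>\<close> and \<open>\<psi>\<close> are transitive, the
  numbers of cycles of \<open>\<psi>\<close>, \<open>\<tau>\<close> and \<open>\<alpha> = inv \<tau> \<circ> \<psi>\<close> add up to \<open>|E| + 2\<close>, and every cycle of \<open>\<alpha>\<close> meets
  every cycle of \<open>\<tau>\<close> at most once.  Collapsing the runs on which \<open>\<psi>\<close> follows \<open>\<tau>\<close> (the fixed points of
  \<open>\<alpha>\<close>) leaves a reduced \<open>\<psi>\<close> together with one composition of \<open>\<mu> i\<close> per white vertex and a base
  point on it, the latter accounting for the factors \<open>\<mu> i\<close>, i.e. for the operators \<open>Y i * partial i\<close>.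

  In a reduced permutation all cycles of \<open>\<psi>\<close> and \<open>\<alpha>\<close> have length at least 2, and Euler's formula
  says that the excesses (length minus 2) sum to 0 for two white vertices and to 2 for three.  So for
  two white vertices everything is one cyclic ladder of 2-cycles.  For three, there are two
  exceptional 3-cycles, each of \<open>\<psi>\<close> or of \<open>\<alpha>\<close>, or one exceptional 4-cycle of
  \<open>\<psi>\<close> (a 4-cycle of \<open>\<alpha>\<close> would meet a white vertex
  twice), joined by ladders of 2-cycles: these are the shapes \<open>Triangle\<close> and \<open>Double\<close>.  A ladder has series
  \<open>1 / (1 - Chat2)\<close>, an exceptional 3-cycle of \<open>\<psi>\<close> has series \<open>Chat3\<close>, and the 4-cycle visits one
  white vertex twice, which gives the terms with \<open>partial a (1 / Y a * Chat3)\<close>.\<close>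

section \<open>Orbits, joins and the genus inequality\<close>

text \<open>Cutting a white vertex, that is replacing \<tau> by \<tau> composed with (b d), gives
  \<tau> one cycle more. In genus 0 the genus inequality leaves no room, so connectedness after the
  cut is decided by whether the product with \<nu> gains or loses a cycle. This turns a condition on
  joins into one on the cycles of \<alpha>, which passes through the collapse of runs.

  The excesses are a count: if B is the set of runs, the cycles of \<psi> and those of \<alpha> each
  have total length |B|, so their excesses add up to 2|B| minus twice the number of these cycles,
  which is twice the number of white vertices minus 4.

  Symmetry is the obstacle to counting, since an object and its rotated copies describe the same
  permutation. For three white vertices the exceptional cycles fix the labels. A closed ladder
  between two white vertices does have rotations, but there the cumulant of the blue vertex already
  singles out one 2-cycle, and this mark fixes the labels.

  The rational functions are divided differences: the coefficients of the series of a 2-cycle depend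
  only on the sum of two exponents, so that multiplication by a difference of variables
  telescopes.\<close>

abbreviation "cyc \<equiv> cycle_partition"
abbreviation "ncyc E f \<equiv> card (cycle_partition E f)"

text \<open>For \<open>R\<close> on \<open>E\<close> this is the generated equivalence relation.
  Working with generators instead of partitions lets them be added and exchanged one at a time,
  which is how numbers of cycles and of blocks of a join are compared.\<close>

definition eqv :: "'b set => ('b \<times> 'b) set => ('b \<times> 'b) set" where
  "eqv E R = {(x, y). x \<in> E \<and> y \<in> E \<and> (x, y) \<in> (R \<union> R\<inverse>)\<^sup>*}"

definition gr :: "'b set => ('b => 'b) => ('b \<times> 'b) set" where
  "gr E \<sigma> = {(x, \<sigma> x) |x. x \<in> E}"

lemma equiv_eqv: "equiv E (eqv E R)"
proof (rule equivI)
  show "sym (eqv E R)"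
    using sym_rtrancl[OF sym_Un_converse[of R]] by (auto simp: eqv_def sym_def)
qed (auto simp: eqv_def refl_on_def trans_def)

lemma eqv_sym: "(x, y) \<in> eqv E R ==> (y, x) \<in> eqv E R"
  using equiv_eqv[of E R] by (auto simp: equiv_def sym_def)

lemma eqv_trans: "(x, y) \<in> eqv E R ==> (y, z) \<in> eqv E R ==> (x, z) \<in> eqv E R"
  by (auto simp: eqv_def)

lemma eqv_base: "(x, y) \<in> R ==> x \<in> E ==> y \<in> E ==> (x, y) \<in> eqv E R"
  by (auto simp: eqv_def)

lemma eqv_baseI: "R \<subseteq> R' ==> R \<subseteq> E \<times> E ==> R \<subseteq> eqv E R'"
  by (auto simp: eqv_def)

lemma eqv_refl: "x \<in> E ==> (x, x) \<in> eqv E R"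
  by (auto simp: eqv_def)

lemma eqv_mono_hull:
  assumes "R \<subseteq> eqv E R'" shows "eqv E R \<subseteq> eqv E R'"
proof -
  have "R \<union> R\<inverse> \<subseteq> eqv E R'" using assms eqv_sym by fast
  then have "R \<union> R\<inverse> \<subseteq> (R' \<union> R'\<inverse>)\<^sup>*" by (auto simp: eqv_def)
  then have "(R \<union> R\<inverse>)\<^sup>* \<subseteq> (R' \<union> R'\<inverse>)\<^sup>*" by (rule rtrancl_subset_rtrancl)
  then show ?thesis by (auto simp: eqv_def)
qed

lemma eqv_insert_in:
  assumes "(x, y) \<in> eqv E R" "R \<subseteq> E \<times> E" shows "eqv E (insert (x, y) R) = eqv E R"
proof
  show "eqv E (insert (x, y) R) \<subseteq> eqv E R"
    using eqv_baseI[of R R E] assms by (intro eqv_mono_hull) simp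
  show "eqv E R \<subseteq> eqv E (insert (x, y) R)"
    by (intro eqv_mono_hull eqv_baseI) (use assms in auto)
qed

lemma eqv_insert:
  assumes "x \<in> E" "y \<in> E"
  shows "(a, b) \<in> eqv E (insert (x, y) R) \<longleftrightarrow> (a, b) \<in> eqv E R
     \<or> (a, x) \<in> eqv E R \<and> (y, b) \<in> eqv E R \<or> (a, y) \<in> eqv E R \<and> (x, b) \<in> eqv E R"
proof -
  have e: "insert (x, y) R \<union> (insert (x, y) R)\<inverse> = insert (x, y) (insert (y, x) (R \<union> R\<inverse>))" by auto
  show ?thesis using assms unfolding eqv_def e rtrancl_insert
    by auto (meson rtrancl_trans)+
qed

text \<open>The new pair merges the classes of \<open>x\<close> and \<open>y\<close> into their
  union and leaves every other class alone.\<close>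

lemma card_quotient_insert:
  assumes fin: "finite E" and x: "x \<in> E" and y: "y \<in> E" and n: "(x, y) \<notin> eqv E R"
  shows "card (E // eqv E R) = Suc (card (E // eqv E (insert (x, y) R)))"
proof -
  let ?r = "eqv E R" and ?r' = "eqv E (insert (x, y) R)"
  let ?X = "?r `` {x}" and ?Y = "?r `` {y}"
  have cl: "?r' `` {a} = (if (a, x) \<in> ?r \<or> (a, y) \<in> ?r then ?X \<union> ?Y else ?r `` {a})" for a
  proof -
    have tr: "(a, b) \<in> ?r ==> (a, c) \<in> ?r \<longleftrightarrow> (b, c) \<in> ?r" for a b c
      using eqv_trans[of _ _ E R] eqv_sym[of _ _ E R] by metis
    have "(a, b) \<in> ?r' \<longleftrightarrow> b \<in> (if (a, x) \<in> ?r \<or> (a, y) \<in> ?r then ?X \<union> ?Y else ?r `` {a})" for b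
    proof -
      have na: "(a, y) \<notin> ?r" if "(a, x) \<in> ?r" using tr[of a x y] n that by blast
      note ei = eqv_insert[OF x y, of a b R]
      consider "(a, x) \<in> ?r" | "(a, x) \<notin> ?r" "(a, y) \<in> ?r" | "(a, x) \<notin> ?r" "(a, y) \<notin> ?r" by blast
      then show ?thesis
      proof cases
        case 1
        then show ?thesis using ei tr[of a x b] na by simp
      next
        case 2
        have "(a, b) \<in> ?r \<longleftrightarrow> (y, b) \<in> ?r" using tr 2 by blast
        then have "(a, b) \<in> ?r' \<longleftrightarrow> (y, b) \<in> ?r \<or> (x, b) \<in> ?r" using ei 2 by simp
        then show ?thesis using 2 by auto
      next
        case 3
        then show ?thesis using ei by simp
      qed
    qed
    then show ?thesis by (intro set_eqI) (simp only: Image_singleton_iff)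
  qed
  have XY: "?X \<noteq> ?Y" "?X \<in> E // ?r" "?Y \<in> E // ?r"
    using n x y eqv_refl[of y E R] eqv_refl[of x E R] by (auto intro: quotientI)
  have ne: "?X \<union> ?Y \<notin> E // ?r - {?X, ?Y}"
  proof
    assume a: "?X \<union> ?Y \<in> E // ?r - {?X, ?Y}"
    have "x \<in> ?X" using x eqv_refl by fast
    then have "(?X \<union> ?Y) \<inter> ?X \<noteq> {}" by blast
    then show False using a XY quotient_disj[OF equiv_eqv, of "?X \<union> ?Y" E R ?X] by auto
  qed
  have "E // ?r' = insert (?X \<union> ?Y) (E // ?r - {?X, ?Y})"
  proof (intro equalityI subsetI)
    fix Z assume "Z \<in> E // ?r'"
    then obtain a where a: "a \<in> E" "Z = ?r' `` {a}" by (rule quotientE) auto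
    show "Z \<in> insert (?X \<union> ?Y) (E // ?r - {?X, ?Y})"
    proof (cases "(a, x) \<in> ?r \<or> (a, y) \<in> ?r")
      case True then show ?thesis using a cl by simp
    next
      case False
      then have "?r `` {a} \<noteq> ?X" "?r `` {a} \<noteq> ?Y" using x y eqv_refl by fast+
      then show ?thesis using a cl False by (auto intro: quotientI)
    qed
  next
    fix Z assume Z: "Z \<in> insert (?X \<union> ?Y) (E // ?r - {?X, ?Y})"
    show "Z \<in> E // ?r'"
    proof (cases "Z = ?X \<union> ?Y")
      case True
      then have "Z = ?r' `` {x}" using cl[of x] eqv_refl[OF x, of R] by simp
      then show ?thesis using x by (auto intro: quotientI)
    next
      case False
      then obtain a where a: "a \<in> E" "Z = ?r `` {a}" "Z \<noteq> ?X" "Z \<noteq> ?Y"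
        using Z by (fast elim: quotientE)
      then have "(a, x) \<notin> ?r" "(a, y) \<notin> ?r"
        using equiv_class_eq[OF equiv_eqv] by metis+
      then have "Z = ?r' `` {a}" using cl[of a] a by simp
      then show ?thesis using a by (auto intro: quotientI)
    qed
  qed
  moreover have f: "finite (E // ?r)" using fin by (rule finite_quotient) (auto simp: eqv_def)
  ultimately have "card (E // ?r') = Suc (card (E // ?r - {?X, ?Y}))" using ne by simp
  also have "card (E // ?r - {?X, ?Y}) = card (E // ?r) - card {?X, ?Y}"
    by (rule card_Diff_subset) (use XY in auto)
  also have "card {?X, ?Y} = 2" using XY by auto
  finally have "card (E // ?r') = Suc (card (E // ?r) - 2)" .
  moreover have "card (E // ?r) \<ge> card {?X, ?Y}" by (rule card_mono) (use f XY in auto)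
  ultimately show ?thesis using XY by auto
qed

context
  fixes E :: "'b set" and \<sigma> :: "'b => 'b"
  assumes fin: "finite E" and perm: "\<sigma> permutes E"
begin

lemma perm_self: "x \<in> orbit \<sigma> x"
  using permutation_self_in_orbit[OF permutes_imp_permutation[OF fin perm]] .

lemma perm_orbit_eq: "y \<in> orbit \<sigma> x ==> orbit \<sigma> y = orbit \<sigma> x"
  using orbit_cyclic_eq3 cyclic_on_orbit[OF perm fin] by metis

lemma perm_orbit_sub: "x \<in> E ==> orbit \<sigma> x \<subseteq> E"
  using permutes_orbit_subset[OF perm] .

lemma perm_orbit_step: "orbit \<sigma> (\<sigma> x) = orbit \<sigma> x"
  by (rule perm_orbit_eq) (rule orbit.base)

lemma perm_orbit_closed: "y \<in> orbit \<sigma> x \<longleftrightarrow> \<sigma> y \<in> orbit \<sigma> x"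
  using perm_orbit_step perm_orbit_eq perm_self by metis

lemma eqv_gr_class: assumes "x \<in> E" shows "eqv E (gr E \<sigma>) `` {x} = orbit \<sigma> x"
proof (intro equalityI subsetI)
  fix y assume "y \<in> eqv E (gr E \<sigma>) `` {x}"
  then have "(x, y) \<in> (gr E \<sigma> \<union> (gr E \<sigma>)\<inverse>)\<^sup>*" by (simp add: eqv_def)
  then show "y \<in> orbit \<sigma> x"
    by (induction rule: rtrancl_induct) (use perm_self perm_orbit_closed in \<open>auto simp: gr_def\<close>)
next
  fix y assume y: "y \<in> orbit \<sigma> x"
  have "(x, y) \<in> eqv E (gr E \<sigma>)" using y
  proof (induction rule: orbit.induct)
    case base
    show ?case by (rule eqv_base) (use assms perm in \<open>auto simp: gr_def permutes_in_image\<close>)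
  next
    case (step y)
    then have "y \<in> E" by (auto simp: eqv_def)
    then have "(y, \<sigma> y) \<in> eqv E (gr E \<sigma>)"
      by (intro eqv_base) (use perm in \<open>auto simp: gr_def permutes_in_image\<close>)
    then show ?case using step eqv_trans by fast
  qed
  then show "y \<in> eqv E (gr E \<sigma>) `` {x}" by simp
qed

lemma cycle_partition_quotient: "cyc E \<sigma> = E // eqv E (gr E \<sigma>)"
  using eqv_gr_class by (auto simp: cycle_partition_def quotient_def)

lemma eqv_gr: "(x, y) \<in> eqv E (gr E \<sigma>) \<longleftrightarrow> x \<in> E \<and> y \<in> orbit \<sigma> x"
  using eqv_gr_class[of x] by (cases "x \<in> E") (auto simp: eqv_def)

lemma gr_sub: "gr E \<sigma> \<subseteq> E \<times> E"
  using perm by (auto simp: gr_def permutes_in_image)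

lemma cycle_partition_partition: "partition_on E (cyc E \<sigma>)"
  unfolding cycle_partition_quotient by (rule partition_on_quotient) (rule equiv_eqv)

text \<open>The composite sends \<open>x\<close> to \<open>\<sigma> y\<close> and then follows
  \<sigma> until it is back at \<open>x\<close>; on this stretch of the old cycle \<open>y\<close>
  does not occur.\<close>

lemma orbit_transpose_split:
  assumes "y \<in> orbit \<sigma> x" "x \<noteq> y" "x \<in> E"
  shows "y \<notin> orbit (\<sigma> \<circ> transpose x y) x"
proof -
  have "x \<in> orbit \<sigma> y" using assms perm_orbit_eq perm_self by metis
  define n where "n = funpow_dist1 \<sigma> y x"
  have n: "(\<sigma> ^^ n) y = x" "0 < n" "\<And>j. 0 < j ==> j < n ==> (\<sigma> ^^ j) y \<noteq> x"
    using funpow_dist1_prop[OF \<open>x \<in> orbit \<sigma> y\<close>] funpow_dist1_least[of _ \<sigma> y x] by (auto simp: n_def)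
  define A where "A = (\<lambda>j. (\<sigma> ^^ j) y) ` {1..n}"
  have yA: "y \<notin> A"
  proof
    assume "y \<in> A"
    then obtain j where j: "1 \<le> j" "j \<le> n" "(\<sigma> ^^ j) y = y" by (auto simp: A_def)
    then have "j < n" using n assms by (cases "j = n") auto
    \<comment> \<open>A return to \<open>y\<close> after \<open>j < n\<close> steps would make
      \<open>x\<close> appear already after \<open>n - j\<close> steps.\<close>
    have "(\<sigma> ^^ n) y = (\<sigma> ^^ (n - j)) ((\<sigma> ^^ j) y)"
      using j funpow_add[of "n - j" j \<sigma>] by simp
    then have "(\<sigma> ^^ (n - j)) y = x" using n j by simp
    then show False using n(3)[of "n - j"] j \<open>j < n\<close> by simp
  qed
  have "z \<in> A" if "z \<in> orbit (\<sigma> \<circ> transpose x y) x" for z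
    using that
  proof (induction rule: orbit.induct)
    case base
    have "\<sigma> y = (\<sigma> ^^ 1) y" by simp
    then show ?case using n by (auto simp: A_def intro!: image_eqI[of _ _ 1])
  next
    case (step z)
    then obtain j where j: "1 \<le> j" "j \<le> n" "z = (\<sigma> ^^ j) y" by (auto simp: A_def)
    show ?case
    proof (cases "z = x")
      case True then show ?thesis using n by (auto simp: A_def image_iff intro!: bexI[of _ 1])
    next
      case False
      then have "j < n" using j n by (cases "j = n") auto
      moreover have "z \<noteq> y" using step yA by auto
      ultimately have "(\<sigma> \<circ> transpose x y) z = (\<sigma> ^^ Suc j) y" using j False by simp
      then show ?thesis using \<open>j < n\<close> by (auto simp: A_def intro!: image_eqI[of _ _ "Suc j"])
    qed
  qed
  then show ?thesis using yA by blast
qed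

text \<open>The composite jumps from \<open>x\<close> to \<open>\<sigma> y\<close> and follows the
  cycle of \<open>y\<close>, which avoids \<open>x\<close>, all the way round to
  \<open>y\<close>.\<close>

lemma orbit_transpose_merge:
  assumes "y \<notin> orbit \<sigma> x"
  shows "y \<in> orbit (\<sigma> \<circ> transpose x y) x"
proof -
  have nx: "x \<notin> orbit \<sigma> y" using assms perm_orbit_eq perm_self by metis
  define n where "n = funpow_dist1 \<sigma> y y"
  have n: "(\<sigma> ^^ n) y = y" "0 < n" "\<And>j. 0 < j ==> j < n ==> (\<sigma> ^^ j) y \<noteq> y"
    using funpow_dist1_prop[OF perm_self] funpow_dist1_least[of _ \<sigma> y y] by (auto simp: n_def)
  have "j < n ==> (\<sigma> ^^ Suc j) y \<in> orbit (\<sigma> \<circ> transpose x y) x" for j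
  proof (induction j)
    case 0
    have "(\<sigma> \<circ> transpose x y) x = \<sigma> y" by simp
    then show ?case using orbit.base[of "\<sigma> \<circ> transpose x y" x] by (simp del: comp_apply)
  next
    case (Suc j)
    let ?z = "(\<sigma> ^^ Suc j) y"
    have "?z \<noteq> y" using n Suc by blast
    moreover have "?z \<noteq> x" using nx funpow_in_orbit[OF perm_self] by metis
    ultimately have "(\<sigma> \<circ> transpose x y) ?z = (\<sigma> ^^ Suc (Suc j)) y" by simp
    moreover have "?z \<in> orbit (\<sigma> \<circ> transpose x y) x" using Suc.IH[OF Suc_lessD[OF Suc.prems]] .
    ultimately show ?case using orbit.step by metis
  qed
  from this[of "n - 1"] show ?thesis using n by simp
qed

end

lemma permutes_comp_transpose:
  "\<sigma> permutes E ==> x \<in> E ==> y \<in> E ==> (\<sigma> \<circ> transpose x y) permutes E"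
  by (intro permutes_compose permutes_swap_id)

lemma eqv_insert_transpose_aux:
  assumes perm: "\<sigma> permutes E" and xy: "x \<in> E" "y \<in> E" and R: "R \<subseteq> E \<times> E"
  shows "eqv E (insert (x, y) (gr E (\<sigma> \<circ> transpose x y) \<union> R)) \<subseteq> eqv E (insert (x, y) (gr E \<sigma> \<union> R))"
proof -
  let ?R = "insert (x, y) (gr E \<sigma> \<union> R)"
  have s: "(z, \<sigma> z) \<in> eqv E ?R" if "z \<in> E" for z
    by (rule eqv_base) (use that perm in \<open>auto simp: gr_def permutes_in_image\<close>)
  have t: "(x, y) \<in> eqv E ?R" by (rule eqv_base) (use xy in auto)
  have "(x, \<sigma> y) \<in> eqv E ?R" using t s[OF xy(2)] by (rule eqv_trans)
  moreover have "(y, \<sigma> x) \<in> eqv E ?R" using eqv_sym[OF t] s[OF xy(1)] by (rule eqv_trans)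
  ultimately have "(z, \<sigma> (transpose x y z)) \<in> eqv E ?R" if "z \<in> E" for z
    using s[OF that] by (cases "z = x"; cases "z = y") simp_all
  then have "gr E (\<sigma> \<circ> transpose x y) \<subseteq> eqv E ?R" by (auto simp: gr_def)
  moreover have "R \<subseteq> eqv E ?R" by (rule eqv_baseI) (use R in auto)
  ultimately show ?thesis using t by (intro eqv_mono_hull) simp
qed

text \<open>The two permutations differ only in exchanging the images of \<open>x\<close> and
  \<open>y\<close>, which is invisible once \<open>x\<close> and \<open>y\<close> are identified.
  One inclusion suffices, since composing twice with the transposition gives \<sigma> back.\<close>

lemma eqv_insert_transpose:
  assumes perm: "\<sigma> permutes E" and xy: "x \<in> E" "y \<in> E" and R: "R \<subseteq> E \<times> E"
  shows "eqv E (insert (x, y) (gr E (\<sigma> \<circ> transpose x y) \<union> R)) = eqv E (insert (x, y) (gr E \<sigma> \<union> R))"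
proof
  have "(\<sigma> \<circ> transpose x y) \<circ> transpose x y = \<sigma>" by (simp add: fun_eq_iff)
  then show "eqv E (insert (x, y) (gr E \<sigma> \<union> R)) \<subseteq> eqv E (insert (x, y) (gr E (\<sigma> \<circ> transpose x y) \<union> R))"
    using eqv_insert_transpose_aux[OF permutes_comp_transpose[OF perm xy] xy R] by metis
qed (rule eqv_insert_transpose_aux[OF assms])

text \<open>Exactly one of the two permutations has \<open>x\<close> and \<open>y\<close> in a
  common cycle, and identifying the two points yields the same classes for both, so the counts
  differ by the one merger of \<open>card_quotient_insert\<close>.\<close>

lemma card_cycle_transpose:
  assumes fin: "finite E" and perm: "\<sigma> permutes E" and xy: "x \<in> E" "y \<in> E" "x \<noteq> y"
  shows "y \<in> orbit \<sigma> x ==> ncyc E (\<sigma> \<circ> transpose x y) = Suc (ncyc E \<sigma>)"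
    and "y \<notin> orbit \<sigma> x ==> ncyc E \<sigma> = Suc (ncyc E (\<sigma> \<circ> transpose x y))"
proof -
  let ?s = "\<sigma> \<circ> transpose x y"
  have p: "?s permutes E" using permutes_comp_transpose[OF perm xy(1,2)] .
  have e: "eqv E (insert (x, y) (gr E ?s)) = eqv E (insert (x, y) (gr E \<sigma>))"
    using eqv_insert_transpose[OF perm xy(1,2), of "{}"] by simp
  note q = cycle_partition_quotient[OF fin perm] cycle_partition_quotient[OF fin p]
  { assume a: "y \<in> orbit \<sigma> x"
    then have "y \<notin> orbit ?s x" using orbit_transpose_split[OF fin perm] xy by blast
    then have 1: "(x, y) \<notin> eqv E (gr E ?s)" using eqv_gr[OF fin p] by simp
    have 2: "(x, y) \<in> eqv E (gr E \<sigma>)" using eqv_gr[OF fin perm] a xy by simp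
    show "ncyc E ?s = Suc (ncyc E \<sigma>)"
      using card_quotient_insert[OF fin xy(1,2) 1] eqv_insert_in[OF 2 gr_sub[OF fin perm]] e q by simp }
  { assume a: "y \<notin> orbit \<sigma> x"
    then have "y \<in> orbit ?s x" using orbit_transpose_merge[OF fin perm] by blast
    then have 1: "(x, y) \<in> eqv E (gr E ?s)" using eqv_gr[OF fin p] xy by simp
    have 2: "(x, y) \<notin> eqv E (gr E \<sigma>)" using eqv_gr[OF fin perm] a by simp
    show "ncyc E \<sigma> = Suc (ncyc E ?s)"
      using card_quotient_insert[OF fin xy(1,2) 2] eqv_insert_in[OF 1 gr_sub[OF fin p]] e q by simp }
qed

text \<open>Turns the join of the formal statement into the quotient by a generated equivalence, in
  which generators can be exchanged.\<close>

lemma partition_join_quotient: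
  assumes fin: "finite E" and s: "\<sigma> permutes E" and r: "\<rho> permutes E"
  shows "partition_join (cyc E \<sigma>) (cyc E \<rho>) = E // eqv E (gr E \<sigma> \<union> gr E \<rho>)"
proof -
  let ?P = "cyc E \<sigma> \<union> cyc E \<rho>"
  let ?r = "\<Union>X\<in>?P. X \<times> X" and ?e = "eqv E (gr E \<sigma> \<union> gr E \<rho>)"
  have UE: "\<Union>?P = E"
    using cycle_partition_partition[OF fin s] cycle_partition_partition[OF fin r]
    by (auto simp: partition_on_def)
  have 1: "eqv E (gr E \<sigma>) \<subseteq> ?e" "eqv E (gr E \<rho>) \<subseteq> ?e"
    by (intro eqv_mono_hull eqv_baseI gr_sub fin s r Un_upper1 Un_upper2)+
  have 2: "?r \<subseteq> ?e"
  proof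
    fix z assume "z \<in> ?r"
    then obtain X a b where X: "X \<in> ?P" "z = (a, b)" "a \<in> X" "b \<in> X" by auto
    then have "(a, b) \<in> eqv E (gr E \<sigma>) \<or> (a, b) \<in> eqv E (gr E \<rho>)"
      unfolding cycle_partition_quotient[OF fin s] cycle_partition_quotient[OF fin r]
      using in_quotient_imp_in_rel[OF equiv_eqv, of X E] by blast
    then show "z \<in> ?e" using 1 X by blast
  qed
  have "?r\<^sup>+ \<subseteq> ?e"
  proof
    fix z assume "z \<in> ?r\<^sup>+"
    then have "(fst z, snd z) \<in> ?r\<^sup>+" by simp
    then have "(fst z, snd z) \<in> ?e"
    proof (induction rule: trancl_induct)
      case (step y z)
      then show ?case using 2 eqv_trans[of _ y E _ z] by (meson subsetD)
    qed (use 2 in blast)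
    then show "z \<in> ?e" by simp
  qed
  moreover have "?e \<subseteq> ?r\<^sup>+"
  proof
    fix z assume z: "z \<in> ?e"
    obtain a b where ab: "z = (a, b)" by (cases z)
    have a: "a \<in> E" "(a, b) \<in> (gr E \<sigma> \<union> gr E \<rho> \<union> (gr E \<sigma> \<union> gr E \<rho>)\<inverse>)\<^sup>*"
      using z ab by (auto simp: eqv_def)
    have in_r: "(c, d) \<in> ?r" if "(c, d) \<in> gr E \<sigma> \<union> gr E \<rho>" for c d
    proof -
      from that consider "c \<in> E" "d = \<sigma> c" | "c \<in> E" "d = \<rho> c" by (auto simp: gr_def)
      then show ?thesis
      proof cases
        case 1
        then have "orbit \<sigma> c \<in> ?P" "c \<in> orbit \<sigma> c" "d \<in> orbit \<sigma> c"
          using perm_self[OF fin s] orbit.base by (auto simp: cycle_partition_def)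
        then show ?thesis by blast
      next
        case 2
        then have "orbit \<rho> c \<in> ?P" "c \<in> orbit \<rho> c" "d \<in> orbit \<rho> c"
          using perm_self[OF fin r] orbit.base by (auto simp: cycle_partition_def)
        then show ?thesis by blast
      qed
    qed
    have "(a, b) \<in> ?r\<^sup>+" using a(2)
    proof (induction rule: rtrancl_induct)
      case base
      have "(a, a) \<in> ?r" using a(1) UE by blast
      then show ?case by (rule r_into_trancl)
    next
      case (step y z)
      then have "(y, z) \<in> ?r" using in_r[of y z] in_r[of z y] by auto
      with step show ?case by (blast intro: trancl_into_trancl)
    qed
    then show "z \<in> ?r\<^sup>+" using ab by simp
  qed
  ultimately have "?r\<^sup>+ = ?e" by blast
  then show ?thesis unfolding partition_join_def UE by simp
qed

lemma card_cycle_le: "finite E ==> ncyc E \<sigma> \<le> card E"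
  by (simp add: cycle_partition_def card_image_le)

text \<open>Nonnegativity of the genus, written additively. The induction detaches a point from its
  cycle by a transposition, which gives \<sigma> one cycle more. If the join keeps its blocks, a
  change of at most one in the product is harmless; if a block falls apart, the product must split
  as well, and both sides change by 2.\<close>

lemma genus_nonneg:
  assumes fin: "finite E" and s: "\<sigma> permutes E" and r: "\<rho> permutes E"
  shows "ncyc E \<sigma> + ncyc E \<rho> + ncyc E (\<sigma> \<circ> \<rho>)
       \<le> card E + 2 * card (partition_join (cyc E \<sigma>) (cyc E \<rho>))"
  using s
proof (induction "card E - ncyc E \<sigma>" arbitrary: \<sigma> rule: less_induct)
  case less
  note s = less.prems
  show ?case
  proof (cases "\<exists>x\<in>E. \<sigma> x \<noteq> x")
    case False
    then have id: "\<sigma> = id" using s by (auto simp: fun_eq_iff permutes_def)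
    then have "orbit \<sigma> x = {x}" for x using orbit_eq_singleton_iff[of \<sigma> x] by simp
    then have c: "ncyc E \<sigma> = card E" by (simp add: cycle_partition_def card_image)
    have "gr E \<sigma> \<subseteq> eqv E (gr E \<rho>)" by (auto simp: id gr_def eqv_refl)
    then have "eqv E (gr E \<sigma> \<union> gr E \<rho>) = eqv E (gr E \<rho>)"
      by (intro equalityI eqv_mono_hull Un_least eqv_baseI[of "gr E \<rho>"]) (use gr_sub[OF fin r] in auto)
    then show ?thesis
      using c partition_join_quotient[OF fin s r] cycle_partition_quotient[OF fin r] by (simp add: id)
  next
    case True
    then obtain x where x: "x \<in> E" "\<sigma> x \<noteq> x" by blast
    define y where "y = \<sigma> x"
    have y: "y \<in> E" "x \<noteq> y" "y \<in> orbit \<sigma> x"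
      using x s orbit.base[of \<sigma> x] by (auto simp: y_def permutes_in_image)
    let ?s = "\<sigma> \<circ> transpose x y"
    have p: "?s permutes E" using permutes_comp_transpose[OF s x(1) y(1)] .
    have c1: "ncyc E ?s = Suc (ncyc E \<sigma>)"
      using card_cycle_transpose[OF fin s x(1) y(1,2)] y by simp
    have IH: "ncyc E ?s + ncyc E \<rho> + ncyc E (?s \<circ> \<rho>)
       \<le> card E + 2 * card (partition_join (cyc E ?s) (cyc E \<rho>))"
      using less.hyps[of ?s] p c1 card_cycle_le[OF fin, of ?s] by simp
    \<comment> \<open>The preimages carry the transposition across \<rho>, so the product also
      changes by one transposition on the right.\<close>
    define x' y' where "x' = inv \<rho> x" and "y' = inv \<rho> y"
    have xy': "\<rho> x' = x" "\<rho> y' = y" using permutes_surj[OF r] by (simp_all add: x'_def y'_def surj_f_inv_f)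
    then have xy'E: "x' \<in> E" "y' \<in> E" "x' \<noteq> y'" using x y r by (auto simp: permutes_in_image)
    have rt: "transpose x y \<circ> \<rho> = \<rho> \<circ> transpose x' y'"
      using xy' permutes_inj[OF r] by (auto simp: fun_eq_iff transpose_def inj_def)
    have sr: "(\<sigma> \<circ> \<rho>) permutes E" "(?s \<circ> \<rho>) permutes E" by (intro permutes_compose s r p)+
    have e1: "?s \<circ> \<rho> = \<sigma> \<circ> \<rho> \<circ> transpose x' y'" using rt by (simp add: comp_assoc)
    have e2: "\<sigma> \<circ> \<rho> = ?s \<circ> \<rho> \<circ> transpose x' y'" unfolding e1 by (simp add: fun_eq_iff)
    let ?J = "gr E \<sigma> \<union> gr E \<rho>" and ?J' = "gr E ?s \<union> gr E \<rho>"
    have "(x, y) \<in> eqv E ?J" by (rule eqv_base) (use x y in \<open>auto simp: gr_def y_def\<close>)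
    then have J: "eqv E (insert (x, y) ?J') = eqv E ?J"
      using eqv_insert_transpose[OF s x(1) y(1) gr_sub[OF fin r]]
        eqv_insert_in[of x y E ?J] gr_sub[OF fin s] gr_sub[OF fin r] by auto
    \<comment> \<open>Passing from \<open>?s\<close> back to \<sigma>, the product gains at most one
      cycle, while \<sigma> itself has one fewer.\<close>
    have up: "ncyc E (\<sigma> \<circ> \<rho>) \<le> Suc (ncyc E (?s \<circ> \<rho>))"
      using card_cycle_transpose[OF fin sr(1) xy'E] e1 by (cases "y' \<in> orbit (\<sigma> \<circ> \<rho>) x'") auto
    show ?thesis
    proof (cases "(x, y) \<in> eqv E ?J'")
      case True
      then have "eqv E ?J' = eqv E ?J" using J eqv_insert_in[OF True] gr_sub[OF fin p] gr_sub[OF fin r] by auto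
      then show ?thesis
        using IH up c1 partition_join_quotient[OF fin s r] partition_join_quotient[OF fin p r] by simp
    next
      case False
      \<comment> \<open>A cycle of the product lies inside one block of the join, so points in
        different blocks cannot share a cycle.\<close>
      have "y' \<notin> orbit (?s \<circ> \<rho>) x'"
      proof
        assume "y' \<in> orbit (?s \<circ> \<rho>) x'"
        then have "(x', y') \<in> eqv E (gr E (?s \<circ> \<rho>))" using eqv_gr[OF fin sr(2)] xy'E by simp
        moreover have "gr E (?s \<circ> \<rho>) \<subseteq> eqv E ?J'"
        proof
          fix z assume "z \<in> gr E (?s \<circ> \<rho>)"
          then obtain a where a: "a \<in> E" "z = (a, ?s (\<rho> a))" by (auto simp: gr_def)
          have "\<rho> a \<in> E" using a r by (simp add: permutes_in_image)
          moreover from this have "?s (\<rho> a) \<in> E" using p by (simp only: permutes_in_image)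
          moreover have "(\<rho> a, ?s (\<rho> a)) \<in> ?J'" using \<open>\<rho> a \<in> E\<close> unfolding gr_def by blast
          moreover have "(a, \<rho> a) \<in> ?J'" using a unfolding gr_def by blast
          ultimately show "z \<in> eqv E ?J'"
            using a eqv_base[of _ _ ?J' E] eqv_trans by metis
        qed
        ultimately have "(x', y') \<in> eqv E ?J'" using eqv_mono_hull by blast
        moreover have "(a, \<rho> a) \<in> eqv E ?J'" if "a \<in> E" for a
          by (rule eqv_base) (use that r in \<open>auto simp: gr_def permutes_in_image\<close>)
        then have "(x', x) \<in> eqv E ?J'" "(y', y) \<in> eqv E ?J'" using xy' xy'E by metis+
        ultimately show False using False eqv_sym eqv_trans by metis
      qed
      then have "ncyc E (?s \<circ> \<rho>) = Suc (ncyc E (\<sigma> \<circ> \<rho>))"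
        using card_cycle_transpose(2)[OF fin sr(2) xy'E] e2 by simp
      moreover have "card (E // eqv E ?J') = Suc (card (E // eqv E ?J))"
        using card_quotient_insert[OF fin x(1) y(1) False] J by simp
      ultimately show ?thesis
        using IH c1 partition_join_quotient[OF fin s r] partition_join_quotient[OF fin p r] by simp
    qed
  qed
qed


section \<open>Non-separability in terms of cycles\<close>

text \<open>Only closure under the maps themselves is asked for: on a finite set a permutation maps
  a closed subset onto itself, so closure under inverses follows and the condition says that the
  join has one block.\<close>

definition transitive_pair :: "'b set => ('b => 'b) => ('b => 'b) => bool" where
  "transitive_pair E \<sigma> \<rho> \<longleftrightarrow> E \<noteq> {} \<and> (\<forall>A\<subseteq>E. A \<noteq> {} --> \<sigma> ` A \<subseteq> A --> \<rho> ` A \<subseteq> A --> A = E)"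

lemma quotient_eq_singleton:
  assumes "equiv E r" shows "E // r = {E} \<longleftrightarrow> E \<noteq> {} \<and> (\<forall>x\<in>E. r `` {x} = E)"
proof
  assume a: "E // r = {E}"
  have "E \<noteq> {}" using a quotient_is_empty[of E r] by (metis insert_not_empty)
  moreover have "r `` {x} \<in> E // r" if "x \<in> E" for x using that by (rule quotientI)
  ultimately show "E \<noteq> {} \<and> (\<forall>x\<in>E. r `` {x} = E)" using a by auto
qed (auto simp: quotient_def)

lemma join_eq_singleton:
  assumes fin: "finite E" and s: "\<sigma> permutes E" and r: "\<rho> permutes E"
  shows "partition_join (cyc E \<sigma>) (cyc E \<rho>) = {E} \<longleftrightarrow> transitive_pair E \<sigma> \<rho>"
proof -
  let ?J = "gr E \<sigma> \<union> gr E \<rho>"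
  let ?e = "eqv E ?J"
  have closed: "\<sigma> ` (?e `` {x}) \<subseteq> ?e `` {x}" "\<rho> ` (?e `` {x}) \<subseteq> ?e `` {x}" for x
  proof -
    have "(x, \<sigma> y) \<in> ?e \<and> (x, \<rho> y) \<in> ?e" if "(x, y) \<in> ?e" for y
    proof -
      have y: "y \<in> E" using that by (simp add: eqv_def)
      have "(y, \<sigma> y) \<in> ?e" "(y, \<rho> y) \<in> ?e"
        by (rule eqv_base; use y s r in \<open>auto simp: gr_def permutes_in_image\<close>)+
      then show ?thesis using that eqv_trans by metis
    qed
    then show "\<sigma> ` (?e `` {x}) \<subseteq> ?e `` {x}" "\<rho> ` (?e `` {x}) \<subseteq> ?e `` {x}" by auto
  qed
  have sub: "?e `` {x} \<subseteq> E" for x by (auto simp: eqv_def)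
  have "(\<forall>x\<in>E. ?e `` {x} = E) \<longleftrightarrow> (\<forall>A\<subseteq>E. A \<noteq> {} --> \<sigma> ` A \<subseteq> A --> \<rho> ` A \<subseteq> A --> A = E)"
  proof (intro iffI allI impI ballI)
    fix A assume all: "\<forall>x\<in>E. ?e `` {x} = E" and A: "A \<subseteq> E" "A \<noteq> {}" "\<sigma> ` A \<subseteq> A" "\<rho> ` A \<subseteq> A"
    have fA: "finite A" using A fin finite_subset by blast
    have onto: "\<sigma> ` A = A" "\<rho> ` A = A"
      by (rule endo_inj_surj[OF fA A(3) permutes_inj_on[OF s]], rule endo_inj_surj[OF fA A(4) permutes_inj_on[OF r]])
    have inv: "y \<in> A \<longleftrightarrow> \<sigma> y \<in> A" "y \<in> A \<longleftrightarrow> \<rho> y \<in> A" for y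
      using onto permutes_inj[OF s] permutes_inj[OF r] by (metis inj_image_mem_iff)+
    obtain a where a: "a \<in> A" using A by blast
    have "y \<in> A" if "(a, y) \<in> (?J \<union> ?J\<inverse>)\<^sup>*" for y
      using that by (induction rule: rtrancl_induct) (use a inv in \<open>auto simp: gr_def\<close>)
    moreover have "?e `` {a} = E" using all a A by blast
    ultimately have "E \<subseteq> A" by (auto simp: eqv_def)
    then show "A = E" using A by blast
  next
    fix x assume all: "\<forall>A\<subseteq>E. A \<noteq> {} --> \<sigma> ` A \<subseteq> A --> \<rho> ` A \<subseteq> A --> A = E" and x: "x \<in> E"
    have "x \<in> ?e `` {x}" using eqv_refl[OF x] by simp
    then have "?e `` {x} \<noteq> {}" by blast
    then show "?e `` {x} = E" using all[rule_format, OF sub _ closed] by simp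
  qed
  then show ?thesis
    unfolding partition_join_quotient[OF assms] quotient_eq_singleton[OF equiv_eqv] transitive_pair_def
    by simp
qed

lemma transitive_pair_commute: "transitive_pair E \<sigma> \<rho> \<longleftrightarrow> transitive_pair E \<rho> \<sigma>"
  unfolding transitive_pair_def by blast

text \<open>After the cut at \<open>b\<close> and \<open>d\<close> there is one more cycle of
  \<tau>. If \<open>b\<close> and \<open>d\<close> share a cycle of
  \<open>\<nu> \<circ> \<tau>\<close>, the product gains a cycle too, and a connected join would
  violate \<open>genus_nonneg\<close>. If they do not, the product of \<nu> with the cut \<tau>
  still links \<open>b\<close> to \<open>d\<close>, and nothing is disconnected.\<close>

lemma NS_iff:
  assumes fin: "finite E" and t: "\<tau> permutes E"
  shows "\<nu> \<in> NS E \<tau> \<longleftrightarrow> \<nu> permutes E \<and> transitive_pair E \<tau> \<nu>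
     \<and> ncyc E \<nu> + ncyc E \<tau> + ncyc E (\<nu> \<circ> \<tau>) = card E + 2
     \<and> (\<forall>b\<in>E. \<forall>d\<in>orbit \<tau> b. b \<noteq> d --> d \<notin> orbit (\<nu> \<circ> \<tau>) b)" (is "_ \<longleftrightarrow> ?R")
proof (cases "\<nu> permutes E \<and> transitive_pair E \<tau> \<nu>
     \<and> ncyc E \<nu> + ncyc E \<tau> + ncyc E (\<nu> \<circ> \<tau>) = card E + 2")
  case False
  have "?R" if NS: "\<nu> \<in> NS E \<tau>" and "\<nu> permutes E" "transitive_pair E \<tau> \<nu>"
  proof -
    have j: "partition_join (cyc E \<nu>) (cyc E \<tau>) = {E}"
      using join_eq_singleton[OF fin that(2) t] that transitive_pair_commute by metis
    have "genus E \<nu> \<tau> = 0" using NS by (simp add: NS_def)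
    then have "(of_nat (ncyc E \<nu> + ncyc E \<tau> + ncyc E (\<nu> \<circ> \<tau>)) :: rat)
        = of_nat (card E + 2)"
      by (simp add: genus_def j)
    then have "ncyc E \<nu> + ncyc E \<tau> + ncyc E (\<nu> \<circ> \<tau>) = card E + 2"
      by (simp only: of_nat_eq_iff)
    then show ?thesis using False that by blast
  qed
  moreover have "\<nu> permutes E \<and> transitive_pair E \<tau> \<nu>" if "\<nu> \<in> NS E \<tau>"
    using that join_eq_singleton[OF fin t, of \<nu>] unfolding NS_def by blast
  ultimately show ?thesis using False by blast
next
  case True
  then have p: "\<nu> permutes E" and tr: "transitive_pair E \<tau> \<nu>"
    and cnt: "ncyc E \<nu> + ncyc E \<tau> + ncyc E (\<nu> \<circ> \<tau>) = card E + 2"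
    by auto
  let ?f = "\<nu> \<circ> \<tau>"
  have pf: "?f permutes E" by (intro permutes_compose t p)
  have j: "partition_join (cyc E \<nu>) (cyc E \<tau>) = {E}"
    using join_eq_singleton[OF fin p t] tr transitive_pair_commute by metis
  have g: "genus E \<nu> \<tau> = 0"
  proof -
    have "(of_nat (ncyc E \<nu> + ncyc E \<tau> + ncyc E (\<nu> \<circ> \<tau>)) :: rat)
        = of_nat (card E + 2)" using cnt by (simp only:)
    then show ?thesis by (simp add: genus_def j)
  qed
  have key: "partition_join (cyc E (\<tau> \<circ> transpose b d)) (cyc E \<nu>) = {E} \<longleftrightarrow> d \<notin> orbit ?f b"
    if b: "b \<in> E" and d: "d \<in> orbit \<tau> b" and bd: "b \<noteq> d" for b d
  proof -
    have dE: "d \<in> E" using perm_orbit_sub[OF fin t b] d by blast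
    let ?t = "\<tau> \<circ> transpose b d"
    have pt: "?t permutes E" using permutes_comp_transpose[OF t b dE] .
    have e: "\<nu> \<circ> ?t = ?f \<circ> transpose b d" by (simp add: comp_assoc)
    have ct: "ncyc E ?t = Suc (ncyc E \<tau>)"
      using card_cycle_transpose[OF fin t b dE bd] d by simp
    show ?thesis
    proof
      assume J: "partition_join (cyc E ?t) (cyc E \<nu>) = {E}"
      show "d \<notin> orbit ?f b"
      proof
        assume "d \<in> orbit ?f b"
        then have "ncyc E (\<nu> \<circ> ?t) = Suc (ncyc E ?f)"
          using card_cycle_transpose[OF fin pf b dE bd] e by simp
        moreover have "partition_join (cyc E \<nu>) (cyc E ?t) = {E}"
          using J join_eq_singleton[OF fin pt p] join_eq_singleton[OF fin p pt] transitive_pair_commute by metis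
        ultimately show False using genus_nonneg[OF fin p pt] ct cnt by simp
      qed
    next
      assume nd: "d \<notin> orbit ?f b"
      let ?e = "eqv E (gr E ?t \<union> gr E \<nu>)"
      \<comment> \<open>The product with the cut \<tau> merges the cycles of \<open>b\<close> and
        \<open>d\<close>, so the two points stay connected. Adding the pair \<open>(b, d)\<close>
        therefore changes nothing, and in its presence the transposition can be undone.\<close>
      have "b \<in> orbit (?f \<circ> transpose b d) b" "d \<in> orbit (\<nu> \<circ> ?t) b"
        unfolding e using orbit_transpose_merge[OF fin pf nd] perm_self[OF fin permutes_comp_transpose[OF pf b dE]] by auto
      have cl: "(z, \<nu> (?t z)) \<in> ?e" if "z \<in> E" for z
      proof (rule eqv_trans)
        have "?t z \<in> E" using that pt by (simp only: permutes_in_image)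
        then show "(z, ?t z) \<in> ?e" "(?t z, \<nu> (?t z)) \<in> ?e"
          by (rule_tac [!] eqv_base) (use that p in \<open>auto simp only: permutes_in_image, auto simp: gr_def\<close>)
      qed
      have pnt: "(\<nu> \<circ> ?t) permutes E" by (intro permutes_compose pt p)
      have "gr E (\<nu> \<circ> ?t) \<subseteq> ?e" using cl by (auto simp: gr_def)
      then have "(b, d) \<in> ?e"
        using eqv_gr[OF fin pnt] \<open>d \<in> orbit (\<nu> \<circ> ?t) b\<close> b eqv_mono_hull by blast
      then have "?e = eqv E (insert (b, d) (gr E ?t \<union> gr E \<nu>))"
        using eqv_insert_in[of b d E "gr E ?t \<union> gr E \<nu>"] gr_sub[OF fin pt] gr_sub[OF fin p] by auto
      also have "\<dots> = eqv E (insert (b, d) (gr E \<tau> \<union> gr E \<nu>))"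
        by (rule eqv_insert_transpose[OF t b dE gr_sub[OF fin p]])
      also have "\<dots> = eqv E (gr E \<tau> \<union> gr E \<nu>)"
      proof (rule eqv_insert_in)
        have "(b, d) \<in> eqv E (gr E \<tau>)" using eqv_gr[OF fin t] b d by simp
        then show "(b, d) \<in> eqv E (gr E \<tau> \<union> gr E \<nu>)"
          using eqv_mono_hull[OF eqv_baseI[of "gr E \<tau>" "gr E \<tau> \<union> gr E \<nu>" E]] gr_sub[OF fin t] by blast
      qed (use gr_sub[OF fin t] gr_sub[OF fin p] in auto)
      finally show "partition_join (cyc E ?t) (cyc E \<nu>) = {E}"
        using tr join_eq_singleton[OF fin t p]
        by (simp add: partition_join_quotient[OF fin pt p] partition_join_quotient[OF fin t p])
    qed
  qed
  have "(\<forall>Z\<in>cyc E \<tau>. \<forall>b\<in>Z. \<forall>d\<in>Z. b \<noteq> d -->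
          partition_join (cyc E (\<tau> \<circ> transpose b d)) (cyc E \<nu>) = {E})
    \<longleftrightarrow> (\<forall>b\<in>E. \<forall>d\<in>orbit \<tau> b. b \<noteq> d -->
          partition_join (cyc E (\<tau> \<circ> transpose b d)) (cyc E \<nu>) = {E})"
    (is "?A \<longleftrightarrow> ?B")
  proof
    assume A: ?A
    show ?B
    proof (intro ballI)
      fix b d assume "b \<in> E" "d \<in> orbit \<tau> b"
      then show "b \<noteq> d --> partition_join (cyc E (\<tau> \<circ> transpose b d)) (cyc E \<nu>) = {E}"
        using A[rule_format, of "orbit \<tau> b" b d] perm_self[OF fin t] by (auto simp: cycle_partition_def)
    qed
  next
    assume B: ?B
    show ?A
    proof (intro ballI)
      fix Z b d assume Z: "Z \<in> cyc E \<tau>" "b \<in> Z" "d \<in> Z"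
      then obtain x where "x \<in> E" "Z = orbit \<tau> x" by (auto simp: cycle_partition_def)
      then have bx: "b \<in> orbit \<tau> x" using Z by simp
      have "b \<in> E" using perm_orbit_sub[OF fin t \<open>x \<in> E\<close>] bx by blast
      moreover have "Z = orbit \<tau> b" using perm_orbit_eq[OF fin t bx] \<open>Z = _\<close> by simp
      ultimately have "b \<in> E" "Z = orbit \<tau> b" by this+
      then show "b \<noteq> d --> partition_join (cyc E (\<tau> \<circ> transpose b d)) (cyc E \<nu>) = {E}"
        using B Z by metis
    qed
  qed
  also have "?B \<longleftrightarrow> (\<forall>b\<in>E. \<forall>d\<in>orbit \<tau> b. b \<noteq> d --> d \<notin> orbit ?f b)"
    by (intro ball_cong refl imp_cong) (rule key)
  finally show ?thesis using True g tr join_eq_singleton[OF fin t p] by (simp add: NS_def)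
qed

section \<open>Dual permutations and collapsing runs\<close>

text \<open>The conditions of \<open>NS_iff\<close> rewritten for the inverse of \<nu>: then
  \<open>inv \<tau> \<circ> \<psi>\<close> is the inverse of \<open>\<nu> \<circ> \<tau>\<close> and
  has the same cycles.\<close>

definition dual_NS :: "'b set => ('b => 'b) => ('b => 'b) set" where
  "dual_NS E \<tau> = {\<psi>. \<psi> permutes E \<and> transitive_pair E \<tau> \<psi>
     \<and> ncyc E \<psi> + ncyc E \<tau> + ncyc E (inv \<tau> \<circ> \<psi>) = card E + 2
     \<and> (\<forall>b\<in>E. \<forall>d\<in>orbit \<tau> b. b \<noteq> d --> d \<notin> orbit (inv \<tau> \<circ> \<psi>) b)}"

lemma cycle_partition_inv:
  assumes "finite E" "\<sigma> permutes E" shows "cyc E (inv \<sigma>) = cyc E \<sigma>"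
  using orbit_inv_eq[OF permutes_imp_permutation[OF assms]] by (simp add: cycle_partition_def)

lemma permutes_image_closed:
  assumes fin: "finite E" and p: "\<sigma> permutes E" and A: "A \<subseteq> E" "\<sigma> ` A \<subseteq> A"
  shows "\<sigma> x \<in> A \<longleftrightarrow> x \<in> A"
proof -
  have "\<sigma> ` A = A"
    by (rule endo_inj_surj) (use finite_subset[OF A(1) fin] A permutes_inj_on[OF p] in auto)
  then show ?thesis using permutes_inj[OF p] by (metis inj_image_mem_iff)
qed

lemma permutes_orbit_closed:
  assumes fin: "finite E" and p: "\<sigma> permutes E" and A: "A \<subseteq> E" "\<sigma> ` A \<subseteq> A" and y: "y \<in> orbit \<sigma> x"
  shows "y \<in> A \<longleftrightarrow> x \<in> A"
  using y by (induction rule: orbit.induct) (use permutes_image_closed[OF fin p A] in auto)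

lemma transitive_pair_inv:
  assumes fin: "finite E" and p: "\<nu> permutes E"
  shows "transitive_pair E \<tau> (inv \<nu>) \<longleftrightarrow> transitive_pair E \<tau> \<nu>"
proof -
  have iff: "inv \<nu> ` A \<subseteq> A \<longleftrightarrow> \<nu> ` A \<subseteq> A" if "A \<subseteq> E" for A
  proof
    assume "\<nu> ` A \<subseteq> A"
    then have "\<nu> x \<in> A \<longleftrightarrow> x \<in> A" for x using permutes_image_closed[OF fin p that] by blast
    then show "inv \<nu> ` A \<subseteq> A" using permutes_inverses[OF p] by (metis image_subsetI)
  next
    assume "inv \<nu> ` A \<subseteq> A"
    then have "inv \<nu> x \<in> A \<longleftrightarrow> x \<in> A" for x
      using permutes_image_closed[OF fin permutes_inv[OF p] that] by blast
    then show "\<nu> ` A \<subseteq> A" using permutes_inverses[OF p] by (metis image_subsetI)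
  qed
  show ?thesis unfolding transitive_pair_def
    by (intro conj_cong refl all_cong1 imp_cong) (rule iff)
qed

lemma inv_in_dual_NS:
  assumes fin: "finite E" and t: "\<tau> permutes E" and p: "\<nu> permutes E"
  shows "inv \<nu> \<in> dual_NS E \<tau> \<longleftrightarrow> \<nu> \<in> NS E \<tau>"
proof -
  have pc: "(\<nu> \<circ> \<tau>) permutes E" by (intro permutes_compose t p)
  have e: "inv \<tau> \<circ> inv \<nu> = inv (\<nu> \<circ> \<tau>)"
    by (rule o_inv_distrib[symmetric]) (use permutes_bij t p in auto)
  show ?thesis
    unfolding dual_NS_def e NS_iff[OF fin t] mem_Collect_eq
      cycle_partition_inv[OF fin p] cycle_partition_inv[OF fin pc]
      orbit_inv_eq[OF permutes_imp_permutation[OF fin pc]] transitive_pair_inv[OF fin p]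
    using permutes_inv[OF p] p by blast
qed

lemma sum_NS_dual:
  assumes fin: "finite E" and t: "\<tau> permutes E"
  shows "(\<Sum>\<nu>\<in>NS E \<tau>. f (cyc E \<nu>)) = (\<Sum>\<psi>\<in>dual_NS E \<tau>. f (cyc E \<psi>))"
proof (rule sum.reindex_bij_witness[where i = inv and j = inv])
  fix \<nu> assume "\<nu> \<in> NS E \<tau>"
  then have p: "\<nu> permutes E" using NS_iff[OF fin t] by blast
  show "inv (inv \<nu>) = \<nu>" using permutes_inv_inv[OF p] .
  show "inv \<nu> \<in> dual_NS E \<tau>" using inv_in_dual_NS[OF fin t p] \<open>\<nu> \<in> NS E \<tau>\<close> by simp
  show "f (cyc E (inv \<nu>)) = f (cyc E \<nu>)" using cycle_partition_inv[OF fin p] by simp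
next
  fix \<psi> assume a: "\<psi> \<in> dual_NS E \<tau>"
  then have p: "\<psi> permutes E" by (simp add: dual_NS_def)
  show "inv (inv \<psi>) = \<psi>" using permutes_inv_inv[OF p] .
  then show "inv \<psi> \<in> NS E \<tau>" using inv_in_dual_NS[OF fin t permutes_inv[OF p]] a by simp
qed

section \<open>Expanding a permutation of runs to a permutation of elements\<close>

text \<open>Seen through the names \<open>c\<close>, the map \<open>f\<close> is \<open>g\<close>
  with pauses: it stays in a run until the last element \<open>en (c e)\<close>, which is always
  reached, and there takes one step of \<open>g\<close>. Hence its orbits are full preimages of
  orbits of \<open>g\<close>.\<close>

lemma orbit_semiconj:
  assumes fin: "finite E" and f: "f permutes E" and e: "e \<in> E"
    and step: "\<And>e. e \<in> E ==> c (f e) = c e \<or> c (f e) = g (c e)"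
    and reach: "\<And>e. e \<in> E ==> en (c e) \<in> orbit f e"
    and en: "\<And>e. e \<in> E ==> c (f (en (c e))) = g (c e)"
    and self: "c e \<in> orbit g (c e)"
  shows "orbit f e = {e' \<in> E. c e' \<in> orbit g (c e)}"
proof (intro equalityI subsetI)
  fix e' assume "e' \<in> orbit f e"
  then show "e' \<in> {e' \<in> E. c e' \<in> orbit g (c e)}"
  proof (induction rule: orbit.induct)
    case base
    have "f e \<in> E" using e f by (simp add: permutes_in_image)
    then show ?case using step[OF e] self orbit.base[of g "c e"] by auto
  next
    case (step y)
    have "f y \<in> E" using step f by (simp add: permutes_in_image)
    then show ?case using assms(4)[of y] step orbit.step[of "c y" g "c e"] by auto
  qed
next
  note oe = perm_orbit_eq[OF fin f]
  have nx: "en (g (c e')) \<in> orbit f e" if "en (c e') \<in> orbit f e" "e' \<in> E" for e'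
  proof -
    have "f (en (c e')) \<in> orbit f e" using that perm_orbit_closed[OF fin f] by blast
    moreover have "en (c e') \<in> E" using that perm_orbit_sub[OF fin f e] by blast
    then have "f (en (c e')) \<in> E" using f by (simp add: permutes_in_image)
    then have "en (c (f (en (c e')))) \<in> orbit f (f (en (c e')))" by (rule reach)
    ultimately show ?thesis using oe en[OF that(2)] by auto
  qed
  have key: "en b \<in> orbit f e \<and> (\<exists>e'\<in>E. c e' = b)" if "b \<in> orbit g (c e)" for b
    using that
  proof (induction rule: orbit.induct)
    case base
    have "en (c e) \<in> E" using reach[OF e] perm_orbit_sub[OF fin f e] by blast
    then have "f (en (c e)) \<in> E" using f by (simp add: permutes_in_image)
    then show ?case using nx[OF reach[OF e] e] en[OF e] by blast
  next
    case (step b)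
    then obtain e' where e': "e' \<in> E" "c e' = b" by blast
    have "en (c e') \<in> E" using reach[OF e'(1)] perm_orbit_sub[OF fin f e'(1)] by blast
    then have "f (en (c e')) \<in> E" using f by (simp add: permutes_in_image)
    then show ?case using nx[of e'] step.IH e' en[of e'] by metis
  qed
  fix e' assume "e' \<in> {e' \<in> E. c e' \<in> orbit g (c e)}"
  then have e': "e' \<in> E" "en (c e') \<in> orbit f e" using key by auto
  then have "orbit f e = orbit f (en (c e'))" using oe by simp
  also have "\<dots> = orbit f e'" using oe reach[OF e'(1)] by simp
  finally show "e' \<in> orbit f e" using perm_self[OF fin f] by simp
qed

text \<open>\<open>B\<close> is a set of names for the runs into which the cycles of \<open>\<tau>\<close> are cut, \<open>c e\<close> is the run
  of \<open>e\<close> and \<open>en b\<close> the last element of the run \<open>b\<close>.\<close>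

locale arcs =
  fixes E :: "'e set" and \<tau> :: "'e => 'e" and B :: "'b set" and N :: "'b => 'b"
    and c :: "'e => 'b" and en :: "'b => 'e"
  assumes finE: "finite E" and finB: "finite B"
    and perm_\<tau>: "\<tau> permutes E" and perm_N: "N permutes B"
    and c_in: "e \<in> E ==> c e \<in> B" and en_in: "b \<in> B ==> en b \<in> E" and c_en: "b \<in> B ==> c (en b) = b"
    and c_step: "e \<in> E ==> e \<notin> en ` B ==> c (\<tau> e) = c e" and c_end: "b \<in> B ==> c (\<tau> (en b)) = N b"
    and reach: "e \<in> E ==> \<exists>k. (\<tau> ^^ k) e = en (c e) \<and> (\<forall>j<k. (\<tau> ^^ j) e \<notin> en ` B)"
begin

text \<open>This is the map \<alpha> of the expanded permutation. Elements inside a run have to be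
  fixed, because there the expanded permutation follows \<tau>.\<close>

definition ext :: "('b => 'b) => 'e => 'e" where
  "ext \<alpha> e = (if e \<in> en ` B then en (\<alpha> (c e)) else e)"

text \<open>Defined through its quotient by \<tau>, so that
  \<open>inv \<tau> \<circ> blow \<psi>\<close> is an \<open>ext\<close> by construction and
  bijectivity needs to be checked for \<open>ext\<close> only.\<close>

definition blow :: "('b => 'b) => 'e => 'e" where
  "blow \<psi> = \<tau> \<circ> ext (inv N \<circ> \<psi>)"

lemma inj_en: "inj_on en B" using c_en by (metis inj_onI)

lemma ext_en: "b \<in> B ==> ext \<alpha> (en b) = en (\<alpha> b)" by (simp add: ext_def c_en)

lemma ext_permutes: assumes "\<alpha> permutes B" shows "ext \<alpha> permutes E"
proof (rule bij_imp_permutes)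
  have s: "\<alpha> b \<in> B \<longleftrightarrow> b \<in> B" for b using assms by (simp add: permutes_in_image)
  have im: "ext \<alpha> ` E \<subseteq> E" by (auto simp: ext_def s c_en en_in)
  have "inj_on (ext \<alpha>) E"
  proof (rule inj_onI)
    fix x y assume "x \<in> E" "y \<in> E" and e: "ext \<alpha> x = ext \<alpha> y"
    have "ext \<alpha> x \<in> en ` B \<longleftrightarrow> x \<in> en ` B" for x by (auto simp: ext_def s c_en)
    then consider "x \<in> en ` B" "y \<in> en ` B" | "x \<notin> en ` B" "y \<notin> en ` B" using e by metis
    then show "x = y"
    proof cases
      case 1
      then obtain a b where ab: "x = en a" "y = en b" "a \<in> B" "b \<in> B" by auto
      then have "\<alpha> a = \<alpha> b" using e inj_en s by (auto simp: ext_en inj_on_def)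
      then show ?thesis using permutes_inj[OF assms] ab by (simp add: inj_eq)
    qed (use e in \<open>simp add: ext_def\<close>)
  qed
  then show "bij_betw (ext \<alpha>) E E"
    using im finE by (simp add: bij_betw_def endo_inj_surj)
  show "ext \<alpha> e = e" if "e \<notin> E" for e using that en_in by (auto simp: ext_def)
qed

context
  fixes \<psi> assumes psi: "\<psi> permutes B"
begin

lemma alpha_permutes: "(inv N \<circ> \<psi>) permutes B"
  by (intro permutes_compose psi permutes_inv perm_N)

lemma blow_permutes: "blow \<psi> permutes E"
  unfolding blow_def by (intro permutes_compose ext_permutes alpha_permutes perm_\<tau>)

lemma blow_en: assumes "b \<in> B" shows "blow \<psi> (en b) = \<tau> (en (inv N (\<psi> b)))" "c (blow \<psi> (en b)) = \<psi> b"
proof -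
  show e: "blow \<psi> (en b) = \<tau> (en (inv N (\<psi> b)))" using assms by (simp add: blow_def ext_en)
  have "inv N (\<psi> b) \<in> B" using alpha_permutes assms by (metis comp_apply permutes_in_image)
  then show "c (blow \<psi> (en b)) = \<psi> b" unfolding e using c_end permutes_inverses[OF perm_N] by simp
qed

lemma blow_step: "e \<in> E ==> e \<notin> en ` B ==> blow \<psi> e = \<tau> e"
  by (simp add: blow_def ext_def)

lemma inv_tau_blow: "inv \<tau> \<circ> blow \<psi> = ext (inv N \<circ> \<psi>)"
  unfolding blow_def using permutes_inverses[OF perm_\<tau>] by (simp add: fun_eq_iff)

lemma blow_reach: assumes e: "e \<in> E" shows "en (c e) \<in> orbit (blow \<psi>) e"
proof -
  obtain k where k: "(\<tau> ^^ k) e = en (c e)" "\<forall>j<k. (\<tau> ^^ j) e \<notin> en ` B" using reach[OF e] by blast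
  have "(\<tau> ^^ j) e \<in> E" for j using e perm_\<tau> by (induction j) (auto simp: permutes_in_image)
  then have "j \<le> k ==> (blow \<psi> ^^ j) e = (\<tau> ^^ j) e" for j
    by (induction j) (use k blow_step in auto)
  then show ?thesis using k funpow_in_orbit[OF perm_self[OF finE blow_permutes]] by (metis le_refl)
qed

lemma orbit_blow: assumes e: "e \<in> E" shows "orbit (blow \<psi>) e = {e' \<in> E. c e' \<in> orbit \<psi> (c e)}"
proof (rule orbit_semiconj[where en = en])
  fix e assume e: "e \<in> E"
  show "c (blow \<psi> e) = c e \<or> c (blow \<psi> e) = \<psi> (c e)"
    using blow_en c_step[OF e] blow_step[OF e] c_en by (cases "e \<in> en ` B") auto
qed (use finE blow_permutes e blow_reach blow_en c_in perm_self[OF finB psi] in auto)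

lemma cycle_partition_blow:
  "cyc E (blow \<psi>) = (\<lambda>V. {e \<in> E. c e \<in> V}) ` cyc B \<psi>"
proof -
  have "c ` E = B" using c_in en_in c_en by force
  then have "cyc B \<psi> = (\<lambda>e. orbit \<psi> (c e)) ` E" by (auto simp: cycle_partition_def)
  then show ?thesis using orbit_blow by (auto simp: cycle_partition_def image_image intro!: image_cong)
qed

lemma inj_on_arc_union: "inj_on (\<lambda>V. {e \<in> E. c e \<in> V}) (Pow B)"
proof (rule inj_onI)
  fix V W assume *: "V \<in> Pow B" "W \<in> Pow B" "{e \<in> E. c e \<in> V} = {e \<in> E. c e \<in> W}"
  have "c ` {e \<in> E. c e \<in> V} = V" if "V \<in> Pow B" for V
    using that en_in c_en by (auto intro!: image_eqI[of _ c "en _"])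
  then show "V = W" using * by metis
qed

lemma cycle_sub: "cyc B \<psi> \<subseteq> Pow B"
  using perm_orbit_sub[OF finB psi] by (auto simp: cycle_partition_def)

lemma card_cycle_blow: "ncyc E (blow \<psi>) = ncyc B \<psi>"
  unfolding cycle_partition_blow
  by (rule card_image) (rule inj_on_subset[OF inj_on_arc_union cycle_sub])

text \<open>Closed sets correspond: in one direction take all elements whose run is in the set, in
  the other all runs whose last element is. The latter loses nothing, since a set closed under
  \<tau> contains a run entirely or not at all.\<close>

lemma transitive_blow: "transitive_pair E \<tau> (blow \<psi>) \<longleftrightarrow> transitive_pair B N \<psi>"
proof -
  have EB: "E = {} \<longleftrightarrow> B = {}" using c_in en_in by blast
  have rt: "en (c e) \<in> orbit \<tau> e" if "e \<in> E" for e
    using reach[OF that] funpow_in_orbit[OF perm_self[OF finE perm_\<tau>]] by metis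
  show ?thesis unfolding transitive_pair_def EB
  proof (rule conj_cong[OF refl], intro iffI allI impI)
    fix A assume all: "\<forall>A\<subseteq>E. A \<noteq> {} --> \<tau> ` A \<subseteq> A --> blow \<psi> ` A \<subseteq> A --> A = E"
      and A: "A \<subseteq> B" "A \<noteq> {}" "N ` A \<subseteq> A" "\<psi> ` A \<subseteq> A"
    let ?A = "{e \<in> E. c e \<in> A}"
    have "c (\<tau> e) \<in> A \<and> c (blow \<psi> e) \<in> A" if e: "e \<in> ?A" for e
    proof (cases "e \<in> en ` B")
      case True
      then obtain b where b: "b \<in> B" "e = en b" by auto
      then have "b \<in> A" using e c_en by simp
      then show ?thesis using A b c_end blow_en by auto
    next
      case False
      then show ?thesis using e c_step blow_step by simp
    qed
    moreover have "\<tau> e \<in> E" "blow \<psi> e \<in> E" if "e \<in> E" for e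
      using that perm_\<tau> blow_permutes by (simp_all add: permutes_in_image)
    ultimately have cl: "\<tau> ` ?A \<subseteq> ?A" "blow \<psi> ` ?A \<subseteq> ?A" by auto
    obtain b where "b \<in> A" using A by blast
    then have "en b \<in> ?A" using A en_in c_en by auto
    then have "?A = E" using all[rule_format, OF _ _ cl] by auto
    then show "A = B" using A en_in c_en by (metis (mono_tags, lifting) mem_Collect_eq subsetI subset_antisym)
  next
    fix A assume all: "\<forall>A\<subseteq>B. A \<noteq> {} --> N ` A \<subseteq> A --> \<psi> ` A \<subseteq> A --> A = B"
      and A: "A \<subseteq> E" "A \<noteq> {}" "\<tau> ` A \<subseteq> A" "blow \<psi> ` A \<subseteq> A"
    let ?A = "{b \<in> B. en b \<in> A}"
    have en_c: "en (c e) \<in> A \<longleftrightarrow> e \<in> A" if "e \<in> E" for e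
      using permutes_orbit_closed[OF finE perm_\<tau> A(1,3) rt[OF that]] .
    have "N b \<in> ?A \<and> \<psi> b \<in> ?A" if "b \<in> ?A" for b
    proof -
      have b: "b \<in> B" "en b \<in> A" using that by auto
      have "\<tau> (en b) \<in> A" "blow \<psi> (en b) \<in> A" using A b by auto
      then have "en (c (\<tau> (en b))) \<in> A" "en (c (blow \<psi> (en b))) \<in> A" using en_c A by blast+
      then show ?thesis using b c_end blow_en perm_N psi by (simp add: permutes_in_image)
    qed
    then have cl: "N ` ?A \<subseteq> ?A" "\<psi> ` ?A \<subseteq> ?A" by auto
    obtain e where e: "e \<in> A" using A by blast
    then have "c e \<in> ?A" using en_c A c_in by blast
    then have AB: "?A = B" using all[rule_format, OF _ _ cl] by auto
    show "A = E"
    proof (intro equalityI subsetI)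
      fix e assume "e \<in> E"
      then show "e \<in> A" using AB en_c c_in by blast
    qed (use A in blast)
  qed
qed

end

lemma ext_id: "\<alpha> permutes B ==> (\<And>b. b \<in> B ==> \<alpha> b = b) ==> ext \<alpha> = id"
  by (auto simp: ext_def fun_eq_iff c_en)

lemma blow_N: "blow N = \<tau>"
  using permutes_inv_o[OF perm_N] ext_id[OF permutes_id] by (simp add: blow_def)

lemma orbit_tau: "e \<in> E ==> orbit \<tau> e = {e' \<in> E. c e' \<in> orbit N (c e)}"
  using orbit_blow[OF perm_N] by (simp add: blow_N)

lemma orbit_ext:
  assumes a: "\<alpha> permutes B" shows "b \<in> B ==> orbit (ext \<alpha>) (en b) = en ` orbit \<alpha> b"
    and "e \<notin> en ` B ==> orbit (ext \<alpha>) e = {e}"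
proof -
  show "e \<notin> en ` B ==> orbit (ext \<alpha>) e = {e}"
    using orbit_eq_singleton_iff[of "ext \<alpha>" e] by (simp add: ext_def)
  assume b: "b \<in> B"
  have sub: "orbit \<alpha> b \<subseteq> B" using perm_orbit_sub[OF finB a b] .
  show "orbit (ext \<alpha>) (en b) = en ` orbit \<alpha> b"
  proof (intro equalityI subsetI)
    fix e assume "e \<in> orbit (ext \<alpha>) (en b)"
    then show "e \<in> en ` orbit \<alpha> b"
    proof (induction rule: orbit.induct)
      case base then show ?case using b orbit.base[of \<alpha> b] by (simp add: ext_en)
    next
      case (step e)
      then obtain x where "x \<in> orbit \<alpha> b" "e = en x" by auto
      then show ?case using sub orbit.step[of x \<alpha> b] by (auto simp: ext_en subset_iff)
    qed
  next
    fix e assume "e \<in> en ` orbit \<alpha> b"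
    then obtain x where x: "x \<in> orbit \<alpha> b" "e = en x" by auto
    from x(1) have "en x \<in> orbit (ext \<alpha>) (en b)"
    proof (induction rule: orbit.induct)
      case base then show ?case using b orbit.base[of "ext \<alpha>" "en b"] by (simp add: ext_en)
    next
      case (step x)
      then show ?case using sub orbit.step[of "en x" "ext \<alpha>" "en b"] by (auto simp: ext_en subset_iff)
    qed
    then show "e \<in> orbit (ext \<alpha>) (en b)" using x by simp
  qed
qed

text \<open>Each of the \<open>card E - card B\<close> elements inside runs is a cycle of its own.
  This surplus is exactly the growth of the ground set, which is why Euler's relation is insensitive
  to the collapse.\<close>

lemma card_cycle_ext:
  assumes a: "\<alpha> permutes B"
  shows "ncyc E (ext \<alpha>) + card B = ncyc B \<alpha> + card E"
proof -
  have EB: "en ` B \<subseteq> E" using en_in by auto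
  have "cyc E (ext \<alpha>) = orbit (ext \<alpha>) ` (en ` B) \<union> orbit (ext \<alpha>) ` (E - en ` B)"
    using EB by (auto simp: cycle_partition_def)
  also have "orbit (ext \<alpha>) ` (en ` B) = (`) en ` cyc B \<alpha>"
    using orbit_ext(1)[OF a] by (auto simp: cycle_partition_def image_image intro!: image_cong)
  also have "orbit (ext \<alpha>) ` (E - en ` B) = (\<lambda>e. {e}) ` (E - en ` B)"
    using orbit_ext(2)[OF a] by (auto intro!: image_cong)
  finally have e: "cyc E (ext \<alpha>) = (`) en ` cyc B \<alpha> \<union> (\<lambda>e. {e}) ` (E - en ` B)" .
  have sub: "cyc B \<alpha> \<subseteq> Pow B"
    using perm_orbit_sub[OF finB a] by (auto simp: cycle_partition_def)
  have "card ((`) en ` cyc B \<alpha> \<union> (\<lambda>e. {e}) ` (E - en ` B))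
      = card ((`) en ` cyc B \<alpha>) + card ((\<lambda>e. {e}) ` (E - en ` B))"
  proof (rule card_Un_disjoint)
    have "V \<noteq> (\<lambda>x. {x}) e" if "V \<in> (`) en ` cyc B \<alpha>" "e \<in> E - en ` B" for V e
      using that sub by auto blast
    then show "(`) en ` cyc B \<alpha> \<inter> (\<lambda>e. {e}) ` (E - en ` B) = {}" by blast
  qed (use finE finB in \<open>auto simp: cycle_partition_def\<close>)
  also have "card ((`) en ` cyc B \<alpha>) = ncyc B \<alpha>"
    by (rule card_image) (rule inj_on_subset[OF inj_on_image_Pow[OF inj_en] sub])
  also have "card ((\<lambda>e. {e}) ` (E - en ` B)) = card E - card B"
    using EB finE finB inj_en by (simp add: card_image card_Diff_subset)
  finally have "ncyc E (ext \<alpha>) = ncyc B \<alpha> + (card E - card B)"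
    using e by simp
  moreover have "card B \<le> card E" using EB finE inj_en card_mono card_image by metis
  ultimately show ?thesis by simp
qed

text \<open>Cycles of \<psi> and of \<tau> correspond one to one, \<open>card_cycle_ext\<close>
  balances the third count, and the new fixed points cannot meet a cycle of \<tau> twice.\<close>

lemma blow_dual_NS:
  assumes psi: "\<psi> permutes B"
  shows "blow \<psi> \<in> dual_NS E \<tau> \<longleftrightarrow> \<psi> \<in> dual_NS B N"
proof -
  let ?a = "inv N \<circ> \<psi>"
  note pa = alpha_permutes[OF psi]
  have rep: "(\<forall>b\<in>E. \<forall>d\<in>orbit \<tau> b. b \<noteq> d --> d \<notin> orbit (ext ?a) b)
     \<longleftrightarrow> (\<forall>b\<in>B. \<forall>d\<in>orbit N b. b \<noteq> d --> d \<notin> orbit ?a b)" (is "?L \<longleftrightarrow> ?R")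
  proof
    assume L: ?L
    show ?R
    proof (intro ballI impI notI)
      fix b d assume b: "b \<in> B" "d \<in> orbit N b" "b \<noteq> d" "d \<in> orbit ?a b"
      have dB: "d \<in> B" using b perm_orbit_sub[OF finB perm_N] by blast
      have "en d \<in> orbit \<tau> (en b)" using b dB en_in c_en by (simp add: orbit_tau)
      moreover have "en d \<in> orbit (ext ?a) (en b)" using orbit_ext(1)[OF pa b(1)] b by simp
      moreover have "en b \<noteq> en d" using b dB c_en by metis
      ultimately show False using L b en_in by blast
    qed
  next
    assume R: ?R
    show ?L
    proof (intro ballI impI notI)
      fix e d assume e: "e \<in> E" "d \<in> orbit \<tau> e" "e \<noteq> d" "d \<in> orbit (ext ?a) e"
      have "e \<in> en ` B"
      proof (rule ccontr)
        assume "e \<notin> en ` B"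
        then show False using orbit_ext(2)[OF pa, of e] e by simp
      qed
      then obtain b where b: "b \<in> B" "e = en b" by auto
      then obtain b' where b': "b' \<in> orbit ?a b" "d = en b'" using e orbit_ext(1)[OF pa] by auto
      then have b'B: "b' \<in> B" using perm_orbit_sub[OF finB pa b(1)] by blast
      have "c d \<in> orbit N (c e)" using e(2) unfolding orbit_tau[OF e(1)] by simp
      then have "b' \<in> orbit N b" using b b' b'B c_en by simp
      moreover have "b \<noteq> b'" using e(3) b b' by blast
      ultimately show False using R b b' by blast
    qed
  qed
  have cN: "ncyc E \<tau> = ncyc B N"
    using card_cycle_blow[OF perm_N] by (simp add: blow_N)
  have "(ncyc E (blow \<psi>) + ncyc E \<tau> + ncyc E (ext ?a) = card E + 2)
     \<longleftrightarrow> (ncyc B \<psi> + ncyc B N + ncyc B ?a = card B + 2)"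
    using card_cycle_ext[OF pa] cN card_cycle_blow[OF psi] by linarith
  then show ?thesis
    unfolding dual_NS_def mem_Collect_eq inv_tau_blow[OF psi] rep transitive_blow[OF psi]
    using psi blow_permutes[OF psi] by blast
qed

text \<open>The quotient of \<open>\<psi>'\<close> by \<tau> fixes everything but run ends, hence
  permutes the run ends; read through \<open>en\<close> it is a permutation of the names.\<close>

lemma blow_surj:
  assumes p: "\<psi>' permutes E" and supp: "\<And>e. e \<in> E ==> inv \<tau> (\<psi>' e) \<noteq> e ==> e \<in> en ` B"
  shows "\<exists>\<psi>. \<psi> permutes B \<and> blow \<psi> = \<psi>'"
proof -
  define a' where "a' = inv \<tau> \<circ> \<psi>'"
  have pa': "a' permutes E" unfolding a'_def by (intro permutes_compose p permutes_inv perm_\<tau>)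
  have fixd: "a' e = e" if "e \<notin> en ` B" for e
    using that supp[of e] pa' by (cases "e \<in> E") (auto simp: a'_def permutes_def)
  have img: "a' e \<in> en ` B" if "e \<in> en ` B" for e
    using that fixd[of "a' e"] permutes_inj[OF pa'] by (metis injD)
  define a where "a = (\<lambda>b. if b \<in> B then c (a' (en b)) else b)"
  have en_a: "en (a b) = a' (en b)" if "b \<in> B" for b using img[of "en b"] that c_en by (auto simp: a_def)
  have aB: "a b \<in> B" if "b \<in> B" for b
    using that img[of "en b"] c_en by (auto simp: a_def)
  have "inj_on a B" using en_a permutes_inj[OF pa'] c_en by (metis inj_onI injD)
  then have pa: "a permutes B"
    by (intro bij_imp_permutes) (use finB aB endo_inj_surj[of B a] in \<open>auto simp: a_def bij_betw_def image_subset_iff\<close>)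
  have ea: "ext a = a'" using en_a fixd c_en by (auto simp: ext_def fun_eq_iff)
  define \<psi> where "\<psi> = N \<circ> a"
  have "inv N \<circ> \<psi> = a" using permutes_inverses[OF perm_N] by (simp add: \<psi>_def fun_eq_iff)
  then have "blow \<psi> = \<tau> \<circ> a'" by (simp add: blow_def ea)
  also have "\<dots> = \<psi>'" using permutes_inverses[OF perm_\<tau>] by (simp add: a'_def fun_eq_iff)
  finally show ?thesis using permutes_compose[OF pa perm_N] \<psi>_def by blast
qed

end

section \<open>Coordinates on the collapsed permutation\<close>

lemma ground_iff [simp]: "(i, e) \<in> ground G \<mu> \<longleftrightarrow> i \<in> G \<and> e < \<mu> i"
  by (auto simp: ground_def)

lemma finite_ground: "finite G ==> finite (ground G \<mu>)"
  by (simp add: ground_def)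

lemma gamma_perm_apply: "i \<in> G ==> e < \<mu> i ==> gamma_perm G \<mu> (i, e) = (i, Suc e mod \<mu> i)"
  by (simp add: gamma_perm_def)

lemma gamma_perm_in: "b \<in> ground G \<mu> ==> gamma_perm G \<mu> b \<in> ground G \<mu> \<and> fst (gamma_perm G \<mu> b) = fst b"
  by (cases b) (auto simp: gamma_perm_apply)

lemma gamma_perm_permutes: assumes "finite G" shows "gamma_perm G \<mu> permutes ground G \<mu>"
proof (rule bij_imp_permutes)
  have "inj_on (gamma_perm G \<mu>) (ground G \<mu>)"
  proof (rule inj_onI)
    fix a b assume "a \<in> ground G \<mu>" "b \<in> ground G \<mu>" "gamma_perm G \<mu> a = gamma_perm G \<mu> b"
    then show "a = b" by (cases a; cases b) (auto simp: gamma_perm_apply mod_Suc split: if_splits)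
  qed
  moreover have "gamma_perm G \<mu> ` ground G \<mu> \<subseteq> ground G \<mu>" using gamma_perm_in by blast
  ultimately show "bij_betw (gamma_perm G \<mu>) (ground G \<mu>) (ground G \<mu>)"
    using finite_ground[OF assms] by (simp add: bij_betw_def endo_inj_surj)
qed (simp add: gamma_perm_def)

lemma gamma_perm_funpow:
  "i \<in> G ==> e < \<mu> i ==> (gamma_perm G \<mu> ^^ j) (i, e) = (i, (e + j) mod \<mu> i)"
proof (induction j)
  case (Suc j)
  then have "0 < \<mu> i" by auto
  then show ?case using Suc by (simp add: gamma_perm_apply mod_Suc_eq)
qed simp

lemma orbit_gamma_perm:
  assumes G: "finite G" and i: "i \<in> G" "e < \<mu> i"
  shows "orbit (gamma_perm G \<mu>) (i, e) = {i} \<times> {..<\<mu> i}"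
proof -
  have "permutation (gamma_perm G \<mu>)"
    using permutes_imp_permutation[OF finite_ground[OF G] gamma_perm_permutes[OF G]] .
  then have "orbit (gamma_perm G \<mu>) (i, e) = {(i, (e + j) mod \<mu> i) |j. True}"
    using gamma_perm_funpow[where \<mu> = \<mu>, OF i] by (simp add: orbit_altdef_permutation)
  also have "\<dots> = {i} \<times> {..<\<mu> i}"
  proof (intro equalityI subsetI)
    fix b assume "b \<in> {i} \<times> {..<\<mu> i}"
    then obtain e' where e': "b = (i, e')" "e' < \<mu> i" by auto
    then have "(e + (e' + \<mu> i - e)) mod \<mu> i = e'" using i by simp
    then show "b \<in> {(i, (e + j) mod \<mu> i) |j. True}" using e'
      by (intro CollectI exI[of _ "e' + \<mu> i - e"]) (use i in simp)
  qed (use i in auto)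
  finally show ?thesis .
qed

lemma cycle_partition_gamma_perm:
  assumes G: "finite G" and pos: "\<And>i. i \<in> G ==> 0 < \<mu> i"
  shows "cyc (ground G \<mu>) (gamma_perm G \<mu>) = (\<lambda>i. {i} \<times> {..<\<mu> i}) ` G"
proof -
  have "cyc (ground G \<mu>) (gamma_perm G \<mu>) = (\<lambda>b. {fst b} \<times> {..<\<mu> (fst b)}) ` ground G \<mu>"
    unfolding cycle_partition_def using orbit_gamma_perm[OF G] by (intro image_cong) auto
  also have "\<dots> = (\<lambda>i. {i} \<times> {..<\<mu> i}) ` (fst ` ground G \<mu>)" by (simp add: image_image)
  also have "fst ` ground G \<mu> = G"
  proof (intro equalityI subsetI)
    fix i assume "i \<in> G"
    then have "(i, 0) \<in> ground G \<mu>" using pos by simp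
    then show "i \<in> fst ` ground G \<mu>" by (rule image_eqI[rotated]) simp
  qed auto
  finally show ?thesis .
qed

lemma card_cycle_gamma_perm:
  assumes G: "finite G" and pos: "\<And>i. i \<in> G ==> 0 < \<mu> i"
  shows "ncyc (ground G \<mu>) (gamma_perm G \<mu>) = card G"
proof (subst cycle_partition_gamma_perm[where \<mu> = \<mu>, OF G pos], assumption, rule card_image, rule inj_onI)
  fix i j assume "i \<in> G" "{i} \<times> {..<\<mu> i} = {j} \<times> {..<\<mu> j}"
  then have "(i, 0) \<in> {j} \<times> {..<\<mu> j}" using pos[of i] by force
  then show "i = j" by simp
qed

text \<open>The number of the run containing offset \<open>z\<close>, for run lengths
  \<open>g\<close>.\<close>

fun arc_index :: "nat list => nat => nat" where
  "arc_index [] z = 0"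
| "arc_index (a # g) z = (if z < a then 0 else Suc (arc_index g (z - a)))"

lemma arc_index_bounds:
  "z < sum_list g ==> arc_index g z < length g
     \<and> sum_list (take (arc_index g z) g) \<le> z \<and> z < sum_list (take (Suc (arc_index g z)) g)"
  by (induction g z rule: arc_index.induct) force+

lemma arc_index_eqI:
  "q < length g ==> sum_list (take q g) \<le> z ==> z < sum_list (take (Suc q) g) ==> arc_index g z = q"
proof (induction g z arbitrary: q rule: arc_index.induct)
  case (2 a g z)
  then show ?case by (cases q) force+
qed simp

lemma sum_list_take_mono: "p \<le> q ==> sum_list (take p g) \<le> sum_list (take q (g :: nat list))"
proof (induction g arbitrary: p q)
  case (Cons a g)
  then show ?case by (cases p; cases q) auto
qed simp

lemma sum_list_take_Suc: "q < length g ==> sum_list (take (Suc q) g) = sum_list (take q g) + (g ! q :: nat)"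
  by (simp add: take_Suc_conv_app_nth)

text \<open>\<open>T\<close> is the set of last offsets of the runs. The induction removes the
  largest one, \<open>m - 1\<close>; the distance to the next smaller one is the last part.\<close>

lemma exists_composition:
  "T \<subseteq> {..<m :: nat} ==> m - 1 \<in> T ==> \<exists>g. (\<forall>a\<in>set g. 0 < a) \<and> sum_list g = m
     \<and> T = (\<lambda>q. sum_list (take (Suc q) g) - 1) ` {..<length g}"
proof (induction m arbitrary: T rule: less_induct)
  case (less m)
  have m: "0 < m" using less.prems by (cases m) auto
  have fin: "finite T" using less.prems finite_subset by blast
  show ?case
  proof (cases "T = {m - 1}")
    case True
    then show ?thesis using m by (intro exI[of _ "[m]"]) auto
  next
    case False
    let ?T = "T - {m - 1}"
    have ne: "?T \<noteq> {}" using False less.prems by auto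
    define m' where "m' = Suc (Max ?T)"
    have mx: "Max ?T \<in> ?T" using fin ne by (intro Max_in) auto
    then have "m' < m" using less.prems by (force simp: m'_def)
    moreover have "?T \<subseteq> {..<m'}"
    proof
      fix t assume "t \<in> ?T"
      then have "t \<le> Max ?T" using fin by (intro Max_ge) auto
      then show "t \<in> {..<m'}" by (simp add: m'_def)
    qed
    moreover have "m' - 1 \<in> ?T" using mx by (simp add: m'_def)
    ultimately obtain g where g: "\<forall>a\<in>set g. 0 < a" "sum_list g = m'"
      "?T = (\<lambda>q. sum_list (take (Suc q) g) - 1) ` {..<length g}"
      using less.IH by blast
    let ?g = "g @ [m - m']"
    have "(\<lambda>q. sum_list (take (Suc q) ?g) - 1) ` {..<length ?g} = insert (m - 1) ?T"
      using g \<open>m' < m\<close> by (auto simp: lessThan_Suc image_iff cong: image_cong)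
    then have "T = (\<lambda>q. sum_list (take (Suc q) ?g) - 1) ` {..<length ?g}" using less.prems by auto
    moreover have "\<forall>a\<in>set ?g. 0 < a" "sum_list ?g = m" using g \<open>m' < m\<close> by auto
    ultimately show ?thesis by blast
  qed
qed

text \<open>On the white vertex \<open>i\<close> the runs have lengths \<open>g i\<close>, and the first run starts at \<open>x i\<close>.\<close>

definition arc_end :: "(nat => nat) => (nat => nat) => (nat => nat list) => nat \<times> nat => nat \<times> nat" where
  "arc_end \<mu> x g b = (fst b, (x (fst b) + (sum_list (take (Suc (snd b)) (g (fst b))) - 1)) mod \<mu> (fst b))"

text \<open>The summand \<open>\<mu> (fst e)\<close> protects the subtraction of the base point from
  truncation.\<close>

definition arc_of :: "(nat => nat) => (nat => nat) => (nat => nat list) => nat \<times> nat => nat \<times> nat" where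
  "arc_of \<mu> x g e = (fst e, arc_index (g (fst e)) ((snd e + \<mu> (fst e) - x (fst e)) mod \<mu> (fst e)))"

locale composition =
  fixes G :: "nat set" and \<mu> x :: "nat => nat" and g :: "nat => nat list"
  assumes finG: "finite G" and x_less: "i \<in> G ==> x i < \<mu> i"
    and sum_g: "i \<in> G ==> sum_list (g i) = \<mu> i" and pos_g: "i \<in> G ==> a \<in> set (g i) ==> 0 < a"
begin

abbreviation "len \<equiv> \<lambda>i. length (g i)"

lemma mu_pos: "i \<in> G ==> 0 < \<mu> i" using x_less by fastforce

lemma len_pos: assumes "i \<in> G" shows "0 < len i"
  using sum_g[OF assms] mu_pos[OF assms] by (cases "g i") auto

lemma take_pos: "i \<in> G ==> q < len i ==> sum_list (take q (g i)) < sum_list (take (Suc q) (g i))"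
  using pos_g[of i "g i ! q"] by (simp add: sum_list_take_Suc)

lemma take_le: "i \<in> G ==> sum_list (take q (g i)) \<le> \<mu> i"
  using sum_list_take_mono[of q "max q (len i)" "g i"] sum_g by simp

lemma off_of:
  assumes "i \<in> G" "z < \<mu> i" shows "((x i + z) mod \<mu> i + \<mu> i - x i) mod \<mu> i = z"
proof (cases "x i + z < \<mu> i")
  case False
  then have "(x i + z) mod \<mu> i = x i + z - \<mu> i"
    using x_less[OF assms(1)] assms(2) by (simp add: le_mod_geq)
  then show ?thesis using False assms x_less by simp
qed (use assms in simp)

lemma of_off:
  assumes "i \<in> G" "e < \<mu> i" shows "\<exists>z<\<mu> i. e = (x i + z) mod \<mu> i"
proof (intro exI conjI)
  show "(e + \<mu> i - x i) mod \<mu> i < \<mu> i" using assms by simp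
  have "(x i + (e + \<mu> i - x i) mod \<mu> i) mod \<mu> i = (x i + (e + \<mu> i - x i)) mod \<mu> i" by (rule mod_add_right_eq)
  also have "\<dots> = e" using assms x_less[of i] by simp
  finally show "e = (x i + (e + \<mu> i - x i) mod \<mu> i) mod \<mu> i" by simp
qed

lemma arc_of_off: "i \<in> G ==> z < \<mu> i ==> arc_of \<mu> x g (i, (x i + z) mod \<mu> i) = (i, arc_index (g i) z)"
  using off_of by (simp add: arc_of_def)

lemma step_off: "i \<in> G ==> gamma_perm G \<mu> (i, (x i + z) mod \<mu> i) = (i, (x i + Suc z) mod \<mu> i)"
  using mu_pos by (simp add: gamma_perm_apply mod_Suc_eq)

lemma end_bounds:
  assumes "i \<in> G" "q < len i"
  shows "sum_list (take (Suc q) (g i)) - 1 < \<mu> i" "0 < sum_list (take (Suc q) (g i))"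
    "arc_index (g i) (sum_list (take (Suc q) (g i)) - 1) = q"
  using take_pos[OF assms] take_le[OF assms(1), of "Suc q"] mu_pos[OF assms(1)]
  by (auto intro!: arc_index_eqI assms(2))

lemma end_iff:
  assumes "i \<in> G" "z < \<mu> i"
  shows "(i, (x i + z) mod \<mu> i) \<in> arc_end \<mu> x g ` ground G len
     \<longleftrightarrow> Suc z = sum_list (take (Suc (arc_index (g i) z)) (g i))" (is "?L \<longleftrightarrow> ?R")
proof
  assume ?L
  then obtain q where q: "q < len i" "(x i + z) mod \<mu> i = (x i + (sum_list (take (Suc q) (g i)) - 1)) mod \<mu> i"
    by (auto simp: arc_end_def)
  then have "z = sum_list (take (Suc q) (g i)) - 1"
    using off_of[OF assms] off_of[OF assms(1) end_bounds(1)[OF assms(1) q(1)]] by simp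
  then show ?R using end_bounds[OF assms(1) q(1)] by simp
next
  assume R: ?R
  then have "(i, (x i + z) mod \<mu> i) = arc_end \<mu> x g (i, arc_index (g i) z)" by (simp add: arc_end_def flip: R)
  then show ?L using arc_index_bounds[of z "g i"] assms sum_g by auto
qed

text \<open>In terms of the offset from the base point the successor is addition of 1, a run is an
  interval of offsets, and the last run is followed by run 0 because the lengths add up to
  \<open>\<mu> i\<close>.\<close>

sublocale arcs "ground G \<mu>" "gamma_perm G \<mu>" "ground G len" "gamma_perm G len" "arc_of \<mu> x g" "arc_end \<mu> x g"
proof
  show "finite (ground G \<mu>)" "finite (ground G len)" using finG by (simp_all add: finite_ground)
  show "gamma_perm G \<mu> permutes ground G \<mu>" "gamma_perm G len permutes ground G len"
    using finG by (simp_all add: gamma_perm_permutes)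
  fix b assume "b \<in> ground G len"
  then obtain i q where b: "b = (i, q)" "i \<in> G" "q < len i" by (cases b) auto
  note eb = end_bounds[OF b(2,3)]
  show "arc_end \<mu> x g b \<in> ground G \<mu>" using b mu_pos by (simp add: arc_end_def)
  show "arc_of \<mu> x g (arc_end \<mu> x g b) = b"
    using b eb arc_of_off[OF b(2) eb(1)] by (simp add: arc_end_def)
  define z where "z = sum_list (take (Suc q) (g i)) - 1"
  have ez: "arc_end \<mu> x g b = (i, (x i + z) mod \<mu> i)" by (simp add: arc_end_def b z_def)
  have Sz: "Suc z = sum_list (take (Suc q) (g i))" using eb by (simp add: z_def)
  show "arc_of \<mu> x g (gamma_perm G \<mu> (arc_end \<mu> x g b)) = gamma_perm G len b"
  proof (cases "Suc q < len i")
    case True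
    have s: "sum_list (take (Suc q) (g i)) < \<mu> i"
      using take_pos[OF b(2) True] take_le[OF b(2), of "Suc (Suc q)"] by simp
    have "arc_index (g i) (sum_list (take (Suc q) (g i))) = Suc q"
      using take_pos[OF b(2) True] by (intro arc_index_eqI) (use True in auto)
    then show ?thesis
      using b True arc_of_off[OF b(2) s] unfolding ez step_off[OF b(2)] Sz by (simp add: gamma_perm_apply)
  next
    case False
    then have q: "Suc q = len i" using b by simp
    then have "sum_list (take (Suc q) (g i)) = \<mu> i" using sum_g b by simp
    moreover have "arc_index (g i) 0 = 0"
      using take_pos[OF b(2) len_pos[OF b(2)]] by (intro arc_index_eqI) (use len_pos b in auto)
    ultimately show ?thesis using b q arc_of_off[OF b(2) mu_pos[OF b(2)]]
      unfolding ez step_off[OF b(2)] Sz by (simp add: gamma_perm_apply)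
  qed
next
  fix e assume "e \<in> ground G \<mu>"
  then obtain i z where e: "e = (i, (x i + z) mod \<mu> i)" "i \<in> G" "z < \<mu> i"
    using of_off by (cases e) auto
  let ?q = "arc_index (g i) z"
  have q: "?q < len i" "sum_list (take ?q (g i)) \<le> z" "z < sum_list (take (Suc ?q) (g i))"
    using arc_index_bounds[of z "g i"] e sum_g by auto
  show "arc_of \<mu> x g e \<in> ground G len" using e q by (simp add: arc_of_off)
  have nx: "arc_index (g i) z' = ?q" if "z \<le> z'" "z' < sum_list (take (Suc ?q) (g i))" for z'
    by (rule arc_index_eqI) (use q that in auto)
  have lt: "z' < \<mu> i" if "z' < sum_list (take (Suc ?q) (g i))" for z'
    using that take_le[OF e(2), of "Suc ?q"] by simp
  { assume "e \<notin> arc_end \<mu> x g ` ground G len"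
    then have "Suc z < sum_list (take (Suc ?q) (g i))" using end_iff[OF e(2,3)] e q by simp
    then show "arc_of \<mu> x g (gamma_perm G \<mu> e) = arc_of \<mu> x g e"
      using e nx[of "Suc z"] lt[of "Suc z"] by (simp only: step_off arc_of_off) }
  define k where "k = sum_list (take (Suc ?q) (g i)) - 1 - z"
  have pw: "(gamma_perm G \<mu> ^^ j) e = (i, (x i + (z + j)) mod \<mu> i)" for j
    using gamma_perm_funpow[OF e(2), of "(x i + z) mod \<mu> i" \<mu> j] e mu_pos[OF e(2)]
    by (simp add: mod_add_left_eq add.assoc)
  have "(gamma_perm G \<mu> ^^ k) e = arc_end \<mu> x g (arc_of \<mu> x g e)"
  proof -
    have "z + k = sum_list (take (Suc ?q) (g i)) - 1" using q by (simp add: k_def)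
    moreover have "arc_of \<mu> x g e = (i, ?q)" using e arc_of_off by simp
    ultimately show ?thesis by (simp only: pw arc_end_def fst_conv snd_conv)
  qed
  moreover have "(gamma_perm G \<mu> ^^ j) e \<notin> arc_end \<mu> x g ` ground G len" if "j < k" for j
  proof -
    have "Suc (z + j) < sum_list (take (Suc ?q) (g i))" using that by (simp add: k_def)
    then show ?thesis using end_iff[OF e(2) lt[of "z + j"]] nx[of "z + j"] by (simp add: pw)
  qed
  ultimately show "\<exists>k. (gamma_perm G \<mu> ^^ k) e = arc_end \<mu> x g (arc_of \<mu> x g e)
     \<and> (\<forall>j<k. (gamma_perm G \<mu> ^^ j) e \<notin> arc_end \<mu> x g ` ground G len)" by blast
qed

lemma card_arc: assumes "b \<in> ground G len" shows "card {e \<in> ground G \<mu>. arc_of \<mu> x g e = b} = g (fst b) ! snd b"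
proof -
  obtain i q where b: "b = (i, q)" "i \<in> G" "q < len i" using assms by (cases b) auto
  let ?Z = "{sum_list (take q (g i))..<sum_list (take (Suc q) (g i))}"
  have lt: "z < \<mu> i" if "z \<in> ?Z" for z using that take_le[OF b(2), of "Suc q"] by simp
  have "{e \<in> ground G \<mu>. arc_of \<mu> x g e = b} = (\<lambda>z. (i, (x i + z) mod \<mu> i)) ` ?Z"
  proof (intro equalityI subsetI)
    fix e assume e: "e \<in> {e \<in> ground G \<mu>. arc_of \<mu> x g e = b}"
    then have "fst e = i" "fst e \<in> G" "snd e < \<mu> (fst e)" by (auto simp: b arc_of_def ground_def)
    then obtain z where z: "e = (i, (x i + z) mod \<mu> i)" "z < \<mu> i" using of_off[of i "snd e"] b by (cases e) auto
    then have "arc_index (g i) z = q" using e b by (simp add: arc_of_off)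
    then have "z \<in> ?Z" using arc_index_bounds[of z "g i"] z b sum_g by auto
    then show "e \<in> (\<lambda>z. (i, (x i + z) mod \<mu> i)) ` ?Z" using z by blast
  next
    fix e assume "e \<in> (\<lambda>z. (i, (x i + z) mod \<mu> i)) ` ?Z"
    then obtain z where z: "e = (i, (x i + z) mod \<mu> i)" "z \<in> ?Z" by blast
    then have "arc_index (g i) z = q" by (intro arc_index_eqI) (use b in auto)
    then show "e \<in> {e \<in> ground G \<mu>. arc_of \<mu> x g e = b}" using z lt[OF z(2)] b mu_pos by (simp add: arc_of_off)
  qed
  moreover have "inj_on (\<lambda>z. (i, (x i + z) mod \<mu> i)) ?Z"
    by (rule inj_onI) (use off_of[OF b(2)] lt in \<open>metis prod.inject\<close>)
  ultimately show ?thesis using b by (simp add: card_image sum_list_take_Suc)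
qed

lemma card_arc_union:
  assumes "V \<subseteq> ground G len"
  shows "card {e \<in> ground G \<mu>. arc_of \<mu> x g e \<in> V} = (\<Sum>b\<in>V. g (fst b) ! snd b)"
proof -
  have "{e \<in> ground G \<mu>. arc_of \<mu> x g e \<in> V} = (\<Union>b\<in>V. {e \<in> ground G \<mu>. arc_of \<mu> x g e = b})" by auto
  also have "card \<dots> = (\<Sum>b\<in>V. card {e \<in> ground G \<mu>. arc_of \<mu> x g e = b})"
    by (rule card_UN_disjoint) (use finite_subset[OF assms finB] finE in auto)
  also have "\<dots> = (\<Sum>b\<in>V. g (fst b) ! snd b)" using assms card_arc by (intro sum.cong) auto
  finally show ?thesis .
qed

end

text \<open>One can prescribe which end \<open>y\<close> closes the last run: the base point is then
  the successor of \<open>y\<close>. \<open>build_surj\<close> uses this freedom to start the runs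
  where the normal form starts.\<close>

lemma exists_arc_end:
  assumes S: "S \<subseteq> {..<m :: nat}" "y \<in> S"
  shows "\<exists>x g. x < m \<and> sum_list g = m \<and> (\<forall>a\<in>set g. 0 < a)
     \<and> S = (\<lambda>q. (x + (sum_list (take (Suc q) g) - 1)) mod m) ` {..<length g} \<and> y = (x + (m - 1)) mod m"
proof -
  have "y < m" using S by auto
  then have m: "0 < m" "y < m" by auto
  define x where "x = Suc y mod m"
  define T where "T = (\<lambda>e. (e + m - x) mod m) ` S"
  have x: "x < m" using m by (simp add: x_def)
  have recov: "(x + (e + m - x) mod m) mod m = e" if "e < m" for e
  proof -
    have "(x + (e + m - x) mod m) mod m = (x + (e + m - x)) mod m" by (rule mod_add_right_eq)
    then show ?thesis using that x by simp
  qed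
  have "(y + m - x) mod m = m - 1" using m by (auto simp: x_def mod_Suc)
  then have "m - 1 \<in> T" using S by (force simp: T_def)
  moreover have "T \<subseteq> {..<m}" using m by (auto simp: T_def)
  ultimately obtain g where g: "\<forall>a\<in>set g. 0 < a" "sum_list g = m"
      "T = (\<lambda>q. sum_list (take (Suc q) g) - 1) ` {..<length g}"
    using exists_composition by blast
  have "S = (\<lambda>z. (x + z) mod m) ` T"
    unfolding T_def image_image using recov S by (auto simp: image_iff subset_iff)
  also have "\<dots> = (\<lambda>q. (x + (sum_list (take (Suc q) g) - 1)) mod m) ` {..<length g}"
    unfolding g(3) image_image ..
  finally have "S = (\<lambda>q. (x + (sum_list (take (Suc q) g) - 1)) mod m) ` {..<length g}" .
  moreover have "y = (x + (m - 1)) mod m" using recov[OF m(2)] \<open>(y + m - x) mod m = m - 1\<close> by simp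
  ultimately show ?thesis using g x by blast
qed

section \<open>Counting marked non-separable permutations by reduced ones\<close>

text \<open>Two decompositions of the same \<tau> with the same run ends differ only in the names of
  the runs. The renaming \<open>shift\<close> conjugates the successor maps and the reduced
  permutations; uniqueness and existence of normal forms both rest on it.\<close>

locale two_arcs = A: arcs E \<tau> B N c en + A': arcs E \<tau> B' N' c' en'
  for E :: "'e set" and \<tau> and B :: "'b set" and N c en and B' :: "'c set" and N' c' en' +
  assumes ends_eq: "en ` B = en' ` B'"
begin

definition shift :: "'c => 'b" where "shift b = c (en' b)"

lemma en_shift: "b \<in> B' ==> en (shift b) = en' b"
proof -
  assume "b \<in> B'"
  then obtain a where "a \<in> B" "en' b = en a" using ends_eq by blast
  then show ?thesis using A.c_en by (simp add: shift_def)
qed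

lemma shift_in: "b \<in> B' ==> shift b \<in> B"
  using A'.en_in A.c_in by (simp add: shift_def)

text \<open>Both sides are the first run end met when following \<tau> from
  \<open>e\<close>.\<close>

lemma en_c_eq: assumes e: "e \<in> E" shows "en (c e) = en' (c' e)"
proof -
  obtain k where k: "(\<tau> ^^ k) e = en (c e)" "\<forall>j<k. (\<tau> ^^ j) e \<notin> en ` B" using A.reach[OF e] by blast
  obtain l where l: "(\<tau> ^^ l) e = en' (c' e)" "\<forall>j<l. (\<tau> ^^ j) e \<notin> en' ` B'" using A'.reach[OF e] by blast
  have "en (c e) \<in> en ` B" "en' (c' e) \<in> en ` B" using A.c_in[OF e] A'.c_in[OF e] ends_eq by auto
  then have "\<not> k < l" "\<not> l < k" using k l ends_eq by auto
  then show ?thesis using k l by simp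
qed

lemma shift_c: "e \<in> E ==> shift (c' e) = c e"
  using en_c_eq[of e] A.c_in A.c_en by (metis shift_def)

lemma shift_N: assumes b: "b \<in> B'" shows "shift (N' b) = N (shift b)"
proof -
  have e: "en' b \<in> E" "\<tau> (en' b) \<in> E" using A'.en_in[OF b] A.perm_\<tau> by (auto simp: permutes_in_image)
  have "shift (N' b) = shift (c' (\<tau> (en' b)))" using A'.c_end[OF b] by simp
  also have "\<dots> = c (\<tau> (en (shift b)))" using shift_c[OF e(2)] en_shift[OF b] by simp
  also have "\<dots> = N (shift b)" using A.c_end[OF shift_in[OF b]] .
  finally show ?thesis .
qed

lemma shift_blow:
  assumes p: "\<psi> permutes B" and p': "\<psi>' permutes B'" and eq: "A.blow \<psi> = A'.blow \<psi>'" and b: "b \<in> B'"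
  shows "shift (\<psi>' b) = \<psi> (shift b)"
proof -
  have e: "en' b \<in> E" "A'.blow \<psi>' (en' b) \<in> E"
    using A'.en_in[OF b] A'.blow_permutes[OF p'] by (auto simp: permutes_in_image)
  have "shift (\<psi>' b) = shift (c' (A'.blow \<psi>' (en' b)))" using A'.blow_en(2)[OF p' b] by simp
  also have "\<dots> = c (A.blow \<psi> (en (shift b)))" using shift_c[OF e(2)] en_shift[OF b] eq by simp
  also have "\<dots> = \<psi> (shift b)" using A.blow_en(2)[OF p shift_in[OF b]] .
  finally show ?thesis .
qed

lemma inj_shift: "inj_on shift B'"
  using en_shift A'.inj_en by (metis inj_on_def)

lemma shift_image: "shift ` B' = B"
proof (intro equalityI subsetI)
  fix a assume a: "a \<in> B"
  then obtain b where b: "b \<in> B'" "en a = en' b" using ends_eq by blast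
  then have "shift b = a" using A.c_en[OF a] by (simp add: shift_def)
  then show "a \<in> shift ` B'" using b by blast
qed (use shift_in in auto)

end

definition rot :: "(nat => nat) => (nat => nat) => nat \<times> nat => nat \<times> nat" where
  "rot s r b = (fst b, (r (fst b) + snd b) mod s (fst b))"

text \<open>Commuting with the successor, such a map is determined on each cycle by the image of
  label 0.\<close>

lemma rotI:
  assumes G: "finite G" and s: "\<And>i. i \<in> G ==> 0 < s i"
    and sh: "\<And>b. b \<in> ground G s ==> fst (\<sigma> b) = fst b \<and> \<sigma> b \<in> ground G s"
    and com: "\<And>b. b \<in> ground G s ==> \<sigma> (gamma_perm G s b) = gamma_perm G s (\<sigma> b)"
    and b: "b \<in> ground G s"
  shows "\<sigma> b = rot s (\<lambda>i. snd (\<sigma> (i, 0))) b"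
proof -
  obtain i q where iq: "b = (i, q)" "i \<in> G" "q < s i" using b by (cases b) auto
  have i0: "(i, 0) \<in> ground G s" using iq s by simp
  define r where "r = snd (\<sigma> (i, 0))"
  have r: "\<sigma> (i, 0) = (i, r)" "r < s i" using sh[OF i0] by (auto simp: r_def prod_eq_iff ground_def)
  have "k < s i ==> \<sigma> (i, k) = (i, (r + k) mod s i)" for k
  proof (induction k)
    case (Suc k)
    have "(i, Suc k) = gamma_perm G s (i, k)" using iq Suc.prems by (simp add: gamma_perm_apply)
    then have "\<sigma> (i, Suc k) = gamma_perm G s (\<sigma> (i, k))" using com[of "(i, k)"] iq Suc.prems by simp
    also have "\<dots> = gamma_perm G s (i, (r + k) mod s i)" using Suc by simp
    also have "\<dots> = (i, (r + Suc k) mod s i)" using iq s[OF iq(2)] by (simp add: gamma_perm_apply mod_Suc_eq)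
    finally show ?case .
  qed (use r in simp)
  from this[OF iq(3)] show ?thesis by (simp add: rot_def r_def iq(1))
qed

text \<open>The dummy mark \<open>{}\<close> in the unmarked case lets one locale serve both
  counting problems; since \<open>{}\<close> is never a cycle, removing it from the set of cycles
  has no effect.\<close>

definition markings :: "bool => 'b set => ('b => 'b) => 'b set set" where
  "markings marked E \<psi> = (if marked then cyc E \<psi> else {{}})"

text \<open>The second condition says that no two neighbouring runs could be joined into a longer
  one.\<close>

definition reduced :: "nat set => (nat => nat) => (nat \<times> nat => nat \<times> nat) => bool" where
  "reduced G s \<psi> \<longleftrightarrow> \<psi> \<in> dual_NS (ground G s) (gamma_perm G s) \<and> (\<forall>b\<in>ground G s. \<psi> b \<noteq> gamma_perm G s b)"

text \<open>The run ends can be read off the expanded permutation as the places where it leaves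
  \<tau>; none is missed because a reduced permutation nowhere agrees with the successor.\<close>

lemma (in composition) reduced_ends:
  assumes "reduced G len \<psi>"
  shows "{e. inv (gamma_perm G \<mu>) (blow \<psi> e) \<noteq> e} = arc_end \<mu> x g ` ground G len"
proof -
  have p: "\<psi> permutes ground G len" using assms by (simp add: reduced_def dual_NS_def)
  have e: "inv (gamma_perm G \<mu>) (blow \<psi> e) = ext (inv (gamma_perm G len) \<circ> \<psi>) e" for e
    using inv_tau_blow[OF p] by (metis comp_apply)
  have "inv (gamma_perm G len) (\<psi> b) \<noteq> b" if "b \<in> ground G len" for b
    using that assms permutes_inverses[OF perm_N] by (metis reduced_def)
  moreover have "inv (gamma_perm G len) (\<psi> b) \<in> ground G len" if "b \<in> ground G len" for b
    using that alpha_permutes[OF p] by (metis comp_apply permutes_in_image)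
  ultimately have ne: "arc_end \<mu> x g (inv (gamma_perm G len) (\<psi> b)) \<noteq> arc_end \<mu> x g b" if "b \<in> ground G len" for b
    using that inj_en by (meson inj_onD)
  show ?thesis
  proof (intro equalityI subsetI CollectI)
    fix e' assume "e' \<in> arc_end \<mu> x g ` ground G len"
    then obtain b where "b \<in> ground G len" "e' = arc_end \<mu> x g b" by blast
    then show "inv (gamma_perm G \<mu>) (blow \<psi> e') \<noteq> e'" using ne ext_en by (simp add: e)
  qed (auto simp: e ext_def split: if_split_asm)
qed

locale two_compositions = A: composition G \<mu> x g + A': composition G \<mu> x' g' for G \<mu> x g x' g' +
  assumes ends: "arc_end \<mu> x g ` ground G A.len = arc_end \<mu> x' g' ` ground G A'.len"
begin

sublocale two_arcs "ground G \<mu>" "gamma_perm G \<mu>" "ground G A.len" "gamma_perm G A.len" "arc_of \<mu> x g"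
  "arc_end \<mu> x g" "ground G A'.len" "gamma_perm G A'.len" "arc_of \<mu> x' g'" "arc_end \<mu> x' g'"
  by unfold_locales (rule ends)

lemma fst_shift: "fst (shift b) = fst b"
  by (simp add: shift_def arc_of_def arc_end_def)

lemma len_eq: assumes i: "i \<in> G" shows "A.len i = A'.len i"
proof -
  define S where "S = arc_end \<mu> x g ` ground G A.len"
  have "arc_end \<mu> x g ` ({i} \<times> {..<A.len i}) = {e \<in> S. fst e = i}"
    using i by (auto simp: S_def arc_end_def image_iff)
  moreover have "arc_end \<mu> x' g' ` ({i} \<times> {..<A'.len i}) = {e \<in> S. fst e = i}"
    using i unfolding S_def ends by (auto simp: arc_end_def image_iff)
  moreover have "{i} \<times> {..<A.len i} \<subseteq> ground G A.len" "{i} \<times> {..<A'.len i} \<subseteq> ground G A'.len"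
    using i by auto
  ultimately have "card ({i} \<times> {..<A.len i}) = card ({i} \<times> {..<A'.len i})"
    using card_image[OF inj_on_subset[OF A.inj_en, of "{i} \<times> {..<A.len i}"]]
      card_image[OF inj_on_subset[OF A'.inj_en, of "{i} \<times> {..<A'.len i}"]] by simp
  then show ?thesis by (simp add: card_cartesian_product)
qed

lemma ground_eq: "ground G A.len = ground G A'.len"
  using len_eq by (auto simp: ground_def)

lemma gamma_eq: "gamma_perm G A.len = gamma_perm G A'.len"
  using len_eq ground_eq by (auto simp: gamma_perm_def fun_eq_iff)

end

text \<open>\<open>Mk\<close> is the marked cycle, or \<open>{}\<close> if \<open>marked\<close> is false.  By \<open>rigid\<close> the objects have no
  rotational symmetry, which is why the base points contribute the full factor \<open>\<Prod>i. \<mu> i\<close>.\<close>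

locale structures =
  fixes G :: "nat set" and Ob :: "'o set" and gl :: "'o => nat => nat list"
    and Psi :: "'o => nat \<times> nat => nat \<times> nat" and Mk :: "'o => (nat \<times> nat) set" and marked :: bool
  assumes finite_G: "finite G" and card_G: "2 \<le> card G"
    and gl_pos: "ob \<in> Ob ==> i \<in> G ==> a \<in> set (gl ob i) ==> 0 < a"
    and reduced_Psi: "ob \<in> Ob ==> reduced G (\<lambda>i. length (gl ob i)) (Psi ob)"
    and Mk_in: "ob \<in> Ob ==> Mk ob \<in> markings marked (ground G (\<lambda>i. length (gl ob i))) (Psi ob)"
    and complete: "(\<And>i. i \<in> G ==> 0 < s i) ==> reduced G s \<psi> ==> m \<in> markings marked (ground G s) \<psi> ==>
      \<exists>r. (\<forall>i\<in>G. r i < s i) \<and> (\<forall>g. (\<forall>i\<in>G. length (g i) = s i \<and> (\<forall>a\<in>set (g i). 0 < a)) -->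
        (\<exists>ob\<in>Ob. (\<forall>i\<in>G. gl ob i = g i) \<and> (\<forall>b\<in>ground G s. \<psi> (rot s r b) = rot s r (Psi ob b))
           \<and> m = rot s r ` Mk ob))"
    and rigid: "ob \<in> Ob ==> ob' \<in> Ob ==> (\<And>i. i \<in> G ==> length (gl ob i) = s i \<and> length (gl ob' i) = s i) ==>
        (\<And>i. i \<in> G ==> r i < s i) ==>
        (\<And>b. b \<in> ground G s ==> Psi ob (rot s r b) = rot s r (Psi ob' b)) ==> Mk ob = rot s r ` Mk ob' ==>
        (\<forall>i\<in>G. r i = 0) \<and> ((\<forall>i\<in>G. gl ob i = gl ob' i) --> ob = ob')"
begin

definition objects :: "(nat => nat) => 'o set" where
  "objects \<mu> = {ob \<in> Ob. \<forall>i\<in>G. sum_list (gl ob i) = \<mu> i}"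

definition base_points :: "(nat => nat) => (nat => nat) set" where
  "base_points \<mu> = (\<Pi>\<^sub>E i\<in>G. {..<\<mu> i})"

definition build :: "(nat => nat) => (nat => nat) \<times> 'o => (nat \<times> nat => nat \<times> nat) \<times> (nat \<times> nat) set" where
  "build \<mu> = (\<lambda>(x, ob). (arcs.blow (gamma_perm G \<mu>) (ground G (\<lambda>i. length (gl ob i)))
      (gamma_perm G (\<lambda>i. length (gl ob i))) (arc_of \<mu> x (gl ob)) (arc_end \<mu> x (gl ob)) (Psi ob),
    {e \<in> ground G \<mu>. arc_of \<mu> x (gl ob) e \<in> Mk ob}))"

definition marked_NS :: "(nat => nat) => ((nat \<times> nat => nat \<times> nat) \<times> (nat \<times> nat) set) set" where
  "marked_NS \<mu> = (SIGMA \<psi> : dual_NS (ground G \<mu>) (gamma_perm G \<mu>). markings marked (ground G \<mu>) \<psi>)"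

lemma composition_object:
  "ob \<in> objects \<mu> ==> x \<in> base_points \<mu> ==> composition G \<mu> x (gl ob)"
  using finite_G gl_pos by unfold_locales (auto simp: objects_def base_points_def PiE_iff)

lemma arcs_blow_markings:
  assumes "arcs E \<tau> B N c en" "\<psi> permutes B"
  shows "markings marked E (arcs.blow \<tau> B N c en \<psi>) = (\<lambda>V. {e \<in> E. c e \<in> V}) ` markings marked B \<psi>"
  using arcs.cycle_partition_blow[OF assms] by (auto simp: markings_def)

lemma markings_sub: "finite B ==> \<psi> permutes B ==> markings marked B \<psi> \<subseteq> Pow B"
  using perm_orbit_sub[of B \<psi>] by (auto simp: markings_def cycle_partition_def)

lemma Psi_permutes: "ob \<in> Ob ==> Psi ob permutes ground G (\<lambda>i. length (gl ob i))"
  using reduced_Psi by (simp add: reduced_def dual_NS_def)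

lemma build_in:
  assumes ob: "ob \<in> objects \<mu>" and x: "x \<in> base_points \<mu>" shows "build \<mu> (x, ob) \<in> marked_NS \<mu>"
proof -
  interpret composition G \<mu> x "gl ob" using composition_object[OF ob x] .
  have o: "ob \<in> Ob" using ob by (simp add: objects_def)
  have "blow (Psi ob) \<in> dual_NS (ground G \<mu>) (gamma_perm G \<mu>)"
    using blow_dual_NS[OF Psi_permutes[OF o]] reduced_Psi[OF o] by (simp add: reduced_def)
  moreover have "{e \<in> ground G \<mu>. arc_of \<mu> x (gl ob) e \<in> Mk ob} \<in> markings marked (ground G \<mu>) (blow (Psi ob))"
    using arcs_blow_markings[OF arcs_axioms Psi_permutes[OF o]] Mk_in[OF o] by blast
  ultimately show ?thesis by (simp add: build_def marked_NS_def)
qed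

text \<open>By \<open>reduced_ends\<close> the two decompositions have the same run ends, so
  \<open>shift\<close> relates them, and by \<open>rotI\<close> it is a rotation.
  \<open>rigid\<close> makes it the identity; equal ends under equal names then give equal base
  points and lengths.\<close>

lemma build_inj: "inj_on (build \<mu>) (base_points \<mu> \<times> objects \<mu>)"
proof (rule inj_onI, clarify)
  fix x ob x' ob'
  assume x: "x \<in> base_points \<mu>" and ob: "ob \<in> objects \<mu>" and x': "x' \<in> base_points \<mu>" and ob': "ob' \<in> objects \<mu>"
    and eq: "build \<mu> (x, ob) = build \<mu> (x', ob')"
  interpret A: composition G \<mu> x "gl ob" using composition_object[OF ob x] .
  interpret A': composition G \<mu> x' "gl ob'" using composition_object[OF ob' x'] .
  have o: "ob \<in> Ob" "ob' \<in> Ob" using ob ob' by (simp_all add: objects_def)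
  have beq: "A.blow (Psi ob) = A'.blow (Psi ob')" using eq by (simp add: build_def)
  have meq: "{e \<in> ground G \<mu>. arc_of \<mu> x (gl ob) e \<in> Mk ob} = {e \<in> ground G \<mu>. arc_of \<mu> x' (gl ob') e \<in> Mk ob'}"
    using eq by (simp add: build_def)
  have ends: "arc_end \<mu> x (gl ob) ` ground G A.len = arc_end \<mu> x' (gl ob') ` ground G A'.len"
    using A.reduced_ends[OF reduced_Psi[OF o(1)]] A'.reduced_ends[OF reduced_Psi[OF o(2)]] beq by simp
  interpret two_compositions G \<mu> x "gl ob" x' "gl ob'"
    by unfold_locales (rule ends)
  note B = ground_eq and N = gamma_eq
  define r where "r i = snd (shift (i, 0))" for i
  have sh: "shift b = rot A'.len r b" if "b \<in> ground G A'.len" for b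
    using rotI[OF finite_G A'.len_pos _ _ that, of shift] shift_in fst_shift shift_N N
    unfolding r_def[abs_def] B by auto
  have pP: "Psi ob permutes ground G A.len" "Psi ob' permutes ground G A'.len" using Psi_permutes o by auto
  have MkB: "Mk ob \<subseteq> ground G A.len" "Mk ob' \<subseteq> ground G A'.len"
    using markings_sub[OF A.finB pP(1)] markings_sub[OF A'.finB pP(2)] Mk_in o by blast+
  have rig: "(\<forall>i\<in>G. r i = 0) \<and> ((\<forall>i\<in>G. gl ob i = gl ob' i) --> ob = ob')"
  proof (rule rigid[OF o])
    show "A.len i = A'.len i \<and> A'.len i = A'.len i" if "i \<in> G" for i using len_eq that by simp
    show "r i < A'.len i" if "i \<in> G" for i
      using shift_in[of "(i, 0)"] that A'.len_pos fst_shift[of "(i, 0)"] B by (auto simp: r_def ground_def)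
    show "Psi ob (rot A'.len r b) = rot A'.len r (Psi ob' b)" if b: "b \<in> ground G A'.len" for b
    proof -
      have "Psi ob' b \<in> ground G A'.len" using pP(2) b by (simp add: permutes_in_image)
      then show ?thesis using shift_blow[OF pP beq b] sh b by simp
    qed
    have "Mk ob = shift ` Mk ob'"
    proof (intro equalityI subsetI)
      fix b assume b: "b \<in> Mk ob"
      then have "b \<in> shift ` ground G A'.len" using MkB shift_image by auto
      then obtain b' where b': "b' \<in> ground G A'.len" "b = shift b'" by blast
      then have "arc_end \<mu> x (gl ob) b \<in> {e \<in> ground G \<mu>. arc_of \<mu> x (gl ob) e \<in> Mk ob}"
        using b MkB A.en_in A.c_en by (metis (mono_tags, lifting) mem_Collect_eq subsetD)
      then have "arc_of \<mu> x' (gl ob') (arc_end \<mu> x' (gl ob') b') \<in> Mk ob'"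
        using meq en_shift b' by auto
      then show "b \<in> shift ` Mk ob'" using A'.c_en b' by simp
    next
      fix b assume "b \<in> shift ` Mk ob'"
      then obtain b' where b': "b' \<in> Mk ob'" "b = shift b'" by blast
      then have "b' \<in> ground G A'.len" using MkB by blast
      then have "arc_end \<mu> x' (gl ob') b' \<in> {e \<in> ground G \<mu>. arc_of \<mu> x' (gl ob') e \<in> Mk ob'}"
        using b' A'.en_in A'.c_en by simp
      then have "arc_of \<mu> x (gl ob) (arc_end \<mu> x' (gl ob') b') \<in> Mk ob" using meq by blast
      then show "b \<in> Mk ob" using b' by (simp add: shift_def)
    qed
    also have "shift ` Mk ob' = rot A'.len r ` Mk ob'" using sh MkB by (intro image_cong) auto
    finally show "Mk ob = rot A'.len r ` Mk ob'" .
  qed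
  have ends_same: "arc_end \<mu> x (gl ob) (i, q) = arc_end \<mu> x' (gl ob') (i, q)" if "i \<in> G" "q < A.len i" for i q
  proof -
    have b: "(i, q) \<in> ground G A'.len" using that len_eq by simp
    have "shift (i, q) = (i, q)" using sh[OF b] rig that len_eq by (simp add: rot_def)
    then show ?thesis using en_shift[OF b] by simp
  qed
  \<comment> \<open>The end of the last run sits just before the base point and so determines
    it.\<close>
  have xx: "x i = x' i" if i: "i \<in> G" for i
  proof -
    have l: "A.len i - 1 < A.len i" "Suc (A.len i - 1) = A.len i" using A.len_pos[OF i] by auto
    have "(x i + (\<mu> i - 1)) mod \<mu> i = (x' i + (\<mu> i - 1)) mod \<mu> i"
      using ends_same[OF i l(1)] l A.sum_g[OF i] A'.sum_g[OF i] len_eq[OF i] by (simp add: arc_end_def)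
    then have "(x i + (\<mu> i - 1) + 1) mod \<mu> i = (x' i + (\<mu> i - 1) + 1) mod \<mu> i" by (metis mod_add_left_eq)
    then show ?thesis using A.x_less[OF i] A'.x_less[OF i] A.mu_pos[OF i] by simp
  qed
  have take_eq: "sum_list (take q (gl ob i)) = sum_list (take q (gl ob' i))" if i: "i \<in> G" and q: "q \<le> A.len i" for i q
  proof (cases q)
    case (Suc q')
    have q': "q' < A.len i" "q' < A'.len i" using Suc q len_eq[OF i] by auto
    have "(x i + (sum_list (take q (gl ob i)) - 1)) mod \<mu> i = (x i + (sum_list (take q (gl ob' i)) - 1)) mod \<mu> i"
      using ends_same[OF i q'(1)] xx[OF i] by (simp add: arc_end_def Suc)
    then have "sum_list (take q (gl ob i)) - 1 = sum_list (take q (gl ob' i)) - 1"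
      using A.off_of[OF i A.end_bounds(1)[OF i q'(1)]] A.off_of[OF i A'.end_bounds(1)[OF i q'(2)]] Suc by metis
    then show ?thesis using A.end_bounds(2)[OF i q'(1)] A'.end_bounds(2)[OF i q'(2)] Suc by simp
  qed simp
  have "gl ob i = gl ob' i" if i: "i \<in> G" for i
  proof (rule nth_equalityI)
    show "length (gl ob i) = length (gl ob' i)" using len_eq[OF i] .
    fix q assume q: "q < length (gl ob i)"
    then show "gl ob i ! q = gl ob' i ! q"
      using take_eq[OF i, of q] take_eq[OF i, of "Suc q"] len_eq[OF i] by (simp add: sum_list_take_Suc)
  qed
  then have "ob = ob'" using rig by blast
  moreover have "x = x'" using x x' xx by (auto simp: base_points_def intro: PiE_ext)
  ultimately show "x = x' \<and> ob = ob'" by simp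
qed

end

lemma transitive_pairD:
  "transitive_pair E \<sigma> \<rho> ==> A \<subseteq> E ==> A \<noteq> {} ==> \<sigma> ` A \<subseteq> A ==> \<rho> ` A \<subseteq> A ==> A = E"
  unfolding transitive_pair_def by simp

lemma ground_orbit_closed_subset:
  assumes fin: "finite G" and pos: "\<And>i. i \<in> G ==> 0 < \<mu> i" and i: "i \<in> G"
  shows "gamma_perm G \<mu> ` ({i} \<times> {..<\<mu> i}) \<subseteq> {i} \<times> {..<\<mu> i}"
  using pos[OF i] i by (auto simp: gamma_perm_apply)

text \<open>Two decompositions of the same permutation occur. The first has arbitrary base points
  and provides the reduced permutation; \<open>complete\<close> tells by which rotation this differs
  from a normal form. The second has the same run ends, but base points moved so that
  \<open>shift\<close> is precisely that rotation.\<close>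

lemma (in structures) build_surj:
  assumes pos: "\<And>i. i \<in> G ==> 0 < \<mu> i" and el: "(\<psi>, m) \<in> marked_NS \<mu>"
  shows "(\<psi>, m) \<in> build \<mu> ` (base_points \<mu> \<times> objects \<mu>)"
proof -
  let ?E = "ground G \<mu>" and ?t = "gamma_perm G \<mu>"
  have fE: "finite ?E" and pt: "?t permutes ?E" using finite_G by (simp_all add: finite_ground gamma_perm_permutes)
  have dual: "\<psi> \<in> dual_NS ?E ?t" and m: "m \<in> markings marked ?E \<psi>" using el by (auto simp: marked_NS_def)
  then have p: "\<psi> permutes ?E" and tr: "transitive_pair ?E ?t \<psi>" by (simp_all add: dual_NS_def)
  define S where "S = {e. inv ?t (\<psi> e) \<noteq> e}"
  have SE: "S \<subseteq> ?E"
  proof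
    fix e assume e: "e \<in> S"
    show "e \<in> ?E"
    proof (rule ccontr)
      assume "e \<notin> ?E"
      then have "inv ?t (\<psi> e) = e" using permutes_not_in[OF p] permutes_not_in[OF permutes_inv[OF pt]] by simp
      then show False using e by (simp add: S_def)
    qed
  qed
  have SIG: "S = (SIGMA i:G. {k. (i, k) \<in> S})" using SE by (auto simp: ground_def)
  \<comment> \<open>A white vertex without run ends is one on which \<psi> agrees with \<tau>; it
    would be a connected component, but there is a second white vertex.\<close>
  have ne: "\<exists>k. (i, k) \<in> S" if i: "i \<in> G" for i
  proof (rule ccontr)
    assume no: "\<nexists>k. (i, k) \<in> S"
    let ?A = "{i} \<times> {..<\<mu> i}"
    have "\<psi> e = ?t e" if "e \<in> ?A" for e
    proof -
      have "e \<notin> S" using that no by (cases e) auto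
      then have "inv ?t (\<psi> e) = e" by (simp add: S_def)
      then show ?thesis using permutes_inverses[OF pt] by metis
    qed
    then have "\<psi> ` ?A = ?t ` ?A" by (rule image_cong[OF refl])
    then have "\<psi> ` ?A \<subseteq> ?A" using ground_orbit_closed_subset[OF finite_G pos i] by simp
    moreover have "?A \<subseteq> ?E" "?A \<noteq> {}" using i pos by auto
    ultimately have "?A = ?E"
      using transitive_pairD[OF tr, of ?A] ground_orbit_closed_subset[where \<mu> = \<mu>, OF finite_G pos i] by blast
    obtain j where j: "j \<in> G" "j \<noteq> i"
    proof -
      have "card (G - {i}) \<noteq> 0" using card_G i finite_G by simp
      then have "G - {i} \<noteq> {}" by force
      then show ?thesis using that by blast
    qed
    then have "(j, 0) \<in> ?E" using pos by simp
    then show False using \<open>?A = ?E\<close> j by force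
  qed
  have ends: "\<exists>x g. composition G \<mu> x g \<and> arc_end \<mu> x g ` ground G (\<lambda>i. length (g i)) = S
      \<and> (\<forall>i\<in>G. (i, (x i + (\<mu> i - 1)) mod \<mu> i) = (i, y i))"
    if y: "\<And>i. i \<in> G ==> (i, y i) \<in> S" for y
  proof -
    define P where "P i z \<longleftrightarrow> fst z < \<mu> i \<and> sum_list (snd z) = \<mu> i \<and> (\<forall>a\<in>set (snd z). 0 < a)
       \<and> {k. (i, k) \<in> S} = (\<lambda>q. (fst z + (sum_list (take (Suc q) (snd z)) - 1)) mod \<mu> i) ` {..<length (snd z)}
       \<and> y i = (fst z + (\<mu> i - 1)) mod \<mu> i" for i and z :: "nat \<times> nat list"
    have ex: "\<forall>i\<in>G. \<exists>z. P i z"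
    proof
      fix i assume i: "i \<in> G"
      have "{k. (i, k) \<in> S} \<subseteq> {..<\<mu> i}" using SE by auto
      from exists_arc_end[OF this, of "y i"] y[OF i] obtain x g where "P i (x, g)"
        unfolding P_def fst_conv snd_conv by blast
      then show "\<exists>z. P i z" by blast
    qed
    obtain xg where "\<forall>i\<in>G. P i (xg i)" using bchoice[OF ex] by blast
    then have xg: "P i (xg i)" if "i \<in> G" for i using that by blast
    note xg = xg[unfolded P_def]
    define x g where "x i = fst (xg i)" and "g i = snd (xg i)" for i
    have c: "composition G \<mu> x g" using finite_G xg by unfold_locales (auto simp: x_def g_def)
    have "arc_end \<mu> x g ` ground G (\<lambda>i. length (g i)) = (SIGMA i:G. {k. (i, k) \<in> S})"
    proof (intro equalityI subsetI)
      fix e assume "e \<in> arc_end \<mu> x g ` ground G (\<lambda>i. length (g i))"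
      then obtain i q where "i \<in> G" "q < length (g i)" "e = arc_end \<mu> x g (i, q)" by auto
      then show "e \<in> (SIGMA i:G. {k. (i, k) \<in> S})" using xg[of i] by (auto simp: arc_end_def x_def g_def)
    next
      fix e assume "e \<in> (SIGMA i:G. {k. (i, k) \<in> S})"
      then obtain i k where e: "i \<in> G" "e = (i, k)" "k \<in> {k. (i, k) \<in> S}" by auto
      then obtain q where q: "q < length (g i)" "k = (x i + (sum_list (take (Suc q) (g i)) - 1)) mod \<mu> i"
        using xg[of i] unfolding x_def g_def by auto
      have "e = arc_end \<mu> x g (i, q)" by (simp add: arc_end_def e(2) q(2))
      moreover have "(i, q) \<in> ground G (\<lambda>i. length (g i))" using e q by simp
      ultimately show "e \<in> arc_end \<mu> x g ` ground G (\<lambda>i. length (g i))" by blast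
    qed
    then have "arc_end \<mu> x g ` ground G (\<lambda>i. length (g i)) = S" using SIG by simp
    then show ?thesis using c xg by (intro exI[of _ x] exI[of _ g]) (auto simp: x_def)
  qed
  \<comment> \<open>The first decomposition may start anywhere, so any run end on each cycle will
    do.\<close>
  define y0 where "y0 i = (SOME k. (i, k) \<in> S)" for i
  have "(i, y0 i) \<in> S" if "i \<in> G" for i using someI_ex[OF ne[OF that]] by (simp add: y0_def)
  from ends[OF this] obtain x0 g0 where c0: "composition G \<mu> x0 g0"
    and S0: "arc_end \<mu> x0 g0 ` ground G (\<lambda>i. length (g0 i)) = S" by blast
  interpret A: composition G \<mu> x0 g0 by (rule c0)
  obtain \<psi>0 where \<psi>0: "\<psi>0 permutes ground G A.len" "A.blow \<psi>0 = \<psi>"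
    using A.blow_surj[OF p] S0 unfolding S_def by blast
  have red0: "reduced G A.len \<psi>0"
    unfolding reduced_def
  proof
    show "\<psi>0 \<in> dual_NS (ground G A.len) (gamma_perm G A.len)" using A.blow_dual_NS[OF \<psi>0(1)] \<psi>0(2) dual by simp
    show "\<forall>b\<in>ground G A.len. \<psi>0 b \<noteq> gamma_perm G A.len b"
    proof
      fix b assume b: "b \<in> ground G A.len"
      then have "inv ?t (A.blow \<psi>0 (arc_end \<mu> x0 g0 b)) \<noteq> arc_end \<mu> x0 g0 b" using S0 \<psi>0(2) unfolding S_def by blast
      moreover have "inv ?t (A.blow \<psi>0 (arc_end \<mu> x0 g0 b)) = arc_end \<mu> x0 g0 (inv (gamma_perm G A.len) (\<psi>0 b))"
        using A.inv_tau_blow[OF \<psi>0(1)] A.ext_en[OF b] by (metis comp_apply)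
      ultimately show "\<psi>0 b \<noteq> gamma_perm G A.len b" using permutes_inverses[OF A.perm_N] by metis
    qed
  qed
  obtain m0 where m0: "m0 \<in> markings marked (ground G A.len) \<psi>0" "m = {e \<in> ?E. arc_of \<mu> x0 g0 e \<in> m0}"
    using m arcs_blow_markings[OF A.arcs_axioms \<psi>0(1)] \<psi>0(2) by auto
  \<comment> \<open>The rotation comes before the run lengths. This order matters: the lengths
    \<open>g\<close> used below are measured from base points that depend on
    \<open>r\<close>.\<close>
  obtain r where r: "\<And>i. i \<in> G ==> r i < A.len i"
    and cpl: "\<And>g. (\<forall>i\<in>G. length (g i) = A.len i \<and> (\<forall>a\<in>set (g i). 0 < a)) ==>
        \<exists>ob\<in>Ob. (\<forall>i\<in>G. gl ob i = g i) \<and> (\<forall>b\<in>ground G A.len. \<psi>0 (rot A.len r b) = rot A.len r (Psi ob b))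
           \<and> m0 = rot A.len r ` Mk ob"
    using complete[OF A.len_pos red0 m0(1)] by blast
  \<comment> \<open>The run with label 0 in the new decomposition is to be the old run
    \<open>r i\<close>, so the new last end is that of the run before it; adding
    \<open>len i - 1\<close> expresses this predecessor without truncated subtraction.\<close>
  define y where "y i = snd (arc_end \<mu> x0 g0 (i, (r i + (A.len i - 1)) mod A.len i))" for i
  have yS: "(i, y i) \<in> S" and y_eq: "arc_end \<mu> x0 g0 (i, (r i + (A.len i - 1)) mod A.len i) = (i, y i)" if i: "i \<in> G" for i
  proof -
    show e: "arc_end \<mu> x0 g0 (i, (r i + (A.len i - 1)) mod A.len i) = (i, y i)" by (simp add: y_def arc_end_def)
    have "(i, (r i + (A.len i - 1)) mod A.len i) \<in> ground G A.len" using i A.len_pos[OF i] by simp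
    then show "(i, y i) \<in> S" using S0 e by (metis imageI)
  qed
  from ends[of y, OF yS] obtain x1 g where c1: "composition G \<mu> x1 g"
    and S1: "arc_end \<mu> x1 g ` ground G (\<lambda>i. length (g i)) = S"
    and y1: "\<And>i. i \<in> G ==> (x1 i + (\<mu> i - 1)) mod \<mu> i = y i" by auto
  define x where "x = restrict x1 G"
  have c: "composition G \<mu> x g" using c1 by (simp add: composition_def x_def)
  have x: "x \<in> base_points \<mu>" using c1 by (auto simp: base_points_def x_def composition_def)
  have xe: "arc_end \<mu> x g (i, q) = arc_end \<mu> x1 g (i, q)" if "i \<in> G" for i q
    using that by (simp add: arc_end_def x_def)
  interpret A': composition G \<mu> x g by (rule c)
  have S': "arc_end \<mu> x g ` ground G A'.len = S"
    unfolding S1[symmetric] by (intro image_cong) (auto simp: xe)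
  interpret two_compositions G \<mu> x0 g0 x g
    by unfold_locales (simp add: S0 S')
  note B = ground_eq and N = gamma_eq
  have r0: "shift (i, 0) = (i, r i)" if i: "i \<in> G" for i
  proof -
    let ?l = "A'.len i - 1"
    have l: "(i, ?l) \<in> ground G A'.len" "Suc ?l = A'.len i" using A'.len_pos[OF i] i by auto
    have "(i, 0) = gamma_perm G A'.len (i, ?l)" using i l by (simp add: gamma_perm_apply)
    then have "shift (i, 0) = gamma_perm G A.len (shift (i, ?l))" using shift_N[OF l(1)] by simp
    have "arc_end \<mu> x g (i, ?l) = (i, y i)"
      using y1[OF i] l A'.sum_g[OF i] i by (simp add: arc_end_def x_def)
    moreover have "(i, (r i + (A.len i - 1)) mod A.len i) \<in> ground G A.len" using i A.len_pos[OF i] by simp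
    ultimately have "shift (i, ?l) = (i, (r i + (A.len i - 1)) mod A.len i)"
      unfolding shift_def using y_eq[OF i] A.c_en by metis
    then show ?thesis using \<open>shift (i, 0) = _\<close> i A.len_pos[OF i] r[OF i] by (simp add: gamma_perm_apply mod_Suc_eq)
  qed
  have sh: "shift b = rot A.len r b" if b: "b \<in> ground G A.len" for b
  proof -
    have "shift b = rot A.len (\<lambda>i. snd (shift (i, 0))) b"
      using rotI[OF finite_G A.len_pos _ _ b, of shift] shift_in fst_shift shift_N N B by auto
    then show ?thesis using r0[of "fst b"] b by (auto simp: rot_def ground_def)
  qed
  obtain ob where ob: "ob \<in> Ob" "\<forall>i\<in>G. gl ob i = g i"
    "\<forall>b\<in>ground G A.len. \<psi>0 (rot A.len r b) = rot A.len r (Psi ob b)" "m0 = rot A.len r ` Mk ob"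
    using cpl[of g] len_eq A'.pos_g by auto
  have oO: "ob \<in> objects \<mu>" using ob A'.sum_g by (simp add: objects_def)
  interpret A1: composition G \<mu> x "gl ob" using composition_object[OF oO x] .
  have en1: "arc_end \<mu> x (gl ob) b = arc_end \<mu> x g b" if "b \<in> ground G A'.len" for b
    using that ob by (auto simp: arc_end_def ground_def)
  have of1: "arc_of \<mu> x (gl ob) e = arc_of \<mu> x g e" if "e \<in> ?E" for e
    using that ob by (auto simp: arc_of_def ground_def)
  have B1: "ground G A1.len = ground G A.len" using ob len_eq by (auto simp: ground_def)
  have N1: "gamma_perm G A1.len = gamma_perm G A'.len" using B1 B ob(2) by (auto simp: gamma_perm_def fun_eq_iff)
  have pP: "Psi ob permutes ground G A.len" using Psi_permutes[OF ob(1)] B1 by simp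
  have Pin: "Psi ob b \<in> ground G A.len" if "b \<in> ground G A.len" for b using pP that by (simp add: permutes_in_image)
  have bl: "A1.blow (Psi ob) e = \<psi> e" for e
  proof (cases "e \<in> arc_end \<mu> x g ` ground G A'.len")
    case True
    then obtain b where b: "b \<in> ground G A'.len" "e = arc_end \<mu> x g b" by blast
    let ?a = "inv (gamma_perm G A'.len) (Psi ob b)" and ?c = "inv (gamma_perm G A.len) (\<psi>0 (shift b))"
    have aB: "?a \<in> ground G A'.len"
      using Pin b B permutes_inv[OF A'.perm_N] by (simp add: permutes_in_image)
    have "gamma_perm G A.len (shift ?a) = shift (Psi ob b)"
      using shift_N[OF aB] permutes_inverses[OF A'.perm_N] by simp
    also have "\<dots> = \<psi>0 (shift b)" using ob(3) sh b Pin B by simp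
    finally have "shift ?a = ?c" using permutes_inverses[OF A.perm_N] by metis
    then have "arc_end \<mu> x g ?a = arc_end \<mu> x0 g0 ?c" using en_shift[OF aB] by simp
    moreover have "A1.blow (Psi ob) e = ?t (arc_end \<mu> x g ?a)"
      using A1.blow_en(1)[of "Psi ob" b] pP B1 B b en1 aB N1 by simp
    moreover have "\<psi> e = ?t (arc_end \<mu> x0 g0 ?c)"
      using A.blow_en(1)[OF \<psi>0(1) shift_in[OF b(1)]] en_shift[OF b(1)] b \<psi>0(2) by simp
    ultimately show ?thesis by simp
  next
    case False
    then have "e \<notin> S" using S' by simp
    then have "\<psi> e = ?t e" using permutes_inverses[OF pt] unfolding S_def by (metis (mono_tags) mem_Collect_eq)
    moreover have "e \<notin> arc_end \<mu> x (gl ob) ` ground G A1.len" using False en1 B1 B by (auto simp: image_iff)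
    then have "A1.blow (Psi ob) e = ?t e" by (simp add: A1.blow_def A1.ext_def)
    ultimately show ?thesis by simp
  qed
  have MkB: "Mk ob \<subseteq> ground G A.len"
    using markings_sub[OF A.finB pP] Mk_in[OF ob(1)] B1 by auto
  have m_eq: "m = {e \<in> ?E. arc_of \<mu> x (gl ob) e \<in> Mk ob}"
  proof -
    have "arc_of \<mu> x0 g0 e \<in> m0 \<longleftrightarrow> arc_of \<mu> x (gl ob) e \<in> Mk ob" if e: "e \<in> ?E" for e
    proof -
      have "m0 = shift ` Mk ob" unfolding ob(4) using sh MkB by (intro image_cong) auto
      moreover have "arc_of \<mu> x0 g0 e = shift (arc_of \<mu> x g e)" using shift_c[OF e] by simp
      moreover have "arc_of \<mu> x g e \<in> ground G A'.len" using A'.c_in[OF e] .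
      ultimately show ?thesis using of1[OF e] inj_on_image_mem_iff[OF inj_shift, of _ "Mk ob"] MkB B by simp
    qed
    then show ?thesis using m0(2) by blast
  qed
  have "(\<psi>, m) = build \<mu> (x, ob)" using bl m_eq by (simp add: build_def fun_eq_iff)
  then show ?thesis using x oO by blast
qed

text \<open>\<open>build\<close> is a bijection, and the weight of its value does not depend on the
  base points, because the size of a cycle is the sum of the lengths of its runs.\<close>

lemma (in structures) sum_marked_NS:
  fixes f :: "nat => 'a :: comm_ring_1" and w :: "nat => 'a"
  assumes pos: "\<And>i. i \<in> G ==> 0 < \<mu> i"
  shows "finite (objects \<mu>)"
    and "(\<Sum>\<psi>\<in>dual_NS (ground G \<mu>) (gamma_perm G \<mu>). \<Sum>m\<in>markings marked (ground G \<mu>) \<psi>.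
           f (card m) * (\<Prod>V\<in>cyc (ground G \<mu>) \<psi> - {m}. w (card V)))
       = of_nat (\<Prod>i\<in>G. \<mu> i) * (\<Sum>ob\<in>objects \<mu>. f (\<Sum>b\<in>Mk ob. gl ob (fst b) ! snd b)
           * (\<Prod>V\<in>cyc (ground G (\<lambda>i. length (gl ob i))) (Psi ob) - {Mk ob}. w (\<Sum>b\<in>V. gl ob (fst b) ! snd b)))"
proof -
  let ?E = "ground G \<mu>" and ?t = "gamma_perm G \<mu>"
  have fE: "finite ?E" using finite_G by (simp add: finite_ground)
  have bij: "bij_betw (build \<mu>) (base_points \<mu> \<times> objects \<mu>) (marked_NS \<mu>)"
    unfolding bij_betw_def using build_inj build_surj[OF pos] build_in by auto
  have fp: "finite {p. p permutes ?E}" using fE by (rule finite_permutations)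
  have fd: "finite (dual_NS ?E ?t)" by (rule finite_subset[OF _ fp]) (auto simp: dual_NS_def)
  have fm: "finite (markings marked ?E \<psi>)" if "\<psi> \<in> dual_NS ?E ?t" for \<psi>
    using fE by (simp add: markings_def cycle_partition_def)
  have "finite (marked_NS \<mu>)" unfolding marked_NS_def using fd fm by blast
  then have fin: "finite (base_points \<mu> \<times> objects \<mu>)" using bij_betw_finite[OF bij] by simp
  have cb: "card (base_points \<mu>) = (\<Prod>i\<in>G. \<mu> i)" unfolding base_points_def by (simp add: card_PiE finite_G)
  then have "base_points \<mu> \<noteq> {}" using pos finite_G by (metis card.empty less_irrefl prod_pos)
  then show "finite (objects \<mu>)" using fin by (metis finite_cartesian_productD2)
  let ?F = "\<lambda>(\<psi>, m). f (card m) * (\<Prod>V\<in>cyc ?E \<psi> - {m}. w (card V))"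
  let ?W = "\<lambda>ob. f (\<Sum>b\<in>Mk ob. gl ob (fst b) ! snd b)
           * (\<Prod>V\<in>cyc (ground G (\<lambda>i. length (gl ob i))) (Psi ob) - {Mk ob}. w (\<Sum>b\<in>V. gl ob (fst b) ! snd b))"
  have weight: "?F (build \<mu> (x, ob)) = ?W ob" if x: "x \<in> base_points \<mu>" and ob: "ob \<in> objects \<mu>" for x ob
  proof -
    interpret composition G \<mu> x "gl ob" using composition_object[OF ob x] .
    have o: "ob \<in> Ob" using ob by (simp add: objects_def)
    note pP = Psi_permutes[OF o]
    let ?u = "\<lambda>V. {e \<in> ?E. arc_of \<mu> x (gl ob) e \<in> V}"
    have sub: "cyc (ground G len) (Psi ob) \<subseteq> Pow (ground G len)" using cycle_sub[OF pP] .
    have M: "Mk ob \<in> Pow (ground G len)" using Mk_in[OF o] markings_sub[OF finB pP] by blast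
    have inj: "inj_on ?u (Pow (ground G len))" by (rule inj_on_arc_union[OF pP])
    have "cyc ?E (blow (Psi ob)) - {?u (Mk ob)} = ?u ` (cyc (ground G len) (Psi ob) - {Mk ob})"
      unfolding cycle_partition_blow[OF pP] using inj_on_image_set_diff[OF inj, of "cyc (ground G len) (Psi ob)" "{Mk ob}"] sub M
      by auto
    then have "(\<Prod>V\<in>cyc ?E (blow (Psi ob)) - {?u (Mk ob)}. w (card V))
        = (\<Prod>V\<in>cyc (ground G len) (Psi ob) - {Mk ob}. w (card (?u V)))"
    proof (simp only:, subst prod.reindex)
      show "inj_on ?u (cyc (ground G len) (Psi ob) - {Mk ob})"
        by (rule inj_on_subset[OF inj]) (use sub in blast)
    qed (simp add: comp_def)
    also have "\<dots> = (\<Prod>V\<in>cyc (ground G len) (Psi ob) - {Mk ob}. w (\<Sum>b\<in>V. gl ob (fst b) ! snd b))"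
      using sub card_arc_union by (intro prod.cong) auto
    finally show ?thesis using card_arc_union[of "Mk ob"] M by (simp add: build_def)
  qed
  have "(\<Sum>\<psi>\<in>dual_NS ?E ?t. \<Sum>m\<in>markings marked ?E \<psi>. ?F (\<psi>, m)) = (\<Sum>z\<in>marked_NS \<mu>. ?F z)"
    unfolding marked_NS_def using sum.Sigma[OF fd, of "markings marked ?E" "\<lambda>\<psi> m. ?F (\<psi>, m)"] fm by simp
  also have "\<dots> = (\<Sum>z\<in>base_points \<mu> \<times> objects \<mu>. ?F (build \<mu> z))"
    by (rule sum.reindex_bij_betw[OF bij, symmetric])
  also have "\<dots> = (\<Sum>(x, ob)\<in>base_points \<mu> \<times> objects \<mu>. ?W ob)"
    by (rule sum.cong[OF refl]) (use weight in auto)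
  also have "\<dots> = of_nat (\<Prod>i\<in>G. \<mu> i) * (\<Sum>ob\<in>objects \<mu>. ?W ob)"
    by (simp add: sum.cartesian_product[symmetric] cb)
  finally show "(\<Sum>\<psi>\<in>dual_NS (ground G \<mu>) (gamma_perm G \<mu>). \<Sum>m\<in>markings marked (ground G \<mu>) \<psi>.
           f (card m) * (\<Prod>V\<in>cyc (ground G \<mu>) \<psi> - {m}. w (card V)))
       = of_nat (\<Prod>i\<in>G. \<mu> i) * (\<Sum>ob\<in>objects \<mu>. f (\<Sum>b\<in>Mk ob. gl ob (fst b) ! snd b)
           * (\<Prod>V\<in>cyc (ground G (\<lambda>i. length (gl ob i))) (Psi ob) - {Mk ob}. w (\<Sum>b\<in>V. gl ob (fst b) ! snd b)))"
    by simp
qed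

section \<open>Reduced permutations\<close>

lemma sum_card_cycle_partition:
  assumes "finite E" "f permutes E"
  shows "(\<Sum>V\<in>cyc E f. card V) = card E"
proof -
  note P = cycle_partition_partition[OF assms]
  have "card (\<Union>(cyc E f)) = sum card (cyc E f)"
  proof (rule card_Union_disjoint)
    show "pairwise disjnt (cyc E f)"
      using P by (auto simp: partition_on_def pairwise_def disjnt_def disjoint_def)
    show "finite V" if "V \<in> cyc E f" for V
      using that P assms(1) by (auto simp: partition_on_def intro: finite_subset)
  qed
  then show ?thesis using P by (simp add: partition_on_def)
qed

context
  fixes E :: "'b set" and f :: "'b => 'b" and b :: 'b
  assumes fin: "finite E" and perm: "f permutes E" and b: "b \<in> E" and nfix: "f b \<noteq> b"
begin

lemma orbit_mem: "b \<in> orbit f b" "f b \<in> orbit f b" "f (f b) \<in> orbit f b" "f (f (f b)) \<in> orbit f b" "f (f (f (f b))) \<in> orbit f b"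
  using perm_self[OF fin perm] by (auto intro: orbit.intros)

lemma finite_orbit_E: "finite (orbit f b)"
  using perm_orbit_sub[OF fin perm b] fin finite_subset by blast

lemma orbit_card_ge: "2 \<le> card (orbit f b)"
proof -
  have "card {b, f b} \<le> card (orbit f b)"
    by (rule card_mono) (use finite_orbit_E orbit_mem in auto)
  then show ?thesis using nfix by auto
qed

lemma orbit_sub_closed: "A \<subseteq> E ==> f ` A \<subseteq> A ==> b \<in> A ==> orbit f b \<subseteq> A"
  using permutes_orbit_closed[OF fin perm] by blast

lemma feq: "f x = f y \<longleftrightarrow> x = y" using permutes_inj[OF perm] by (auto simp: inj_def)

lemma orbit_card2: "card (orbit f b) = 2 \<longleftrightarrow> f (f b) = b"
proof
  assume c: "card (orbit f b) = 2"
  have "{b, f b} = orbit f b"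
    by (rule card_subset_eq) (use finite_orbit_E orbit_mem nfix c in auto)
  then show "f (f b) = b" using orbit_mem(3) feq nfix by auto
next
  assume a: "f (f b) = b"
  have "orbit f b \<subseteq> {b, f b}"
    by (rule orbit_sub_closed) (use a b perm in \<open>auto simp: permutes_in_image\<close>)
  then have "orbit f b = {b, f b}" using orbit_mem by blast
  then show "card (orbit f b) = 2" using nfix by auto
qed

lemma orbit_card3:
  assumes c: "card (orbit f b) = 3"
  shows "orbit f b = {b, f b, f (f b)}" "f (f (f b)) = b" "f (f b) \<noteq> b"
proof -
  show n: "f (f b) \<noteq> b" using c orbit_card2 by auto
  show e: "orbit f b = {b, f b, f (f b)}"
    by (rule card_subset_eq[symmetric]) (use finite_orbit_E orbit_mem nfix n feq c in auto)
  show "f (f (f b)) = b" using orbit_mem(4) feq nfix n unfolding e by auto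
qed

lemma orbit_card4:
  assumes c: "card (orbit f b) = 4"
  shows "orbit f b = {b, f b, f (f b), f (f (f b))}" "f (f (f (f b))) = b" "f (f b) \<noteq> b" "f (f (f b)) \<noteq> b"
proof -
  show n: "f (f b) \<noteq> b" using c orbit_card2 by auto
  show n3: "f (f (f b)) \<noteq> b"
  proof
    assume a: "f (f (f b)) = b"
    have "orbit f b \<subseteq> {b, f b, f (f b)}"
      by (rule orbit_sub_closed) (use a b perm in \<open>auto simp: permutes_in_image\<close>)
    then have "card (orbit f b) \<le> card {b, f b, f (f b)}" by (intro card_mono) auto
    also have "\<dots> \<le> 3" by (simp add: card_insert_if)
    finally show False using c by simp
  qed
  show e: "orbit f b = {b, f b, f (f b), f (f (f b))}"
    by (rule card_subset_eq[symmetric]) (use finite_orbit_E orbit_mem nfix n n3 feq c in auto)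
  show "f (f (f (f b))) = b" using orbit_mem(5) feq nfix n n3 unfolding e by auto
qed

end

text \<open>The \<open>k\<close>-th element of the cycle \<open>i\<close>, counted modulo \<open>s i\<close> from the base point \<open>r i\<close>.\<close>

definition pt :: "(nat => nat) => (nat => nat) => nat => int => nat \<times> nat" where
  "pt s r i k = (i, nat ((int (r i) + k) mod int (s i)))"

abbreviation "pt0 s \<equiv> pt s (\<lambda>_. 0)"

lemma fst_pt [simp]: "fst (pt s r i k) = i" by (simp add: pt_def)

lemma pt_in: "i \<in> G ==> 0 < s i ==> pt s r i k \<in> ground G s"
  by (simp add: pt_def nat_less_iff)

lemma pt_eq_iff: assumes "0 < s i" shows "pt s r i k = pt s r i l \<longleftrightarrow> int (s i) dvd k - l"
proof -
  have "pt s r i k = pt s r i l \<longleftrightarrow> (int (r i) + k) mod int (s i) = (int (r i) + l) mod int (s i)"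
    using assms by (simp add: pt_def eq_nat_nat_iff)
  also have "\<dots> \<longleftrightarrow> int (s i) dvd k - l" by (simp add: mod_eq_dvd_iff)
  finally show ?thesis .
qed

lemma pt_cong: "int (s i) dvd k - l ==> pt s r i k = pt s r i l"
  by (simp add: pt_def mod_eq_dvd_iff[symmetric] flip: mod_eq_dvd_iff) (metis add_diff_cancel_left mod_eq_dvd_iff)

lemma gamma_pt: assumes "i \<in> G" "0 < s i" shows "gamma_perm G s (pt s r i k) = pt s r i (k + 1)"
proof -
  have "Suc (nat ((int (r i) + k) mod int (s i))) mod s i = nat ((int (r i) + (k + 1)) mod int (s i))"
    using assms by (simp add: nat_mod_distrib[symmetric] Suc_nat_eq_nat_zadd1 nat_eq_iff2 zmod_int mod_add_right_eq ac_simps)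
  then show ?thesis using pt_in[where s = s, OF assms, of r k] by (simp add: pt_def gamma_perm_apply assms nat_less_iff)
qed

lemma inv_gamma_pt:
  assumes "finite G" "i \<in> G" "0 < s i" shows "inv (gamma_perm G s) (pt s r i k) = pt s r i (k - 1)"
  using gamma_pt[where s = s, OF assms(2,3), of r "k - 1"] permutes_inverses[OF gamma_perm_permutes[OF assms(1)]]
  by (metis diff_add_cancel)

lemma pt_surj:
  assumes "b \<in> ground G s" shows "\<exists>k. 0 \<le> k \<and> k < int (s (fst b)) \<and> b = pt s r (fst b) k"
proof -
  obtain i e where b: "b = (i, e)" "e < s i" using assms by (cases b) auto
  have "(int (r i) + (int e - int (r i)) mod int (s i)) mod int (s i) = int e"
    using b by (simp add: mod_add_right_eq)
  then show ?thesis using b by (intro exI[of _ "(int e - int (r i)) mod int (s i)"]) (auto simp: pt_def)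
qed

lemma rot_pt: assumes "0 < s i" shows "rot s r (pt0 s i k) = pt s r i k"
proof -
  have "int ((r i + nat (k mod int (s i))) mod s i) = (int (r i) + k) mod int (s i)"
    using assms by (simp add: zmod_int mod_add_right_eq)
  then show ?thesis using assms by (simp add: rot_def pt_def)
qed

locale reduced_perm =
  fixes G :: "nat set" and s :: "nat => nat" and \<psi> :: "nat \<times> nat => nat \<times> nat"
  assumes finite_G: "finite G" and s_pos: "i \<in> G ==> 0 < s i" and red: "reduced G s \<psi>"
begin

abbreviation "B \<equiv> ground G s"
abbreviation "N \<equiv> gamma_perm G s"
definition "\<alpha> = inv N \<circ> \<psi>"

lemma finB: "finite B" using finite_G by (rule finite_ground)
lemma perm_N: "N permutes B" using finite_G by (rule gamma_perm_permutes)
lemma perm_psi: "\<psi> permutes B" using red by (simp add: reduced_def dual_NS_def)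
lemma perm_alpha: "\<alpha> permutes B" unfolding \<alpha>_def by (intro permutes_compose perm_psi permutes_inv perm_N)

lemma N_alpha: "N (\<alpha> b) = \<psi> b" using permutes_inverses[OF perm_N] by (simp add: \<alpha>_def)
lemma psi_in: "b \<in> B ==> \<psi> b \<in> B" using perm_psi by (simp add: permutes_in_image)
lemma alpha_in: "b \<in> B ==> \<alpha> b \<in> B" using perm_alpha by (simp add: permutes_in_image)
lemma fst_N: "b \<in> B ==> fst (N b) = fst b" using gamma_perm_in by blast
lemma fst_psi_alpha: "b \<in> B ==> fst (\<psi> b) = fst (\<alpha> b)" using N_alpha fst_N alpha_in by metis

lemma alpha_neq: "b \<in> B ==> \<alpha> b \<noteq> b"
  using red N_alpha by (metis reduced_def)

lemma orbit_N: assumes "b \<in> B" "d \<in> B" "fst d = fst b" shows "d \<in> orbit N b"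
proof -
  have b: "fst b \<in> G" "snd b < s (fst b)" using assms(1) by (auto simp: ground_def)
  have "orbit N (fst b, snd b) = {fst b} \<times> {..<s (fst b)}"
    by (rule orbit_gamma_perm[where \<mu> = s, OF finite_G b])
  then show ?thesis using assms by (cases d) auto
qed

lemma alpha_orbit_fst: "b \<in> B ==> d \<in> orbit \<alpha> b ==> d \<noteq> b ==> fst d \<noteq> fst b"
proof
  assume b: "b \<in> B" "d \<in> orbit \<alpha> b" "d \<noteq> b" "fst d = fst b"
  have "d \<in> B" using perm_orbit_sub[OF finB perm_alpha b(1)] b(2) by blast
  then have "d \<in> orbit N b" using orbit_N b by simp
  moreover have "\<forall>b\<in>B. \<forall>d\<in>orbit N b. b \<noteq> d --> d \<notin> orbit \<alpha> b"
    using red by (simp add: reduced_def dual_NS_def \<alpha>_def)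
  ultimately show False using b by metis
qed

lemma fst_alpha: "b \<in> B ==> fst (\<alpha> b) \<noteq> fst b"
  using alpha_orbit_fst[of b "\<alpha> b"] alpha_neq orbit.base by metis

lemma fst_psi: "b \<in> B ==> fst (\<psi> b) \<noteq> fst b"
  using fst_alpha fst_psi_alpha by simp

lemma psi_neq: "b \<in> B ==> \<psi> b \<noteq> b"
  using fst_psi by metis

text \<open>A cycle of \<alpha> meets each white vertex at most once, so \<open>fst\<close> is
  injective on it.\<close>

lemma card_orbit_alpha: assumes b: "b \<in> B" shows "card (orbit \<alpha> b) \<le> card G"
proof -
  have sub: "orbit \<alpha> b \<subseteq> B" using perm_orbit_sub[OF finB perm_alpha b] .
  have "inj_on fst (orbit \<alpha> b)"
  proof (rule inj_onI)
    fix x y assume xy: "x \<in> orbit \<alpha> b" "y \<in> orbit \<alpha> b" "fst x = fst y"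
    then have "y \<in> orbit \<alpha> x" using perm_orbit_eq[OF finB perm_alpha xy(1)] by simp
    then show "x = y" using alpha_orbit_fst[of x y] xy sub by auto
  qed
  moreover have "fst ` orbit \<alpha> b \<subseteq> G" using sub by (auto simp: ground_def)
  ultimately show ?thesis using card_mono[OF finite_G] card_image by metis
qed

text \<open>Both permutations move every point, hence all cycles have length at least 2 and the
  truncated differences are exact; the rest is Euler's relation.\<close>

lemma excess_sum:
  "(\<Sum>V\<in>cyc B \<alpha>. card V - 2) + (\<Sum>V\<in>cyc B \<psi>. card V - 2) = 2 * card G - 4"
proof -
  have ge: "2 \<le> card V" if "V \<in> cyc B f" "f permutes B" "\<And>b. b \<in> B ==> f b \<noteq> b" for V f
    using that orbit_card_ge[OF finB that(2)] by (auto simp: cycle_partition_def)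
  have sm: "(\<Sum>V\<in>cyc B f. card V - 2) + 2 * ncyc B f = card B"
    if f: "f permutes B" "\<And>b. b \<in> B ==> f b \<noteq> b" for f
  proof -
    have "(\<Sum>V\<in>cyc B f. card V - 2) + 2 * ncyc B f
       = (\<Sum>V\<in>cyc B f. (card V - 2) + 2)" by (subst sum.distrib) simp
    also have "\<dots> = (\<Sum>V\<in>cyc B f. card V)" by (rule sum.cong) (use ge f in force)+
    finally show ?thesis using sum_card_cycle_partition[OF finB f(1)] by simp
  qed
  have "ncyc B \<psi> + ncyc B N + ncyc B \<alpha> = card B + 2"
    using red by (simp add: reduced_def dual_NS_def \<alpha>_def)
  moreover have "ncyc B N = card G"
    using card_cycle_gamma_perm[where \<mu> = s, OF finite_G s_pos] by simp
  ultimately show ?thesis using sm[OF perm_alpha alpha_neq] sm[OF perm_psi psi_neq] by linarith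
qed

lemma alpha_pt: "i \<in> G ==> j \<in> G ==> \<psi> (pt s r i k) = pt s r j l \<longleftrightarrow> \<alpha> (pt s r i k) = pt s r j (l - 1)"
proof -
  assume "j \<in> G"
  then have "inv N (pt s r j l) = pt s r j (l - 1)" "N (pt s r j (l - 1)) = pt s r j l"
    using inv_gamma_pt[OF finite_G, of j s r l] gamma_pt[of j G s r "l - 1"] s_pos by auto
  then show ?thesis using N_alpha[of "pt s r i k"] by (auto simp: \<alpha>_def)
qed

end

section \<open>Classification of reduced permutations\<close>

text \<open>The two cyclic orders of a set of three white vertices. Both are kept as parameters so
  that reversing the orientation is just exchanging them.\<close>

definition tri :: "nat set => (nat => nat) => (nat => nat) => bool" where
  "tri G nx pv \<longleftrightarrow> (\<forall>i\<in>G. nx i \<in> G \<and> pv i \<in> G \<and> nx (pv i) = i \<and> pv (nx i) = i \<and> nx i \<noteq> i \<and> pv i \<noteq> i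
      \<and> nx i \<noteq> pv i \<and> nx (nx i) = pv i \<and> pv (pv i) = nx i \<and> G = {i, nx i, pv i})"

lemma tri_swap: "tri G nx pv ==> tri G pv nx"
proof -
  assume t: "tri G nx pv"
  have e: "{i, pv i, nx i} = {i, nx i, pv i}" for i by auto
  show "tri G pv nx" unfolding tri_def e
  proof
    fix i assume "i \<in> G"
    from bspec[OF t[unfolded tri_def] this]
    show "pv i \<in> G \<and> nx i \<in> G \<and> pv (nx i) = i \<and> nx (pv i) = i \<and> pv i \<noteq> i \<and> nx i \<noteq> i
      \<and> pv i \<noteq> nx i \<and> pv (pv i) = nx i \<and> nx (nx i) = pv i \<and> G = {i, nx i, pv i}"
      by (metis (no_types))
  qed
qed

lemma triD:
  assumes "tri G nx pv" "i \<in> G"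
  shows "nx i \<in> G" "pv i \<in> G" "nx (pv i) = i" "pv (nx i) = i" "nx i \<noteq> i" "pv i \<noteq> i" "nx i \<noteq> pv i"
    "nx (nx i) = pv i" "pv (pv i) = nx i" "G = {i, nx i, pv i}"
  using assms unfolding tri_def by blast+

text \<open>\<open>p\<close> and \<open>q\<close> are 1 or 0 according to whether the two exceptional 3-cycles belong to \<open>\<psi>\<close> or to
  \<open>\<alpha>\<close>; \<open>n i\<close> is the number of 2-cycles of \<open>\<psi>\<close> in the ladder between \<open>i\<close> and \<open>nx i\<close>.\<close>

definition triangle_family ::
  "nat set => (nat => nat) => (nat => nat) => (nat => nat) => (nat => int => nat \<times> nat) => (nat \<times> nat => nat \<times> nat)
    => int => int => (nat => int) => bool" where
  "triangle_family G nx pv s P \<psi> p q n \<longleftrightarrow> (\<forall>i\<in>G. 0 \<le> n i \<and> (p = 0 --> q = 0 --> 0 < n i)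
     \<and> int (s i) = n i + n (pv i) + p + q
     \<and> (\<forall>k. 0 \<le> k --> k < n i + p --> \<psi> (P i k) = P (nx i) (p - 1 - k))
     \<and> (\<forall>k. p \<le> k --> k < n i + p + q --> \<psi> (P (nx i) (p - 1 - k)) = P i k))"

text \<open>The 4-cycle of \<open>\<psi>\<close> is \<open>P a 0\<close>, \<open>P b 0\<close>, \<open>P a (s b)\<close>, \<open>P c 0\<close>.\<close>

definition double_family ::
  "(nat => nat) => (nat => int => nat \<times> nat) => (nat \<times> nat => nat \<times> nat) => nat => nat => nat => bool" where
  "double_family s P \<psi> a b c \<longleftrightarrow> int (s a) = int (s b) + int (s c)
     \<and> (\<forall>k. 0 \<le> k --> k < int (s b) --> \<psi> (P a k) = P b (- k))
     \<and> (\<forall>k. 1 \<le> k --> k \<le> int (s b) --> \<psi> (P b (- k)) = P a k)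
     \<and> (\<forall>k. 0 \<le> k --> k < int (s c) --> \<psi> (P a (int (s b) + k)) = P c (- k))
     \<and> (\<forall>k. 1 \<le> k --> k \<le> int (s c) --> \<psi> (P c (- k)) = P a (int (s b) + k))"

lemma sum_eq_2_cases:
  fixes e :: "'b => nat"
  assumes fin: "finite X" and sum: "sum e X = 2"
  shows "(\<exists>x\<in>X. e x = 2 \<and> (\<forall>z\<in>X. z \<noteq> x --> e z = 0))
     \<or> (\<exists>x\<in>X. \<exists>y\<in>X. x \<noteq> y \<and> e x = 1 \<and> e y = 1 \<and> (\<forall>z\<in>X. z \<noteq> x --> z \<noteq> y --> e z = 0))"
proof -
  have pick: "\<exists>x\<in>A. 0 < e x" if "0 < sum e A" for A
    using that by (metis bot_nat_0.not_eq_extremum less_irrefl sum.neutral)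
  obtain x where x: "x \<in> X" "0 < e x" using pick[of X] sum by auto
  have s1: "e x + sum e (X - {x}) = 2" using sum sum.remove[OF fin x(1), of e] by simp
  show ?thesis
  proof (cases "e x = 2")
    case True
    then have "sum e (X - {x}) = 0" using s1 by simp
    then have "\<forall>z\<in>X. z \<noteq> x --> e z = 0" using fin by auto
    then show ?thesis using x True by blast
  next
    case False
    then have ex: "e x = 1" and s2: "sum e (X - {x}) = 1" using s1 x by auto
    obtain y where y: "y \<in> X - {x}" "0 < e y" using pick[of "X - {x}"] s2 by auto
    have "e y + sum e (X - {x} - {y}) = 1" using s2 sum.remove[OF _ y(1), of e] fin by simp
    then have ey: "e y = 1" and "sum e (X - {x} - {y}) = 0" using y by auto
    then have "\<forall>z\<in>X. z \<noteq> x --> z \<noteq> y --> e z = 0" using fin by auto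
    then show ?thesis using x y ex ey by blast
  qed
qed

section \<open>Exceptional cycles\<close>

context reduced_perm
begin

text \<open>One notation for \<psi> and \<alpha>, so that the possible owners of an exceptional
  3-cycle need no separate arguments.\<close>

definition "fc t = (if t then \<psi> else \<alpha>)"

lemma fc_simps [simp]: "fc True = \<psi>" "fc False = \<alpha>" by (simp_all add: fc_def)

lemma perm_fc: "fc t permutes B" using perm_psi perm_alpha by (cases t) auto
lemma fc_in: "b \<in> B ==> fc t b \<in> B" using psi_in alpha_in by (cases t) auto
lemma fc_neq: "b \<in> B ==> fc t b \<noteq> b" using psi_neq alpha_neq by (cases t) auto
lemma fst_fc: "b \<in> B ==> fst (fc t b) \<noteq> fst b" using fst_psi fst_alpha by (cases t) auto
text \<open>The cycles of both permutations, tagged by their owner, are put into a single sum of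
  excesses with value 2. The tags are needed because the same set could be a cycle of both.\<close>

lemma special_cases:
  assumes G3: "card G = 3"
  shows "(\<exists>v\<in>B. card (orbit \<psi> v) = 4 \<and> (\<forall>b\<in>B. \<alpha> (\<alpha> b) = b) \<and> (\<forall>b\<in>B. \<psi> (\<psi> b) \<noteq> b --> b \<in> orbit \<psi> v))
    \<or> (\<exists>t t'. \<exists>v\<in>B. \<exists>v'\<in>B. card (orbit (fc t) v) = 3 \<and> card (orbit (fc t') v') = 3
        \<and> (t, orbit (fc t) v) \<noteq> (t', orbit (fc t') v')
        \<and> (\<forall>t0. \<forall>b\<in>B. fc t0 (fc t0 b) \<noteq> b --> t0 = t \<and> b \<in> orbit (fc t) v \<or> t0 = t' \<and> b \<in> orbit (fc t') v'))"
proof -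
  define X where "X = (SIGMA t : UNIV. cyc B (fc t))"
  define e :: "bool \<times> (nat \<times> nat) set => nat" where "e z = card (snd z) - 2" for z
  have finX: "finite X" unfolding X_def
    by (intro finite_SigmaI finite) (auto simp: cycle_partition_def finB)
  have "sum e X = (\<Sum>t\<in>UNIV. \<Sum>V\<in>cyc B (fc t). card V - 2)"
    unfolding X_def e_def using finB by (subst sum.Sigma) (auto simp: cycle_partition_def split_def)
  also have "\<dots> = 2" using excess_sum G3 by (simp add: UNIV_bool)
  finally have sum2: "sum e X = 2" .
  have sp: "e (t0, orbit (fc t0) b) \<noteq> 0" if "b \<in> B" "fc t0 (fc t0 b) \<noteq> b" for t0 b
    using orbit_card2[OF finB perm_fc[of t0] that(1) fc_neq[OF that(1)]] that(2)
      orbit_card_ge[OF finB perm_fc[of t0] that(1) fc_neq[OF that(1)]] by (simp add: e_def)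
  have mX: "(t0, orbit (fc t0) b) \<in> X" if "b \<in> B" for t0 b using that by (simp add: X_def cycle_partition_def)
  have selfo: "b \<in> orbit (fc t0) b" for t0 b using perm_self[OF finB perm_fc] .
  from sum_eq_2_cases[OF finX sum2] show ?thesis
  proof (elim disjE bexE conjE)
    fix x assume x: "x \<in> X" "e x = 2" "\<forall>z\<in>X. z \<noteq> x --> e z = 0"
    then obtain t v where tv: "x = (t, orbit (fc t) v)" "v \<in> B" by (auto simp: X_def cycle_partition_def)
    then have c4: "card (orbit (fc t) v) = 4" using x by (simp add: e_def)
    then have t: t using card_orbit_alpha[OF tv(2)] G3 by (cases t) auto
    have "t0 = t \<and> b \<in> orbit (fc t) v" if "b \<in> B" "fc t0 (fc t0 b) \<noteq> b" for b t0
      using sp[OF that] mX[OF that(1), of t0] x(3) tv(1) selfo by (metis prod.inject)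
    from this[of _ False] this[of _ True] show ?thesis using t tv c4 by (intro disjI1 bexI[of _ v]) auto
  next
    fix x y assume xy: "x \<in> X" "y \<in> X" "x \<noteq> y" "e x = 1" "e y = 1" "\<forall>z\<in>X. z \<noteq> x --> z \<noteq> y --> e z = 0"
    have obX: "\<exists>t. \<exists>v\<in>B. z = (t, orbit (fc t) v)" if "z \<in> X" for z
      using that by (auto simp: X_def cycle_partition_def)
    from obX[OF xy(1)] obX[OF xy(2)] obtain t v t' v'
      where tv: "x = (t, orbit (fc t) v)" "v \<in> B" "y = (t', orbit (fc t') v')" "v' \<in> B" by blast
    have c3: "card (orbit (fc t) v) = 3" "card (orbit (fc t') v') = 3" using xy tv by (simp_all add: e_def)
    have "t0 = t \<and> b \<in> orbit (fc t) v \<or> t0 = t' \<and> b \<in> orbit (fc t') v'" if "b \<in> B" "fc t0 (fc t0 b) \<noteq> b" for b t0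
    proof -
      have "(t0, orbit (fc t0) b) = x \<or> (t0, orbit (fc t0) b) = y" using sp[OF that] mX[OF that(1), of t0] xy(6) by metis
      then show ?thesis using selfo[of b t0] tv by auto
    qed
    then show ?thesis using c3 tv xy(3) by (intro disjI2) blast
  qed
qed

section \<open>Ladders and their ends\<close>

text \<open>The ladder is found by walking away from an exceptional cycle, which passes through
  label 0 if it belongs to \<psi> (\<open>p = 1\<close>) and through label -1 if it belongs to
  \<alpha> (\<open>p = 0\<close>). While \<psi> acts as an involution a rung can be crossed in both
  directions; while \<alpha> does, the next rung follows, with labels rising on \<open>i\<close> and
  falling on \<open>j\<close>. The walk stops at the first exceptional point, and \<open>q\<close>
  records whose it is.\<close>

lemma ladder:
  fixes p :: int
  assumes i: "i \<in> G" and j: "j \<in> G"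
    and base: "p = 1 \<and> \<psi> (pt s r i 0) = pt s r j 0 \<and> \<psi> (\<psi> (pt s r j 0)) \<noteq> pt s r j 0
       \<or> p = 0 \<and> \<psi> (pt s r j (-1)) = pt s r i 0 \<and> \<alpha> (\<alpha> (pt s r i (-1))) \<noteq> pt s r i (-1)"
  shows "\<exists>n q. 0 \<le> n \<and> (q = 0 \<or> q = 1) \<and> (p = 0 --> q = 0 --> 0 < n)
     \<and> (\<forall>k. 0 \<le> k --> k < n + p --> \<psi> (pt s r i k) = pt s r j (p - 1 - k))
     \<and> (\<forall>k. p \<le> k --> k < n + p + q --> \<psi> (pt s r j (p - 1 - k)) = pt s r i k)
     \<and> (\<forall>k. 0 \<le> k --> k < n + p + q - 1 --> \<alpha> (\<alpha> (pt s r i k)) = pt s r i k)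
     \<and> (q = 1 --> \<psi> (\<psi> (pt s r j (- 1 - n))) \<noteq> pt s r j (- 1 - n) \<and> \<psi> (pt s r j (- 1 - n)) = pt s r i (n + p))
     \<and> (q = 0 --> \<alpha> (\<alpha> (pt s r i (n + p - 1))) \<noteq> pt s r i (n + p - 1) \<and> \<alpha> (pt s r i (n + p - 1)) = pt s r j (- 1 - n))"
proof -
  let ?i = "pt s r i" and ?j = "pt s r j"
  define F where "F k \<longleftrightarrow> \<psi> (?i k) = ?j (p - 1 - k)" for k
  define Bk where "Bk k \<longleftrightarrow> \<psi> (?j (p - 1 - k)) = ?i k" for k
  \<comment> \<open>The condition \<open>p \<le> k\<close> keeps the starting point itself, which is
    exceptional for \<open>p = 1\<close>, from stopping the walk.\<close>
  define sP where "sP k \<longleftrightarrow> p \<le> k \<and> \<psi> (\<psi> (?j (p - 1 - k))) \<noteq> ?j (p - 1 - k)" for k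
  define sA where "sA k \<longleftrightarrow> \<alpha> (\<alpha> (?i k)) \<noteq> ?i k" for k
  have p01: "p = 0 \<or> p = 1" using base by blast
  have FB: "Bk (k + 1)" if "F k" "\<not> sA k" for k
  proof -
    have "\<alpha> (?i k) = ?j (p - 1 - k - 1)" using that alpha_pt[OF i j] by (simp add: F_def)
    then have "\<alpha> (?j (p - 1 - (k + 1))) = ?i (k + 1 - 1)" using that by (simp add: sA_def algebra_simps)
    then show ?thesis using alpha_pt[OF j i] by (simp add: Bk_def)
  qed
  have BF: "F k" if "Bk k" "p \<le> k" "\<not> sP k" for k
    using that by (simp add: F_def Bk_def sP_def)
  \<comment> \<open>The walk must stop: after a full turn of the cycle it would be back at the
    exceptional point it started from.\<close>
  have ex: "\<exists>k::nat. sP (int k) \<or> sA (int k)"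
  proof (cases "p = 1")
    case True
    have "?j (p - 1 - int (s j)) = ?j 0" by (rule pt_cong) (simp add: True)
    then have "sP (int (s j))" using base True s_pos[OF j] by (simp add: sP_def)
    then show ?thesis by blast
  next
    case False
    have e: "?i (int (s i - 1)) = ?i (-1)" by (rule pt_cong) (use s_pos[OF i] in \<open>simp add: of_nat_diff\<close>)
    then have "sA (int (s i - 1))" using base False unfolding sA_def by simp
    then show ?thesis by blast
  qed
  define K where "K = (LEAST k::nat. sP (int k) \<or> sA (int k))"
  have K: "sP (int K) \<or> sA (int K)" unfolding K_def by (rule LeastI_ex[OF ex])
  have below: "\<not> sP (int k) \<and> \<not> sA (int k)" if "k < K" for k
    using not_less_Least[of k "\<lambda>k. sP (int k) \<or> sA (int k)"] that unfolding K_def by blast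
  have walk: "k \<le> K ==> (p \<le> int k --> Bk (int k)) \<and> (\<not> sP (int k) --> F (int k))" for k
  proof (induction k)
    case 0
    then show ?case using base BF[of 0] p01 by (auto simp: F_def Bk_def)
  next
    case (Suc k)
    then have "F (int k)" "\<not> sA (int k)" using below[of k] by auto
    then have "Bk (int (Suc k))" using FB[of "int k"] by (simp add: add.commute)
    then show ?case using BF[of "int (Suc k)"] p01 by auto
  qed
  have Fk: "F k" if "0 \<le> k" "k < int K" for k
    using walk[of "nat k"] below[of "nat k"] that by auto
  have Bkk: "Bk k" if "p \<le> k" "k \<le> int K" for k
    using walk[of "nat k"] that p01 by auto
  have nsA: "\<not> sA k" if "0 \<le> k" "k < int K" for k using below[of "nat k"] that by auto
  show ?thesis
  proof (cases "sP (int K)")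
    case True
    then have pK: "p \<le> int K" by (simp add: sP_def)
    \<comment> \<open>An exceptional point of \<psi> at \<open>K\<close> leaves the labels
      \<open>p\<close> to \<open>K - 1\<close> as rungs; in the other case label \<open>K\<close>
      still carries a rung, hence the witness \<open>K + 1 - p\<close> there.\<close>
    have eK: "- 1 - (int K - p) = p - 1 - int K" by simp
    show ?thesis
      by (rule exI[of _ "int K - p"], rule exI[of _ 1])
        (use True pK Fk Bkk nsA in \<open>auto simp: sP_def F_def Bk_def sA_def eK\<close>)
  next
    case False
    then have sAK: "sA (int K)" using K by blast
    have FK: "F (int K)" using walk[of K] False by simp
    have Fk': "F k" if "0 \<le> k" "k < int K + 1" for k using Fk FK that by (cases "k = int K") auto
    have aK: "\<alpha> (?i (int K)) = ?j (p - 1 - int K - 1)" using FK alpha_pt[OF i j] by (simp add: F_def)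
    show ?thesis
      by (rule exI[of _ "int K + 1 - p"], rule exI[of _ 0])
        (use sAK aK Fk' Bkk nsA p01 in \<open>auto simp: F_def Bk_def sA_def algebra_simps\<close>)
  qed
qed

section \<open>Two exceptional 3-cycles\<close>

text \<open>Any two elements of a 3-cycle are neighbours, and neighbours lie on different white
  vertices.\<close>

lemma triangle_cycle_unique:
  assumes G3: "card G = 3" and v: "v \<in> B" and c3: "card (orbit (fc t) v) = 3"
    and xy: "x \<in> orbit (fc t) v" "y \<in> orbit (fc t) v" "fst x = fst y"
  shows "x = y"
proof -
  note oc = orbit_card3[OF finB perm_fc v fc_neq[OF v] c3]
  let ?f = "fc t"
  have in_B: "?f v \<in> B" "?f (?f v) \<in> B" using v fc_in by auto
  have "fst (?f v) \<noteq> fst v" "fst (?f (?f v)) \<noteq> fst (?f v)" "fst v \<noteq> fst (?f (?f v))"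
    using fst_fc[OF v, of t] fst_fc[OF in_B(1), of t] fst_fc[OF in_B(2), of t] oc(2) by auto
  then show ?thesis using xy unfolding oc(1) by auto
qed

text \<open>From the given exceptional cycle one ladder starts between every \<open>i\<close> and
  \<open>nx i\<close>, and all of them end at the second exceptional cycle. What remains is to see
  that together they go round each white vertex exactly once. The second conclusion records the
  direction of the second cycle, from which \<open>classify3\<close> decides which cycle to start
  with.\<close>

lemma triangle_classify:
  fixes p :: int
  assumes tri: "tri G nx pv" and G3: "card G = 3" and p01: "p = 0 \<or> p = 1"
    and base1: "\<And>i. i \<in> G ==> p = 1 ==> \<psi> (pt s r i 0) = pt s r (nx i) 0 \<and> \<psi> (\<psi> (pt s r i 0)) \<noteq> pt s r i 0"
    and base0: "\<And>i. i \<in> G ==> p = 0 ==> \<psi> (pt s r (nx i) (-1)) = pt s r i 0 \<and> \<alpha> (\<alpha> (pt s r i (-1))) \<noteq> pt s r i (-1)"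
    and v: "v \<in> B" and c3: "card (orbit (fc t) v) = 3"
    and spP: "\<And>b. b \<in> B ==> \<psi> (\<psi> b) \<noteq> b ==> p = 1 \<and> b = pt s r (fst b) 0 \<or> t \<and> b \<in> orbit (fc t) v"
    and spA: "\<And>b. b \<in> B ==> \<alpha> (\<alpha> b) \<noteq> b ==> p = 0 \<and> b = pt s r (fst b) (-1) \<or> \<not> t \<and> b \<in> orbit (fc t) v"
  shows "\<exists>n. triangle_family G nx pv s (pt s r) \<psi> p (of_bool t) n"
    and "\<exists>y\<in>orbit (fc t) v. fst (fc t y) = (if t then pv (fst y) else nx (fst y))"
proof -
  let ?V = "orbit (fc t) v" and ?p = "pt s r"
  note T = triD[OF tri]
  note ptB = pt_in[where s = s, OF _ s_pos]
  have pi: "?p i k \<in> B" if "i \<in> G" for i k using ptB[OF that that] .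
  have "\<forall>i\<in>G. \<exists>z. 0 \<le> fst z \<and> (snd z = 0 \<or> snd z = 1) \<and> (p = 0 --> snd z = 0 --> 0 < fst z)
     \<and> (\<forall>k. 0 \<le> k --> k < fst z + p --> \<psi> (?p i k) = ?p (nx i) (p - 1 - k))
     \<and> (\<forall>k. p \<le> k --> k < fst z + p + snd z --> \<psi> (?p (nx i) (p - 1 - k)) = ?p i k)
     \<and> (\<forall>k. 0 \<le> k --> k < fst z + p + snd z - 1 --> \<alpha> (\<alpha> (?p i k)) = ?p i k)
     \<and> (snd z = 1 --> \<psi> (\<psi> (?p (nx i) (- 1 - fst z))) \<noteq> ?p (nx i) (- 1 - fst z) \<and> \<psi> (?p (nx i) (- 1 - fst z)) = ?p i (fst z + p))
     \<and> (snd z = 0 --> \<alpha> (\<alpha> (?p i (fst z + p - 1))) \<noteq> ?p i (fst z + p - 1) \<and> \<alpha> (?p i (fst z + p - 1)) = ?p (nx i) (- 1 - fst z))"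
    (is "\<forall>i\<in>G. \<exists>z. ?Q i z")
  proof
    fix i assume i: "i \<in> G"
    have "p = 1 \<and> \<psi> (?p i 0) = ?p (nx i) 0 \<and> \<psi> (\<psi> (?p (nx i) 0)) \<noteq> ?p (nx i) 0
       \<or> p = 0 \<and> \<psi> (?p (nx i) (-1)) = ?p i 0 \<and> \<alpha> (\<alpha> (?p i (-1))) \<noteq> ?p i (-1)"
      using base1[OF i] base1[OF T(1)[OF i]] base0[OF i] p01 by auto
    from ladder[OF i T(1)[OF i] this] obtain n q where "?Q i (n, q)" unfolding fst_conv snd_conv by blast
    then show "\<exists>z. ?Q i z" by blast
  qed
  from bchoice[OF this] obtain z where z: "\<forall>i\<in>G. ?Q i (z i)" by blast
  define n where "n i = fst (z i)" for i
  define qq where "qq i = snd (z i)" for i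
  have n0: "0 \<le> n i" and q01: "qq i = 0 \<or> qq i = 1" and npos: "p = 0 --> qq i = 0 --> 0 < n i"
    and F: "\<And>k. 0 \<le> k ==> k < n i + p ==> \<psi> (?p i k) = ?p (nx i) (p - 1 - k)"
    and Bk: "\<And>k. p \<le> k ==> k < n i + p + qq i ==> \<psi> (?p (nx i) (p - 1 - k)) = ?p i k"
    and nsA: "\<And>k. 0 \<le> k ==> k < n i + p + qq i - 1 ==> \<alpha> (\<alpha> (?p i k)) = ?p i k"
    and e1: "qq i = 1 ==> \<psi> (\<psi> (?p (nx i) (- 1 - n i))) \<noteq> ?p (nx i) (- 1 - n i) \<and> \<psi> (?p (nx i) (- 1 - n i)) = ?p i (n i + p)"
    and e0: "qq i = 0 ==> \<alpha> (\<alpha> (?p i (n i + p - 1))) \<noteq> ?p i (n i + p - 1) \<and> \<alpha> (?p i (n i + p - 1)) = ?p (nx i) (- 1 - n i)"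
    if "i \<in> G" for i
    using bspec[OF z that] unfolding n_def qq_def by blast+
  \<comment> \<open>A ladder cannot end at the cycle it started from: that cycle turns from each
    white vertex in the other direction than the exceptional point at the end of the ladder
    does.\<close>
  have endV: "qq i = of_bool t \<and> ?p i (n i + p + qq i - 1) \<in> ?V \<and> ?p (nx i) (- 1 - n i) \<in> ?V
      \<and> (t --> fst (fc t (?p (nx i) (- 1 - n i))) = i) \<and> (\<not> t --> fst (fc t (?p i (n i + p - 1))) = nx i)"
    if i: "i \<in> G" for i
  proof (cases "qq i = 1")
    case True
    let ?y = "?p (nx i) (- 1 - n i)"
    have y: "\<psi> (\<psi> ?y) \<noteq> ?y" "\<psi> ?y = ?p i (n i + p)" using e1[OF i True] by auto
    have "\<not> (p = 1 \<and> ?y = ?p (nx i) 0)"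
    proof
      assume a: "p = 1 \<and> ?y = ?p (nx i) 0"
      then have "\<psi> ?y = ?p (nx (nx i)) 0" using base1[OF T(1)[OF i]] by simp
      then have "fst (\<psi> ?y) = pv i" using T(8)[OF i] by simp
      then show False using y(2) T(6)[OF i] by simp
    qed
    then have "t \<and> ?y \<in> ?V" using spP[OF pi[OF T(1)[OF i]] y(1)] by auto
    then have "t" "?y \<in> ?V" "\<psi> ?y \<in> ?V" using orbit.step[of ?y \<psi> v] by auto
    then show ?thesis using True y(2) by simp
  next
    case False
    then have q0: "qq i = 0" using q01[OF i] by blast
    let ?y = "?p i (n i + p - 1)"
    have y: "\<alpha> (\<alpha> ?y) \<noteq> ?y" "\<alpha> ?y = ?p (nx i) (- 1 - n i)" using e0[OF i q0] by auto
    have "\<not> (p = 0 \<and> ?y = ?p i (-1))"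
    proof
      assume a: "p = 0 \<and> ?y = ?p i (-1)"
      then have p0: "p = 0" and ye: "?y = ?p i (-1)" by auto
      have "\<psi> ?y = ?p (pv i) 0" unfolding ye using base0[OF T(2)[OF i] p0] T(3)[OF i] by simp
      then have "fst (\<alpha> ?y) = pv i" using fst_psi_alpha[OF pi[OF i], of "n i + p - 1"] by simp
      then show False using y(2) T(7)[OF i] by simp
    qed
    then have "\<not> t \<and> ?y \<in> ?V" using spA[OF pi[OF i] y(1)] by auto
    then have "\<not> t" "?y \<in> ?V" "\<alpha> ?y \<in> ?V" using orbit.step[of ?y \<alpha> v] by auto
    then show ?thesis using q0 y(2) by simp
  qed
  define q :: int where "q = of_bool t"
  have qq: "qq i = q" if "i \<in> G" for i using endV[OF that] by (simp add: q_def)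
  have vG: "fst v \<in> G" using v by (auto simp: ground_def)
  show "\<exists>y\<in>?V. fst (fc t y) = (if t then pv (fst y) else nx (fst y))"
  proof (cases t)
    case True
    then show ?thesis using endV[OF vG] T(4)[OF vG] by (intro bexI[of _ "?p (nx (fst v)) (- 1 - n (fst v))"]) auto
  next
    case False
    then have "qq (fst v) = 0" using endV[OF vG] by simp
    then show ?thesis using endV[OF vG] False
      by (intro bexI[of _ "?p (fst v) (n (fst v) + p - 1)"]) auto
  qed
  \<comment> \<open>The second exceptional cycle meets vertex \<open>i\<close> in one point only, so
    the ladder to \<open>nx i\<close> and the ladder from \<open>pv i\<close> end at the same point.
    This gives divisibility; equality needs the bound below.\<close>
  have len: "int (s i) = n i + n (pv i) + p + q" if i: "i \<in> G" for i
  proof -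
    note pG = T(2)[OF i]
    have "?p i (n i + p + q - 1) \<in> ?V" using endV[OF i] unfolding qq[OF i] by blast
    moreover have "?p i (- 1 - n (pv i)) \<in> ?V" using endV[OF pG] T(3)[OF i] by simp
    ultimately have "?p i (n i + p + q - 1) = ?p i (- 1 - n (pv i))"
      by (intro triangle_cycle_unique[OF G3 v c3]) auto
    then have d: "int (s i) dvd n i + n (pv i) + p + q" unfolding pt_eq_iff[where s = s, OF s_pos[OF i]] by (simp add: algebra_simps)
    define L where "L = n i + n (pv i) + p + q"
    have L0: "0 < L" using n0[OF i] n0[OF pG] npos[OF i] qq[OF i] p01 by (auto simp: L_def q_def)
    have per: "?p i k = ?p i (k + int (s i))" "?p i k = ?p i (k - int (s i))" for k by (rule pt_cong, simp)+
    have Fi: "fst (\<psi> (?p i k)) = nx i" if "0 \<le> k" "k < n i + p" for k using F[OF i that] by simp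
    have Bi: "\<psi> (?p i (- 1 - m)) = ?p (pv i) (m + p)" if "0 \<le> m" "m < n (pv i) + q" for m
      using Bk[OF pG, of "m + p"] that T(3)[OF i] qq[OF pG] by (simp add: algebra_simps)
    \<comment> \<open>Otherwise one of the two ladders alone goes round the vertex. Either it
      overlaps the other one, where \<psi> would have to lead to both \<open>nx i\<close> and
      \<open>pv i\<close>, or the other one is empty and an exceptional point of \<alpha> lies among
      the regular points of the long ladder.\<close>
    have "\<not> L \<ge> 2 * int (s i)"
    proof
      assume L2: "L \<ge> 2 * int (s i)"
      then consider "n i + p \<ge> int (s i)" | "n (pv i) + q \<ge> int (s i)" unfolding L_def by linarith
      then show False
      proof cases
        case 1
        show False
        proof (cases "n (pv i) + q \<ge> 1")
          case True
          have "fst (\<psi> (?p i (-1))) = pv i" using Bi[of 0] True by simp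
          moreover have "fst (\<psi> (?p i (-1))) = nx i"
            using Fi[of "int (s i) - 1"] per(1)[of "-1"] 1 s_pos[OF i] by (simp add: add.commute)
          ultimately show False using T(7)[OF i] by simp
        next
          case False
          moreover have "0 \<le> q" by (simp add: q_def)
          ultimately have z: "n (pv i) = 0" "q = 0" using n0[OF pG] by linarith+
          have "\<alpha> (\<alpha> (?p i (n i + p - 1 - int (s i)))) = ?p i (n i + p - 1 - int (s i))"
            using nsA[OF i, of "n i + p - 1 - int (s i)"] L2 z s_pos[OF i] qq[OF i] by (simp add: L_def)
          then have "\<alpha> (\<alpha> (?p i (n i + p - 1))) = ?p i (n i + p - 1)" using per(2)[of "n i + p - 1"] by simp
          moreover have "qq i = 0" using qq[OF i] z by simp
          ultimately show False using e0[OF i] by blast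
        qed
      next
        case 2
        show False
        proof (cases "n i + p \<ge> 1")
          case True
          have "fst (\<psi> (?p i 0)) = nx i" using Fi[of 0] True by simp
          moreover have "fst (\<psi> (?p i 0)) = pv i"
            using Bi[of "int (s i) - 1"] per(2)[of 0] 2 s_pos[OF i] by simp
          ultimately show False using T(7)[OF i] by simp
        next
          case False
          then have z: "n i = 0" "p = 0" using n0[OF i] p01 by auto
          let ?m = "int (s i)"
          have m: "0 < ?m" "?m < n (pv i) + q" using L2 z s_pos[OF i] by (auto simp: L_def)
          have "\<alpha> (?p i (- 1 - ?m)) = ?p (pv i) (?m - 1)"
            using Bi[of ?m] m alpha_pt[OF i pG] z by simp
          moreover have "q \<le> 1" by (simp add: q_def)
          then have "?m - 1 < n (pv i)" using m by linarith
          then have "\<psi> (?p (pv i) (?m - 1)) = ?p i (- ?m)" using F[OF pG, of "?m - 1"] m z T(3)[OF i] by simp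
          then have "\<alpha> (?p (pv i) (?m - 1)) = ?p i (- ?m - 1)" using alpha_pt[OF pG i] by simp
          moreover have "- ?m - 1 = - 1 - ?m" by simp
          ultimately have "\<alpha> (\<alpha> (?p i (- 1 - ?m))) = ?p i (- 1 - ?m)" by (simp only:)
          then have "\<alpha> (\<alpha> (?p i (- 1))) = ?p i (- 1)" using per(2)[of "-1"] by simp
          then show False using base0[OF i] z by simp
        qed
      qed
    qed
    moreover obtain m where m: "L = int (s i) * m" using d unfolding L_def dvd_def by blast
    have "0 < m" using L0 m s_pos[OF i] by (simp add: zero_less_mult_iff)
    moreover have "m < 2"
    proof (rule ccontr)
      assume "\<not> m < 2"
      then have "int (s i) * 2 \<le> int (s i) * m" by (intro mult_left_mono) auto
      then show False using \<open>\<not> L \<ge> 2 * int (s i)\<close> m by simp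
    qed
    ultimately have "m = 1" by simp
    then show ?thesis using m by (simp add: L_def)
  qed
  show "\<exists>n. triangle_family G nx pv s ?p \<psi> p (of_bool t) n"
    unfolding triangle_family_def q_def[symmetric]
    by (rule exI[of _ n]) (use n0 npos len F Bk qq in auto)
qed

section \<open>One exceptional 4-cycle\<close>

text \<open>Some white vertex \<open>a\<close> is met by two opposite elements of the 4-cycle. From
  each of them a ladder leaves towards one of the other two vertices and goes once round it, since
  that vertex carries only one element of the 4-cycle.\<close>

lemma double_classify:
  assumes tri: "tri G nx pv" and G3: "card G = 3"
    and v: "v \<in> B" and c4: "card (orbit \<psi> v) = 4"
    and invol: "\<And>b. b \<in> B ==> \<alpha> (\<alpha> b) = b"
    and spP: "\<And>b. b \<in> B ==> \<psi> (\<psi> b) \<noteq> b ==> b \<in> orbit \<psi> v"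
  shows "\<exists>a\<in>G. \<exists>r. (\<forall>i\<in>G. r i < s i) \<and> double_family s (pt s r) \<psi> a (nx a) (pv a)"
proof -
  note T = triD[OF tri]
  let ?V = "orbit \<psi> v"
  have VB: "?V \<subseteq> B" using perm_orbit_sub[OF finB perm_psi v] .
  have oeq: "orbit \<psi> y = ?V" if "y \<in> ?V" for y using perm_orbit_eq[OF finB perm_psi that] .
  have four: "?V = {y, \<psi> y, \<psi> (\<psi> y), \<psi> (\<psi> (\<psi> y))}" "\<psi> (\<psi> (\<psi> (\<psi> y))) = y" "\<psi> (\<psi> y) \<noteq> y" "\<psi> (\<psi> (\<psi> y)) \<noteq> y"
    if "y \<in> ?V" for y
  proof -
    have yB: "y \<in> B" using that VB by blast
    note o4 = orbit_card4[OF finB perm_psi yB psi_neq[OF yB], unfolded oeq[OF that], OF c4]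
    show "?V = {y, \<psi> y, \<psi> (\<psi> y), \<psi> (\<psi> (\<psi> y))}" "\<psi> (\<psi> (\<psi> (\<psi> y))) = y" "\<psi> (\<psi> y) \<noteq> y" "\<psi> (\<psi> (\<psi> y)) \<noteq> y"
      by (rule o4)+
  qed
  \<comment> \<open>The ladder between two consecutive elements of the 4-cycle.\<close>
  define L4 where "L4 r i j K \<longleftrightarrow> 1 \<le> K \<and> (\<forall>k. 0 \<le> k --> k < int K --> \<psi> (pt s r i k) = pt s r j (- k))
     \<and> (\<forall>k. 1 \<le> k --> k \<le> int K --> \<psi> (pt s r j (- k)) = pt s r i k)
     \<and> (\<forall>k. 1 \<le> k --> k < int K --> pt s r j (- k) \<notin> ?V) \<and> pt s r j (- int K) \<in> ?V" for r i j and K :: nat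
  have L4D: "1 \<le> K" "\<And>k. 0 \<le> k ==> k < int K ==> \<psi> (pt s r i k) = pt s r j (- k)"
      "\<And>k. 1 \<le> k ==> k \<le> int K ==> \<psi> (pt s r j (- k)) = pt s r i k"
      "\<And>k. 1 \<le> k ==> k < int K ==> pt s r j (- k) \<notin> ?V" "pt s r j (- int K) \<in> ?V"
    if "L4 r i j K" for r i j K using that unfolding L4_def by blast+
  have ladder4: "\<exists>K. L4 r i j K"
    if i: "i \<in> G" and j: "j \<in> G" and base: "\<psi> (pt s r i 0) = pt s r j 0" "pt s r j 0 \<in> ?V" for r i j
  proof -
    let ?i = "pt s r i" and ?j = "pt s r j"
    have iB: "?i k \<in> B" and jB: "?j k \<in> B" for k using pt_in[where s = s] i j s_pos by auto
    have FB: "\<psi> (?j (- (k + 1))) = ?i (k + 1)" if "\<psi> (?i k) = ?j (- k)" for k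
    proof -
      have "\<alpha> (?i k) = ?j (- k - 1)" using that alpha_pt[OF i j] by simp
      then have "\<alpha> (?j (- k - 1)) = ?i (k + 1 - 1)" using invol[OF iB, of k] by simp
      moreover have "- k - 1 = - (k + 1)" by simp
      ultimately have "\<alpha> (?j (- (k + 1))) = ?i (k + 1 - 1)" by (simp only:)
      then show ?thesis using alpha_pt[OF j i] by simp
    qed
    have BF: "\<psi> (?i k) = ?j (- k)" if "\<psi> (?j (- k)) = ?i k" "?j (- k) \<notin> ?V" for k
      using that spP[OF jB] by metis
    have "?j (- int (s j)) = ?j 0" by (rule pt_cong) simp
    then have ex: "\<exists>k::nat. 1 \<le> k \<and> ?j (- int k) \<in> ?V"
      using base s_pos[OF j] by (intro exI[of _ "s j"]) simp
    define K where "K = (LEAST k::nat. 1 \<le> k \<and> ?j (- int k) \<in> ?V)"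
    have K: "1 \<le> K" "?j (- int K) \<in> ?V" using LeastI_ex[OF ex] unfolding K_def by auto
    have below: "?j (- int k) \<notin> ?V" if "1 \<le> k" "k < K" for k
      using not_less_Least[of k "\<lambda>k. 1 \<le> k \<and> ?j (- int k) \<in> ?V"] that unfolding K_def by blast
    have walk: "k < K ==> \<psi> (?i (int k)) = ?j (- int k)" for k
    proof (induction k)
      case (Suc k)
      then have "\<psi> (?j (- (int k + 1))) = ?i (int k + 1)" using FB by simp
      then show ?case using BF[of "int k + 1"] below[of "Suc k"] Suc.prems by (simp add: add.commute)
    qed (use base in simp)
    have F: "\<psi> (?i k) = ?j (- k)" if "0 \<le> k" "k < int K" for k using walk[of "nat k"] that by simp
    have Bk: "\<psi> (?j (- k)) = ?i k" if "1 \<le> k" "k \<le> int K" for k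
      using FB[OF F[of "k - 1"]] that by simp
    have "?j (- k) \<notin> ?V" if "1 \<le> k" "k < int K" for k using below[of "nat k"] that by simp
    then have "L4 r i j K" unfolding L4_def using K F Bk by blast
    then show ?thesis by blast
  qed
  have main: "double_family s (pt s (\<lambda>i. if i = fst z then snd z else if i = fst (\<psi> z) then snd (\<psi> z) else snd (\<psi> (\<psi> (\<psi> z)))))
        \<psi> (fst z) (fst (\<psi> z)) (fst (\<psi> (\<psi> (\<psi> z)))) \<and> fst (\<psi> (\<psi> (\<psi> z))) \<noteq> fst (\<psi> z)"
    if z: "z \<in> ?V" and same: "fst (\<psi> (\<psi> z)) = fst z" for z
  proof -
    define z1 z2 z3 where "z1 = \<psi> z" and "z2 = \<psi> z1" and "z3 = \<psi> z2"
    define a b c where "a = fst z" and "b = fst z1" and "c = fst z3"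
    note f4 = four[OF z, folded z1_def, folded z2_def, folded z3_def]
    have zV: "z \<in> ?V" "z1 \<in> ?V" "z2 \<in> ?V" "z3 \<in> ?V" using f4(1) by auto
    then have zB: "z \<in> B" "z1 \<in> B" "z2 \<in> B" "z3 \<in> B" using VB by auto
    have z30: "\<psi> z3 = z" using f4(2) .
    have dist: "z2 \<noteq> z" "z3 \<noteq> z" "z1 \<noteq> z3"
      using f4(3,4) four(3)[OF zV(2)] by (auto simp: z3_def z2_def)
    have abc: "a \<in> G" "b \<in> G" "c \<in> G" "a \<noteq> b" "a \<noteq> c" "fst z2 = a"
      using zB fst_psi[OF zB(1)] fst_psi[OF zB(4)] z30 same
      by (auto simp: a_def b_def c_def z1_def z2_def ground_def)
    have lt: "snd y < s (fst y)" if "y \<in> B" for y using that by (auto simp: ground_def)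
    have start: "pt s r (fst y) 0 = y" if "y \<in> B" "r (fst y) = snd y" for r y
      using lt[OF that(1)] that(2) by (simp add: pt_def prod_eq_iff)
    have sb: "0 < s b" "0 < s a" "0 < s c" using s_pos abc by auto
    \<comment> \<open>The case in which the 4-cycle visits only two whites contradicts planarity.\<close>
    have bc: "b \<noteq> c"
    proof
      assume eq: "b = c"
      define r where "r i = (if i = a then snd z else snd z1)" for i
      have p0: "pt s r a 0 = z" "pt s r b 0 = z1"
        using start[OF zB(1), of r] start[OF zB(2), of r] abc by (auto simp: r_def a_def b_def)
      have "\<psi> (pt s r a 0) = pt s r b 0" "pt s r b 0 \<in> ?V" using p0 zV by (simp_all add: z1_def)
      from ladder4[OF abc(1,2) this] obtain K where K4: "L4 r a b K" by blast
      note K = L4D[OF K4]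
      have fz3: "fst z3 = b" using eq by (simp add: c_def)
      obtain l where l: "0 \<le> l" "l < int (s b)" "z3 = pt s r b l" using pt_surj[OF zB(4), of r, unfolded fz3] by blast
      have lne: "l \<noteq> 0" using l p0 dist by auto
      have e3: "z3 = pt s r b (- (int (s b) - l))" unfolding l(3) by (rule pt_cong) simp
      have Kl: "int K \<le> int (s b) - l"
      proof (rule ccontr)
        assume "\<not> int K \<le> int (s b) - l"
        then have "z3 \<notin> ?V" using K(4)[of "int (s b) - l"] l e3 by simp
        then show False using zV by blast
      qed
      have "pt s r b (- int K) \<in> {z, z1, z2, z3}" using K(5) f4(1) by simp
      moreover have "fst z \<noteq> b" "fst z2 \<noteq> b" using abc by (auto simp: a_def)
      ultimately have "pt s r b (- int K) = z1 \<or> pt s r b (- int K) = z3" by (metis empty_iff fst_pt insert_iff)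
      moreover have "pt s r b (- int K) \<noteq> z1"
      proof
        assume "pt s r b (- int K) = z1"
        then have "int (s b) dvd int K" using p0 pt_eq_iff[where s = s, OF sb(1), of r "- int K" 0] by simp
        then have "int (s b) \<le> int K" using K(1) by (intro zdvd_imp_le) auto
        then show False using Kl lne l by simp
      qed
      ultimately have "pt s r b (- int K) = z3" by blast
      then have "pt s r a (int K) = z" using K(3)[of "int K"] K(1) z30 by simp
      then have "int (s a) dvd int K" using p0 pt_eq_iff[where s = s, OF sb(2), of r "int K" 0] by simp
      then have saK: "int (s a) \<le> int K" using K(1) by (intro zdvd_imp_le) auto
      \<comment> \<open>The ladder from \<open>z\<close> has now passed over all of vertex
        \<open>a\<close>, in particular over \<open>z2\<close>. Its partner \<open>z3\<close>
        belongs to the 4-cycle, which an inner rung does not.\<close>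
      have a2: "fst z2 = a" using abc by blast
      obtain m where m: "0 \<le> m" "m < int (s a)" "z2 = pt s r a m" using pt_surj[OF zB(3), of r, unfolded a2] by blast
      have "m \<noteq> 0" using m p0 dist by auto
      then have m1: "1 \<le> m" "m < int K" using m saK by auto
      have "pt s r b (- m) \<in> ?V"
        using K(2)[of m] m1 m(3) zV by (metis z3_def order_trans zero_le_one)
      then show False using K(4)[OF m1] by blast
    qed
    define r where "r i = (if i = a then snd z else if i = b then snd z1 else snd z3)" for i
    have p0: "pt s r a 0 = z" "pt s r b 0 = z1" "pt s r c 0 = z3"
      using start[OF zB(1), of r] start[OF zB(2), of r] start[OF zB(4), of r] abc bc
      by (auto simp: r_def a_def b_def c_def)
    \<comment> \<open>If a vertex carries a single element of the 4-cycle, the first return of the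
      ladder to the 4-cycle is at this element, after exactly one turn.\<close>
    have full: "int K = int (s j)" if "L4 r i j K" "0 < s j" "pt s r j 0 \<in> ?V"
      "\<And>y. y \<in> ?V ==> fst y = j ==> y = pt s r j 0" for r i j K
    proof -
      note K = L4D[OF that(1)]
      have "pt s r j (- int K) = pt s r j 0" using that(4)[OF K(5)] by simp
      then have "int (s j) dvd int K" using pt_eq_iff[where s = s, OF that(2), of r "- int K" 0] by simp
      then have "int (s j) \<le> int K" using K(1) by (intro zdvd_imp_le) auto
      moreover have "pt s r j (- int (s j)) = pt s r j 0" by (rule pt_cong) simp
      then have "\<not> int (s j) < int K" using K(4)[of "int (s j)"] that(2,3) by auto
      ultimately show ?thesis by simp
    qed
    have inV: "y = z1" if "y \<in> ?V" "fst y = b" for y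
      using that abc bc unfolding f4(1) by (auto simp: a_def b_def c_def)
    have inV3: "y = z3" if "y \<in> ?V" "fst y = c" for y
      using that abc bc unfolding f4(1) by (auto simp: a_def b_def c_def)
    have "\<psi> (pt s r a 0) = pt s r b 0" "pt s r b 0 \<in> ?V" using p0 zV by (simp_all add: z1_def)
    from ladder4[OF abc(1,2) this] obtain K where K4: "L4 r a b K" by blast
      note K = L4D[OF K4]
    have Keq: "int K = int (s b)" using full[OF K4 sb(1)] inV p0 zV by simp
    have aK: "pt s r a (int (s b)) = z2" using K(3)[of "int K"] K(1) inV[OF K(5)] Keq by (simp add: z2_def)
    \<comment> \<open>The second ladder starts at \<open>z2\<close>, which the first one has shown
      to have label \<open>s b\<close> on \<open>a\<close>; \<open>r'\<close> makes it label 0 for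
      this purpose.\<close>
    define r' where "r' i = (if i = a then snd z2 else r i)" for i
    have r'a: "pt s r' a k = pt s r a (int (s b) + k)" for k
    proof -
      have "pt s r' a 0 = z2" using start[OF zB(3), of r'] abc by (simp add: r'_def)
      then have e: "int (r' a) mod int (s a) = (int (r a) + int (s b)) mod int (s a)"
        using aK sb by (simp add: pt_def eq_nat_nat_iff flip: aK)
      have "(int (r' a) + k) mod int (s a) = (int (r' a) mod int (s a) + k) mod int (s a)" by (simp add: mod_add_left_eq)
      also have "\<dots> = (int (r a) + int (s b) + k) mod int (s a)" unfolding e by (simp add: mod_add_left_eq)
      finally show ?thesis by (simp add: pt_def add.assoc)
    qed
    have r'c: "pt s r' c k = pt s r c k" for k using abc by (simp add: pt_def r'_def)
    have "\<psi> (pt s r' a 0) = pt s r' c 0" "pt s r' c 0 \<in> ?V" using p0 zV aK by (simp_all add: r'a r'c z3_def)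
    from ladder4[OF abc(1,3) this] obtain L where L4: "L4 r' a c L" by blast
      note L = L4D[OF L4]
    note L = L[unfolded r'a r'c]
    have Leq: "int L = int (s c)" using full[OF L4 sb(3)] inV3 p0 zV r'c by simp
    have "pt s r a (int (s b) + int (s c)) = pt s r a 0"
      using L(3)[of "int L"] L(1) inV3[OF L(5)] Leq z30 p0 by simp
    then have d: "int (s a) dvd int (s b) + int (s c)" using pt_eq_iff[where s = s, OF sb(2), of r _ 0] by simp
    have Fa: "fst (\<psi> (pt s r a k)) = b" if "0 \<le> k" "k < int (s b)" for k using K(2)[of k] that Keq by simp
    have Fc: "fst (\<psi> (pt s r a (int (s b) + k))) = c" if "0 \<le> k" "k < int (s c)" for k using L(2)[of k] that Leq by simp
    \<comment> \<open>Otherwise label \<open>s a\<close>, which is again the point of label 0, lies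
      inside one of the ladders: it would have the wrong partner on \<open>b\<close>, or a partner
      on \<open>c\<close>.\<close>
    have "int (s b) + int (s c) \<le> int (s a)"
    proof (rule ccontr)
      assume lt: "\<not> int (s b) + int (s c) \<le> int (s a)"
      have e: "pt s r a (int (s a)) = pt s r a 0" by (rule pt_cong) simp
      show False
      proof (cases "int (s a) < int (s b)")
        case True
        have "pt s r b (- int (s a)) = pt s r b 0" using K(2)[of "int (s a)"] K(2)[of 0] e True Keq sb by simp
        then have "int (s b) dvd int (s a)" using pt_eq_iff[where s = s, OF sb(1), of r "- int (s a)" 0] by simp
        then show False using True sb by (auto dest: zdvd_imp_le)
      next
        case False
        then have "fst (\<psi> (pt s r a (int (s a)))) = c" using Fc[of "int (s a) - int (s b)"] lt by simp
        then show False using Fa[of 0] e sb bc by simp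
      qed
    qed
    moreover have "int (s a) \<le> int (s b) + int (s c)" using zdvd_imp_le[OF d] sb by linarith
    ultimately have "int (s a) = int (s b) + int (s c)" by linarith
    then have "double_family s (pt s r) \<psi> a b c"
      unfolding double_family_def using K(2,3) L(2,3) Keq Leq by auto
    then show ?thesis using bc[symmetric]
      unfolding r_def[abs_def] a_def b_def c_def z3_def z2_def z1_def by (rule conjI)
  qed
  have three: "x = y \<or> x = w \<or> y = w \<or> u = x \<or> u = y \<or> u = w" if "x \<in> G" "y \<in> G" "w \<in> G" "u \<in> G" for x y w u
    using T(10)[OF that(1)] that by auto
  \<comment> \<open>Of four cyclically arranged white vertices, neighbours being different and only
    three available, two opposite ones coincide.\<close>
  have exz: "\<exists>z\<in>?V. fst (\<psi> (\<psi> z)) = fst z"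
  proof (rule ccontr)
    assume no: "\<not> (\<exists>z\<in>?V. fst (\<psi> (\<psi> z)) = fst z)"
    have vV: "v \<in> ?V" using perm_self[OF finB perm_psi] .
    note f4 = four[OF vV]
    have V: "\<psi> v \<in> ?V" "\<psi> (\<psi> v) \<in> ?V" "\<psi> (\<psi> (\<psi> v)) \<in> ?V" using f4(1) by auto
    have Bs: "v \<in> B" "\<psi> v \<in> B" "\<psi> (\<psi> v) \<in> B" "\<psi> (\<psi> (\<psi> v)) \<in> B" using V vV VB by auto
    have G: "fst v \<in> G" "fst (\<psi> v) \<in> G" "fst (\<psi> (\<psi> v)) \<in> G" "fst (\<psi> (\<psi> (\<psi> v))) \<in> G"
      using Bs by (auto simp: ground_def)
    show False using three[OF G] no vV V f4(2) fst_psi[OF Bs(1)] fst_psi[OF Bs(2)] fst_psi[OF Bs(3)] fst_psi[OF Bs(4)]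
      by metis
  qed
  then obtain z where z: "z \<in> ?V" "fst (\<psi> (\<psi> z)) = fst z" by blast
  \<comment> \<open>Starting from the opposite element \<open>\<psi> (\<psi> z)\<close> exchanges
    the two neighbouring vertices.\<close>
  have "\<exists>z\<in>?V. fst (\<psi> (\<psi> z)) = fst z \<and> fst (\<psi> z) = nx (fst z)"
  proof (cases "fst (\<psi> z) = nx (fst z)")
    case True then show ?thesis using z by blast
  next
    case False
    have zB: "z \<in> B" "\<psi> (\<psi> (\<psi> z)) \<in> B" using z four(1)[OF z(1)] VB by auto
    have gG: "fst y \<in> G" if "y \<in> B" for y using that by (auto simp: ground_def)
    have G: "fst z \<in> G" "fst (\<psi> (\<psi> (\<psi> z))) \<in> G" "fst (\<psi> z) \<in> G" using gG zB psi_in[OF zB(1)] by auto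
    have "fst (\<psi> (\<psi> (\<psi> z))) \<noteq> fst z" using fst_psi[OF zB(2)] four(2)[OF z(1)] by simp
    then have "fst (\<psi> (\<psi> (\<psi> z))) = nx (fst z)"
      using main[OF z] G T(10)[OF G(1)] False fst_psi[OF zB(1)] by auto
    moreover have "\<psi> (\<psi> z) \<in> ?V" using four(1)[OF z(1)] by auto
    ultimately show ?thesis using z four(2)[OF z(1)] by (intro bexI[of _ "\<psi> (\<psi> z)"]) auto
  qed
  then obtain z where z: "z \<in> ?V" "fst (\<psi> (\<psi> z)) = fst z" "fst (\<psi> z) = nx (fst z)" by blast
  have zB: "z \<in> B" "\<psi> z \<in> B" "\<psi> (\<psi> (\<psi> z)) \<in> B" using z four(1)[OF z(1)] VB by auto
  then have G: "fst z \<in> G" "fst (\<psi> (\<psi> (\<psi> z))) \<in> G" and lt: "snd z < s (fst z)" "snd (\<psi> z) < s (fst (\<psi> z))"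
      "snd (\<psi> (\<psi> (\<psi> z))) < s (fst (\<psi> (\<psi> (\<psi> z))))" by (auto simp: ground_def)
  have "fst (\<psi> (\<psi> (\<psi> z))) \<noteq> fst z" using fst_psi[OF zB(3)] four(2)[OF z(1)] by simp
  then have c: "fst (\<psi> (\<psi> (\<psi> z))) = pv (fst z)"
    using main[OF z(1,2)] G T(10)[OF G(1)] z(3) by auto
  define r where "r i = (if i = fst z then snd z else if i = fst (\<psi> z) then snd (\<psi> z) else snd (\<psi> (\<psi> (\<psi> z))))" for i
  have "double_family s (pt s r) \<psi> (fst z) (nx (fst z)) (pv (fst z))"
    using main[OF z(1,2)] unfolding r_def[abs_def] c z(3) by simp
  moreover have "r i < s i" if "i \<in> G" for i
    using that T(10)[OF G(1)] lt z(3) c by (auto simp: r_def)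
  ultimately show ?thesis using G by blast
qed

section \<open>Two white vertices\<close>

text \<open>With excess 0 both permutations are involutions, so the ladder that starts at the
  2-cycle \<open>V\<close> is never interrupted. Its periods on the two vertices divide each
  other.\<close>

lemma annular_classify:
  assumes G: "G = {b, c}" "b \<noteq> c" and V: "V \<in> cyc B \<psi>"
  shows "\<exists>r. (\<forall>i\<in>G. r i < s i) \<and> s b = s c \<and> V = {pt s r b 0, pt s r c 0}
     \<and> (\<forall>k\<ge>0. \<psi> (pt s r b k) = pt s r c (- k)) \<and> (\<forall>k\<ge>0. \<psi> (pt s r c (- k)) = pt s r b k)"
proof -
  have G2: "card G = 2" using G by simp
  have z: "(\<Sum>V\<in>cyc B \<alpha>. card V - 2) = 0" "(\<Sum>V\<in>cyc B \<psi>. card V - 2) = 0"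
    using excess_sum G2 by simp_all
  have iv: "fc t (fc t x) = x" if x: "x \<in> B" for t x
  proof -
    have "(\<Sum>V\<in>cyc B (fc t). card V - 2) = 0" using z by (cases t) auto
    then have "card (orbit (fc t) x) - 2 = 0" using x finB by (auto simp: cycle_partition_def)
    then show ?thesis
      using orbit_card2[OF finB perm_fc[of t] x fc_neq[OF x]] orbit_card_ge[OF finB perm_fc[of t] x fc_neq[OF x]] by simp
  qed
  have ia: "\<alpha> (\<alpha> x) = x" and ip: "\<psi> (\<psi> x) = x" if "x \<in> B" for x using iv[OF that, of False] iv[OF that, of True] by simp_all
  obtain y where y: "y \<in> B" "V = orbit \<psi> y" using V by (auto simp: cycle_partition_def)
  have Vy: "V = {y, \<psi> y}"
  proof -
    have "{y, \<psi> y} \<subseteq> orbit \<psi> y" using perm_self[OF finB perm_psi] orbit.base[of \<psi> y] by auto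
    moreover have "orbit \<psi> y \<subseteq> {y, \<psi> y}"
      by (rule orbit_sub_closed[OF finB perm_psi y(1) psi_neq[OF y(1)]]) (use y ip psi_in in auto)
    ultimately show ?thesis using y by blast
  qed
  have gr: "fst x \<in> G" "snd x < s (fst x)" if "x \<in> B" for x using that by (auto simp: ground_def)
  obtain x where x: "x \<in> B" "V = {x, \<psi> x}" "fst x = b"
  proof (cases "fst y = b")
    case True then show ?thesis using that y Vy by blast
  next
    case False
    then have "fst (\<psi> y) = b" using gr(1)[OF y(1)] gr(1)[OF psi_in[OF y(1)]] fst_psi[OF y(1)] G by auto
    then show ?thesis using that[of "\<psi> y"] y Vy ip psi_in by auto
  qed
  have fc: "fst (\<psi> x) = c" using gr(1)[OF psi_in[OF x(1)]] fst_psi[OF x(1)] x(3) G by auto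
  define r where "r i = (if i = b then snd x else snd (\<psi> x))" for i
  have bG: "b \<in> G" and cG: "c \<in> G" using G by auto
  let ?b = "pt s r b" and ?c = "pt s r c"
  have bB: "?b k \<in> B" and cB: "?c k \<in> B" for k using pt_in[where s = s] bG cG s_pos by auto
  have p0: "?b 0 = x" "?c 0 = \<psi> x"
    using gr[OF x(1)] gr[OF psi_in[OF x(1)]] x(3) fc G(2) by (auto simp: pt_def r_def prod_eq_iff)
  have F: "\<psi> (?b (int k)) = ?c (- int k)" for k
  proof (induction k)
    case (Suc k)
    have "\<alpha> (?b (int k)) = ?c (- int k - 1)" using Suc alpha_pt[OF bG cG] by simp
    then have "\<alpha> (?c (- int k - 1)) = ?b (int k)" using ia[OF bB] by metis
    then have "\<psi> (?c (- int k - 1)) = ?b (int k + 1)" using alpha_pt[OF cG bG] by simp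
    then have "\<psi> (?b (int k + 1)) = ?c (- int k - 1)" using ip[OF cB] by metis
    moreover have "int (Suc k) = int k + 1" "- int (Suc k) = - int k - 1" by simp_all
    ultimately show ?case by (simp only:)
  qed (use p0 in simp)
  have F': "\<psi> (?b k) = ?c (- k)" if "0 \<le> k" for k using F[of "nat k"] that by simp
  have Bk: "\<psi> (?c (- k)) = ?b k" if "0 \<le> k" for k using F'[OF that] ip[OF bB] by metis
  have "?b (int (s b)) = ?b 0" "?c (- int (s c)) = ?c 0" by (rule pt_cong, simp)+
  then have "?c (- int (s b)) = ?c 0" "?b (int (s c)) = ?b 0"
    using F'[of "int (s b)"] F'[of 0] Bk[of "int (s c)"] Bk[of 0] by simp_all
  then have "int (s c) dvd int (s b)" "int (s b) dvd int (s c)"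
    using pt_eq_iff[where s = s, OF s_pos[OF cG], of r "- int (s b)" 0] pt_eq_iff[where s = s, OF s_pos[OF bG], of r "int (s c)" 0] by simp_all
  then have "s b = s c" by (simp add: dvd_antisym)
  moreover have "r i < s i" if "i \<in> G" for i
    using that gr[OF x(1)] gr[OF psi_in[OF x(1)]] x(3) fc G by (auto simp: r_def)
  ultimately show ?thesis using F' Bk x(2) p0 by (intro exI[of _ r]) simp
qed

end

section \<open>Orientation of the exceptional 3-cycles\<close>

context reduced_perm
begin

text \<open>The three elements lie on three different vertices and visit them in one of the two
  cyclic orders.\<close>

lemma triangle_orientation:
  assumes tri: "tri G nx pv" and v: "v \<in> B" and c3: "card (orbit (fc t) v) = 3"
  shows "(\<forall>y\<in>orbit (fc t) v. fst (fc t y) = nx (fst y)) \<or> (\<forall>y\<in>orbit (fc t) v. fst (fc t y) = pv (fst y))"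
proof -
  note T = triD[OF tri]
  note oc = orbit_card3[OF finB perm_fc v fc_neq[OF v] c3]
  let ?f = "fc t"
  have in_B: "?f v \<in> B" "?f (?f v) \<in> B" using v fc_in by auto
  have G: "fst v \<in> G" "fst (?f v) \<in> G" "fst (?f (?f v)) \<in> G" using v in_B by (auto simp: ground_def)
  have d: "fst (?f v) \<noteq> fst v" "fst (?f (?f v)) \<noteq> fst (?f v)" "fst v \<noteq> fst (?f (?f v))"
    using fst_fc[OF v, of t] fst_fc[OF in_B(1), of t] fst_fc[OF in_B(2), of t] oc(2) by auto
  have "fst (?f v) = nx (fst v) \<or> fst (?f v) = pv (fst v)" using T(10)[OF G(1)] G(2) d(1) by blast
  then show ?thesis
  proof
    assume a: "fst (?f v) = nx (fst v)"
    then have "fst (?f (?f v)) = pv (fst v)" using T(10)[OF G(1)] G(3) d by auto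
    then have "\<forall>y\<in>orbit ?f v. fst (?f y) = nx (fst y)" unfolding oc(1) using a oc(2) T(8)[OF G(1)] T(3)[OF G(1)] by simp
    then show ?thesis by blast
  next
    assume a: "fst (?f v) = pv (fst v)"
    then have "fst (?f (?f v)) = nx (fst v)" using T(10)[OF G(1)] G(3) d by auto
    then have "\<forall>y\<in>orbit ?f v. fst (?f y) = pv (fst y)" unfolding oc(1) using a oc(2) T(9)[OF G(1)] T(4)[OF G(1)] by simp
    then show ?thesis by blast
  qed
qed

text \<open>The labels are taken from the first exceptional cycle: its element on \<open>i\<close>
  gets label 0 if it is a cycle of \<psi> and -1 if it is a cycle of \<alpha>. The orientation
  required of it is the one in which \<psi> follows \<open>nx\<close> and \<alpha> follows
  \<open>pv\<close>; the other cycle then has the opposite one.\<close>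

lemma triangle_from_special:
  assumes tri: "tri G nx pv" and G3: "card G = 3"
    and v: "v \<in> B" and c3: "card (orbit (fc t) v) = 3"
    and orient: "\<And>y. y \<in> orbit (fc t) v ==> fst (fc t y) = (if t then nx (fst y) else pv (fst y))"
    and v': "v' \<in> B" and c3': "card (orbit (fc t') v') = 3"
    and sp: "\<And>t0 b. b \<in> B ==> fc t0 (fc t0 b) \<noteq> b ==> t0 = t \<and> b \<in> orbit (fc t) v \<or> t0 = t' \<and> b \<in> orbit (fc t') v'"
  shows "\<exists>r. (\<forall>i\<in>G. r i < s i) \<and> (\<exists>n. triangle_family G nx pv s (pt s r) \<psi> (of_bool t) (of_bool t') n)"
    and "\<exists>y\<in>orbit (fc t') v'. fst (fc t' y) = (if t' then pv (fst y) else nx (fst y))"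
proof -
  note T = triD[OF tri]
  let ?V = "orbit (fc t) v"
  have VB: "?V \<subseteq> B" using perm_orbit_sub[OF finB perm_fc v] .
  have step: "fc t y \<in> ?V" if "y \<in> ?V" for y using that by (rule orbit.step)
  have vV: "v \<in> ?V" using perm_self[OF finB perm_fc] .
  have vG: "fst v \<in> G" using v by (auto simp: ground_def)
  have nsp: "fc t (fc t y) \<noteq> y" if "y \<in> ?V" for y
  proof -
    have "orbit (fc t) y = ?V" using perm_orbit_eq[OF finB perm_fc that] .
    then have "card (orbit (fc t) y) = 3" using c3 by simp
    moreover have "y \<in> B" using that VB by blast
    ultimately show ?thesis using orbit_card3(3)[OF finB perm_fc _ fc_neq] by blast
  qed
  have "\<exists>y\<in>?V. fst y = i" if i: "i \<in> G" for i
  proof -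
    have "fst (fc t v) = nx (fst v) \<and> fst (fc t (fc t v)) = pv (fst v) \<or> fst (fc t v) = pv (fst v) \<and> fst (fc t (fc t v)) = nx (fst v)"
      using orient[OF vV] orient[OF step[OF vV]] T(8,9)[OF vG] by (cases t) auto
    then show ?thesis using T(10)[OF vG] i vV step by (metis empty_iff insert_iff)
  qed
  then obtain yy where yy: "\<And>i. i \<in> G ==> yy i \<in> ?V \<and> fst (yy i) = i" by metis
  have uniq: "y = yy (fst y)" if "y \<in> ?V" for y
  proof -
    have "fst y \<in> G" using that VB by (auto simp: ground_def)
    then show ?thesis using triangle_cycle_unique[OF G3 v c3 that, of "yy (fst y)"] yy by simp
  qed
  have yB: "yy i \<in> B" "snd (yy i) < s i" if "i \<in> G" for i using yy[OF that] VB by (auto simp: ground_def)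
  define p :: int where "p = of_bool t"
  \<comment> \<open>For a cycle of \<alpha> the base point is one step further, as its elements are
    to receive label -1.\<close>
  define r where "r i = (if t then snd (yy i) else Suc (snd (yy i)) mod s i)" for i
  have r: "r i < s i" if "i \<in> G" for i using yB[OF that] s_pos[OF that] by (simp add: r_def)
  have base: "pt s r i (p - 1) = yy i" if i: "i \<in> G" for i
  proof (cases t)
    case True
    then show ?thesis using yy[OF i] yB[OF i] by (simp add: p_def pt_def r_def prod_eq_iff)
  next
    case False
    have "(int (r i) - 1) mod int (s i) = int (snd (yy i))"
      using yB[OF i] by (simp add: False r_def zmod_int mod_diff_left_eq)
    then show ?thesis using yy[OF i] False by (simp add: p_def pt_def prod_eq_iff)
  qed
  have fyy: "fc t (yy i) = yy (if t then nx i else pv i)" if i: "i \<in> G" for i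
    using uniq[OF step, of "yy i"] orient[of "yy i"] yy[OF i] by (cases t) auto
  have p01: "p = 0 \<or> p = 1" by (simp add: p_def)
  have b1: "\<psi> (pt s r i 0) = pt s r (nx i) 0 \<and> \<psi> (\<psi> (pt s r i 0)) \<noteq> pt s r i 0" if i: "i \<in> G" and p: "p = 1" for i
  proof -
    have t: t using p by (simp add: p_def split: if_splits)
    have e: "pt s r i 0 = yy i" "pt s r (nx i) 0 = yy (nx i)" using base[OF i] base[OF T(1)[OF i]] p by simp_all
    show ?thesis unfolding e using fyy[OF i] nsp[of "yy i"] yy[OF i] t by simp
  qed
  have b0: "\<psi> (pt s r (nx i) (-1)) = pt s r i 0 \<and> \<alpha> (\<alpha> (pt s r i (-1))) \<noteq> pt s r i (-1)" if i: "i \<in> G" and p: "p = 0" for i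
  proof -
    have t: "\<not> t" using p by (simp add: p_def split: if_splits)
    have e: "pt s r i (-1) = yy i" "pt s r (nx i) (-1) = yy (nx i)" using base[OF i] base[OF T(1)[OF i]] p by simp_all
    have "\<alpha> (yy (nx i)) = yy i" using fyy[OF T(1)[OF i]] t T(4)[OF i] by simp
    then have "\<alpha> (pt s r (nx i) (-1)) = pt s r i (0 - 1)" using e by simp
    then have "\<psi> (pt s r (nx i) (-1)) = pt s r i 0" using alpha_pt[OF T(1)[OF i] i] by simp
    then show ?thesis using nsp[of "yy i"] yy[OF i] t e by simp
  qed
  have sP: "p = 1 \<and> b = pt s r (fst b) 0 \<or> t' \<and> b \<in> orbit (fc t') v'" if b: "b \<in> B" "\<psi> (\<psi> b) \<noteq> b" for b
  proof -
    have "fst b \<in> G" using b by (auto simp: ground_def)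
    then show ?thesis using sp[of b True] b uniq[of b] base[of "fst b"] by (auto simp: p_def)
  qed
  have sA: "p = 0 \<and> b = pt s r (fst b) (-1) \<or> \<not> t' \<and> b \<in> orbit (fc t') v'" if b: "b \<in> B" "\<alpha> (\<alpha> b) \<noteq> b" for b
  proof -
    have "fst b \<in> G" using b by (auto simp: ground_def)
    then show ?thesis using sp[of b False] b uniq[of b] base[of "fst b"] by (auto simp: p_def)
  qed
  note tc = triangle_classify[OF tri G3 p01 b1 b0 v' c3' sP sA]
  show "\<exists>r. (\<forall>i\<in>G. r i < s i) \<and> (\<exists>n. triangle_family G nx pv s (pt s r) \<psi> (of_bool t) (of_bool t') n)"
    using r tc(1) unfolding p_def by (intro exI[of _ r]) simp
  show "\<exists>y\<in>orbit (fc t') v'. fst (fc t' y) = (if t' then pv (fst y) else nx (fst y))" using tc(2) .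
qed

text \<open>If the first cycle has the wrong orientation, the preceding lemma applied with
  \<open>nx\<close> and \<open>pv\<close> exchanged shows that the second one has the right
  orientation, and the two change places.\<close>

lemma classify3:
  assumes tri: "tri G nx pv" and G3: "card G = 3"
  shows "\<exists>r. (\<forall>i\<in>G. r i < s i) \<and> ((\<exists>t t' n. triangle_family G nx pv s (pt s r) \<psi> (of_bool t) (of_bool t') n)
     \<or> (\<exists>a\<in>G. double_family s (pt s r) \<psi> a (nx a) (pv a)))"
  using special_cases[OF G3]
proof (elim disjE exE bexE conjE)
  fix v assume "v \<in> B" "card (orbit \<psi> v) = 4" "\<forall>b\<in>B. \<alpha> (\<alpha> b) = b" "\<forall>b\<in>B. \<psi> (\<psi> b) \<noteq> b --> b \<in> orbit \<psi> v"
  then show ?thesis using double_classify[OF tri G3, of v] by blast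
next
  fix t t' v v'
  assume v: "v \<in> B" and v': "v' \<in> B" and c: "card (orbit (fc t) v) = 3" and c': "card (orbit (fc t') v') = 3"
    and sp: "\<forall>t0. \<forall>b\<in>B. fc t0 (fc t0 b) \<noteq> b --> t0 = t \<and> b \<in> orbit (fc t) v \<or> t0 = t' \<and> b \<in> orbit (fc t') v'"
  have sp1: "t0 = t \<and> b \<in> orbit (fc t) v \<or> t0 = t' \<and> b \<in> orbit (fc t') v'" if "b \<in> B" "fc t0 (fc t0 b) \<noteq> b" for t0 b
    using sp that by blast
  have sp2: "t0 = t' \<and> b \<in> orbit (fc t') v' \<or> t0 = t \<and> b \<in> orbit (fc t) v" if "b \<in> B" "fc t0 (fc t0 b) \<noteq> b" for t0 b
    using sp1[OF that] by blast
  show ?thesis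
  proof (cases "\<forall>y\<in>orbit (fc t) v. fst (fc t y) = (if t then nx (fst y) else pv (fst y))")
    case True
    then have "\<And>y. y \<in> orbit (fc t) v ==> fst (fc t y) = (if t then nx (fst y) else pv (fst y))" by blast
    from triangle_from_special(1)[OF tri G3 v c this v' c' sp1] show ?thesis by blast
  next
    case False
    then have "\<And>y. y \<in> orbit (fc t) v ==> fst (fc t y) = (if t then pv (fst y) else nx (fst y))"
      using triangle_orientation[OF tri v c] by (cases t) auto
    from triangle_from_special(2)[OF tri_swap[OF tri] G3 v c this v' c' sp1]
    obtain y where y: "y \<in> orbit (fc t') v'" "fst (fc t' y) = (if t' then nx (fst y) else pv (fst y))" by blast
    have "y \<in> B" using y perm_orbit_sub[OF finB perm_fc v'] by blast
    then have "fst y \<in> G" by (auto simp: ground_def)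
    then have "nx (fst y) \<noteq> pv (fst y)" using triD(7)[OF tri] by blast
    then have "\<And>y. y \<in> orbit (fc t') v' ==> fst (fc t' y) = (if t' then nx (fst y) else pv (fst y))"
      using triangle_orientation[OF tri v' c'] y by (cases t') auto
    from triangle_from_special(1)[OF tri G3 v' c' this v c sp2] show ?thesis by blast
  qed
qed

end

section \<open>Criteria for permutations given by formulas\<close>

text \<open>\<open>A\<close> holds one element of each 2-cycle and \<open>Z\<close> the remaining
  cycles. Indexing the 2-cycles by \<open>A\<close> later turns products over cycles into products
  over rungs.\<close>

lemma cycle_partition_pairs:
  assumes fin: "finite B" and f: "f permutes B"
    and cover: "B \<subseteq> A \<union> f ` A \<union> \<Union>Z" and A: "A \<subseteq> B" and dis: "A \<inter> f ` A = {}"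
    and inv: "\<And>a. a \<in> A ==> f (f a) = a" and Z: "Z \<subseteq> cyc B f" and dZ: "A \<inter> \<Union>Z = {}"
  shows "cyc B f = (\<lambda>a. {a, f a}) ` A \<union> Z" and "inj_on (\<lambda>a. {a, f a}) A"
    and "(\<lambda>a. {a, f a}) ` A \<inter> Z = {}"
proof -
  have o2: "orbit f a = {a, f a}" if "a \<in> A" for a
  proof -
    have "orbit f a \<subseteq> {a, f a}"
    proof
      fix y assume "y \<in> orbit f a"
      then show "y \<in> {a, f a}" by (induction rule: orbit.induct) (use inv that in auto)
    qed
    then show ?thesis using perm_self[OF fin f, of a] orbit.base[of f a] by blast
  qed
  show inj: "inj_on (\<lambda>a. {a, f a}) A"
    using dis by (intro inj_onI) (auto simp: doubleton_eq_iff)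
  show "(\<lambda>a. {a, f a}) ` A \<inter> Z = {}" using dZ by auto
  show "cyc B f = (\<lambda>a. {a, f a}) ` A \<union> Z"
  proof (intro equalityI subsetI)
    fix V assume V: "V \<in> cyc B f"
    then obtain b where b: "b \<in> B" "V = orbit f b" by (auto simp: cycle_partition_def)
    consider "b \<in> A" | a where "a \<in> A" "b = f a" | W where "W \<in> Z" "b \<in> W" using cover b by blast
    then show "V \<in> (\<lambda>a. {a, f a}) ` A \<union> Z"
    proof cases
      case 1 then show ?thesis using o2 b by blast
    next
      case 2 then show ?thesis using o2 b perm_orbit_step[OF fin f] by auto
    next
      case 3
      then obtain x where "W = orbit f x" using Z by (auto simp: cycle_partition_def)
      then have "V = W" using 3 b perm_orbit_eq[OF fin f, of b x] by simp
      then show ?thesis using 3 by blast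
    qed
  next
    fix V assume "V \<in> (\<lambda>a. {a, f a}) ` A \<union> Z"
    then show "V \<in> cyc B f"
    proof
      assume "V \<in> (\<lambda>a. {a, f a}) ` A"
      then obtain a where a: "a \<in> A" "V = {a, f a}" by blast
      then have "V = orbit f a" using o2 by simp
      then show ?thesis using a A by (auto simp: cycle_partition_def)
    qed (use Z in blast)
  qed
qed

text \<open>The successor is transitive on every white vertex. Connectedness therefore concerns sets
  of white vertices only, and the intersection condition is injectivity of \<open>fst\<close> on the
  cycles of \<alpha>.\<close>

lemma reducedI:
  assumes G: "finite G" and pos: "\<And>i. i \<in> G ==> 0 < s i" and ne: "G \<noteq> {}"
    and p: "\<psi> permutes ground G s"
    and col: "\<And>b. b \<in> ground G s ==> fst (\<psi> b) \<noteq> fst b"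
    and cnt: "ncyc (ground G s) \<psi> + ncyc (ground G s) (inv (gamma_perm G s) \<circ> \<psi>) + card G
        = card (ground G s) + 2"
    and inj: "\<And>V. V \<in> cyc (ground G s) (inv (gamma_perm G s) \<circ> \<psi>) ==> inj_on fst V"
    and conn: "\<And>W. W \<subseteq> G ==> W \<noteq> {} ==> (\<And>b. b \<in> ground G s ==> fst b \<in> W ==> fst (\<psi> b) \<in> W) ==> W = G"
  shows "reduced G s \<psi>"
proof -
  let ?B = "ground G s" and ?N = "gamma_perm G s"
  have finB: "finite ?B" and pN: "?N permutes ?B" using G by (simp_all add: finite_ground gamma_perm_permutes)
  have pa: "(inv ?N \<circ> \<psi>) permutes ?B" by (intro permutes_compose p permutes_inv pN)
  have oN: "orbit ?N b = {fst b} \<times> {..<s (fst b)}" if "b \<in> ?B" for b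
    using orbit_gamma_perm[where \<mu> = s, OF G, of "fst b" "snd b"] that by (auto simp: ground_def)
  have "transitive_pair ?B ?N \<psi>"
    unfolding transitive_pair_def
  proof (intro conjI allI impI)
    show "?B \<noteq> {}" using ne pos by (force simp: ground_def)
    fix A assume A: "A \<subseteq> ?B" "A \<noteq> {}" "?N ` A \<subseteq> A" "\<psi> ` A \<subseteq> A"
    have full: "b' \<in> A" if "b \<in> A" "b' \<in> ?B" "fst b' = fst b" for b b'
    proof -
      have "b' \<in> orbit ?N b" using oN[of b] that A by (cases b') (auto simp: ground_def)
      then show ?thesis using permutes_orbit_closed[OF finB pN A(1,3)] that by blast
    qed
    have "fst ` A = G"
    proof (rule conn)
      show "fst ` A \<subseteq> G" using A by (auto simp: ground_def)
      show "fst ` A \<noteq> {}" using A by blast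
      fix b assume b: "b \<in> ?B" "fst b \<in> fst ` A"
      then have "b \<in> A" using full by (metis imageE)
      then show "fst (\<psi> b) \<in> fst ` A" using A by blast
    qed
    show "A = ?B"
    proof (intro equalityI subsetI)
      fix b assume b: "b \<in> ?B"
      then have "fst b \<in> fst ` A" unfolding \<open>fst ` A = G\<close> by (cases b) simp
      then obtain a where "a \<in> A" "fst a = fst b" by (metis imageE)
      then show "b \<in> A" using full b by metis
    qed (use A in blast)
  qed
  moreover have "ncyc ?B ?N = card G" using card_cycle_gamma_perm[where \<mu> = s, OF G pos] by simp
  moreover have "\<forall>b\<in>?B. \<forall>d\<in>orbit ?N b. b \<noteq> d --> d \<notin> orbit (inv ?N \<circ> \<psi>) b"
  proof (intro ballI impI notI)
    fix b d assume b: "b \<in> ?B" "d \<in> orbit ?N b" "b \<noteq> d" "d \<in> orbit (inv ?N \<circ> \<psi>) b"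
    have "d \<in> {fst b} \<times> {..<s (fst b)}" using b(2) unfolding oN[OF b(1)] .
    then have "fst d = fst b" by auto
    moreover have "inj_on fst (orbit (inv ?N \<circ> \<psi>) b)" by (rule inj) (use b in \<open>auto simp: cycle_partition_def\<close>)
    moreover have "b \<in> orbit (inv ?N \<circ> \<psi>) b" using perm_self[OF finB pa] .
    ultimately show False using b by (metis inj_onD)
  qed
  moreover have "\<forall>b\<in>?B. \<psi> b \<noteq> ?N b" using col gamma_perm_in by metis
  ultimately show ?thesis unfolding reduced_def dual_NS_def using p cnt by simp
qed

section \<open>Normal forms\<close>

lemma orbit_three:
  assumes "f (f (f b)) = b" shows "orbit f b = {b, f b, f (f b)}"
proof (intro equalityI subsetI)
  fix y assume "y \<in> orbit f b"
  then show "y \<in> {b, f b, f (f b)}" by (induction rule: orbit.induct) (use assms in auto)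
next
  have "f b \<in> orbit f b" "f (f b) \<in> orbit f b" "f (f (f b)) \<in> orbit f b" by (auto intro: orbit.intros)
  then show "y \<in> orbit f b" if "y \<in> {b, f b, f (f b)}" for y using that assms by auto
qed

text \<open>Injectivity follows from periodicity, without an explicit inverse.\<close>

lemma permutes_if_power:
  assumes fin: "finite B" and into: "\<And>b. b \<in> B ==> f b \<in> B" and pw: "\<And>b. b \<in> B ==> (f ^^ Suc n) b = b"
    and off: "\<And>b. b \<notin> B ==> f b = b"
  shows "f permutes B"
proof (rule bij_imp_permutes)
  have "inj_on f B"
  proof (rule inj_onI)
    fix x y assume "x \<in> B" "y \<in> B" "f x = f y"
    then have "(f ^^ Suc n) x = (f ^^ Suc n) y" by (simp only: funpow_Suc_right comp_apply)
    then show "x = y" using pw \<open>x \<in> B\<close> \<open>y \<in> B\<close> by simp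
  qed
  then show "bij_betw f B B" using into fin by (simp add: bij_betw_def endo_inj_surj image_subset_iff)
qed (rule off)

text \<open>Labels count modulo \<open>s i\<close>, so they are determined by the point only within
  a window of one period; \<open>lo\<close> allows windows that start at a negative label.\<close>

lemma pt_inj:
  assumes "0 < s i" "pt s r i k = pt s r j l" "lo \<le> k" "k < lo + int (s i)" "lo \<le> l" "l < lo + int (s i)"
  shows "i = j \<and> k = l"
proof -
  have "fst (pt s r i k) = fst (pt s r j l)" using assms by simp
  then have ij: "i = j" by simp
  then have d: "int (s i) dvd k - l" using assms pt_eq_iff[where s = s and i = i, OF assms(1)] by simp
  have "\<bar>k - l\<bar> < int (s i)" using assms by linarith
  then have "k - l = 0" using d dvd_imp_le_int[of "k - l" "int (s i)"] by linarith
  then show ?thesis using ij by simp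
qed

lemma pt_surj_from:
  assumes "b \<in> ground G s" shows "\<exists>k. lo \<le> k \<and> k < lo + int (s (fst b)) \<and> b = pt s r (fst b) k"
proof -
  obtain k where k: "b = pt s r (fst b) k" using pt_surj[OF assms, of r] by blast
  have s: "0 < int (s (fst b))" using assms by (auto simp: ground_def)
  define l where "l = lo + (k - lo) mod int (s (fst b))"
  have "int (s (fst b)) dvd (k - lo) - (k - lo) mod int (s (fst b))" by (simp add: minus_mod_eq_mult_div)
  then have "int (s (fst b)) dvd k - l" by (simp add: l_def algebra_simps)
  then have "b = pt s r (fst b) l" using k pt_cong[where s = s] by metis
  moreover have "lo \<le> l" "l < lo + int (s (fst b))" using s by (simp_all add: l_def)
  ultimately show ?thesis by blast
qed

text \<open>One pattern for both \<psi> and \<alpha> of a triangle: \<open>m i\<close> 2-cycles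
  between \<open>i\<close> and \<open>nx i\<close>, and at either end an optional 3-cycle
  (\<open>e1\<close>, \<open>e2\<close> are 1 if present) that turns along \<open>g1\<close> or
  \<open>g2\<close>. The label \<open>x\<close> is where the ladder leaving \<open>i\<close>
  begins.\<close>

locale ladder_perm =
  fixes G nx pv s r and f :: "nat \<times> nat => nat \<times> nat" and x e1 e2 :: int and m g1 h1 g2 h2
  assumes tri: "tri G nx pv" and finG: "finite G" and neG: "G \<noteq> {}" and s_pos: "\<And>i. i \<in> G ==> 0 < s i"
    and e01: "e1 = 0 \<or> e1 = 1" "e2 = 0 \<or> e2 = 1" and m0: "\<And>i. i \<in> G ==> 0 \<le> m i"
    and len: "\<And>i. i \<in> G ==> int (s i) = m i + m (pv i) + e1 + e2"
    and f1: "\<And>i k. i \<in> G ==> 0 \<le> k ==> k < m i ==> f (pt s r i (x + k)) = pt s r (nx i) (x - e1 - 1 - k)"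
    and f2: "\<And>i k. i \<in> G ==> 0 \<le> k ==> k < m i ==> f (pt s r (nx i) (x - e1 - 1 - k)) = pt s r i (x + k)"
    and t1: "tri G g1 h1" and z1: "\<And>i. e1 = 1 ==> i \<in> G ==> f (pt s r i (x - 1)) = pt s r (g1 i) (x - 1)"
    and t2: "tri G g2 h2" and z2: "\<And>i. e2 = 1 ==> i \<in> G ==> f (pt s r i (x + m i)) = pt s r (g2 i) (x + m (g2 i))"
    and off: "\<And>b. b \<notin> ground G s ==> f b = b"
begin

abbreviation "P \<equiv> pt s r"
abbreviation "B \<equiv> ground G s"
definition "Z1 = (\<lambda>i. P i (x - 1)) ` G"
definition "Z2 = (\<lambda>i. P i (x + m i)) ` G"
definition "I = (SIGMA i:G. {0..<m i})"
definition "A = (\<lambda>(i, k). P i (x + k)) ` I"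
definition "Z = (if e1 = 1 then {Z1} else {}) \<union> (if e2 = 1 then {Z2} else {})"

lemma P_in: "i \<in> G ==> P i k \<in> B" using pt_in[where s = s] s_pos by blast

lemma P_inj:
  assumes "i \<in> G" "P i k = P j l" "x - e1 - m (pv i) \<le> k" "k < x + m i + e2" "x - e1 - m (pv i) \<le> l" "l < x + m i + e2"
  shows "i = j \<and> k = l"
  by (rule pt_inj[where s = s and r = r and lo = "x - e1 - m (pv i)", OF s_pos[OF assms(1)] assms(2)])
    (use assms len in auto)

lemma finB: "finite B" using finG by (rule finite_ground)

lemma cases_B:
  assumes "b \<in> B"
  obtains (fwd) i k where "i \<in> G" "0 \<le> k" "k < m i" "b = P i (x + k)"
  | (bwd) i k where "i \<in> G" "0 \<le> k" "k < m i" "b = P (nx i) (x - e1 - 1 - k)"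
  | (one) i where "e1 = 1" "i \<in> G" "b = P i (x - 1)"
  | (two) i where "e2 = 1" "i \<in> G" "b = P i (x + m i)"
proof -
  define i where "i = fst b"
  have i: "i \<in> G" using assms by (auto simp: i_def ground_def)
  obtain l where l: "x - e1 - m (pv i) \<le> l" "l < x - e1 - m (pv i) + int (s i)" "b = P i l"
    using pt_surj_from[OF assms, of "x - e1 - m (pv i)" r] unfolding i_def by blast
  \<comment> \<open>Along cycle \<open>i\<close> the window consists of the ladder coming from
    \<open>pv i\<close>, the element of \<open>Z1\<close>, the ladder to \<open>nx i\<close> and the
    element of \<open>Z2\<close>.\<close>
  consider "x \<le> l" "l < x + m i" | "l = x + m i" "e2 = 1" | "l = x - 1" "e1 = 1" | "l \<le> x - e1 - 1"
    using l(2) len[OF i] e01 by fastforce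
  then show thesis
  proof cases
    case 1 then show ?thesis using fwd[of i "l - x"] i l by simp
  next
    case 2 then show ?thesis using two i l by simp
  next
    case 3 then show ?thesis using one i l by simp
  next
    case 4
    then show ?thesis using bwd[of "pv i" "x - e1 - 1 - l"] triD(2,3)[OF tri i] i l by simp
  qed
qed

lemma f_in: "b \<in> B ==> f b \<in> B \<and> fst (f b) \<noteq> fst b"
  by (erule cases_B) (use f1 f2 z1 z2 P_in triD(1,5)[OF tri] triD(1,5)[OF t1] triD(1,5)[OF t2] triD(5)[OF tri, THEN not_sym] in simp_all)

lemma f_power: "b \<in> B ==> f (f b) = b \<or> f (f (f b)) = b"
  by (erule cases_B) (use f1 f2 z1 z2 triD(1,2,3,8)[OF t1] triD(1,2,3,8)[OF t2] in simp_all)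

lemma perm: "f permutes B"
proof (rule permutes_if_power[OF finB])
  \<comment> \<open>The exponent 6 is a common multiple of the cycle lengths 2 and 3.\<close>
  show "(f ^^ Suc 5) b = b" if "b \<in> B" for b using f_power[OF that] by (auto simp: eval_nat_numeral)
qed (use f_in off in auto)

lemma Z_orbit:
  assumes "i \<in> G" shows "e1 = 1 ==> orbit f (P i (x - 1)) = Z1" "e2 = 1 ==> orbit f (P i (x + m i)) = Z2"
proof -
  { assume e: "e1 = 1"
    note T = triD[OF t1 assms]
    have "f (P i (x - 1)) = P (g1 i) (x - 1)" "f (P (g1 i) (x - 1)) = P (h1 i) (x - 1)" "f (P (h1 i) (x - 1)) = P i (x - 1)"
      using z1[OF e assms] z1[OF e T(1)] z1[OF e T(2)] T by simp_all
    moreover have "Z1 = {P i (x - 1), P (g1 i) (x - 1), P (h1 i) (x - 1)}" unfolding Z1_def by (subst T(10)) simp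
    ultimately show "orbit f (P i (x - 1)) = Z1" using orbit_three[of f "P i (x - 1)"] by simp }
  { assume e: "e2 = 1"
    note T = triD[OF t2 assms]
    have "f (P i (x + m i)) = P (g2 i) (x + m (g2 i))" "f (P (g2 i) (x + m (g2 i))) = P (h2 i) (x + m (h2 i))"
      "f (P (h2 i) (x + m (h2 i))) = P i (x + m i)"
      using z2[OF e assms] z2[OF e T(1)] z2[OF e T(2)] T by simp_all
    moreover have "Z2 = {P i (x + m i), P (g2 i) (x + m (g2 i)), P (h2 i) (x + m (h2 i))}" unfolding Z2_def by (subst T(10)) simp
    ultimately show "orbit f (P i (x + m i)) = Z2" using orbit_three[of f "P i (x + m i)"] by simp }
qed

lemma A_cases: "a \<in> A \<longleftrightarrow> (\<exists>i k. i \<in> G \<and> 0 \<le> k \<and> k < m i \<and> a = P i (x + k))"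
proof
  assume "a \<in> A"
  then obtain z where "z \<in> I" "a = (\<lambda>(i, k). P i (x + k)) z" unfolding A_def by blast
  then obtain i k where "(i, k) \<in> I" "a = P i (x + k)" by (cases z) simp
  then have "i \<in> G \<and> 0 \<le> k \<and> k < m i \<and> a = P i (x + k)" by (simp add: I_def)
  then show "\<exists>i k. i \<in> G \<and> 0 \<le> k \<and> k < m i \<and> a = P i (x + k)" by blast
qed (force simp: A_def I_def)

lemma inj_A: "inj_on (\<lambda>(i, k). P i (x + k)) I"
proof (rule inj_onI, clarify)
  fix i k j l assume a: "(i, k) \<in> I" "(j, l) \<in> I" "P i (x + k) = P j (x + l)"
  from arg_cong[OF a(3), of fst] have "i = j" by simp
  moreover have i: "i \<in> G" using a(1) by (simp add: I_def)
  moreover have kl: "0 \<le> k" "k < m i" "0 \<le> l" "l < m j" using a(1,2) by (simp_all add: I_def)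
  ultimately have "i = j \<and> x + k = x + l"
    by (intro P_inj[OF i a(3)]) (use m0[OF triD(2)[OF tri i]] e01 in linarith | simp)+
  then show "i = j \<and> k = l" by simp
qed

lemma disjoint_parts: "A \<inter> f ` A = {}" "A \<inter> \<Union>Z = {}" "e1 = 1 ==> e2 = 1 ==> Z1 \<noteq> Z2"
proof -
  have "a \<notin> f ` A" if "a \<in> A" for a
  proof
    assume "a \<in> f ` A"
    then obtain j l where j: "j \<in> G" "0 \<le> l" "l < m j" "a = P (nx j) (x - e1 - 1 - l)"
      using f1 A_cases by auto
    obtain i k where i: "i \<in> G" "0 \<le> k" "k < m i" "a = P i (x + k)" using \<open>a \<in> A\<close> A_cases by auto
    have "fst (P i (x + k)) = fst (P (nx j) (x - e1 - 1 - l))" using i(4) j(4) by metis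
    then have "i = nx j" by simp
    then have "pv i = j" using triD(4)[OF tri j(1)] by simp
    then show False using P_inj[OF i(1), of "x + k" "nx j" "x - e1 - 1 - l"] i j e01 m0[OF i(1)] by auto
  qed
  then show "A \<inter> f ` A = {}" by blast
  have "a \<notin> \<Union>Z" if "a \<in> A" for a
  proof
    assume aZ: "a \<in> \<Union>Z"
    obtain i k where i: "i \<in> G" "0 \<le> k" "k < m i" "a = P i (x + k)" using \<open>a \<in> A\<close> A_cases by auto
    note pm = m0[OF triD(2)[OF tri i(1)]]
    from aZ consider j where "e1 = 1" "j \<in> G" "a = P j (x - 1)" | j where "e2 = 1" "j \<in> G" "a = P j (x + m j)"
      by (auto simp: Z_def Z1_def Z2_def split: if_splits)
    then show False
    proof cases
      case 1
      then have "fst (P i (x + k)) = fst (P j (x - 1))" using i by simp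
      then show False using P_inj[OF i(1), of "x + k" j "x - 1"] i 1 pm e01 by auto
    next
      case 2
      then have "fst (P i (x + k)) = fst (P j (x + m j))" using i by simp
      then show False using P_inj[OF i(1), of "x + k" j "x + m j"] i 2 pm e01 by auto
    qed
  qed
  then show "A \<inter> \<Union>Z = {}" by blast
  assume e: "e1 = 1" "e2 = 1"
  obtain i where i: "i \<in> G" using neG by blast
  show "Z1 \<noteq> Z2"
  proof
    assume "Z1 = Z2"
    then have "P i (x - 1) \<in> Z2" using i by (auto simp: Z1_def)
    then obtain j where j: "j \<in> G" "P i (x - 1) = P j (x + m j)" by (auto simp: Z2_def)
    then have "fst (P i (x - 1)) = fst (P j (x + m j))" by simp
    then have "i = j" by simp
    then show False using P_inj[OF i, of "x - 1" j "x + m j"] j e m0[OF i] m0[OF triD(2)[OF tri i]] by auto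
  qed
qed

lemma pairs_ok:
  "B \<subseteq> A \<union> f ` A \<union> \<Union>Z" "A \<subseteq> B" "\<And>a. a \<in> A ==> f (f a) = a" "Z \<subseteq> cyc B f"
proof -
  show "B \<subseteq> A \<union> f ` A \<union> \<Union>Z"
  proof
    fix b assume "b \<in> B"
    then show "b \<in> A \<union> f ` A \<union> \<Union>Z"
    proof (cases rule: cases_B)
      case (fwd i k) then show ?thesis using A_cases by blast
    next
      case (bwd i k)
      then have "P i (x + k) \<in> A" "b = f (P i (x + k))" using f1 A_cases by auto
      then show ?thesis by blast
    next
      case (one i)
      have "Z1 \<in> Z" unfolding Z_def using one(1) by simp
      moreover have "b \<in> Z1" unfolding Z1_def using one by blast
      ultimately show ?thesis by blast
    next
      case (two i)
      have "Z2 \<in> Z" unfolding Z_def using two(1) by simp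
      moreover have "b \<in> Z2" unfolding Z2_def using two by blast
      ultimately show ?thesis by blast
    qed
  qed
  show "A \<subseteq> B"
  proof
    fix a assume "a \<in> A"
    then obtain i k where "i \<in> G" "a = P i (x + k)" unfolding A_cases by blast
    then show "a \<in> B" using P_in by simp
  qed
  show "f (f a) = a" if "a \<in> A" for a using that f1 f2 by (auto simp: A_cases)
  obtain i where i: "i \<in> G" using neG by blast
  have "orbit f (P i k) \<in> cyc B f" for k using P_in[OF i] by (simp add: cycle_partition_def)
  then show "Z \<subseteq> cyc B f" using Z_orbit[OF i] by (auto simp: Z_def) metis+
qed

lemma cycles:
  "cyc B f = (\<lambda>a. {a, f a}) ` A \<union> Z" "inj_on (\<lambda>a. {a, f a}) A" "(\<lambda>a. {a, f a}) ` A \<inter> Z = {}"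
  by (rule cycle_partition_pairs[OF finB perm pairs_ok(1,2) disjoint_parts(1) _ pairs_ok(4) disjoint_parts(2)];
      erule pairs_ok(3))+

lemma finI: "finite I" unfolding I_def using finG by auto

lemma prod_cycles:
  fixes h :: "(nat \<times> nat) set => 'a :: comm_monoid_mult"
  shows "(\<Prod>V\<in>cyc B f. h V) = (\<Prod>i\<in>G. \<Prod>k\<in>{0..<m i}. h {P i (x + k), P (nx i) (x - e1 - 1 - k)})
     * (if e1 = 1 then h Z1 else 1) * (if e2 = 1 then h Z2 else 1)"
proof -
  have fA: "finite ((\<lambda>a. {a, f a}) ` A)" "finite Z" using finI by (simp_all add: A_def Z_def)
  have "(\<Prod>V\<in>cyc B f. h V) = (\<Prod>V\<in>(\<lambda>a. {a, f a}) ` A. h V) * (\<Prod>V\<in>Z. h V)"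
    unfolding cycles(1) by (rule prod.union_disjoint[OF fA cycles(3)])
  also have "(\<Prod>V\<in>(\<lambda>a. {a, f a}) ` A. h V) = (\<Prod>a\<in>A. h {a, f a})"
    by (rule prod.reindex_cong[OF cycles(2)]) auto
  also have "\<dots> = (\<Prod>(i, k)\<in>I. h {P i (x + k), f (P i (x + k))})"
    unfolding A_def by (rule prod.reindex_cong[OF inj_A]) auto
  also have "\<dots> = (\<Prod>(i, k)\<in>I. h {P i (x + k), P (nx i) (x - e1 - 1 - k)})"
    by (rule prod.cong) (auto simp: I_def f1)
  also have "\<dots> = (\<Prod>i\<in>G. \<Prod>k\<in>{0..<m i}. h {P i (x + k), P (nx i) (x - e1 - 1 - k)})"
    unfolding I_def by (rule prod.Sigma[symmetric]) (use finG in auto)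
  also have "(\<Prod>V\<in>Z. h V) = (if e1 = 1 then h Z1 else 1) * (if e2 = 1 then h Z2 else 1)"
    unfolding Z_def using disjoint_parts(3) by (cases "e1 = 1"; cases "e2 = 1") (simp_all add: mult.commute)
  finally show ?thesis by (simp add: mult.assoc)
qed

lemma card_cycles: "int (ncyc B f) = (\<Sum>i\<in>G. m i) + e1 + e2"
proof -
  have fA: "finite ((\<lambda>a. {a, f a}) ` A)" "finite Z" using finI by (simp_all add: A_def Z_def)
  have "ncyc B f = card ((\<lambda>a. {a, f a}) ` A) + card Z"
    unfolding cycles(1) by (rule card_Un_disjoint[OF fA cycles(3)])
  also have "card ((\<lambda>a. {a, f a}) ` A) = card I"
    using card_image[OF cycles(2)] card_image[OF inj_A] unfolding A_def by simp
  also have "card I = (\<Sum>i\<in>G. nat (m i))" unfolding I_def using finG by simp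
  also have "int ((\<Sum>i\<in>G. nat (m i)) + card Z) = (\<Sum>i\<in>G. m i) + e1 + e2"
    using disjoint_parts(3) e01 m0 by (auto simp: Z_def)
  finally show ?thesis .
qed

lemma inj_fst: "V \<in> cyc B f ==> inj_on fst V"
  unfolding cycles(1)
proof (elim UnE imageE)
  fix a assume a: "a \<in> A" "V = {a, f a}"
  then have "fst (f a) \<noteq> fst a" using f_in pairs_ok(2) by blast
  then show ?thesis using a by auto
next
  assume "V \<in> Z"
  moreover have "inj_on fst Z1" "inj_on fst Z2"
    unfolding Z1_def Z2_def by (rule inj_on_imageI, simp add: comp_def)+
  ultimately show ?thesis unfolding Z_def by (auto split: if_splits)
qed

end

locale triangle_perm =
  fixes G nx pv s r and f :: "nat \<times> nat => nat \<times> nat" and p q :: int and n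
  assumes tri: "tri G nx pv" and G3: "card G = 3"
    and p01: "p = 0 \<or> p = 1" and q01: "q = 0 \<or> q = 1"
    and fam: "triangle_family G nx pv s (pt s r) f p q n"
    and off: "\<And>b. b \<notin> ground G s ==> f b = b"
begin

lemma finG: "finite G" and neG: "G \<noteq> {}" using G3 by (auto intro: card_ge_0_finite)

lemma famD:
  assumes "i \<in> G"
  shows "0 \<le> n i" "p = 0 ==> q = 0 ==> 0 < n i" "int (s i) = n i + n (pv i) + p + q"
    "\<And>k. 0 \<le> k ==> k < n i + p ==> f (pt s r i k) = pt s r (nx i) (p - 1 - k)"
    "\<And>k. p \<le> k ==> k < n i + p + q ==> f (pt s r (nx i) (p - 1 - k)) = pt s r i k"
  using fam assms unfolding triangle_family_def by blast+

lemma s_pos: assumes "i \<in> G" shows "0 < s i"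
  using famD(1-3)[OF assms] famD(1)[OF triD(2)[OF tri assms]] p01 q01 by linarith

definition "\<alpha> = inv (gamma_perm G s) \<circ> f"

lemma inv_N: "i \<in> G ==> inv (gamma_perm G s) (pt s r i k) = pt s r i (k - 1)"
  using inv_gamma_pt[OF finG] s_pos by blast

sublocale psi: ladder_perm G nx pv s r f p p q n nx pv pv nx
proof
  fix i assume i: "i \<in> G"
  note T = triD[OF tri i]
  show "f (pt s r i (p + k)) = pt s r (nx i) (p - p - 1 - k)" if "0 \<le> k" "k < n i" for k
    using famD(4)[OF i, of "p + k"] that p01 by auto
  show "f (pt s r (nx i) (p - p - 1 - k)) = pt s r i (p + k)" if "0 \<le> k" "k < n i" for k
    using famD(5)[OF i, of "p + k"] that q01 by auto
  show "f (pt s r i (p - 1)) = pt s r (nx i) (p - 1)" if "p = 1"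
    using famD(4)[OF i, of 0] that famD(1)[OF i] by simp
  show "f (pt s r i (p + n i)) = pt s r (pv i) (p + n (pv i))" if "q = 1"
  proof -
    have "pt s r i (p + n i) = pt s r (nx (pv i)) (p - 1 - (p + n (pv i)))"
      unfolding T(3) by (rule pt_cong) (use famD(3)[OF i] that in \<open>simp add: algebra_simps\<close>)
    also have "f \<dots> = pt s r (pv i) (p + n (pv i))" using famD(5)[OF T(2), of "p + n (pv i)"] that famD(1)[OF T(2)] by simp
    finally show ?thesis .
  qed
qed (use tri tri_swap finG neG s_pos p01 q01 famD off in auto)

text \<open>\<alpha> shifts the image label of \<psi> by one, so its rungs lie between neighbouring
  rungs of \<psi>. An end carries a 3-cycle of \<alpha> exactly when it carries none of \<psi>, and
  a 3-cycle of \<psi> at an end gives \<alpha> one more rung in each ladder.\<close>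

sublocale al: ladder_perm G nx pv s r \<alpha> 0 "1 - p" "1 - q" "\<lambda>i. n i + p + q - 1" pv nx nx pv
proof
  fix i assume i: "i \<in> G"
  note T = triD[OF tri i]
  show "0 \<le> n i + p + q - 1" using famD(1,2)[OF i] p01 q01 by auto
  have aF: "\<alpha> (pt s r i k) = pt s r (nx i) (p - 2 - k)" if "0 \<le> k" "k < n i + p" for k
    using famD(4)[OF i that] inv_N[OF T(1), of "p - 1 - k"] by (simp add: \<alpha>_def algebra_simps)
  have aB: "\<alpha> (pt s r (nx i) (p - 2 - k)) = pt s r i k" if "p - 1 \<le> k" "k < n i + p + q - 1" for k
  proof -
    have e: "p - 2 - k = p - 1 - (k + 1)" by simp
    have "f (pt s r (nx i) (p - 2 - k)) = pt s r i (k + 1)"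
      unfolding e by (rule famD(5)[OF i]) (use that in auto)
    then show ?thesis using inv_N[OF i, of "k + 1"] by (simp add: \<alpha>_def)
  qed
  show "\<alpha> (pt s r i (0 + k)) = pt s r (nx i) (0 - (1 - p) - 1 - k)" if "0 \<le> k" "k < n i + p + q - 1" for k
    using aF[of k] that q01 by (auto simp: algebra_simps)
  show "\<alpha> (pt s r (nx i) (0 - (1 - p) - 1 - k)) = pt s r i (0 + k)" if "0 \<le> k" "k < n i + p + q - 1" for k
  proof -
    have "0 - (1 - p) - 1 - k = p - 2 - k" by simp
    then show ?thesis using aB[of k] that p01 by auto
  qed
  show "\<alpha> (pt s r i (0 - 1)) = pt s r (pv i) (0 - 1)" if "1 - p = 1"
  proof -
    have "0 < n (pv i) + q" using famD(1,2)[OF T(2)] that q01 by auto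
    then have "f (pt s r i (-1)) = pt s r (pv i) 0" using famD(5)[OF T(2), of 0] that T(3) by simp
    then show ?thesis using inv_N[OF T(2), of 0] by (simp add: \<alpha>_def)
  qed
  show "\<alpha> (pt s r i (0 + (n i + p + q - 1))) = pt s r (nx i) (0 + (n (nx i) + p + q - 1))" if "1 - q = 1"
  proof -
    have "0 < n i + p" using famD(1,2)[OF i] that p01 by auto
    then have "\<alpha> (pt s r i (n i + p - 1)) = pt s r (nx i) (p - 2 - (n i + p - 1))" using aF[of "n i + p - 1"] by simp
    also have "\<dots> = pt s r (nx i) (n (nx i) + p - 1)"
    proof (rule pt_cong)
      have "p - 2 - (n i + p - 1) - (n (nx i) + p - 1) = - int (s (nx i))" using famD(3)[OF T(1)] T(4) that by simp
      then show "int (s (nx i)) dvd p - 2 - (n i + p - 1) - (n (nx i) + p - 1)" by (simp only: dvd_minus_iff dvd_refl)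
    qed
    finally show ?thesis using that by simp
  qed
  show "int (s i) = n i + p + q - 1 + (n (pv i) + p + q - 1) + (1 - p) + (1 - q)" using famD(3)[OF i] by simp
qed (use tri tri_swap finG neG s_pos p01 q01 off permutes_not_in[OF permutes_inv[OF gamma_perm_permutes[OF finG]]] in \<open>auto simp: \<alpha>_def\<close>)

lemma card_ground: "int (card (ground G s)) = 2 * (\<Sum>i\<in>G. n i) + 3 * (p + q)"
proof -
  obtain i where i: "i \<in> G" using neG by blast
  note T = triD[OF tri i]
  have d: "i \<notin> {nx i, pv i}" "nx i \<notin> {pv i}" using T by auto
  have G: "G = insert i (insert (nx i) {pv i})" using T(10) .
  have s3: "sum u G = u i + u (nx i) + u (pv i)" for u :: "nat => int" unfolding G using d by simp
  have "int (card (ground G s)) = (\<Sum>i\<in>G. int (s i))" unfolding ground_def using finG by simp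
  also have "\<dots> = 2 * (\<Sum>i\<in>G. n i) + 3 * (p + q)"
    unfolding s3 using famD(3)[OF i] famD(3)[OF T(1)] famD(3)[OF T(2)] T by simp
  finally show ?thesis .
qed

lemma sum_shift: "(\<Sum>i\<in>G. n i + p + q - 1) = (\<Sum>i\<in>G. n i) + 3 * (p + q - 1)"
  using G3 by (simp add: sum.distrib sum_subtractf)

text \<open>Euler's relation comes out of three counts. With \<open>S\<close> the sum of the
  \<open>n i\<close>, there are \<open>S + p + q\<close> cycles of \<psi>,
  \<open>S + 3 (p + q - 1) + 2 - p - q\<close> of \<alpha>, and \<open>2 S + 3 (p + q)\<close>
  points.\<close>

lemma reduced_f: "reduced G s f"
proof (rule reducedI[OF finG s_pos neG psi.perm])
  show "fst (f b) \<noteq> fst b" if "b \<in> ground G s" for b using psi.f_in that by blast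
  have "int (ncyc (ground G s) f) + int (ncyc (ground G s) \<alpha>) + 3 = int (card (ground G s)) + 2"
    unfolding psi.card_cycles al.card_cycles card_ground sum_shift by simp
  then show "ncyc (ground G s) f + ncyc (ground G s) (inv (gamma_perm G s) \<circ> f) + card G
        = card (ground G s) + 2" using G3 by (simp flip: \<alpha>_def)
  show "inj_on fst V" if "V \<in> cyc (ground G s) (inv (gamma_perm G s) \<circ> f)" for V
    using al.inj_fst that by (simp add: \<alpha>_def)
  fix W assume W: "W \<subseteq> G" "W \<noteq> {}" "\<And>b. b \<in> ground G s ==> fst b \<in> W ==> fst (f b) \<in> W"
  have "(\<forall>i\<in>W. nx i \<in> W) \<or> (\<forall>i\<in>W. pv i \<in> W)"
  proof (cases "p = 1")
    case True
    have "nx i \<in> W" if i: "i \<in> W" for i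
    proof -
      have iG: "i \<in> G" using i W by blast
      have "f (pt s r i 0) = pt s r (nx i) 0" using famD(4)[OF iG, of 0] famD(1)[OF iG] True by simp
      then show ?thesis using W(3)[OF psi.P_in[OF iG, of 0]] i by simp
    qed
    then show ?thesis by blast
  next
    case False
    then have p: "p = 0" using p01 by blast
    have "pv i \<in> W" if i: "i \<in> W" for i
    proof -
      have iG: "i \<in> G" using i W by blast
      note T = triD[OF tri iG]
      have "0 < n (pv i) + q" using famD(1,2)[OF T(2)] p q01 by auto
      then have "f (pt s r i (-1)) = pt s r (pv i) 0" using famD(5)[OF T(2), of 0] p T(3) by simp
      then show ?thesis using W(3)[OF psi.P_in[OF iG, of "-1"]] i by simp
    qed
    then show ?thesis by blast
  qed
  moreover obtain i where "i \<in> W" using W by blast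
  moreover have "i \<in> G" using \<open>i \<in> W\<close> W by blast
  ultimately show "W = G" using triD(8,9,10)[OF tri, of i] W(1) by (metis insert_subset subset_antisym empty_subsetI)
qed

end

context triangle_perm
begin

text \<open>The two ends of the ladders can be told apart without labels: at the first end \<psi>
  turns along \<open>nx\<close> and \<alpha> along \<open>pv\<close>, at the second end the other
  way round.\<close>

lemma special_psi:
  assumes "b \<in> ground G s" "f (f b) \<noteq> b"
  shows "(p = 1 \<and> b = pt s r (fst b) (p - 1) \<and> fst (f b) = nx (fst b)) \<or> (q = 1 \<and> fst (f b) = pv (fst b))"
  using assms(1)
  by (cases rule: psi.cases_B) (use psi.f1 psi.f2 psi.z1 psi.z2 assms(2) in simp_all)

lemma special_alpha:
  assumes "b \<in> ground G s" "\<alpha> (\<alpha> b) \<noteq> b"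
  shows "(p = 0 \<and> b = pt s r (fst b) (p - 1) \<and> fst (\<alpha> b) = pv (fst b)) \<or> (q = 0 \<and> fst (\<alpha> b) = nx (fst b))"
  using assms(1)
  by (cases rule: al.cases_B) (use al.f1 al.f2 al.z1 al.z2 assms(2) in simp_all)

lemma base_special:
  assumes i: "i \<in> G"
  shows "p = 1 ==> f (f (pt s r i (p - 1))) \<noteq> pt s r i (p - 1) \<and> fst (f (pt s r i (p - 1))) = nx i"
    and "p = 0 ==> \<alpha> (\<alpha> (pt s r i (p - 1))) \<noteq> pt s r i (p - 1) \<and> fst (\<alpha> (pt s r i (p - 1))) = pv i"
    and "q = 1 ==> \<exists>b\<in>ground G s. f (f b) \<noteq> b \<and> fst b = i \<and> fst (f b) = pv i"
    and "q = 0 ==> \<exists>b\<in>ground G s. \<alpha> (\<alpha> b) \<noteq> b \<and> fst b = i \<and> fst (\<alpha> b) = nx i"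
proof -
  note T = triD[OF tri i]
  { assume e: "p = 1"
    have "f (pt s r i (p - 1)) = pt s r (nx i) (p - 1)" "f (pt s r (nx i) (p - 1)) = pt s r (pv i) (p - 1)"
      using psi.z1[OF e i] psi.z1[OF e T(1)] T(8) by simp_all
    moreover have "fst (pt s r (pv i) (p - 1)) \<noteq> fst (pt s r i (p - 1))" using T by simp
    ultimately show "f (f (pt s r i (p - 1))) \<noteq> pt s r i (p - 1) \<and> fst (f (pt s r i (p - 1))) = nx i" by (metis fst_pt) }
  { assume e: "p = 0"
    have e': "1 - p = 1" "p - 1 = 0 - 1" using e by simp_all
    have "\<alpha> (pt s r i (p - 1)) = pt s r (pv i) (p - 1)" "\<alpha> (pt s r (pv i) (p - 1)) = pt s r (nx i) (p - 1)"
      unfolding e'(2) using al.z1[OF e'(1) i] al.z1[OF e'(1) T(2)] T(9) by simp_all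
    moreover have "fst (pt s r (nx i) (p - 1)) \<noteq> fst (pt s r i (p - 1))" using T by simp
    ultimately show "\<alpha> (\<alpha> (pt s r i (p - 1))) \<noteq> pt s r i (p - 1) \<and> fst (\<alpha> (pt s r i (p - 1))) = pv i" by (metis fst_pt) }
  { assume e: "q = 1"
    let ?b = "\<lambda>i. pt s r i (p + n i)"
    have "f (?b i) = ?b (pv i)" "f (?b (pv i)) = ?b (nx i)"
      using psi.z2[OF e i] psi.z2[OF e T(2)] T(9) by simp_all
    moreover have "fst (?b (nx i)) \<noteq> fst (?b i)" using T by simp
    ultimately have "f (f (?b i)) \<noteq> ?b i \<and> fst (?b i) = i \<and> fst (f (?b i)) = pv i" by (metis fst_pt)
    then show "\<exists>b\<in>ground G s. f (f b) \<noteq> b \<and> fst b = i \<and> fst (f b) = pv i" using psi.P_in[OF i] by blast }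
  { assume e: "q = 0"
    then have e': "1 - q = 1" by simp
    let ?b = "\<lambda>i. pt s r i (0 + (n i + p + q - 1))"
    have "\<alpha> (?b i) = ?b (nx i)" "\<alpha> (?b (nx i)) = ?b (pv i)"
      using al.z2[OF e' i] al.z2[OF e' T(1)] T(8) by simp_all
    moreover have "fst (?b (pv i)) \<noteq> fst (?b i)" using T by simp
    ultimately have "\<alpha> (\<alpha> (?b i)) \<noteq> ?b i \<and> fst (?b i) = i \<and> fst (\<alpha> (?b i)) = nx i" by (metis fst_pt)
    then show "\<exists>b\<in>ground G s. \<alpha> (\<alpha> b) \<noteq> b \<and> fst b = i \<and> fst (\<alpha> b) = nx i" using psi.P_in[OF i] by blast }
qed

lemma special_cube: "b \<in> ground G s ==> f (f b) \<noteq> b ==> f (f (f b)) = b"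
  using psi.f_power by blast

end

text \<open>The direction of turning singles out the first exceptional cycle, hence \<open>p\<close>
  and the labels, and then \<open>q\<close>. The lengths give the sums
  \<open>n i + n (pv i)\<close>, and around a cycle of odd length these determine
  \<open>n\<close>.\<close>

lemma triangle_rigid:
  assumes "triangle_perm G nx pv s r f p q n" "triangle_perm G nx pv s r' f p' q' n'"
  shows "p = p'" "q = q'" "\<And>i. i \<in> G ==> pt s r i (p - 1) = pt s r' i (p - 1)" "\<And>i. i \<in> G ==> n i = n' i"
proof -
  interpret A: triangle_perm G nx pv s r f p q n by fact
  interpret A': triangle_perm G nx pv s r' f p' q' n' by fact
  have key: "p = p' \<and> pt s r i (p - 1) = pt s r' i (p - 1)" if i: "i \<in> G" for i
  proof (cases "p = 1")
    case True
    note bs = A.base_special(1)[OF i True]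
    have "p' = 1 \<and> pt s r i (p - 1) = pt s r' i (p' - 1)"
      using A'.special_psi[OF A.psi.P_in[OF i], of "p - 1"] bs triD(7)[OF A.tri i] by auto
    then show ?thesis using True by simp
  next
    case False
    then have p: "p = 0" using A.p01 by blast
    note bs = A.base_special(2)[OF i p]
    have "p' = 0 \<and> pt s r i (p - 1) = pt s r' i (p' - 1)"
      using A'.special_alpha[OF A.psi.P_in[OF i], of "p - 1"] bs triD(7)[OF A.tri i] by auto
    then show ?thesis using p by simp
  qed
  obtain i where i: "i \<in> G" using A.neG by blast
  show p: "p = p'" using key[OF i] by blast
  show "pt s r i (p - 1) = pt s r' i (p - 1)" if "i \<in> G" for i using key[OF that] by blast
  show q: "q = q'"
  proof (cases "q = 1")
    case True
    obtain b where b: "b \<in> ground G s" "f (f b) \<noteq> b" "fst b = i" "fst (f b) = pv i"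
      using A.base_special(3)[OF i True] by blast
    then show ?thesis using A'.special_psi[OF b(1,2)] triD(7)[OF A.tri i] True by auto
  next
    case False
    then have q0: "q = 0" using A.q01 by blast
    obtain b where b: "b \<in> ground G s" "A.\<alpha> (A.\<alpha> b) \<noteq> b" "fst b = i" "fst (A.\<alpha> b) = nx i"
      using A.base_special(4)[OF i q0] by blast
    then show ?thesis using A'.special_alpha[OF b(1,2)] triD(7)[OF A.tri i] q0 by auto
  qed
  show "n i = n' i" if i: "i \<in> G" for i
  proof -
    note T = triD[OF A.tri i]
    have "int (s j) = n j + n (pv j) + p + q" "int (s j) = n' j + n' (pv j) + p + q" if "j \<in> G" for j
      using A.famD(3)[OF that] A'.famD(3)[OF that] p q by simp_all
    from this[OF i] this[OF T(1)] this[OF T(2)] show ?thesis using T(4,9) by simp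
  qed
qed

lemma disjoint_imageI: "(\<And>y. y \<in> A ==> g y \<notin> A) ==> A \<inter> g ` A = {}"
  by blast

section \<open>The normal form with a 4-cycle\<close>

locale double_perm =
  fixes G :: "nat set" and a b c s r and f :: "nat \<times> nat => nat \<times> nat"
  assumes G: "G = {a, b, c}" and dist: "a \<noteq> b" "a \<noteq> c" "b \<noteq> c"
    and s_pos: "\<And>i. i \<in> G ==> 0 < s i"
    and fam: "double_family s (pt s r) f a b c"
    and off: "\<And>b. b \<notin> ground G s ==> f b = b"
begin

abbreviation "P \<equiv> pt s r"
abbreviation "B \<equiv> ground G s"
abbreviation "K \<equiv> int (s b)"
abbreviation "L \<equiv> int (s c)"

lemma in_G: "a \<in> G" "b \<in> G" "c \<in> G" using G by auto
lemma finG: "finite G" using G by simp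
lemma finB: "finite B" using finG by (rule finite_ground)
lemma P_in: "i \<in> G ==> P i k \<in> B" using pt_in[where s = s] s_pos by blast
lemma KL: "0 < K" "0 < L" "int (s a) = K + L" using s_pos in_G fam by (auto simp: double_family_def)

lemma fD:
  "\<And>k. 0 \<le> k ==> k < K ==> f (P a k) = P b (- k)"
  "\<And>k. 1 \<le> k ==> k \<le> K ==> f (P b (- k)) = P a k"
  "\<And>k. 0 \<le> k ==> k < L ==> f (P a (K + k)) = P c (- k)"
  "\<And>k. 1 \<le> k ==> k \<le> L ==> f (P c (- k)) = P a (K + k)"
  using fam by (simp_all add: double_family_def)

lemma wrap: "P b (- K) = P b 0" "P c (- L) = P c 0" "P a (K + L) = P a 0"
  by (rule pt_cong, simp add: KL flip: KL(3))+

lemma cyc4: "f (P a 0) = P b 0" "f (P b 0) = P a K" "f (P a K) = P c 0" "f (P c 0) = P a 0"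
  using fD(1)[of 0] fD(2)[of K] fD(3)[of 0] fD(4)[of L] KL wrap by simp_all

lemma cases_B:
  assumes "y \<in> B"
  obtains (ab) k where "1 \<le> k" "k < K" "y = P a k" | (ba) k where "1 \<le> k" "k < K" "y = P b (- k)"
  | (ac) k where "1 \<le> k" "k < L" "y = P a (K + k)" | (ca) k where "1 \<le> k" "k < L" "y = P c (- k)"
  | (z0) "y = P a 0" | (z1) "y = P b 0" | (z2) "y = P a K" | (z3) "y = P c 0"
proof -
  have "fst y \<in> {a, b, c}" using assms G by (auto simp: ground_def)
  then consider "fst y = a" | "fst y = b" | "fst y = c" by blast
  then show thesis
  proof cases
    case 1
    obtain k where k: "0 \<le> k" "k < 0 + int (s a)" "y = P a k" using pt_surj_from[OF assms, of 0 r, unfolded 1] by blast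
    consider "k = 0" | "1 \<le> k" "k < K" | "k = K" | "1 \<le> k - K" "k - K < L" using k KL by linarith
    then show ?thesis using ab[of k] z0 z2 ac[of "k - K"] k by cases auto
  next
    case 2
    obtain k where k: "1 - K \<le> k" "k < 1 - K + K" "y = P b k" using pt_surj_from[OF assms, of "1 - K" r, unfolded 2] by blast
    then show ?thesis using z1 ba[of "- k"] by (cases "k = 0") auto
  next
    case 3
    obtain k where k: "1 - L \<le> k" "k < 1 - L + L" "y = P c k" using pt_surj_from[OF assms, of "1 - L" r, unfolded 3] by blast
    then show ?thesis using z3 ca[of "- k"] by (cases "k = 0") auto
  qed
qed

lemma f_in: assumes "y \<in> B" shows "f y \<in> B \<and> fst (f y) \<noteq> fst y"
  using assms by (cases rule: cases_B) (use fD cyc4 P_in in_G dist in auto)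

lemma f_power: assumes "y \<in> B" shows "f (f y) = y \<or> y \<in> {P a 0, P b 0, P a K, P c 0}"
  using assms by (cases rule: cases_B) (use fD in auto)

lemma perm: "f permutes B"
proof (rule permutes_if_power[OF finB])
  \<comment> \<open>The exponent 4 is a multiple of the cycle lengths 2 and 4.\<close>
  show "(f ^^ Suc 3) y = y" if "y \<in> B" for y
    using f_power[OF that] cyc4 by (auto simp: eval_nat_numeral)
qed (use f_in off in auto)

lemma P_inj:
  assumes "i \<in> G" "P i k = P j l" "lo \<le> k" "k < lo + int (s i)" "lo \<le> l" "l < lo + int (s i)"
  shows "i = j \<and> k = l"
  using pt_inj[where s = s, OF s_pos[OF assms(1)] assms(2-6)] .

lemma P_fst: "P i k = P j l ==> i = j"
  using fst_pt by metis

definition "I = {1..<K} \<union> {K + 1..<K + L}"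
definition "A = P a ` I"
definition "D = {P a 0, P b 0, P a K, P c 0}"

lemma inj_A: "inj_on (P a) I"
  by (rule inj_onI) (use P_inj[OF in_G(1), where lo = 0] KL in \<open>force simp: I_def\<close>)

lemma f_A: assumes "k \<in> I" shows "f (P a k) = (if k < K then P b (- k) else P c (K - k))" "f (f (P a k)) = P a k"
  using assms fD(1,2)[of k] fD(3,4)[of "k - K"] by (auto simp: I_def)

lemma D_orbit: "orbit f (P a 0) = D"
proof (intro equalityI subsetI)
  fix y assume "y \<in> orbit f (P a 0)"
  then show "y \<in> D" by (induction rule: orbit.induct) (use cyc4 in \<open>auto simp: D_def\<close>)
next
  have "f (P a 0) \<in> orbit f (P a 0)" "f (f (P a 0)) \<in> orbit f (P a 0)" "f (f (f (P a 0))) \<in> orbit f (P a 0)"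
    "f (f (f (f (P a 0)))) \<in> orbit f (P a 0)" by (auto intro: orbit.intros)
  then show "y \<in> orbit f (P a 0)" if "y \<in> D" for y using that cyc4 by (auto simp: D_def)
qed

lemma cycles:
  "cyc B f = (\<lambda>y. {y, f y}) ` A \<union> {D}" "inj_on (\<lambda>y. {y, f y}) A" "(\<lambda>y. {y, f y}) ` A \<inter> {D} = {}"
proof -
  have 1: "B \<subseteq> A \<union> f ` A \<union> \<Union>{D}"
  proof
    fix y assume "y \<in> B"
    then show "y \<in> A \<union> f ` A \<union> \<Union>{D}"
    proof (cases rule: cases_B)
      case (ab k) then show ?thesis by (auto simp: A_def I_def)
    next
      case (ac k) then show ?thesis by (auto simp: A_def I_def)
    next
      case (ba k)
      then have "k \<in> I" "y = f (P a k)" using fD(1)[of k] by (auto simp: I_def)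
      then show ?thesis by (auto simp: A_def)
    next
      case (ca k)
      then have "K + k \<in> I" "y = f (P a (K + k))" using fD(3)[of k] by (auto simp: I_def)
      then show ?thesis by (auto simp: A_def)
    qed (auto simp: D_def)
  qed
  have 2: "A \<subseteq> B" using P_in in_G by (auto simp: A_def)
  have 3: "A \<inter> f ` A = {}"
  proof -
    have "fst y = a" if "y \<in> A" for y using that by (auto simp: A_def)
    moreover have "fst (f y) \<noteq> fst y" if "y \<in> A" for y using f_in 2 that by blast
    ultimately have "f y \<notin> A" if "y \<in> A" for y using that by metis
    then show ?thesis by blast
  qed
  have 4: "f (f y) = y" if "y \<in> A" for y using that f_A(2) by (auto simp: A_def)
  have 5: "{D} \<subseteq> cyc B f" using D_orbit P_in[OF in_G(1), of 0] by (auto simp: cycle_partition_def)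
  have 6: "A \<inter> \<Union>{D} = {}"
  proof -
    have "P a k \<notin> D" if k: "k \<in> I" for k
    proof
      assume "P a k \<in> D"
      then have "P a k = P a 0 \<or> P a k = P a K" using P_fst dist by (auto simp: D_def)
      then show False using P_inj[OF in_G(1), of k a 0 0] P_inj[OF in_G(1), of k a K 0] k KL by (auto simp: I_def)
    qed
    then show ?thesis by (auto simp: A_def)
  qed
  show "cyc B f = (\<lambda>y. {y, f y}) ` A \<union> {D}" "inj_on (\<lambda>y. {y, f y}) A" "(\<lambda>y. {y, f y}) ` A \<inter> {D} = {}"
    by (rule cycle_partition_pairs[OF finB perm 1 2 3 _ 5 6], erule 4)+
qed

lemma prod_cycles:
  fixes h :: "(nat \<times> nat) set => 'a :: comm_monoid_mult"
  shows "(\<Prod>V\<in>cyc B f. h V) = (\<Prod>k\<in>{1..<K}. h {P a k, P b (- k)})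
     * (\<Prod>k\<in>{1..<L}. h {P a (K + k), P c (- k)}) * h D"
proof -
  have fA: "finite ((\<lambda>y. {y, f y}) ` A)" "finite {D}" by (simp_all add: A_def I_def)
  have "(\<Prod>V\<in>cyc B f. h V) = (\<Prod>V\<in>(\<lambda>y. {y, f y}) ` A. h V) * (\<Prod>V\<in>{D}. h V)"
    unfolding cycles(1) by (rule prod.union_disjoint[OF fA cycles(3)])
  also have "(\<Prod>V\<in>(\<lambda>y. {y, f y}) ` A. h V) = (\<Prod>y\<in>A. h {y, f y})"
    by (rule prod.reindex_cong[OF cycles(2)]) auto
  also have "\<dots> = (\<Prod>k\<in>I. h {P a k, f (P a k)})"
    unfolding A_def by (rule prod.reindex_cong[OF inj_A]) auto
  also have "\<dots> = (\<Prod>k\<in>{1..<K}. h {P a k, f (P a k)}) * (\<Prod>k\<in>{K + 1..<K + L}. h {P a k, f (P a k)})"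
    unfolding I_def by (rule prod.union_disjoint) auto
  also have "(\<Prod>k\<in>{1..<K}. h {P a k, f (P a k)}) = (\<Prod>k\<in>{1..<K}. h {P a k, P b (- k)})"
    by (rule prod.cong) (use fD(1) in auto)
  also have "(\<Prod>k\<in>{K + 1..<K + L}. h {P a k, f (P a k)}) = (\<Prod>k\<in>{K + 1..<K + L}. h {P a k, P c (K - k)})"
    by (rule prod.cong) (use fD(3)[of "_ - K"] in auto)
  also have "\<dots> = (\<Prod>k\<in>{1..<L}. h {P a (K + k), P c (- k)})"
    by (rule prod.reindex_bij_witness[where i = "\<lambda>k. K + k" and j = "\<lambda>k. k - K"]) auto
  finally show ?thesis by simp
qed

lemma card_cycles: "int (ncyc B f) = K + L - 1"
proof -
  have fA: "finite ((\<lambda>y. {y, f y}) ` A)" "finite {D}" by (simp_all add: A_def I_def)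
  have "ncyc B f = card ((\<lambda>y. {y, f y}) ` A) + card {D}"
    unfolding cycles(1) by (rule card_Un_disjoint[OF fA cycles(3)])
  also have "card ((\<lambda>y. {y, f y}) ` A) = card I"
    using card_image[OF cycles(2)] card_image[OF inj_A] unfolding A_def by simp
  also have "card I = card {1..<K} + card {K + 1..<K + L}" unfolding I_def by (rule card_Un_disjoint) auto
  finally show ?thesis using KL by simp
qed

definition "\<alpha> = inv (gamma_perm G s) \<circ> f"

lemma alphaD:
  "\<And>k. 0 \<le> k ==> k < K ==> \<alpha> (P a k) = P b (- k - 1)"
  "\<And>k. 1 \<le> k ==> k \<le> K ==> \<alpha> (P b (- k)) = P a (k - 1)"
  "\<And>k. 0 \<le> k ==> k < L ==> \<alpha> (P a (K + k)) = P c (- k - 1)"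
  "\<And>k. 1 \<le> k ==> k \<le> L ==> \<alpha> (P c (- k)) = P a (K + k - 1)"
  using fD inv_gamma_pt[where s = s, OF finG _ s_pos] in_G by (simp_all add: \<alpha>_def)

lemma alpha_pairs: assumes "y \<in> B" shows "\<alpha> (\<alpha> y) = y" "fst (\<alpha> y) \<noteq> fst y" "fst y = a \<or> fst (\<alpha> y) = a"
proof -
  have aab: "\<alpha> (\<alpha> (P a k)) = P a k \<and> fst (\<alpha> (P a k)) = b" if "0 \<le> k" "k < K" for k
    using alphaD(1)[of k] alphaD(2)[of "k + 1"] that by simp
  have aba: "\<alpha> (\<alpha> (P b (- k))) = P b (- k) \<and> fst (\<alpha> (P b (- k))) = a" if "1 \<le> k" "k \<le> K" for k
    using alphaD(2)[of k] alphaD(1)[of "k - 1"] that by simp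
  have aac: "\<alpha> (\<alpha> (P a (K + k))) = P a (K + k) \<and> fst (\<alpha> (P a (K + k))) = c" if "0 \<le> k" "k < L" for k
    using alphaD(3)[of k] alphaD(4)[of "k + 1"] that by simp
  have aca: "\<alpha> (\<alpha> (P c (- k))) = P c (- k) \<and> fst (\<alpha> (P c (- k))) = a" if "1 \<le> k" "k \<le> L" for k
  proof -
    have e: "K + k - 1 = K + (k - 1)" by simp
    have "\<alpha> (P c (- k)) = P a (K + (k - 1))" using alphaD(4)[OF that] unfolding e .
    then show ?thesis using alphaD(3)[of "k - 1"] that by simp
  qed
  have "\<alpha> (\<alpha> y) = y \<and> fst (\<alpha> y) \<noteq> fst y \<and> (fst y = a \<or> fst (\<alpha> y) = a)" using assms
  proof (cases rule: cases_B)
    case z1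
    then show ?thesis using aba[of K] wrap(1) KL dist by simp
  next
    case z3
    then show ?thesis using aca[of L] wrap(2) KL dist by simp
  qed (use aab[of 0] aac[of 0] aab aba aac aca KL dist in simp_all)
  then show "\<alpha> (\<alpha> y) = y" "fst (\<alpha> y) \<noteq> fst y" "fst y = a \<or> fst (\<alpha> y) = a" by auto
qed

lemma perm_alpha: "\<alpha> permutes B"
  unfolding \<alpha>_def by (intro permutes_compose perm permutes_inv gamma_perm_permutes finG)

text \<open>Every cycle of \<alpha> is a pair with exactly one element on \<open>a\<close>, so the
  points of \<open>a\<close> count the cycles.\<close>

lemma alpha_cycles:
  "int (ncyc B \<alpha>) = K + L" "\<And>V. V \<in> cyc B \<alpha> ==> inj_on fst V"
proof -
  let ?A = "{a} \<times> {..<s a}"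
  have 2: "?A \<subseteq> B" using in_G by auto
  have 1: "B \<subseteq> ?A \<union> \<alpha> ` ?A \<union> \<Union>{}"
  proof
    fix y assume y: "y \<in> B"
    have "\<alpha> y \<in> B" using y perm_alpha by (simp add: permutes_in_image)
    then show "y \<in> ?A \<union> \<alpha> ` ?A \<union> \<Union>{}"
      using alpha_pairs[OF y] y by (cases y; cases "\<alpha> y") (force intro!: image_eqI)
  qed
  have na: "fst (\<alpha> y) \<noteq> a" if "y \<in> ?A" for y
  proof -
    have "y \<in> B" "fst y = a" using that 2 by auto
    then show ?thesis using alpha_pairs(2)[of y] by simp
  qed
  have "\<alpha> y \<notin> ?A" if "y \<in> ?A" for y using na[OF that] by (cases "\<alpha> y") auto
  then have 3: "?A \<inter> \<alpha> ` ?A = {}" by (rule disjoint_imageI)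
  have 4: "\<alpha> (\<alpha> y) = y" if "y \<in> ?A" for y using alpha_pairs(1) 2 that by blast
  have 5: "{} \<subseteq> cyc B \<alpha>" "?A \<inter> \<Union>{} = {}" by simp_all
  have cy: "cyc B \<alpha> = (\<lambda>y. {y, \<alpha> y}) ` ?A \<union> {}" "inj_on (\<lambda>y. {y, \<alpha> y}) ?A"
    by (rule cycle_partition_pairs[OF finB perm_alpha 1 2 3 _ 5], erule 4)+
  have "ncyc B \<alpha> = card ?A" unfolding cy(1) Un_empty_right by (rule card_image[OF cy(2)])
  then show "int (ncyc B \<alpha>) = K + L" using KL by (simp add: card_cartesian_product)
  fix V assume "V \<in> cyc B \<alpha>"
  then obtain y where "y \<in> ?A" "V = {y, \<alpha> y}" unfolding cy(1) by blast
  then show "inj_on fst V" using alpha_pairs(2)[of y] 2 by auto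
qed

lemma reduced_f: "reduced G s f"
proof (rule reducedI[OF finG s_pos _ perm])
  show "G \<noteq> {}" using G by simp
  show "fst (f y) \<noteq> fst y" if "y \<in> B" for y using f_in that by blast
  have cG: "card G = 3" using G dist by simp
  have "int (card B) = 2 * (K + L)" unfolding ground_def G using dist KL by simp
  then show "ncyc B f + ncyc B (inv (gamma_perm G s) \<circ> f) + card G = card B + 2"
    using card_cycles alpha_cycles(1) cG by (simp flip: \<alpha>_def)
  show "inj_on fst V" if "V \<in> cyc B (inv (gamma_perm G s) \<circ> f)" for V
    using alpha_cycles(2) that by (simp add: \<alpha>_def)
  fix W assume W: "W \<subseteq> G" "W \<noteq> {}" "\<And>y. y \<in> B ==> fst y \<in> W ==> fst (f y) \<in> W"
  have "a \<in> W ==> b \<in> W" "a \<in> W ==> c \<in> W" "b \<in> W ==> a \<in> W" "c \<in> W ==> a \<in> W"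
    using W(3)[OF P_in[OF in_G(1), of 0]] W(3)[OF P_in[OF in_G(1), of K]] W(3)[OF P_in[OF in_G(2), of 0]]
      W(3)[OF P_in[OF in_G(3), of 0]] cyc4 by auto
  then show "W = G" using W(1,2) G by blast
qed

lemma no_special_alpha: "y \<in> B ==> \<alpha> (\<alpha> y) = y" by (rule alpha_pairs)

text \<open>The third iterate tells a 4-cycle from the 3-cycles of a triangle;
  \<open>triangle_not_double\<close> relies on it.\<close>

lemma specials:
  assumes "y \<in> B" "f (f y) \<noteq> y"
  shows "y \<in> {P a 0, P b 0, P a K, P c 0}" "f (f (f y)) \<noteq> y"
proof -
  show y: "y \<in> {P a 0, P b 0, P a K, P c 0}" using f_power assms by blast
  have "P a 0 \<noteq> P c 0" "P b 0 \<noteq> P a 0" "P a K \<noteq> P b 0" "P c 0 \<noteq> P a K" using P_fst dist by blast+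
  then show "f (f (f y)) \<noteq> y" using y cyc4 by auto
qed

lemma base_special: "f (f (P a 0)) \<noteq> P a 0" "fst (f (P a 0)) = b" "fst (f (f (P a 0))) = a"
  using cyc4 P_inj[OF in_G(1), of K a 0 0] KL by auto

end

text \<open>Among the four exceptional points \<open>P a 0\<close> is the only one that
  \<open>f\<close> sends to the \<open>nx\<close> of its own vertex and whose second image is on its
  own vertex again.\<close>

lemma double_rigid:
  assumes "double_perm G a (nx a) (pv a) s r f" "double_perm G a' (nx a') (pv a') s r' f"
    and tri: "tri G nx pv"
  shows "a = a'" "\<And>i. i \<in> G ==> pt s r i 0 = pt s r' i 0"
proof -
  interpret A: double_perm G a "nx a" "pv a" s r f by fact
  interpret A': double_perm G a' "nx a'" "pv a'" s r' f by fact
  note T = triD[OF tri A.in_G(1)] and T' = triD[OF tri A'.in_G(1)]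
  have "A.P a 0 \<in> {A'.P a' 0, A'.P (nx a') 0, A'.P a' (int (s (nx a'))), A'.P (pv a') 0}"
    using A'.specials(1)[OF A.P_in[OF A.in_G(1)] A.base_special(1)] .
  then consider "A.P a 0 = A'.P a' 0" | "A.P a 0 = A'.P (nx a') 0" | "A.P a 0 = A'.P a' (int (s (nx a')))" | "A.P a 0 = A'.P (pv a') 0"
    by blast
  then have e: "A.P a 0 = A'.P a' 0"
  proof cases
    case 2
    then have "fst (f (A'.P (nx a') 0)) = nx a" "a = nx a'" using A.base_special(2) A.P_fst by (metis, metis fst_pt)
    then have "a' = nx (nx a')" using A'.cyc4 by simp
    then show ?thesis using T' by simp
  next
    case 3
    then have "fst (f (A'.P a' (int (s (nx a'))))) = nx a" "a = a'" using A.base_special(2) by (metis, metis fst_pt)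
    then have "pv a' = nx a'" using A'.cyc4 by simp
    then show ?thesis using T' by simp
  next
    case 4
    then have "fst (f (f (A'.P (pv a') 0))) = a" "a = pv a'" using A.base_special(3) by (metis, metis fst_pt)
    then have "nx a' = pv a'" using A'.cyc4 by simp
    then show ?thesis using T' by simp
  qed
  then show aa: "a = a'" using fst_pt by metis
  have "A.P (nx a) 0 = A'.P (nx a) 0" using A.cyc4(1) A'.cyc4(1) e aa by metis
  moreover have "A.P (pv a) 0 = A'.P (pv a) 0"
    using A.cyc4 A'.cyc4 e aa by metis
  ultimately show "pt s r i 0 = pt s r' i 0" if "i \<in> G" for i using that T(10) e aa by auto
qed

lemma triangle_not_double:
  assumes "triangle_perm G nx pv s r f p q n" "double_perm G a b c s r' f"
  shows False
proof -
  interpret A: triangle_perm G nx pv s r f p q n by fact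
  interpret A': double_perm G a b c s r' f by fact
  have al: "A'.\<alpha> = A.\<alpha>" by (simp add: A.\<alpha>_def A'.\<alpha>_def)
  obtain i where i: "i \<in> G" using A.neG by blast
  show False
  proof (cases "p = 1")
    case True
    note bs = conjunct1[OF A.base_special(1)[OF i True]]
    show False using A'.specials(2)[OF A.psi.P_in[OF i] bs] A.special_cube[OF A.psi.P_in[OF i] bs] by blast
  next
    case False
    then have p: "p = 0" using A.p01 by blast
    show False using A.base_special(2)[OF i p] A'.no_special_alpha[OF A.psi.P_in[OF i]] unfolding al by blast
  qed
qed

section \<open>The normal form for two white vertices\<close>

locale annular_perm =
  fixes G :: "nat set" and b c s r and f :: "nat \<times> nat => nat \<times> nat"
  assumes G: "G = {b, c}" and dist: "b \<noteq> c" and s_eq: "s c = s b" and s_pos: "0 < s b"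
    and fb: "\<And>k. 0 \<le> k ==> k < int (s b) ==> f (pt s r b k) = pt s r c (- k)"
    and fc: "\<And>k. 0 \<le> k ==> k < int (s b) ==> f (pt s r c (- k)) = pt s r b k"
    and off: "\<And>y. y \<notin> ground G s ==> f y = y"
begin

abbreviation "P \<equiv> pt s r"
abbreviation "B \<equiv> ground G s"

lemma in_G: "b \<in> G" "c \<in> G" using G by auto
lemma finG: "finite G" using G by simp
lemma finB: "finite B" using finG by (rule finite_ground)
lemma s_pos': "i \<in> G ==> 0 < s i" using G s_eq s_pos by auto
lemma P_in: "i \<in> G ==> P i k \<in> B" using pt_in[where s = s] s_pos' by blast

lemma cases_B:
  assumes "y \<in> B"
  obtains (b) k where "0 \<le> k" "k < int (s b)" "y = P b k" | (c) k where "0 \<le> k" "k < int (s b)" "y = P c (- k)"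
proof -
  have "fst y \<in> {b, c}" using assms G by (auto simp: ground_def)
  then consider "fst y = b" | "fst y = c" by blast
  then show thesis
  proof cases
    case 1
    obtain k where "0 \<le> k" "k < 0 + int (s b)" "y = P b k" using pt_surj_from[OF assms, of 0 r, unfolded 1] by blast
    then show ?thesis using b by simp
  next
    case 2
    obtain k where "1 - int (s b) \<le> k" "k < 1 - int (s b) + int (s c)" "y = P c k"
      using pt_surj_from[OF assms, of "1 - int (s b)" r, unfolded 2] by blast
    then show ?thesis using c[of "- k"] s_eq by simp
  qed
qed

lemma f_pairs: assumes "y \<in> B" shows "f (f y) = y" "f y \<in> B" "fst (f y) \<noteq> fst y"
proof -
  have "f (f y) = y \<and> f y \<in> B \<and> fst (f y) \<noteq> fst y"
    using assms by (cases rule: cases_B) (use fb fc P_in in_G dist in auto)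
  then show "f (f y) = y" "f y \<in> B" "fst (f y) \<noteq> fst y" by auto
qed

lemma perm: "f permutes B"
  by (rule permutes_if_power[OF finB, where n = 1]) (use f_pairs off in auto)

lemma pairs_cycles:
  assumes g: "g permutes B" and iv: "\<And>y. y \<in> B ==> g (g y) = y" and ne: "\<And>y. y \<in> B ==> fst (g y) \<noteq> fst y"
  shows "cyc B g = (\<lambda>y. {y, g y}) ` ({b} \<times> {..<s b})" "inj_on (\<lambda>y. {y, g y}) ({b} \<times> {..<s b})"
proof -
  let ?A = "{b} \<times> {..<s b}"
  have 2: "?A \<subseteq> B" using in_G by auto
  have 1: "B \<subseteq> ?A \<union> g ` ?A \<union> \<Union>{}"
  proof
    fix y assume y: "y \<in> B"
    have gy: "g y \<in> B" using y g by (simp add: permutes_in_image)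
    have "fst y = b \<or> fst (g y) = b" using ne[OF y] y gy G by (auto simp: ground_def)
    then have "y \<in> ?A \<or> g y \<in> ?A" using y gy by (auto simp: ground_def)
    then show "y \<in> ?A \<union> g ` ?A \<union> \<Union>{}" using iv[OF y] by (metis UnI1 UnI2 imageI)
  qed
  have nb: "fst (g y) \<noteq> b" if "y \<in> ?A" for y
  proof -
    have "y \<in> B" "fst y = b" using that 2 by auto
    then show ?thesis using ne[of y] by simp
  qed
  have "g y \<notin> ?A" if "y \<in> ?A" for y using nb[OF that] by (cases "g y") auto
  then have 3: "?A \<inter> g ` ?A = {}" by (rule disjoint_imageI)
  have 4: "g (g y) = y" if "y \<in> ?A" for y using iv 2 that by blast
  have 5: "{} \<subseteq> cyc B g" "?A \<inter> \<Union>{} = {}" by simp_all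
  have "cyc B g = (\<lambda>y. {y, g y}) ` ?A \<union> {}"
    by (rule cycle_partition_pairs[OF finB g 1 2 3 _ 5], erule 4)
  then show "cyc B g = (\<lambda>y. {y, g y}) ` ?A" by simp
  show "inj_on (\<lambda>y. {y, g y}) ?A"
    by (rule cycle_partition_pairs[OF finB g 1 2 3 _ 5], erule 4)
qed

lemma f_cycles:
  "cyc B f = (\<lambda>y. {y, f y}) ` ({b} \<times> {..<s b})" "inj_on (\<lambda>y. {y, f y}) ({b} \<times> {..<s b})"
  by (rule pairs_cycles[OF perm]; erule f_pairs)+

lemma reduced_f: "reduced G s f"
proof (rule reducedI[OF finG s_pos' _ perm])
  show "G \<noteq> {}" using G by simp
  show "fst (f y) \<noteq> fst y" if "y \<in> B" for y using f_pairs that by blast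
  define \<alpha> where "\<alpha> = inv (gamma_perm G s) \<circ> f"
  have pa: "\<alpha> permutes B"
    unfolding \<alpha>_def by (intro permutes_compose perm permutes_inv gamma_perm_permutes finG)
  have iN: "inv (gamma_perm G s) (P i k) = P i (k - 1)" if "i \<in> G" for i k
    using inv_gamma_pt[where s = s, OF finG that s_pos'[OF that]] .
  have ab: "\<alpha> (P b k) = P c (- (k + 1))" if "0 \<le> k" "k < int (s b)" for k
  proof -
    have e: "- (k + 1) = - k - 1" by simp
    show ?thesis unfolding e using fb[OF that] iN[OF in_G(2), of "- k"] by (simp add: \<alpha>_def)
  qed
  have per: "P c (- int (s b)) = P c 0" "P b (int (s b) - 1) = P b (- 1)" by (rule pt_cong, simp add: s_eq)+
  have ac: "\<alpha> (P c (- k)) = P b (k - 1)" if "0 \<le> k" "k < int (s b)" for k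
    using fc[OF that] iN[OF in_G(1), of k] by (simp add: \<alpha>_def)
  have al: "\<alpha> (\<alpha> y) = y \<and> fst (\<alpha> y) \<noteq> fst y" if "y \<in> B" for y
    using that
  proof (cases rule: cases_B)
    case (b k)
    have "\<alpha> (P c (- (k + 1))) = P b k"
    proof (cases "k + 1 < int (s b)")
      case True then show ?thesis using ac[of "k + 1"] b by simp
    next
      case False
      then have "k = int (s b) - 1" using b by simp
      then show ?thesis using ac[of 0] per s_pos by simp
    qed
    then show ?thesis using ab b dist by simp
  next
    case (c k)
    have "\<alpha> (P b (k - 1)) = P c (- k)"
    proof (cases "k = 0")
      case True
      then show ?thesis using ab[of "int (s b) - 1"] per s_pos by simp
    next
      case False then show ?thesis using ab[of "k - 1"] c by simp
    qed
    then show ?thesis using ac c dist by simp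
  qed
  have ca: "cyc B \<alpha> = (\<lambda>y. {y, \<alpha> y}) ` ({b} \<times> {..<s b})" "inj_on (\<lambda>y. {y, \<alpha> y}) ({b} \<times> {..<s b})"
    by (rule pairs_cycles[OF pa]; use al in blast)+
  note cf = f_cycles
  have "ncyc B \<alpha> = s b" using card_image[OF ca(2)] ca(1) by (simp add: card_cartesian_product)
  moreover have "ncyc B f = s b" using card_image[OF cf(2)] cf(1) by (simp add: card_cartesian_product)
  moreover have cG: "card G = 2" using G dist by simp
  moreover have "card B = 2 * s b" unfolding ground_def G using dist s_eq by simp
  ultimately show "ncyc B f + ncyc B (inv (gamma_perm G s) \<circ> f) + card G = card B + 2"
    using cG by (simp flip: \<alpha>_def)
  show "inj_on fst V" if "V \<in> cyc B (inv (gamma_perm G s) \<circ> f)" for V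
  proof -
    have "V \<in> cyc B \<alpha>" using that by (simp add: \<alpha>_def)
    then have "\<exists>y\<in>{b} \<times> {..<s b}. V = {y, \<alpha> y}" unfolding ca(1) image_iff .
    then obtain y where y: "y \<in> {b} \<times> {..<s b}" "V = {y, \<alpha> y}" by (elim bexE)
    then have "y \<in> B" using in_G by auto
    then have "fst (\<alpha> y) \<noteq> fst y" using al by blast
    then show ?thesis using y(2) by auto
  qed
  fix W assume W: "W \<subseteq> G" "W \<noteq> {}" "\<And>y. y \<in> B ==> fst y \<in> W ==> fst (f y) \<in> W"
  have "b \<in> W ==> c \<in> W" "c \<in> W ==> b \<in> W"
    using W(3)[OF P_in[OF in_G(1), of 0]] W(3)[OF P_in[OF in_G(2), of 0]] fb[of 0] fc[of 0] s_pos by auto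
  then show "W = G" using W(1,2) G by blast
qed

lemma mark_cycle: "{P b 0, P c 0} \<in> cyc B f"
proof -
  have "orbit f (P b 0) = {P b 0, P c 0}"
  proof (intro equalityI subsetI)
    fix y assume "y \<in> orbit f (P b 0)"
    then show "y \<in> {P b 0, P c 0}"
      by (induction rule: orbit.induct) (use fb[of 0] fc[of 0] s_pos in auto)
  next
    have "f (P b 0) \<in> orbit f (P b 0)" "f (f (P b 0)) \<in> orbit f (P b 0)" by (auto intro: orbit.intros)
    then show "y \<in> orbit f (P b 0)" if "y \<in> {P b 0, P c 0}" for y using that fb[of 0] fc[of 0] s_pos by auto
  qed
  then show ?thesis using P_in[OF in_G(1), of 0] by (auto simp: cycle_partition_def)
qed

lemma prod_cycles:
  fixes h :: "(nat \<times> nat) set => 'a :: comm_monoid_mult"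
  shows "(\<Prod>V\<in>cyc B f - {{P b 0, P c 0}}. h V) = (\<Prod>k\<in>{1..<int (s b)}. h {P b k, P c (- k)})"
proof -
  note cf = f_cycles
  have A: "{b} \<times> {..<s b} = P b ` {0..<int (s b)}"
  proof (intro equalityI subsetI)
    fix y assume "y \<in> {b} \<times> {..<s b}"
    then have "y \<in> B" "fst y = b" using in_G by auto
    then show "y \<in> P b ` {0..<int (s b)}" using pt_surj_from[of y G s 0 r] by auto
  next
    fix y assume "y \<in> P b ` {0..<int (s b)}"
    then obtain k where "y = P b k" by blast
    then show "y \<in> {b} \<times> {..<s b}" using P_in[OF in_G(1), of k] by (cases y) (auto simp: pt_def)
  qed
  have inj: "inj_on (P b) {0..<int (s b)}"
    by (rule inj_onI) (use pt_inj[where s = s and lo = 0, OF s_pos] in force)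
  let ?g = "\<lambda>k. {P b k, P c (- k)}"
  have "cyc B f = (\<lambda>y. {y, f y}) ` (P b ` {0..<int (s b)})" using cf(1) A by simp
  also have "\<dots> = ?g ` {0..<int (s b)}"
    unfolding image_image by (rule image_cong[OF refl]) (simp only: fb atLeastLessThan_iff)
  finally have cy: "cyc B f = ?g ` {0..<int (s b)}" .
  have ig: "inj_on ?g {0..<int (s b)}"
  proof (rule inj_onI)
    fix k l assume kl: "k \<in> {0..<int (s b)}" "l \<in> {0..<int (s b)}" "?g k = ?g l"
    have "P b k \<noteq> P c (- l)" using dist fst_pt by metis
    then have "P b k = P b l" using kl(3) by auto
    then show "k = l" using inj kl by (auto dest: inj_onD)
  qed
  have "cyc B f - {?g 0} = ?g ` ({0..<int (s b)} - {0})"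
    unfolding cy using inj_on_image_set_diff[OF ig, of "{0..<int (s b)}" "{0}"] s_pos by auto
  also have "{0..<int (s b)} - {0} = {1..<int (s b)}" by auto
  finally have e: "cyc B f - {{P b 0, P c 0}} = ?g ` {1..<int (s b)}" by simp
  show ?thesis unfolding e
    by (rule prod.reindex_cong[OF inj_on_subset[OF ig]]) auto
qed

end

section \<open>Shapes on three and two cycles\<close>

definition "G3 = {1, 2, 3 :: nat}"
definition nx3 :: "nat => nat" where "nx3 i = (if i = 1 then 2 else if i = 2 then 3 else 1)"
definition pv3 :: "nat => nat" where "pv3 i = (if i = 1 then 3 else if i = 2 then 1 else 2)"

lemma tri3: "tri G3 nx3 pv3"
  unfolding tri_def G3_def nx3_def pv3_def by auto

lemma card_G3: "card G3 = 3" "finite G3" by (simp_all add: G3_def)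

lemma pt_0: "e < s i ==> pt0 s i (int e) = (i, e)"
  by (simp add: pt_def)

lemma pt_0_neg: "k < s i ==> pt0 s i (- 1 - int k) = (i, s i - 1 - k)"
proof -
  assume k: "k < s i"
  have "(- 1 - int k) mod int (s i) = (- 1 - int k + int (s i)) mod int (s i)" by (rule mod_add_self2[symmetric])
  also have "- 1 - int k + int (s i) = int (s i - 1 - k)" using k by (simp add: of_nat_diff)
  also have "int (s i - 1 - k) mod int (s i) = int (s i - 1 - k)" using k by (intro mod_pos_pos_trivial) auto
  finally have "(0 + (- 1 - int k)) mod int (s i) = int (s i - 1 - k)" by (simp only: add_0)
  then show ?thesis unfolding pt_def by (simp only: of_nat_0 nat_int)
qed

text \<open>The equations of \<open>triangle_family\<close> for base points 0, solved for \<psi>. In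
  the second branch the label \<open>e\<close> stands for \<open>e - s i\<close>, which lies in the
  ladder coming from \<open>pv i\<close> or in the second 3-cycle.\<close>

definition triangle_map :: "(nat => nat) => int => (nat => int) => nat \<times> nat => nat \<times> nat" where
  "triangle_map s p n y = (if y \<in> ground G3 s then
     (if int (snd y) < n (fst y) + p then pt0 s (nx3 (fst y)) (p - 1 - int (snd y))
      else pt0 s (pv3 (fst y)) (int (s (fst y)) + p - 1 - int (snd y))) else y)"

lemma triangle_map_perm:
  assumes p: "p = 0 \<or> p = 1" and q: "q = 0 \<or> q = 1" and n: "\<And>i. i \<in> G3 ==> 0 \<le> n i \<and> (p = 0 --> q = 0 --> 0 < n i)"
    and s: "\<And>i. i \<in> G3 ==> int (s i) = n i + n (pv3 i) + p + q"
  shows "triangle_perm G3 nx3 pv3 s (\<lambda>_. 0) (triangle_map s p n) p q n"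
proof
  show "triangle_family G3 nx3 pv3 s (pt0 s) (triangle_map s p n) p q n"
    unfolding triangle_family_def
  proof (intro ballI conjI allI impI)
    fix i assume i: "i \<in> G3"
    note T = triD[OF tri3 i]
    show "0 \<le> n i" "p = 0 ==> q = 0 ==> 0 < n i" "int (s i) = n i + n (pv3 i) + p + q" using n s i by auto
    have s1: "int (s (nx3 i)) = n (nx3 i) + n i + p + q" using s[OF T(1)] T(4) by simp
    have npos: "0 \<le> n i" "0 \<le> n (pv3 i)" "0 \<le> n (nx3 i)" using n i T by auto
    { fix k assume k: "0 \<le> k" "k < n i + p"
      have ks: "k < int (s i)" using k s[OF i] npos q by auto
      then have e: "pt0 s i k = (i, nat k)" using pt_0[of "nat k" s i] k by simp
      have "(i, nat k) \<in> ground G3 s" using i ks k by auto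
      then show "triangle_map s p n (pt0 s i k) = pt0 s (nx3 i) (p - 1 - k)"
        unfolding e triangle_map_def using k by simp }
    { fix k assume k: "p \<le> k" "k < n i + p + q"
      let ?e = "k - p"
      have ks: "0 \<le> ?e" "?e < int (s (nx3 i))" using k s1 npos p by auto
      have e': "p - 1 - k = - 1 - int (nat ?e)" using ks by simp
      have "nat ?e < s (nx3 i)" using ks by linarith
      then have e: "pt0 s (nx3 i) (p - 1 - k) = (nx3 i, s (nx3 i) - 1 - nat ?e)"
        unfolding e' by (rule pt_0_neg)
      have in_g: "(nx3 i, s (nx3 i) - 1 - nat ?e) \<in> ground G3 s" using T(1) ks by auto
      have ie: "int (s (nx3 i) - 1 - nat ?e) = int (s (nx3 i)) - 1 - ?e" using ks by (simp add: of_nat_diff)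
      then have "\<not> int (s (nx3 i) - 1 - nat ?e) < n (nx3 i) + p" using k s1 by linarith
      then show "triangle_map s p n (pt0 s (nx3 i) (p - 1 - k)) = pt0 s i k"
        unfolding e triangle_map_def using in_g T(4) ie by simp }
  qed
qed (use tri3 card_G3 p q in \<open>auto simp: triangle_map_def\<close>)

definition double_map :: "(nat => nat) => nat => nat \<times> nat => nat \<times> nat" where
  "double_map s a y = (if y \<in> ground G3 s then
     (if fst y = a then
        (if snd y < s (nx3 a) then pt0 s (nx3 a) (- int (snd y)) else pt0 s (pv3 a) (int (s (nx3 a)) - int (snd y)))
      else if fst y = nx3 a then pt0 s a (int (s (nx3 a)) - int (snd y))
      else pt0 s a (int (s (nx3 a)) + (int (s (pv3 a)) - int (snd y)))) else y)"

lemma pt_0_minus: "1 \<le> k ==> k \<le> int (s i) ==> pt0 s i (- k) = (i, s i - nat k)"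
  using pt_0_neg[of "nat (k - 1)" s i] by (simp add: nat_diff_distrib Suc_diff_le algebra_simps nat_le_iff nat_less_iff)

lemma double_map_perm:
  assumes a: "a \<in> G3" and s: "s a = s (nx3 a) + s (pv3 a)" "0 < s (nx3 a)" "0 < s (pv3 a)"
  shows "double_perm G3 a (nx3 a) (pv3 a) s (\<lambda>_. 0) (double_map s a)"
proof
  note T = triD[OF tri3 a]
  show "G3 = {a, nx3 a, pv3 a}" by (rule T)
  show "a \<noteq> nx3 a" "a \<noteq> pv3 a" "nx3 a \<noteq> pv3 a" using T by auto
  show "0 < s i" if "i \<in> G3" for i
  proof -
    have "i = a \<or> i = nx3 a \<or> i = pv3 a" using that unfolding T(10) by blast
    then show ?thesis using s by auto
  qed
  let ?P = "pt0 s"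
  have g: "(a, e) \<in> ground G3 s" if "e < s a" for e using that a by simp
  have g': "(nx3 a, e) \<in> ground G3 s" if "e < s (nx3 a)" for e using that T(1) by simp
  have g'': "(pv3 a, e) \<in> ground G3 s" if "e < s (pv3 a)" for e using that T(2) by simp
  show "double_family s ?P (double_map s a) a (nx3 a) (pv3 a)"
    unfolding double_family_def
  proof (intro conjI allI impI)
    show "int (s a) = int (s (nx3 a)) + int (s (pv3 a))" using s by simp
    fix k :: int
    { assume k: "0 \<le> k" "k < int (s (nx3 a))"
      have e: "?P a k = (a, nat k)" using pt_0[of "nat k" s a] k s by simp
      have "(a, nat k) \<in> ground G3 s" by (rule g) (use k s in linarith)
      then show "double_map s a (?P a k) = ?P (nx3 a) (- k)" unfolding e double_map_def using k by (simp add: nat_less_iff) }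
    { assume k: "1 \<le> k" "k \<le> int (s (nx3 a))"
      have e: "?P (nx3 a) (- k) = (nx3 a, s (nx3 a) - nat k)" by (rule pt_0_minus) (rule k)+
      have "(nx3 a, s (nx3 a) - nat k) \<in> ground G3 s" by (rule g') (use k s in linarith)
      moreover have "int (s (nx3 a) - nat k) = int (s (nx3 a)) - k" using k by (simp add: of_nat_diff nat_le_iff)
      ultimately show "double_map s a (?P (nx3 a) (- k)) = ?P a k" unfolding e double_map_def using T(5) by simp }
    { assume k: "0 \<le> k" "k < int (s (pv3 a))"
      have "int (s (nx3 a)) + k = int (s (nx3 a) + nat k)" using k by simp
      then have e: "?P a (int (s (nx3 a)) + k) = (a, s (nx3 a) + nat k)"
        using pt_0[of "s (nx3 a) + nat k" s a] k s by (simp add: nat_less_iff)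
      have "(a, s (nx3 a) + nat k) \<in> ground G3 s" by (rule g) (use k s in linarith)
      then show "double_map s a (?P a (int (s (nx3 a)) + k)) = ?P (pv3 a) (- k)" unfolding e double_map_def using k by simp }
    { assume k: "1 \<le> k" "k \<le> int (s (pv3 a))"
      have e: "?P (pv3 a) (- k) = (pv3 a, s (pv3 a) - nat k)" by (rule pt_0_minus) (rule k)+
      have "(pv3 a, s (pv3 a) - nat k) \<in> ground G3 s" by (rule g'') (use k s in linarith)
      moreover have "int (s (pv3 a) - nat k) = int (s (pv3 a)) - k" using k by (simp add: of_nat_diff nat_le_iff)
      ultimately show "double_map s a (?P (pv3 a) (- k)) = ?P a (int (s (nx3 a)) + k)"
        unfolding e double_map_def using T(6,7) by simp }
  qed
  show "double_map s a b = b" if "b \<notin> ground G3 s" for b using that by (simp add: double_map_def)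
qed

text \<open>A shape records the run lengths, grouped by the cycles of \<open>\<psi>\<close>: triples for exceptional 3-cycles
  (none if the 3-cycle belongs to \<open>\<alpha>\<close>), and pairs for the 2-cycles of a ladder.\<close>

datatype shape =
  Triangle "(nat \<times> nat \<times> nat) list" "(nat \<times> nat \<times> nat) list" "(nat \<times> nat) list" "(nat \<times> nat) list" "(nat \<times> nat) list"
| Double nat nat nat nat nat "(nat \<times> nat) list" "(nat \<times> nat) list"

definition pick3 :: "nat => 'a => 'a => 'a => 'a" where
  "pick3 i x y z = (if i = 1 then x else if i = 2 then y else z)"

definition sel3 :: "nat => 'a \<times> 'a \<times> 'a => 'a" where
  "sel3 i t = pick3 i (fst t) (fst (snd t)) (snd (snd t))"

text \<open>The run lengths in the order of the labels 0, 1, and so on. A ladder is listed backwards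
  on its second vertex, because the labels fall there while they rise on the first.\<close>

fun shape_gaps :: "shape => nat => nat list" where
  "shape_gaps (Triangle P Q u v w) i = map (sel3 i) P @ map fst (pick3 i u v w) @ map (sel3 i) Q @ rev (map snd (pick3 (pv3 i) u v w))"
| "shape_gaps (Double a x y j k u v) i = (if i = a then x # map fst u @ y # map fst v
     else if i = nx3 a then j # rev (map snd u) else k # rev (map snd v))"

fun shape_map :: "shape => nat \<times> nat => nat \<times> nat" where
  "shape_map (Triangle P Q u v w) =
     triangle_map (\<lambda>i. length (shape_gaps (Triangle P Q u v w) i)) (int (length P)) (\<lambda>i. int (length (pick3 i u v w)))"
| "shape_map (Double a x y j k u v) = double_map (\<lambda>i. length (shape_gaps (Double a x y j k u v) i)) a"

definition pos3 :: "nat \<times> nat \<times> nat => bool" where "pos3 t \<longleftrightarrow> 0 < fst t \<and> 0 < fst (snd t) \<and> 0 < snd (snd t)"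
definition pos2 :: "nat \<times> nat => bool" where "pos2 t \<longleftrightarrow> 0 < fst t \<and> 0 < snd t"

abbreviation "ladders \<equiv> {u. list_all pos2 u}"
abbreviation "ladders1 \<equiv> {u. u \<noteq> [] \<and> list_all pos2 u}"

text \<open>If both exceptional 3-cycles belong to \<alpha>, each ladder between them has
  \<open>n i - 1\<close> rungs of \<alpha>, so it must contain a 2-cycle of \<psi>.\<close>

fun shape_ok :: "shape => bool" where
  "shape_ok (Triangle P Q u v w) \<longleftrightarrow> length P \<le> 1 \<and> length Q \<le> 1 \<and> list_all pos3 P \<and> list_all pos3 Q
     \<and> list_all pos2 u \<and> list_all pos2 v \<and> list_all pos2 w \<and> (P = [] --> Q = [] --> u \<noteq> [] \<and> v \<noteq> [] \<and> w \<noteq> [])"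
| "shape_ok (Double a x y j k u v) \<longleftrightarrow> a \<in> G3 \<and> 0 < x \<and> 0 < y \<and> 0 < j \<and> 0 < k \<and> list_all pos2 u \<and> list_all pos2 v"

lemma pick3_cases: "pick3 i u v w = u \<or> pick3 i u v w = v \<or> pick3 i u v w = w"
  by (simp add: pick3_def)

lemma shape_gaps_pos: "shape_ok ob ==> i \<in> G3 ==> a \<in> set (shape_gaps ob i) ==> 0 < a"
  by (cases ob) (auto simp: list_all_iff pos3_def pos2_def sel3_def pick3_def split: if_splits)

lemma Triangle_perm:
  assumes "shape_ok (Triangle P Q u v w)" and s: "\<And>i. i \<in> G3 ==> s i = length (shape_gaps (Triangle P Q u v w) i)"
  shows "triangle_perm G3 nx3 pv3 s (\<lambda>_. 0) (triangle_map s (int (length P)) (\<lambda>i. int (length (pick3 i u v w))))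
     (int (length P)) (int (length Q)) (\<lambda>i. int (length (pick3 i u v w)))"
proof (rule triangle_map_perm)
  have "length P \<le> 1" "length Q \<le> 1" using assms(1) by simp_all
  then show "int (length P) = 0 \<or> int (length P) = 1" "int (length Q) = 0 \<or> int (length Q) = 1" by linarith+
  show "0 \<le> int (length (pick3 i u v w)) \<and> (int (length P) = 0 --> int (length Q) = 0 --> 0 < int (length (pick3 i u v w)))" for i
    using assms(1) pick3_cases[of i u v w] by auto
qed (simp add: s)

lemma ground_cong: "(\<And>i. i \<in> G ==> s i = s' i) ==> ground G s = ground G s'"
  by (auto simp: ground_def)

lemma triangle_map_cong: assumes "\<And>i. i \<in> G3 ==> s i = s' i" shows "triangle_map s p n = triangle_map s' p n"
proof
  fix y
  show "triangle_map s p n y = triangle_map s' p n y"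
    using assms triD(1,2)[OF tri3] ground_cong[of G3 s s', OF assms]
    by (auto simp: triangle_map_def pt_def ground_def)
qed

lemma double_map_cong: assumes "\<And>i. i \<in> G3 ==> s i = s' i" "a \<in> G3" shows "double_map s a = double_map s' a"
proof
  fix y
  show "double_map s a y = double_map s' a y"
    using assms triD(1,2)[OF tri3] by (auto simp: double_map_def pt_def ground_def)
qed

lemma Double_perm:
  assumes ok: "shape_ok (Double a x y j k u v)" and s: "\<And>i. i \<in> G3 ==> s i = length (shape_gaps (Double a x y j k u v) i)"
  shows "double_perm G3 a (nx3 a) (pv3 a) s (\<lambda>_. 0) (double_map s a)"
proof -
  have a: "a \<in> G3" using ok by simp
  note T = triD[OF tri3 a]
  show ?thesis by (rule double_map_perm[OF a]) (use T in \<open>auto simp: s[OF a] s[OF T(1)] s[OF T(2)]\<close>)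
qed

lemma shape_reduced: assumes "shape_ok ob" shows "reduced G3 (\<lambda>i. length (shape_gaps ob i)) (shape_map ob)"
proof (cases ob)
  case (Triangle P Q u v w)
  interpret triangle_perm G3 nx3 pv3 "\<lambda>i. length (shape_gaps ob i)" "\<lambda>_. 0" "shape_map ob"
    "int (length P)" "int (length Q)" "\<lambda>i. int (length (pick3 i u v w))"
    using Triangle_perm[OF assms[unfolded Triangle], of "\<lambda>i. length (shape_gaps ob i)"] by (simp add: Triangle del: shape_gaps.simps)
  show ?thesis by (rule reduced_f)
next
  case (Double a x y j k u v)
  interpret double_perm G3 a "nx3 a" "pv3 a" "\<lambda>i. length (shape_gaps ob i)" "\<lambda>_. 0" "shape_map ob"
    using Double_perm[OF assms[unfolded Double], of "\<lambda>i. length (shape_gaps ob i)"] by (simp add: Double del: shape_gaps.simps)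
  show ?thesis by (rule reduced_f)
qed

text \<open>Both permutations satisfy the same equations in terms of labels, and \<open>rot\<close>
  carries labels counted from 0 to labels counted from \<open>r\<close>.
  \<open>triangle_rotate\<close> is the converse passage.\<close>

lemma triangle_transfer:
  assumes "triangle_perm G nx pv s r f p q n" "triangle_perm G nx pv s (\<lambda>_. 0) f' p q n" and b: "b \<in> ground G s"
  shows "f (rot s r b) = rot s r (f' b)"
proof -
  interpret A: triangle_perm G nx pv s r f p q n by fact
  interpret A': triangle_perm G nx pv s "\<lambda>_. 0" f' p q n by fact
  have rp: "rot s r (pt0 s i k) = pt s r i k" if "i \<in> G" for i k using rot_pt[where s = s] A.s_pos[OF that] by blast
  note T = triD[OF A.tri]
  from b show ?thesis
    by (cases rule: A'.psi.cases_B)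
      (use A.psi.f1 A'.psi.f1 A.psi.f2 A'.psi.f2 A.psi.z1 A'.psi.z1 A.psi.z2 A'.psi.z2 rp T(1,2) in simp_all)
qed

lemma double_transfer:
  assumes "double_perm G a b c s r f" "double_perm G a b c s (\<lambda>_. 0) f'" and y: "y \<in> ground G s"
  shows "f (rot s r y) = rot s r (f' y)"
proof -
  interpret A: double_perm G a b c s r f by fact
  interpret A': double_perm G a b c s "\<lambda>_. 0" f' by fact
  have rp: "rot s r (pt0 s i k) = pt s r i k" if "i \<in> G" for i k using rot_pt[where s = s] A.s_pos[OF that] by blast
  note rps = rp[OF A.in_G(1)] rp[OF A.in_G(2)] rp[OF A.in_G(3)]
  from y show ?thesis
    by (cases rule: A'.cases_B) (simp_all add: A.fD A'.fD A.cyc4 A'.cyc4 rps)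
qed

lemma rot_equation:
  assumes eq: "\<And>b. b \<in> ground G s ==> f (rot s r b) = rot s r (f' b)" and pos: "\<And>i. i \<in> G ==> 0 < s i"
    and i: "i \<in> G" "j \<in> G" and f': "f' (pt0 s i k) = pt0 s j l"
  shows "f (pt s r i k) = pt s r j l"
  using eq[OF pt_in[where s = s and r = "\<lambda>_. 0" and k = k, OF i(1) pos[OF i(1)]]]
    rot_pt[where s = s, OF pos[OF i(1)], of r k] rot_pt[where s = s, OF pos[OF i(2)], of r l] f' by simp

lemma triangle_rotate:
  assumes "triangle_perm G nx pv s (\<lambda>_. 0) f' p q n" and off: "\<And>b. b \<notin> ground G s ==> f b = b"
    and eq: "\<And>b. b \<in> ground G s ==> f (rot s r b) = rot s r (f' b)"
  shows "triangle_perm G nx pv s r f p q n"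
proof -
  interpret A': triangle_perm G nx pv s "\<lambda>_. 0" f' p q n by fact
  note T = triD[OF A'.tri]
  note re = rot_equation[where G = G and s = s and r = r and f = f and f' = f', OF eq A'.s_pos]
  show ?thesis
  proof
    show "triangle_family G nx pv s (pt s r) f p q n"
      unfolding triangle_family_def
      using A'.famD T(1) by (auto intro!: re)
  qed (use A'.tri A'.G3 A'.p01 A'.q01 off in auto)
qed

lemma double_rotate:
  assumes "double_perm G a b c s (\<lambda>_. 0) f'" and off: "\<And>b. b \<notin> ground G s ==> f b = b"
    and eq: "\<And>b. b \<in> ground G s ==> f (rot s r b) = rot s r (f' b)"
  shows "double_perm G a b c s r f"
proof -
  interpret A': double_perm G a b c s "\<lambda>_. 0" f' by fact
  note re = rot_equation[where G = G and s = s and r = r and f = f and f' = f', OF eq A'.s_pos]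
  show ?thesis
  proof
    show "double_family s (pt s r) f a b c"
      unfolding double_family_def
      using A'.fD A'.KL(3) A'.in_G by (auto intro!: re)
  qed (use A'.G A'.dist A'.s_pos off in auto)
qed

lemma shape_map_off: "y \<notin> ground G3 (\<lambda>i. length (shape_gaps ob i)) ==> shape_map ob y = y"
  by (cases ob) (auto simp: triangle_map_def double_map_def)

lemma exists_Triangle:
  assumes p: "p \<le> 1" and q: "q \<le> 1" and n: "\<And>i. i \<in> G3 ==> p = 0 ==> q = 0 ==> 0 < n i"
    and len: "\<And>i. i \<in> G3 ==> length (g i) = n i + n (pv3 i) + p + q"
    and pos: "\<And>i a. i \<in> G3 ==> a \<in> set (g i) ==> 0 < (a::nat)"
  shows "\<exists>P Q u v w. shape_ok (Triangle P Q u v w) \<and> length P = p \<and> length Q = q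
     \<and> (\<forall>i\<in>G3. length (pick3 i u v w) = n i \<and> shape_gaps (Triangle P Q u v w) i = g i)"
proof -
  define P where "P = (if p = 1 then [(g 1 ! 0, g 2 ! 0, g 3 ! 0)] else [])"
  define Q where "Q = (if q = 1 then [(g 1 ! (n 1 + p), g 2 ! (n 2 + p), g 3 ! (n 3 + p))] else [])"
  \<comment> \<open>The partner of label \<open>p + k\<close> on \<open>i\<close> has label
    \<open>p - 1 - (p + k) = - 1 - k\<close> on \<open>nx i\<close>, that is, it is counted from the
    end of the list.\<close>
  define U where "U i = map (\<lambda>k. (g i ! (p + k), g (nx3 i) ! (length (g (nx3 i)) - 1 - k))) [0..<n i]" for i
  have sP: "map (sel3 i) P = take p (g i)" if i: "i \<in> G3" for i
  proof (cases "p = 1")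
    case True
    then have "g i \<noteq> []" using len[OF i] by auto
    then show ?thesis using i True by (cases "g i") (auto simp: P_def sel3_def pick3_def G3_def)
  qed (use p in \<open>simp add: P_def\<close>)
  have sQ: "map (sel3 i) Q = (if q = 1 then [g i ! (n i + p)] else [])" if i: "i \<in> G3" for i
    using i by (auto simp: Q_def sel3_def pick3_def G3_def)
  have gaps: "shape_gaps (Triangle P Q (U 1) (U 2) (U 3)) i = g i" if i: "i \<in> G3" for i
  proof -
    note T = triD[OF tri3 i]
    have pk: "pick3 j (U 1) (U 2) (U 3) = U j" if "j \<in> G3" for j using that by (auto simp: pick3_def G3_def)
    let ?L = "take p (g i) @ map fst (U i) @ (if q = 1 then [g i ! (n i + p)] else []) @ rev (map snd (U (pv3 i)))"
    have "?L = g i"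
    proof (rule nth_equalityI)
      show l: "length ?L = length (g i)" using len[OF i] p q by (auto simp: U_def)
      fix e assume e: "e < length ?L"
      then have el: "e < n i + n (pv3 i) + p + q" using l len[OF i] by simp
      have lp: "length (take p (g i)) = p" using len[OF i] by simp
      consider "e < p" | "p \<le> e" "e < p + n i" | "e = p + n i" "q = 1" | "p + n i + q \<le> e" using q by linarith
      then show "?L ! e = g i ! e"
      proof cases
        case 1 then show ?thesis using lp by (simp add: nth_append)
      next
        case 2
        then have "\<not> e < p" "e - p < n i" "p + (e - p) = e" by auto
        then show ?thesis using lp by (simp add: nth_append U_def)
      next
        case 3 then show ?thesis using lp by (simp add: nth_append U_def add.commute)
      next
        case 4
        define m where "m = e - (p + n i + q)"
        have m: "e = p + n i + q + m" "m < n (pv3 i)" using 4 el by (auto simp: m_def)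
        have "?L ! e = rev (map snd (U (pv3 i))) ! m"
        proof -
          have "length (take p (g i) @ map fst (U i) @ (if q = 1 then [g i ! (n i + p)] else [])) = p + n i + q"
            using lp q by (auto simp: U_def)
          then show ?thesis
            unfolding m(1) using nth_append_length_plus[of "take p (g i) @ map fst (U i) @ (if q = 1 then [g i ! (n i + p)] else [])"
                "rev (map snd (U (pv3 i)))" m] by simp
        qed
        also have "\<dots> = snd (U (pv3 i) ! (n (pv3 i) - 1 - m))" using m by (simp add: rev_nth U_def)
        also have "\<dots> = g i ! (length (g i) - 1 - (n (pv3 i) - 1 - m))" using m T(3) by (simp add: U_def)
        also have "length (g i) - 1 - (n (pv3 i) - 1 - m) = e" using m len[OF i] by simp
        finally show ?thesis .
      qed
    qed
    then show ?thesis using sP[OF i] sQ[OF i] pk[OF i] pk[OF T(2)] by simp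
  qed
  have G: "1 \<in> G3" "2 \<in> G3" "3 \<in> G3" by (simp_all add: G3_def)
  have nth_pos: "0 < g i ! e" if "i \<in> G3" "e < length (g i)" for i e using pos[OF that(1) nth_mem[OF that(2)]] .
  have upos: "list_all pos2 (U i)" if i: "i \<in> G3" for i
  proof -
    note T = triD[OF tri3 i]
    have "p + k < length (g i)" "length (g (nx3 i)) - 1 - k < length (g (nx3 i))" if "k < n i" for k
      using that len[OF i] len[OF T(1)] T(4) by auto
    then show ?thesis using nth_pos[OF i] nth_pos[OF T(1)] by (auto simp: U_def list_all_iff pos2_def)
  qed
  have "shape_ok (Triangle P Q (U 1) (U 2) (U 3))"
  proof -
    have "0 < g i ! 0" if "p = 1" "i \<in> G3" for i by (rule nth_pos) (use len[of i] that in simp_all)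
    then have "list_all pos3 P" using G by (simp add: P_def pos3_def)
    moreover have "0 < g i ! (n i + p)" if "q = 1" "i \<in> G3" for i by (rule nth_pos) (use len[of i] that in simp_all)
    then have "list_all pos3 Q" using G by (simp add: Q_def pos3_def)
    moreover have "length P \<le> 1" "length Q \<le> 1" by (simp_all add: P_def Q_def)
    moreover have "U i \<noteq> []" if "P = []" "Q = []" "i \<in> G3" for i
      using that n[OF that(3)] p q by (auto simp: P_def Q_def U_def split: if_splits)
    ultimately show ?thesis using upos G by simp
  qed
  moreover have "length P = p" "length Q = q" using p q by (auto simp: P_def Q_def)
  moreover have "length (pick3 i (U 1) (U 2) (U 3)) = n i" if "i \<in> G3" for i
    using that by (auto simp: pick3_def G3_def U_def)
  ultimately show ?thesis using gaps by blast
qed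

lemma exists_Double:
  assumes a: "a \<in> G3" and len: "length (g a) = length (g (nx3 a)) + length (g (pv3 a))"
    and ne: "g (nx3 a) \<noteq> []" "g (pv3 a) \<noteq> []"
    and pos: "\<And>i a. i \<in> G3 ==> a \<in> set (g i) ==> 0 < (a::nat)"
  shows "\<exists>x y j k u v. shape_ok (Double a x y j k u v) \<and> (\<forall>i\<in>G3. shape_gaps (Double a x y j k u v) i = g i)"
proof -
  note T = triD[OF tri3 a]
  obtain j l where j: "g (nx3 a) = j # l" using ne by (cases "g (nx3 a)") auto
  obtain k m where k: "g (pv3 a) = k # m" using ne by (cases "g (pv3 a)") auto
  obtain x h where x: "g a = x # h" using len j by (cases "g a") auto
  define h1 where "h1 = take (length l) h"
  obtain y h2 where y: "drop (length l) h = y # h2" using len j k x by (cases "drop (length l) h") auto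
  have h: "h = h1 @ y # h2" using y unfolding h1_def by (metis append_take_drop_id)
  have l1: "length h1 = length l" using len j k x by (simp add: h1_def)
  have l2: "length h2 = length m" using len j k x h l1 by simp
  let ?u = "zip h1 (rev l)" and ?v = "zip h2 (rev m)"
  have gaps: "shape_gaps (Double a x y j k ?u ?v) i = g i" if "i \<in> G3" for i
  proof -
    have "i = a \<or> i = nx3 a \<or> i = pv3 a" using that unfolding T(10) by blast
    moreover have "shape_gaps (Double a x y j k ?u ?v) a = g a" using l1 l2 by (simp add: x h)
    moreover have "shape_gaps (Double a x y j k ?u ?v) (nx3 a) = g (nx3 a)" using T(5) l1 by (simp add: j)
    moreover have "shape_gaps (Double a x y j k ?u ?v) (pv3 a) = g (pv3 a)" using T(6,7) l2 by (simp add: k)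
    ultimately show ?thesis by blast
  qed
  have "pos2 z" if "z \<in> set ?u \<or> z \<in> set ?v" for z
  proof -
    have "fst z \<in> set (g a)" using that x h set_zip_leftD[of "fst z" "snd z"] by auto
    moreover have "snd z \<in> set (g (nx3 a)) \<or> snd z \<in> set (g (pv3 a))"
    proof -
      obtain z1 z2 where z: "z = (z1, z2)" by (cases z)
      have "z2 \<in> set (rev l) \<or> z2 \<in> set (rev m)" using that unfolding z by (meson set_zip_rightD)
      then show ?thesis unfolding z j k by auto
    qed
    ultimately show ?thesis using pos[OF a] pos[OF T(1)] pos[OF T(2)] unfolding pos2_def by blast
  qed
  moreover have "0 < x" "0 < y" "0 < j" "0 < k" using pos[OF a] pos[OF T(1)] pos[OF T(2)] x h j k by auto
  ultimately have "shape_ok (Double a x y j k ?u ?v)" using a by (simp add: list_all_iff)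
  then show ?thesis using gaps by blast
qed

lemma pair_list_eq: "map fst u = map fst u' ==> map snd u = map snd u' ==> u = u'"
  by (metis zip_map_fst_snd)

text \<open>Equal segment lengths allow the concatenated lists to be cut at the same places; the
  first components of a ladder are then read on its vertex \<open>i\<close> and the second ones on
  \<open>nx i\<close>.\<close>

lemma Triangle_eqI:
  assumes len: "length P = length P'" "length Q = length Q'" "\<And>i. i \<in> G3 ==> length (pick3 i u v w) = length (pick3 i u' v' w')"
    and eq: "\<And>i. i \<in> G3 ==> shape_gaps (Triangle P Q u v w) i = shape_gaps (Triangle P' Q' u' v' w') i"
  shows "Triangle P Q u v w = Triangle P' Q' u' v' w'"
proof -
  have parts: "map (sel3 i) P = map (sel3 i) P' \<and> map (sel3 i) Q = map (sel3 i) Q'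
     \<and> map fst (pick3 i u v w) = map fst (pick3 i u' v' w')
     \<and> map snd (pick3 (pv3 i) u v w) = map snd (pick3 (pv3 i) u' v' w')" if i: "i \<in> G3" for i
    using eq[OF i] len len(3)[OF i] by (simp add: append_eq_append_conv)
  have pk: "pick3 i u v w = pick3 i u' v' w'" if i: "i \<in> G3" for i
    using parts[OF i] parts[OF triD(1)[OF tri3 i]] triD(4)[OF tri3 i] by (intro pair_list_eq) simp_all
  have G: "1 \<in> G3" "2 \<in> G3" "3 \<in> G3" by (simp_all add: G3_def)
  have sel: "R = R'" if "length R = length R'" "\<And>i. i \<in> G3 ==> map (sel3 i) R = map (sel3 i) R'" for R R' :: "(nat \<times> nat \<times> nat) list"
  proof (rule nth_equalityI[OF that(1)])
    fix k assume k: "k < length R"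
    have "sel3 i (R ! k) = sel3 i (R' ! k)" if "i \<in> G3" for i
      using that(1) \<open>\<And>i. i \<in> G3 ==> map (sel3 i) R = map (sel3 i) R'\<close>[OF that] k \<open>length R = length R'\<close> by (metis nth_map)
    from this[OF G(1)] this[OF G(2)] this[OF G(3)] show "R ! k = R' ! k" by (simp add: sel3_def pick3_def prod_eq_iff)
  qed
  have "P = P'" "Q = Q'" using sel[OF len(1)] sel[OF len(2)] parts by blast+
  then show ?thesis using pk[OF G(1)] pk[OF G(2)] pk[OF G(3)] by (simp add: pick3_def)
qed

lemma Double_eqI:
  assumes a: "a \<in> G3"
    and eq: "\<And>i. i \<in> G3 ==> shape_gaps (Double a x y j k u v) i = shape_gaps (Double a x' y' j' k' u' v') i"
  shows "Double a x y j k u v = Double a x' y' j' k' u' v'"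
proof -
  note T = triD[OF tri3 a]
  have b: "j = j'" "map snd u = map snd u'" using eq[OF T(1)] T(5) by auto
  have c: "k = k'" "map snd v = map snd v'" using eq[OF T(2)] T(6,7) by auto
  have "length u = length u'" using b(2) by (metis length_map)
  then have "x = x'" "map fst u = map fst u'" "y = y'" "map fst v = map fst v'" using eq[OF a] by auto
  then show ?thesis using b c pair_list_eq by blast
qed

text \<open>No mark is used here: the exceptional cycles already exclude every rotation, by
  \<open>triangle_rigid\<close> and \<open>double_rigid\<close>.\<close>

interpretation shapes: structures G3 "Collect shape_ok" shape_gaps shape_map "\<lambda>_. {}" False
proof
  show "finite G3" "2 \<le> card G3" using card_G3 by simp_all
  show "0 < a" if "ob \<in> Collect shape_ok" "i \<in> G3" "a \<in> set (shape_gaps ob i)" for ob i a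
    using shape_gaps_pos that by simp
  show "reduced G3 (\<lambda>i. length (shape_gaps ob i)) (shape_map ob)" if "ob \<in> Collect shape_ok" for ob
    using shape_reduced that by simp
  show "{} \<in> markings False (ground G3 (\<lambda>i. length (shape_gaps ob i))) (shape_map ob)" for ob
    by (simp add: markings_def)
next
  fix s \<psi> m
  assume s: "\<And>i. i \<in> G3 ==> 0 < s i" and red: "reduced G3 s \<psi>" and m: "m \<in> markings False (ground G3 s) \<psi>"
  have m0: "m = {}" using m by (simp add: markings_def)
  interpret R: reduced_perm G3 s \<psi> using card_G3 s red by unfold_locales auto
  have off: "\<psi> b = b" if "b \<notin> ground G3 s" for b using permutes_not_in[OF R.perm_psi that] .
  obtain r where r: "\<forall>i\<in>G3. r i < s i"
    and cl: "(\<exists>t t' n. triangle_family G3 nx3 pv3 s (pt s r) \<psi> (of_bool t) (of_bool t') n)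
     \<or> (\<exists>a\<in>G3. double_family s (pt s r) \<psi> a (nx3 a) (pv3 a))"
    using R.classify3[OF tri3 card_G3(1)] by blast
  have "\<exists>ob\<in>Collect shape_ok. (\<forall>i\<in>G3. shape_gaps ob i = g i) \<and> (\<forall>b\<in>ground G3 s. \<psi> (rot s r b) = rot s r (shape_map ob b)) \<and> m = rot s r ` {}"
    if g: "\<forall>i\<in>G3. length (g i) = s i \<and> (\<forall>a\<in>set (g i). 0 < a)" for g
  proof -
    have gl: "\<And>i. i \<in> G3 ==> length (g i) = s i" and gp: "\<And>i a. i \<in> G3 ==> a \<in> set (g i) ==> 0 < a" using g by auto
    from cl show ?thesis
    proof (elim disjE exE bexE)
      fix t t' n
      assume fam: "triangle_family G3 nx3 pv3 s (pt s r) \<psi> (of_bool t) (of_bool t') n"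
      have tp: "triangle_perm G3 nx3 pv3 s r \<psi> (of_bool t) (of_bool t') n"
        by unfold_locales (use tri3 card_G3 fam off in auto)
      interpret tt: triangle_perm G3 nx3 pv3 s r \<psi> "of_bool t" "of_bool t'" n by (rule tp)
      define n' where "n' i = nat (n i)" for i
      have n': "int (n' i) = n i" if "i \<in> G3" for i using tt.famD(1)[OF that] by (simp add: n'_def)
      have sl: "s i = n' i + n' (pv3 i) + of_bool t + of_bool t'" if "i \<in> G3" for i
        using tt.famD(3)[OF that] n'[OF that] n'[OF triD(2)[OF tri3 that]] by (cases t; cases t') auto
      have ex: "\<exists>P Q u v w. shape_ok (Triangle P Q u v w) \<and> length P = of_bool t \<and> length Q = of_bool t'
         \<and> (\<forall>i\<in>G3. length (pick3 i u v w) = n' i \<and> shape_gaps (Triangle P Q u v w) i = g i)"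
      proof (rule exists_Triangle)
        show "0 < n' i" if "i \<in> G3" "of_bool t = (0::nat)" "of_bool t' = (0::nat)" for i
          using tt.famD(2)[OF that(1)] that n'[OF that(1)] by (cases t; cases t') auto
      qed (use gl gp sl in auto)
      then obtain P Q u v w where ob: "shape_ok (Triangle P Q u v w)" "length P = of_bool t" "length Q = of_bool t'"
         "\<And>i. i \<in> G3 ==> length (pick3 i u v w) = n' i" "\<And>i. i \<in> G3 ==> shape_gaps (Triangle P Q u v w) i = g i" by blast
      let ?ob = "Triangle P Q u v w" and ?n = "\<lambda>i. int (length (pick3 i u v w))"
      have len: "s i = length (shape_gaps ?ob i)" if "i \<in> G3" for i using ob(5)[OF that] gl[OF that] by simp
      have tp0: "triangle_perm G3 nx3 pv3 s (\<lambda>_. 0) (shape_map ?ob) (int (length P)) (int (length Q)) ?n"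
      proof -
        have "shape_map ?ob = triangle_map s (int (length P)) ?n"
          unfolding shape_map.simps by (rule triangle_map_cong) (use len in simp)
        then show ?thesis using Triangle_perm[OF ob(1) len] by simp
      qed
      have tp1: "triangle_perm G3 nx3 pv3 s r \<psi> (int (length P)) (int (length Q)) ?n"
      proof
        have "triangle_family G3 nx3 pv3 s (pt s r) \<psi> (of_bool t) (of_bool t') ?n"
          using fam ob(4) n' triD(2)[OF tri3] unfolding triangle_family_def by simp
        then show "triangle_family G3 nx3 pv3 s (pt s r) \<psi> (int (length P)) (int (length Q)) ?n" using ob(2,3) by simp
      qed (use tri3 card_G3 off ob(2,3) in auto)
      show ?thesis
        using ob triangle_transfer[OF tp1 tp0] m0 by (intro bexI[of _ ?ob]) auto
    next
      fix a assume a: "a \<in> G3" and fam: "double_family s (pt s r) \<psi> a (nx3 a) (pv3 a)"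
      note T = triD[OF tri3 a]
      have dp: "double_perm G3 a (nx3 a) (pv3 a) s r \<psi>"
      proof
        show "G3 = {a, nx3 a, pv3 a}" by (rule T)
      qed (use T fam off s in auto)
      have "s a = s (nx3 a) + s (pv3 a)" using fam by (simp add: double_family_def)
      then have "\<exists>x y j k u v. shape_ok (Double a x y j k u v) \<and> (\<forall>i\<in>G3. shape_gaps (Double a x y j k u v) i = g i)"
        using gl[OF a] gl[OF T(1)] gl[OF T(2)] s[OF T(1)] s[OF T(2)] gp by (intro exists_Double[OF a]) auto
      then obtain x y j k u v where ob: "shape_ok (Double a x y j k u v)"
        "\<And>i. i \<in> G3 ==> shape_gaps (Double a x y j k u v) i = g i" by blast
      let ?ob = "Double a x y j k u v"
      have len: "s i = length (shape_gaps ?ob i)" if "i \<in> G3" for i using ob(2)[OF that] gl[OF that] by simp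
      have dp0: "double_perm G3 a (nx3 a) (pv3 a) s (\<lambda>_. 0) (shape_map ?ob)"
      proof -
        have "shape_map ?ob = double_map s a"
          unfolding shape_map.simps by (rule double_map_cong) (use len a in auto)
        then show ?thesis using Double_perm[OF ob(1) len] by simp
      qed
      show ?thesis
        using ob double_transfer[OF dp dp0] m0 by (intro bexI[of _ ?ob]) auto
    qed
  qed
  then show "\<exists>r. (\<forall>i\<in>G3. r i < s i) \<and> (\<forall>g. (\<forall>i\<in>G3. length (g i) = s i \<and> (\<forall>a\<in>set (g i). 0 < a)) -->
        (\<exists>ob\<in>Collect shape_ok. (\<forall>i\<in>G3. shape_gaps ob i = g i) \<and> (\<forall>b\<in>ground G3 s. \<psi> (rot s r b) = rot s r (shape_map ob b))
           \<and> m = rot s r ` {}))" using r by blast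
next
  fix ob ob' s r
  assume ok0: "ob \<in> Collect shape_ok" "ob' \<in> Collect shape_ok"
    and len: "\<And>i. i \<in> G3 ==> length (shape_gaps ob i) = s i \<and> length (shape_gaps ob' i) = s i"
    and r: "\<And>i. i \<in> G3 ==> r i < s i"
    and eq: "\<And>b. b \<in> ground G3 s ==> shape_map ob (rot s r b) = rot s r (shape_map ob' b)"
  have ok: "shape_ok ob" "shape_ok ob'" using ok0 by simp_all
  have gr: "ground G3 (\<lambda>i. length (shape_gaps ob i)) = ground G3 s" by (rule ground_cong) (use len in simp)
  have off: "shape_map ob b = b" if "b \<notin> ground G3 s" for b using shape_map_off[of b ob] that gr by simp
  \<comment> \<open>A point with the same label for base points 0 and \<open>r i\<close> forces
    \<open>s i\<close> to divide \<open>r i\<close>, which is smaller.\<close>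
  have r0: "r i = 0" if i: "i \<in> G3" and e: "pt0 s i k = pt s r i k" for i k
  proof -
    have si: "0 < s i" using r[OF i] by simp
    have "(0 + k) mod int (s i) = (int (r i) + k) mod int (s i)"
      using e si by (simp add: pt_def eq_nat_nat_iff)
    then have "int (s i) dvd int (r i)" by (metis add.commute add_diff_cancel_right' add_0 mod_eq_dvd_iff dvd_diff_commute diff_zero)
    then show ?thesis using r[OF i] by (auto dest: zdvd_imp_le)
  qed
  have TP: "triangle_perm G3 nx3 pv3 s (\<lambda>_. 0) (shape_map (Triangle P Q u v w)) (int (length P)) (int (length Q)) (\<lambda>i. int (length (pick3 i u v w)))"
    if "shape_ok (Triangle P Q u v w)" "\<And>i. i \<in> G3 ==> length (shape_gaps (Triangle P Q u v w) i) = s i" for P Q u v w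
  proof -
    have "shape_map (Triangle P Q u v w) = triangle_map s (int (length P)) (\<lambda>i. int (length (pick3 i u v w)))"
      unfolding shape_map.simps by (rule triangle_map_cong) (use that(2) in simp)
    then show ?thesis using Triangle_perm[OF that(1), of s] that(2) by simp
  qed
  have DP: "double_perm G3 a (nx3 a) (pv3 a) s (\<lambda>_. 0) (shape_map (Double a x y j k u v))"
    if "shape_ok (Double a x y j k u v)" "\<And>i. i \<in> G3 ==> length (shape_gaps (Double a x y j k u v) i) = s i" for a x y j k u v
  proof -
    have "shape_map (Double a x y j k u v) = double_map s a"
      unfolding shape_map.simps by (rule double_map_cong) (use that in auto)
    then show ?thesis using Double_perm[OF that(1), of s] that(2) by simp
  qed
  show "(\<forall>i\<in>G3. r i = 0) \<and> ((\<forall>i\<in>G3. shape_gaps ob i = shape_gaps ob' i) --> ob = ob')"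
  proof (cases ob)
    case T: (Triangle P Q u v w)
    have tp: "triangle_perm G3 nx3 pv3 s (\<lambda>_. 0) (shape_map ob) (int (length P)) (int (length Q)) (\<lambda>i. int (length (pick3 i u v w)))"
      unfolding T by (rule TP) (use ok len T in auto)
    show ?thesis
    proof (cases ob')
      case T': (Triangle P' Q' u' v' w')
      have tp': "triangle_perm G3 nx3 pv3 s (\<lambda>_. 0) (shape_map ob') (int (length P')) (int (length Q')) (\<lambda>i. int (length (pick3 i u' v' w')))"
        unfolding T' by (rule TP) (use ok len T' in auto)
      note rig = triangle_rigid[OF tp triangle_rotate[OF tp' off eq]]
      have "ob = ob'" if "\<forall>i\<in>G3. shape_gaps ob i = shape_gaps ob' i"
        unfolding T T' by (rule Triangle_eqI) (use rig that T T' in auto)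
      then show ?thesis using r0 rig(3) by blast
    next
      case D': (Double a x y j k u' v')
      have dp': "double_perm G3 a (nx3 a) (pv3 a) s (\<lambda>_. 0) (shape_map ob')"
        unfolding D' by (rule DP) (use ok len D' in auto)
      show ?thesis using triangle_not_double[OF tp double_rotate[OF dp' off eq]] by blast
    qed
  next
    case D: (Double a x y j k u v)
    have dp: "double_perm G3 a (nx3 a) (pv3 a) s (\<lambda>_. 0) (shape_map ob)"
      unfolding D by (rule DP) (use ok len D in auto)
    show ?thesis
    proof (cases ob')
      case T': (Triangle P' Q' u' v' w')
      have tp': "triangle_perm G3 nx3 pv3 s (\<lambda>_. 0) (shape_map ob') (int (length P')) (int (length Q')) (\<lambda>i. int (length (pick3 i u' v' w')))"
        unfolding T' by (rule TP) (use ok len T' in auto)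
      show ?thesis using triangle_not_double[OF triangle_rotate[OF tp' off eq] dp] by blast
    next
      case D': (Double a' x' y' j' k' u' v')
      have dp': "double_perm G3 a' (nx3 a') (pv3 a') s (\<lambda>_. 0) (shape_map ob')"
        unfolding D' by (rule DP) (use ok len D' in auto)
      note rig = double_rigid[OF dp double_rotate[OF dp' off eq] tri3]
      have "ob = ob'" if "\<forall>i\<in>G3. shape_gaps ob i = shape_gaps ob' i"
      proof -
        have a: "a \<in> G3" using ok(1) D by simp
        show ?thesis using Double_eqI[OF a, of x y j k u v x' y' j' k' u' v'] that rig(1) unfolding D D' by blast
      qed
      then show ?thesis using r0 rig(2) by blast
    qed
  qed
qed

section \<open>Weights as products over cycles\<close>

lemma prod_int_interval_list:
  assumes "\<And>j. j < length u ==> F (lo + int j) = g (u ! j)" and hi: "hi = lo + int (length u)"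
  shows "(\<Prod>k\<in>{lo..<hi}. F k) = prod_list (map g u)"
proof -
  have "{lo..<hi} = (\<lambda>j. lo + int j) ` {0..<length u}"
  proof (intro equalityI subsetI)
    fix k assume "k \<in> {lo..<hi}"
    then show "k \<in> (\<lambda>j. lo + int j) ` {0..<length u}" using hi by (intro image_eqI[of _ _ "nat (k - lo)"]) auto
  qed (use hi in auto)
  then have "(\<Prod>k\<in>{lo..<hi}. F k) = (\<Prod>j\<in>{0..<length u}. F (lo + int j))"
    by (simp add: prod.reindex inj_on_def)
  also have "\<dots> = (\<Prod>j\<in>{0..<length u}. g (u ! j))" using assms(1) by (intro prod.cong) auto
  also have "\<dots> = prod_list (map g u)" by (simp add: prod.list_conv_set_nth)
  finally show ?thesis .
qed

fun sum2 :: "nat \<times> nat => nat" where "sum2 (x, y) = x + y"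
fun sum3 :: "nat \<times> nat \<times> nat => nat" where "sum3 (x, y, z) = x + y + z"

definition pairs_weight :: "(nat => 'a::comm_ring_1) => (nat \<times> nat) list => 'a" where
  "pairs_weight w u = prod_list (map (w \<circ> sum2) u)"

text \<open>A single ladder, in the generality of all its uses: on \<open>i\<close> the rungs begin
  at position \<open>d\<close>, after what precedes them there, and on \<open>j\<close> they are
  counted from the end. The offsets \<open>lo\<close>, \<open>e\<close> and \<open>f\<close> match
  the differing label conventions.\<close>

lemma prod_rungs:
  assumes "i \<noteq> j"
    and i: "\<And>l. l < length u ==> d + l < length (g i) \<and> g i ! (d + l) = fst (u ! l)"
    and j: "\<And>l. l < length u ==> l < length (g j) \<and> rev (g j) ! l = snd (u ! l)"
    and lo: "int d = e + lo" and hi: "hi = lo + int (length u)" and f: "f = lo - 1"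
  shows "(\<Prod>k\<in>{lo..<hi}. w (\<Sum>b\<in>{pt0 (\<lambda>i. length (g i)) i (e + k), pt0 (\<lambda>i. length (g i)) j (f - k)}. g (fst b) ! snd b))
    = pairs_weight w u"
  unfolding pairs_weight_def
proof (rule prod_int_interval_list[OF _ hi])
  fix l assume l: "l < length u"
  let ?s = "\<lambda>i. length (g i)"
  have e: "e + (lo + int l) = int (d + l)" "f - (lo + int l) = - 1 - int l" using lo f by simp_all
  have p: "pt0 ?s i (int (d + l)) = (i, d + l)" "pt0 ?s j (- 1 - int l) = (j, ?s j - 1 - l)"
    by (rule pt_0, use i[OF l] in simp) (rule pt_0_neg, use j[OF l] in simp)
  have g: "g i ! (d + l) = fst (u ! l)" "g j ! (?s j - 1 - l) = snd (u ! l)"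
    using i[OF l] j[OF l] rev_nth[of l "g j"] by simp_all
  have "(\<Sum>b\<in>{(i, d + l), (j, ?s j - 1 - l)}. g (fst b) ! snd b) = g i ! (d + l) + g j ! (?s j - 1 - l)"
    using assms(1) by simp
  also have "\<dots> = sum2 (u ! l)" unfolding g by (cases "u ! l") simp
  finally show "w (\<Sum>b\<in>{pt0 ?s i (e + (lo + int l)), pt0 ?s j (f - (lo + int l))}. g (fst b) ! snd b) = (w \<circ> sum2) (u ! l)"
    unfolding e p by simp
qed

fun shape_weight :: "(nat => 'a::comm_ring_1) => shape => 'a" where
  "shape_weight w (Triangle P Q t u v) = prod_list (map (w \<circ> sum3) P) * prod_list (map (w \<circ> sum3) Q)
     * (pairs_weight w t * pairs_weight w u * pairs_weight w v)"
| "shape_weight w (Double a x y j k u v) =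
     w (x + y + j + k) * pairs_weight w u * pairs_weight w v"

lemma prod_shape:
  assumes ok: "shape_ok ob"
  shows "(\<Prod>V\<in>cyc (ground G3 (\<lambda>i. length (shape_gaps ob i))) (shape_map ob).
      w (\<Sum>b\<in>V. shape_gaps ob (fst b) ! snd b)) = shape_weight w ob"
proof (cases ob)
  case ob: (Triangle P Q t u v)
  let ?g = "shape_gaps ob" and ?k = "\<lambda>i. pick3 i t u v"
  let ?s = "\<lambda>i. length (?g i)"
  let ?h = "\<lambda>V. w (\<Sum>b\<in>V. ?g (fst b) ! snd b)"
  interpret T: triangle_perm G3 nx3 pv3 ?s "\<lambda>_. 0" "shape_map ob"
    "int (length P)" "int (length Q)" "\<lambda>i. int (length (?k i))"
    using Triangle_perm[OF ok[unfolded ob], of ?s] by (simp add: ob del: shape_gaps.simps)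
  have G: "1 \<in> G3" "2 \<in> G3" "3 \<in> G3" by (simp_all add: G3_def)
  have gi: "?g i = map (sel3 i) P @ map fst (?k i) @ map (sel3 i) Q @ rev (map snd (?k (pv3 i)))" for i by (simp add: ob)
  have "length P \<le> 1" "length Q \<le> 1" using ok ob by simp_all
  then have len: "length P = 0 \<or> length P = 1" "length Q = 0 \<or> length Q = 1" by linarith+
  have pairs: "(\<Prod>k\<in>{0..<int (length (?k i))}. ?h {pt0 ?s i (int (length P) + k),
       pt0 ?s (nx3 i) (int (length P) - int (length P) - 1 - k)}) = pairs_weight w (?k i)" if i: "i \<in> G3" for i
  proof (rule prod_rungs[where d = "length P"])
    note N = triD[OF tri3 i]
    show "i \<noteq> nx3 i" using N(5) by auto
    fix l assume l: "l < length (?k i)"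
    then show "length P + l < ?s i \<and> ?g i ! (length P + l) = fst (?k i ! l)" by (simp add: gi nth_append)
    show "l < ?s (nx3 i) \<and> rev (?g (nx3 i)) ! l = snd (?k i ! l)" using l N(4) by (simp add: gi nth_append)
  qed simp_all
  have tri: "?h ((\<lambda>i. (i, e i)) ` G3) = w (?g 1 ! e 1 + ?g 2 ! e 2 + ?g 3 ! e 3)" for e
  proof -
    have "(\<Sum>b\<in>(\<lambda>i. (i, e i)) ` G3. ?g (fst b) ! snd b) = (\<Sum>i\<in>G3. ?g i ! e i)"
      by (subst sum.reindex) (auto simp: inj_on_def)
    then show ?thesis by (simp add: G3_def add.assoc)
  qed
  have Z1: "(if int (length P) = 1 then ?h T.psi.Z1 else 1) = prod_list (map (w \<circ> sum3) P)"
  proof (cases "length P = 1")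
    case True
    then obtain a where P: "P = [a]" by (cases P) auto
    have "pt0 ?s i (int (length P) - 1) = (i, 0)" for i
      using pt_0[where s = ?s and i = i and e = 0] by (simp add: P gi)
    then have "T.psi.Z1 = (\<lambda>i. (i, 0)) ` G3" unfolding T.psi.Z1_def by simp
    then show ?thesis using tri[of "\<lambda>_. 0"] by (cases a) (simp add: P gi sel3_def pick3_def)
  qed (use len in simp)
  have Z2: "(if int (length Q) = 1 then ?h T.psi.Z2 else 1) = prod_list (map (w \<circ> sum3) Q)"
  proof (cases "length Q = 1")
    case True
    then obtain a where Q: "Q = [a]" by (cases Q) auto
    let ?e = "\<lambda>i. length P + length (?k i)"
    have "pt0 ?s i (int (length P) + int (length (?k i))) = (i, ?e i)" for i
      using pt_0[where s = ?s and i = i and e = "?e i"] by (simp add: Q gi)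
    then have Z: "T.psi.Z2 = (\<lambda>i. (i, ?e i)) ` G3" unfolding T.psi.Z2_def by simp
    have "?g i ! ?e i = sel3 i a" for i by (simp add: gi Q nth_append)
    then have "?h T.psi.Z2 = w (sel3 1 a + sel3 2 a + sel3 3 a)" unfolding Z tri by simp
    then show ?thesis by (cases a) (simp add: Q sel3_def pick3_def)
  qed (use len in simp)
  have "(\<Prod>i\<in>G3. pairs_weight w (?k i))
     = pairs_weight w t * pairs_weight w u * pairs_weight w v"
    by (simp add: G3_def pick3_def mult.assoc)
  then show ?thesis
    unfolding T.psi.prod_cycles Z1 Z2 using pairs by (simp add: ob mult_ac cong: prod.cong)
next
  case ob: (Double a x y j k u v)
  let ?g = "shape_gaps ob"
  let ?s = "\<lambda>i. length (?g i)" and ?b = "nx3 a" and ?c = "pv3 a"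
  let ?h = "\<lambda>V. w (\<Sum>b\<in>V. ?g (fst b) ! snd b)"
  interpret D: double_perm G3 a ?b ?c ?s "\<lambda>_. 0" "shape_map ob"
    using Double_perm[OF ok[unfolded ob], of ?s] by (simp add: ob del: shape_gaps.simps)
  have a: "a \<in> G3" using ok ob by simp
  note N = triD[OF tri3 a]
  have ga: "?g a = x # map fst u @ y # map fst v" and gb: "?g ?b = j # rev (map snd u)" and gc: "?g ?c = k # rev (map snd v)"
    using N by (simp_all add: ob)
  have p1: "(\<Prod>k\<in>{1..<int (?s ?b)}. ?h {pt0 ?s a k, pt0 ?s ?b (- k)}) = pairs_weight w u"
    using prod_rungs[where g = ?g and i = a and j = ?b and d = 1 and e = 0 and f = 0 and u = u and lo = 1 and w = w, OF D.dist(1) _ _ _ refl]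
    by (simp add: ga gb nth_append)
  have p2: "(\<Prod>k\<in>{1..<int (?s ?c)}. ?h {pt0 ?s a (int (?s ?b) + k), pt0 ?s ?c (- k)}) = pairs_weight w v"
    using prod_rungs[where g = ?g and i = a and j = ?c and d = "?s ?b + 1" and e = "int (?s ?b)" and f = 0 and u = v and lo = 1 and w = w, OF D.dist(2) _ _ _ refl]
    by (simp add: ga gb gc nth_append)
  have DD: "D.D = {(a, 0), (?b, 0), (a, ?s ?b), (?c, 0)}"
  proof -
    have "pt0 ?s i 0 = (i, 0)" if "0 < ?s i" for i using pt_0[where s = ?s, OF that] by simp
    moreover have "0 < ?s a" "0 < ?s ?b" "0 < ?s ?c" unfolding ga gb gc by simp_all
    moreover have "pt0 ?s a (int (?s ?b)) = (a, ?s ?b)" by (rule pt_0) (simp add: ga gb)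
    ultimately show ?thesis unfolding D.D_def by simp
  qed
  have sb: "?s ?b \<noteq> 0" by (simp add: gb)
  have vals: "?g a ! 0 = x" "?g a ! ?s ?b = y" "?g ?b ! 0 = j" "?g ?c ! 0 = k" by (simp_all add: ga gb gc nth_append)
  have "(\<Sum>b\<in>D.D. ?g (fst b) ! snd b) = x + y + j + k"
  proof -
    \<comment> \<open>The summands are reordered so that the two runs on the doubly visited vertex
      come first.\<close>
    have four: "(\<Sum>z\<in>{z1, z2, z3, z4}. F z) = F z1 + F z3 + F z2 + F z4"
      if "z1 \<noteq> z2" "z1 \<noteq> z3" "z1 \<noteq> z4" "z2 \<noteq> z3" "z2 \<noteq> z4" "z3 \<noteq> z4" for z1 z2 z3 z4 :: "nat \<times> nat" and F :: "nat \<times> nat => nat"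
      using that by simp
    have "(\<Sum>b\<in>D.D. ?g (fst b) ! snd b) = ?g a ! 0 + ?g a ! ?s ?b + ?g ?b ! 0 + ?g ?c ! 0"
      unfolding DD by (subst four) (use D.dist sb in simp_all)
    then show ?thesis unfolding vals .
  qed
  then show ?thesis
    unfolding D.prod_cycles p1 p2 by (simp add: ob mult_ac)
qed

section \<open>Cyclic ladders with a marked rung\<close>

text \<open>The head of \<open>u\<close> is the marked rung, which has label 0 on both vertices.
  Only the remaining rungs are reversed on the second vertex.\<close>

definition annular_gaps :: "nat => (nat \<times> nat) list => nat => nat list" where
  "annular_gaps b u i = (if i = b then map fst u else snd (hd u) # rev (map snd (tl u)))"

definition annular_map :: "nat => nat => (nat \<times> nat) list => nat \<times> nat => nat \<times> nat" where
  "annular_map b c u y = (if y \<in> ground {b, c} (\<lambda>_. length u)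
     then pt0 (\<lambda>_. length u) (if fst y = b then c else b) (- int (snd y)) else y)"

lemma annular_map_pt:
  assumes "i \<in> {b, c}" "0 < length u" "\<And>i. i \<in> {b, c} ==> s i = length u"
  shows "annular_map b c u (pt0 s i k) = pt0 s (if i = b then c else b) (- k)"
proof -
  have "pt0 s i k = (i, nat (k mod int (length u)))" using assms by (simp add: pt_def)
  moreover have "(i, nat (k mod int (length u))) \<in> ground {b, c} (\<lambda>_. length u)" using assms by (auto simp: nat_less_iff)
  moreover have "int (nat (k mod int (length u))) = k mod int (length u)" using assms(2) by simp
  ultimately show ?thesis using assms(3)[of b] assms(3)[of c] by (simp add: annular_map_def pt_def mod_minus_eq)
qed

lemma annular_perm_map:
  assumes "b \<noteq> c" "u \<noteq> []" "\<And>i. i \<in> {b, c} ==> s i = length u"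
  shows "annular_perm {b, c} b c s (\<lambda>_. 0) (annular_map b c u)"
proof
  have gr: "ground {b, c} s = ground {b, c} (\<lambda>_. length u)" by (rule ground_cong) (rule assms)
  show "annular_map b c u y = y" if "y \<notin> ground {b, c} s" for y using that unfolding gr by (simp add: annular_map_def)
  have l: "0 < length u" using assms by simp
  show "annular_map b c u (pt0 s b k) = pt0 s c (- k)" for k
    using annular_map_pt[where s = s and i = b, OF _ l assms(3)] by simp
  show "annular_map b c u (pt0 s c (- k)) = pt0 s b k" for k
    using annular_map_pt[where s = s and i = c and b = b and c = c and k = "- k", OF _ l assms(3)] assms(1) by simp
qed (use assms in auto)

lemma length_annular_gaps: "u \<noteq> [] ==> length (annular_gaps b u i) = length u"
  by (cases u) (simp_all add: annular_gaps_def)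

lemma pt_0_0: "0 < s i ==> pt0 s i 0 = (i, 0)"
  using pt_0[of 0 s i] by simp

text \<open>The mark is part of the problem, being the cycle attached to the blue vertex. Placed at
  label 0 on both vertices it makes the cyclic ladder rigid: a rotation that preserves the mark
  preserves the base points.\<close>

lemma annular_structures:
  assumes bc: "b \<noteq> c"
  shows "structures {b, c} ladders1 (annular_gaps b) (annular_map b c) (\<lambda>_. {(b, 0), (c, 0)}) True"
proof
  show "finite {b, c}" "2 \<le> card {b, c}" using bc by simp_all
  show "0 < a" if u: "u \<in> ladders1" and "i \<in> {b, c}" "a \<in> set (annular_gaps b u i)" for u i a
  proof -
    obtain z zs where "u = z # zs" using u by (cases u) auto
    then show ?thesis using that by (auto simp: annular_gaps_def list_all_iff pos2_def split: if_splits)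
  qed
  fix u :: "(nat \<times> nat) list" assume "u \<in> ladders1"
  then have u: "u \<noteq> []" by simp
  let ?s = "\<lambda>i. length (annular_gaps b u i)"
  interpret A: annular_perm "{b, c}" b c ?s "\<lambda>_. 0" "annular_map b c u"
    by (rule annular_perm_map[OF bc u]) (rule length_annular_gaps[OF u])
  show "reduced {b, c} ?s (annular_map b c u)" by (rule A.reduced_f)
  have "0 < ?s b" "0 < ?s c" using u by (simp_all add: length_annular_gaps)
  then show "{(b, 0), (c, 0)} \<in> markings True (ground {b, c} ?s) (annular_map b c u)"
    using A.mark_cycle by (simp add: markings_def pt_0_0)
next
  fix s \<psi> m
  assume s: "\<And>i. i \<in> {b, c} ==> 0 < s i" and red: "reduced {b, c} s \<psi>" and m: "m \<in> markings True (ground {b, c} s) \<psi>"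
  interpret R: reduced_perm "{b, c}" s \<psi> using s red by unfold_locales auto
  have "m \<in> cyc (ground {b, c} s) \<psi>" using m by (simp add: markings_def)
  from R.annular_classify[OF refl bc this] obtain r where r: "\<forall>i\<in>{b, c}. r i < s i" "s b = s c" "m = {pt s r b 0, pt s r c 0}"
    and F: "\<forall>k\<ge>0. \<psi> (pt s r b k) = pt s r c (- k)" "\<forall>k\<ge>0. \<psi> (pt s r c (- k)) = pt s r b k" by blast
  have sp: "0 < s b" "0 < s c" using s by simp_all
  have "\<exists>u\<in>ladders1. (\<forall>i\<in>{b, c}. annular_gaps b u i = g i)
      \<and> (\<forall>y\<in>ground {b, c} s. \<psi> (rot s r y) = rot s r (annular_map b c u y)) \<and> m = rot s r ` {(b, 0), (c, 0)}"
    if g: "\<forall>i\<in>{b, c}. length (g i) = s i \<and> (\<forall>a\<in>set (g i). 0 < a)" for g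
  proof -
    obtain j l where j: "g c = j # l" using g sp by (cases "g c") auto
    have lb: "length (g b) = Suc (length l)" using g r(2) j by simp
    define u where "u = zip (g b) (j # rev l)"
    have lu: "length u = s b" using g lb by (simp add: u_def)
    have u: "u \<noteq> []" using lu sp by auto
    have mf: "map fst u = g b" "map snd u = j # rev l" using lb by (simp_all add: u_def)
    have "0 < fst z \<and> 0 < snd z" if z: "z \<in> set u" for z
    proof -
      have "fst z \<in> set (map fst u)" "snd z \<in> set (map snd u)" using z by auto
      then have "fst z \<in> set (g b)" "snd z \<in> set (g c)" unfolding mf j by simp_all
      then show ?thesis using g by simp
    qed
    then have ok: "list_all pos2 u" by (simp add: list_all_iff pos2_def)
    have "snd (hd u) = j" "map snd (tl u) = rev l" using mf(2) u by (cases u; simp)+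
    then have gaps: "\<forall>i\<in>{b, c}. annular_gaps b u i = g i" using mf(1) bc j by (simp add: annular_gaps_def)
    have su: "s i = length u" if "i \<in> {b, c}" for i using that lu r(2) by auto
    have lu0: "0 < length u" using u by simp
    have pm: "annular_map b c u (pt0 s b k) = pt0 s c (- k)"
      "annular_map b c u (pt0 s c (- k)) = pt0 s b k" for k
      using annular_map_pt[where s = s and i = b, OF _ lu0 su] annular_map_pt[where s = s and i = c and b = b and c = c and k = "- k", OF _ lu0 su] bc
      by simp_all
    have rp: "rot s r (pt0 s b k) = pt s r b k" "rot s r (pt0 s c k) = pt s r c k" for k
      using rot_pt[where s = s] sp by blast+
    have "\<psi> (rot s r y) = rot s r (annular_map b c u y)" if y: "y \<in> ground {b, c} s" for y
    proof -
      consider "fst y = b" | "fst y = c" using y by (auto simp: ground_def)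
      then show ?thesis
      proof cases
        case 1
        obtain k where "0 \<le> k" "y = pt0 s b k" using pt_surj[OF y] 1 by metis
        then show ?thesis using pm rp F by simp
      next
        case 2
        obtain k where k: "y = pt0 s c k" "- int (s c) + 1 \<le> k" "k < - int (s c) + 1 + int (s c)"
          using pt_surj_from[OF y, of "- int (s c) + 1" "\<lambda>_. 0"] 2 by metis
        then have "y = pt0 s c (- (- k))" "0 \<le> - k" by simp_all
        then show ?thesis using pm rp F by metis
      qed
    qed
    moreover have "rot s r ` {(b, 0), (c, 0)} = m"
      using rp(1)[of 0] rp(2)[of 0] sp unfolding r(3) by (simp add: pt_0_0)
    ultimately show ?thesis using u ok gaps by blast
  qed
  then show "\<exists>r. (\<forall>i\<in>{b, c}. r i < s i) \<and> (\<forall>g. (\<forall>i\<in>{b, c}. length (g i) = s i \<and> (\<forall>a\<in>set (g i). 0 < a)) -->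
      (\<exists>u\<in>ladders1. (\<forall>i\<in>{b, c}. annular_gaps b u i = g i)
        \<and> (\<forall>y\<in>ground {b, c} s. \<psi> (rot s r y) = rot s r (annular_map b c u y)) \<and> m = rot s r ` {(b, 0), (c, 0)}))"
    using r(1) by blast
next
  fix u u' :: "(nat \<times> nat) list" and s r
  assume u: "u \<in> ladders1" "u' \<in> ladders1"
    and r: "\<And>i. i \<in> {b, c} ==> r i < s i" and eq: "{(b, 0), (c, 0)} = rot s r ` {(b, 0), (c, 0 :: nat)}"
  have "rot s r ` {(b, 0), (c, 0)} = {(b, r b), (c, r c)}" using r by (simp add: rot_def)
  then have "{(b, 0), (c, 0)} = {(b, r b), (c, r c)}" using eq by simp
  then have "(b, r b) \<in> {(b, 0), (c, 0)}" "(c, r c) \<in> {(b, 0), (c, 0)}" by blast+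
  then have r0: "\<forall>i\<in>{b, c}. r i = 0" using bc by auto
  have "u = u'" if g: "\<forall>i\<in>{b, c}. annular_gaps b u i = annular_gaps b u' i"
  proof -
    obtain z zs z' zs' where e: "u = z # zs" "u' = z' # zs'" using u by (cases u; cases u') auto
    have "map fst u = map fst u'" using g by (simp add: annular_gaps_def)
    moreover have "map snd u = map snd u'" using g bc by (simp add: annular_gaps_def e)
    ultimately show ?thesis by (rule pair_list_eq)
  qed
  then show "(\<forall>i\<in>{b, c}. r i = 0) \<and> ((\<forall>i\<in>{b, c}. annular_gaps b u i = annular_gaps b u' i) --> u = u')"
    using r0 by blast
qed

lemma annular_weights:
  assumes bc: "b \<noteq> c" and u: "u \<noteq> []"
  shows "(\<Sum>y\<in>{(b, 0), (c, 0)}. annular_gaps b u (fst y) ! snd y) = sum2 (hd u)"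
    and "(\<Prod>V\<in>cyc (ground {b, c} (\<lambda>i. length (annular_gaps b u i))) (annular_map b c u) - {{(b, 0), (c, 0)}}.
      w (\<Sum>y\<in>V. annular_gaps b u (fst y) ! snd y)) = pairs_weight w (tl u)"
proof -
  obtain z zs where z: "u = z # zs" using u by (cases u) auto
  let ?g = "annular_gaps b u"
  let ?s = "\<lambda>i. length (?g i)"
  have gb: "?g b = map fst u" and gc: "?g c = snd z # rev (map snd zs)" using bc by (simp_all add: annular_gaps_def z)
  show "(\<Sum>y\<in>{(b, 0), (c, 0)}. ?g (fst y) ! snd y) = sum2 (hd u)"
  proof -
    have "?g b ! 0 = fst z" "?g c ! 0 = snd z" unfolding gb gc by (simp_all add: z)
    then show ?thesis using bc by (cases z) (simp add: z)
  qed
  interpret A: annular_perm "{b, c}" b c ?s "\<lambda>_. 0" "annular_map b c u"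
    by (rule annular_perm_map[OF bc u]) (rule length_annular_gaps[OF u])
  let ?h = "\<lambda>V. w (\<Sum>b\<in>V. ?g (fst b) ! snd b)"
  have "0 < ?s b" "0 < ?s c" using u by (simp_all add: length_annular_gaps)
  then have mk: "{(b, 0), (c, 0)} = {pt0 ?s b 0, pt0 ?s c 0}" by (simp add: pt_0_0)
  have "(\<Prod>k\<in>{1..<int (?s b)}. ?h {pt0 ?s b k, pt0 ?s c (- k)}) = pairs_weight w zs"
    using prod_rungs[where g = ?g and i = b and j = c and d = 1 and e = 0 and f = 0 and u = zs and lo = 1 and w = w, OF bc _ _ _ refl]
    unfolding gb gc by (simp add: z nth_append)
  then show "(\<Prod>V\<in>cyc (ground {b, c} ?s) (annular_map b c u) - {{(b, 0), (c, 0)}}. ?h V) = pairs_weight w (tl u)"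
    unfolding mk A.prod_cycles by (simp add: z)
qed

section \<open>Generating series\<close>

definition fps3 :: "((nat => nat) => 'a::zero) => 'a fps3" where
  "fps3 f = Abs_fps (\<lambda>a. Abs_fps (\<lambda>b. Abs_fps (\<lambda>c. f ((\<lambda>_. 0)(1 := a, 2 := b, 3 := c)))))"

definition coeff3 :: "'a::zero fps3 => (nat => nat) => 'a" where
  "coeff3 F \<mu> = fps_nth (fps_nth (fps_nth F (\<mu> 1)) (\<mu> 2)) (\<mu> 3)"

text \<open>Only these exponent vectors name monomials in three variables. Coefficient functions
  live on all of \<open>nat \<Rightarrow> nat\<close>, so comparisons are restricted to
  them.\<close>

definition supp3 :: "(nat => nat) => bool" where "supp3 \<mu> \<longleftrightarrow> (\<forall>i. i \<notin> G3 --> \<mu> i = 0)"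

lemma ser_eq: "ser f = to_fract (fps3 f)"
  by (simp add: ser_def fps3_def)

lemma supp3_upd: "supp3 \<mu> ==> i \<in> G3 ==> supp3 (\<mu>(i := n))"
  by (auto simp: supp3_def)

lemma supp3_cong: "supp3 \<mu> ==> supp3 \<nu> ==> (\<And>i. i \<in> G3 ==> \<mu> i = \<nu> i) ==> \<mu> = \<nu>"
  by (auto simp: supp3_def fun_eq_iff) metis

lemma supp3_vec: "supp3 ((\<lambda>_. 0)(1 := a, 2 := b, 3 := c))"
  by (auto simp: supp3_def G3_def)

lemma coeff3_fps3: assumes "supp3 \<mu>" shows "coeff3 (fps3 f) \<mu> = f \<mu>"
proof -
  have "(\<lambda>_. 0)(1 := \<mu> 1, 2 := \<mu> 2, 3 := \<mu> 3) = \<mu>"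
    by (rule supp3_cong[OF supp3_vec assms]) (auto simp: G3_def)
  then show ?thesis by (simp add: coeff3_def fps3_def)
qed

lemma coeff3_cong: "(\<And>i. i \<in> G3 ==> \<mu> i = \<nu> i) ==> coeff3 F \<mu> = coeff3 F \<nu>"
  by (simp add: coeff3_def G3_def)

lemma fps3_eqI: assumes "\<And>\<mu>. supp3 \<mu> ==> coeff3 F \<mu> = coeff3 G \<mu>" shows "F = G"
proof (intro fps_ext)
  fix a b c
  show "fps_nth (fps_nth (fps_nth F a) b) c = fps_nth (fps_nth (fps_nth G a) b) c"
    using assms[OF supp3_vec, of a b c] by (simp add: coeff3_def)
qed

lemma coeff3_simps [simp]:
  "coeff3 (F + G) \<mu> = coeff3 F \<mu> + coeff3 G \<mu>"
  "coeff3 (H - K) \<mu> = coeff3 H \<mu> - coeff3 K \<mu>"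
  "coeff3 0 \<mu> = 0"
  for F G :: "'a::comm_ring_1 fps3" and H K :: "'a::comm_ring_1 fps3"
  by (simp_all add: coeff3_def)

lemma coeff3_1: "coeff3 (1 :: 'a::comm_ring_1 fps3) \<mu> = (if \<forall>i\<in>G3. \<mu> i = 0 then 1 else 0)"
  by (simp add: coeff3_def G3_def)

definition var3 :: "nat => 'a::comm_ring_1 fps3" where
  "var3 i = fps3 (\<lambda>\<mu>. if \<mu> = (\<lambda>_. 0)(i := 1) then 1 else 0)"

lemma Y_eq: "Y i = to_fract (var3 i)"
  by (simp add: Y_def ser_eq var3_def)

lemma var3_eq:
  "var3 1 = (fps_X :: 'a fps3)" "var3 2 = (fps_const fps_X :: 'a fps3)" "var3 3 = fps_const (fps_const (fps_X :: 'a::comm_ring_1 fps))"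
proof -
  have e: "\<mu> = (\<lambda>_. 0)(i := 1) \<longleftrightarrow> (\<forall>j\<in>G3. \<mu> j = (if j = i then 1 else 0))" if "supp3 \<mu>" "i \<in> G3" for \<mu> i
  proof
    assume "\<forall>j\<in>G3. \<mu> j = (if j = i then 1 else 0)"
    then show "\<mu> = (\<lambda>_. 0)(i := 1)" using that by (intro supp3_cong[OF that(1)]) (auto simp: supp3_def)
  qed auto
  show "var3 1 = (fps_X :: 'a fps3)"
  proof (rule fps3_eqI)
    fix \<mu> assume s: "supp3 \<mu>"
    show "coeff3 (var3 1) \<mu> = coeff3 (fps_X :: 'a fps3) \<mu>"
      using e[OF s, of 1] unfolding var3_def coeff3_fps3[OF s] by (auto simp: coeff3_def G3_def fps_X_def)
  qed
  show "var3 2 = (fps_const fps_X :: 'a fps3)"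
  proof (rule fps3_eqI)
    fix \<mu> assume s: "supp3 \<mu>"
    show "coeff3 (var3 2) \<mu> = coeff3 (fps_const fps_X :: 'a fps3) \<mu>"
      using e[OF s, of 2] unfolding var3_def coeff3_fps3[OF s] by (auto simp: coeff3_def G3_def fps_X_def)
  qed
  show "var3 3 = (fps_const (fps_const fps_X) :: 'a fps3)"
  proof (rule fps3_eqI)
    fix \<mu> assume s: "supp3 \<mu>"
    show "coeff3 (var3 3) \<mu> = coeff3 (fps_const (fps_const fps_X) :: 'a fps3) \<mu>"
      using e[OF s, of 3] unfolding var3_def coeff3_fps3[OF s] by (auto simp: coeff3_def G3_def fps_X_def)
  qed
qed

lemma coeff3_var3_mult:
  fixes F :: "'a::comm_ring_1 fps3"
  assumes "i \<in> G3"
  shows "coeff3 (var3 i * F) \<mu> = (if \<mu> i = 0 then 0 else coeff3 F (\<mu>(i := \<mu> i - 1)))"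
proof -
  have "i = 1 \<or> i = 2 \<or> i = 3" using assms by (auto simp: G3_def)
  then show ?thesis
  proof (elim disjE)
    assume "i = 1" then show ?thesis by (simp add: coeff3_def var3_eq(1)[unfolded One_nat_def])
  next
    assume "i = 2" then show ?thesis by (simp add: coeff3_def var3_eq(2))
  next
    assume "i = 3" then show ?thesis by (simp add: coeff3_def var3_eq(3))
  qed
qed

lemma coeff3_deriv:
  fixes F :: "'a::comm_ring_1 fps3"
  assumes "i \<in> G3"
  shows "coeff3 (fps3_deriv i F) \<mu> = of_nat (\<mu> i + 1) * coeff3 F (\<mu>(i := \<mu> i + 1))"
proof -
  have "i = 1 \<or> i = 2 \<or> i = 3" using assms by (auto simp: G3_def)
  then show ?thesis
  proof (elim disjE)
    assume i: "i = 1"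
    have "fps_nth (fps_nth (of_nat n * G) k) l = of_nat n * fps_nth (fps_nth G k) l" for n k l and G :: "'a fps fps"
      by (simp add: fps_mult_of_nat_nth)
    then show ?thesis using i by (simp add: coeff3_def fps3_deriv_def del: of_nat_Suc of_nat_add)
  next
    assume i: "i = 2"
    have "fps_nth (of_nat n * G) k = of_nat n * fps_nth G k" for n k and G :: "'a fps"
      by (simp add: fps_mult_of_nat_nth)
    then show ?thesis using i by (simp add: coeff3_def fps3_deriv_def del: of_nat_Suc of_nat_add)
  next
    assume "i = 3" then show ?thesis by (simp add: coeff3_def fps3_deriv_def del: of_nat_Suc of_nat_add)
  qed
qed

lemma deriv_1: "fps3_deriv i 1 = (0 :: 'a::comm_ring_1 fps3)"
  using fps3_deriv_mult[of i 1 1] by simp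

lemma partial_to_fract: "partial i (to_fract F) = to_fract (fps3_deriv i (F :: 'a::idom fps3))"
  using partial_Fract[of 1 i F] by (simp add: to_fract_def deriv_1)

lemma deriv_var3: assumes "i \<in> G3" shows "fps3_deriv i (var3 i) = (1 :: 'a::comm_ring_1 fps3)"
proof (rule fps3_eqI)
  fix \<mu> assume s: "supp3 \<mu>"
  have s': "supp3 (\<mu>(i := \<mu> i + 1))" by (rule supp3_upd[OF s assms])
  have "\<mu>(i := \<mu> i + 1) = (\<lambda>_. 0)(i := 1) \<longleftrightarrow> (\<forall>j\<in>G3. \<mu> j = 0)"
  proof
    assume e: "\<mu>(i := \<mu> i + 1) = (\<lambda>_. 0)(i := 1)"
    have "\<mu> j = 0" for j using fun_cong[OF e, of j] by (cases "j = i") auto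
    then show "\<forall>j\<in>G3. \<mu> j = 0" by blast
  next
    assume "\<forall>j\<in>G3. \<mu> j = 0"
    then have "\<mu> j = 0" for j using s by (cases "j \<in> G3") (auto simp: supp3_def)
    then show "\<mu>(i := \<mu> i + 1) = (\<lambda>_. 0)(i := 1)" by auto
  qed
  then show "coeff3 (fps3_deriv i (var3 i)) \<mu> = coeff3 (1 :: 'a fps3) \<mu>"
    unfolding coeff3_deriv[OF assms] var3_def coeff3_fps3[OF s'] coeff3_1 using assms by simp
qed

lemma var3_nonzero: "i \<in> G3 ==> var3 i \<noteq> (0 :: 'a::comm_ring_1 fps3)"
  using deriv_var3[of i, where 'a = 'a] coeff3_deriv[of i "0 :: 'a fps3" "\<lambda>_. 0"] coeff3_1[of "\<lambda>_. 0", where 'a = 'a] by auto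

lemma var3_inj: assumes "b \<in> G3" "c \<in> G3" "b \<noteq> c" shows "var3 b - var3 c \<noteq> (0 :: 'a::comm_ring_1 fps3)"
proof
  assume 0: "var3 b - var3 c = (0 :: 'a fps3)"
  have s: "supp3 ((\<lambda>_. 0)(b := 1))" using assms by (auto simp: supp3_def)
  have ne: "(\<lambda>_. 0 :: nat)(b := 1) \<noteq> (\<lambda>_. 0)(c := 1)" using assms by (auto dest: fun_cong[of _ _ b])
  have "coeff3 (var3 b - var3 c) ((\<lambda>_. 0)(b := 1)) = (1 :: 'a)"
    using ne unfolding coeff3_simps var3_def coeff3_fps3[OF s] by simp
  then show False using 0 by simp
qed

section \<open>Generating functions of sets of objects with sizes\<close>

definition gf :: "'o set => ('o => nat => nat) => ('o => 'a::comm_ring_1) => 'a fps3" where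
  "gf A sz w = fps3 (\<lambda>\<mu>. \<Sum>ob\<in>{ob \<in> A. \<forall>i\<in>G3. sz ob i = \<mu> i}. w ob)"

text \<open>A sum over infinitely many objects would be 0 by convention, which would spoil the
  splitting of sums; hence this side condition.\<close>

definition finite_sizes :: "'o set => ('o => nat => nat) => bool" where
  "finite_sizes A sz \<longleftrightarrow> (\<forall>\<mu>. finite {ob \<in> A. \<forall>i\<in>G3. sz ob i = \<mu> i})"

lemma coeff3_gf: "coeff3 (gf A sz w) \<mu> = (\<Sum>ob\<in>{ob \<in> A. \<forall>i\<in>G3. sz ob i = \<mu> i}. w ob)"
  by (simp add: coeff3_def gf_def fps3_def G3_def)

lemma coeff3_mult:
  fixes F K :: "'a::comm_ring_1 fps3"
  shows "coeff3 (F * K) \<mu> = (\<Sum>(i, j, k)\<in>{..\<mu> 1} \<times> {..\<mu> 2} \<times> {..\<mu> 3}.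
      coeff3 F (\<lambda>l. pick3 l i j k) * coeff3 K (\<lambda>l. \<mu> l - pick3 l i j k))"
proof -
  have e: "{..\<mu> 1} \<times> {..\<mu> 2} \<times> {..\<mu> 3} = {0..\<mu> 1} \<times> {0..\<mu> 2} \<times> {0..\<mu> 3}" by (simp add: atMost_atLeast0)
  show ?thesis
    unfolding e sum.cartesian_product[symmetric]
    by (simp add: coeff3_def fps_mult_nth fps_sum_nth pick3_def)
qed

lemma finite_sizes_Times:
  assumes "finite_sizes A s" "finite_sizes B t"
  shows "finite_sizes (A \<times> B) (\<lambda>(a, b) i. s a i + t b i)"
  unfolding finite_sizes_def
proof
  fix \<mu> :: "nat => nat"
  let ?I = "{..\<mu> 1} \<times> {..\<mu> 2} \<times> {..\<mu> 3}"
  let ?A = "\<lambda>(i, j, k). {a \<in> A. \<forall>l\<in>G3. s a l = pick3 l i j k}" and ?B = "\<lambda>(i, j, k). {b \<in> B. \<forall>l\<in>G3. t b l = pick3 l i j k}"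
  have "{ob \<in> A \<times> B. \<forall>i\<in>G3. (case ob of (a, b) => \<lambda>i. s a i + t b i) i = \<mu> i} \<subseteq> (\<Union>p\<in>?I. ?A p) \<times> (\<Union>p\<in>?I. ?B p)"
  proof (clarify, intro conjI SigmaI)
    fix a b assume ab: "a \<in> A" "b \<in> B" and e: "\<forall>i\<in>G3. s a i + t b i = \<mu> i"
    show "a \<in> (\<Union>p\<in>?I. ?A p)" using ab e by (intro UN_I[of "(s a 1, s a 2, s a 3)"]) (auto simp: G3_def pick3_def)
    show "b \<in> (\<Union>p\<in>?I. ?B p)" using ab e by (intro UN_I[of "(t b 1, t b 2, t b 3)"]) (auto simp: G3_def pick3_def)
  qed
  moreover have "finite (\<Union>p\<in>?I. ?A p)" "finite (\<Union>p\<in>?I. ?B p)"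
    using assms by (auto simp: finite_sizes_def)
  ultimately show "finite {ob \<in> A \<times> B. \<forall>i\<in>G3. (case ob of (a, b) => \<lambda>i. s a i + t b i) i = \<mu> i}"
    by (meson finite_SigmaI finite_subset)
qed

text \<open>Grouping the pairs by the size of their first component gives the convolution of
  coefficients.\<close>

lemma gf_Times:
  assumes fA: "finite_sizes A s" and fB: "finite_sizes B t"
  shows "gf (A \<times> B) (\<lambda>(a, b) i. s a i + t b i) (\<lambda>(a, b). u a * v b) = gf A s u * gf B t v"
proof (rule fps3_eqI)
  fix \<mu> :: "nat => nat"
  let ?I = "{..\<mu> 1} \<times> {..\<mu> 2} \<times> {..\<mu> 3}"
  let ?T = "{ob \<in> A \<times> B. \<forall>i\<in>G3. (case ob of (a, b) => \<lambda>i. s a i + t b i) i = \<mu> i}"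
  let ?h = "\<lambda>ob. (s (fst ob) 1, s (fst ob) 2, s (fst ob) 3)"
  let ?A = "\<lambda>\<mu>. {a \<in> A. \<forall>l\<in>G3. s a l = \<mu> l}" and ?B = "\<lambda>\<mu>. {b \<in> B. \<forall>l\<in>G3. t b l = \<mu> l}"
  have finT: "finite ?T" using finite_sizes_Times[OF fA fB] by (simp add: finite_sizes_def)
  have hI: "?h ` ?T \<subseteq> ?I" by (fastforce simp: G3_def)
  have "coeff3 (gf (A \<times> B) (\<lambda>(a, b) i. s a i + t b i) (\<lambda>(a, b). u a * v b)) \<mu>
      = (\<Sum>p\<in>?I. \<Sum>ob\<in>{ob \<in> ?T. ?h ob = p}. (case ob of (a, b) => u a * v b))"
    unfolding coeff3_gf by (rule sum.group[symmetric, OF finT _ hI]) simp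
  also have "\<dots> = (\<Sum>(i, j, k)\<in>?I. (\<Sum>a\<in>?A (\<lambda>l. pick3 l i j k). u a) * (\<Sum>b\<in>?B (\<lambda>l. \<mu> l - pick3 l i j k). v b))"
  proof (rule sum.cong[OF refl])
    fix p assume pI: "p \<in> ?I"
    obtain i j k where p: "p = (i, j, k)" by (cases p)
    have le: "i \<in> {..\<mu> 1}" "j \<in> {..\<mu> 2}" "k \<in> {..\<mu> 3}" using pI p by auto
    have "{ob \<in> ?T. ?h ob = (i, j, k)} = ?A (\<lambda>l. pick3 l i j k) \<times> ?B (\<lambda>l. \<mu> l - pick3 l i j k)"
      using le by (auto simp: G3_def pick3_def)
    then show "(\<Sum>ob\<in>{ob \<in> ?T. ?h ob = p}. (case ob of (a, b) => u a * v b))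
       = (case p of (i, j, k) => (\<Sum>a\<in>?A (\<lambda>l. pick3 l i j k). u a) * (\<Sum>b\<in>?B (\<lambda>l. \<mu> l - pick3 l i j k). v b))"
      unfolding p by (simp add: sum_product sum.cartesian_product)
  qed
  also have "\<dots> = coeff3 (gf A s u * gf B t v) \<mu>"
    unfolding coeff3_mult coeff3_gf ..
  finally show "coeff3 (gf (A \<times> B) (\<lambda>(a, b) i. s a i + t b i) (\<lambda>(a, b). u a * v b)) \<mu> = coeff3 (gf A s u * gf B t v) \<mu>" .
qed

lemma gf_cong:
  assumes "\<And>ob i. ob \<in> A ==> i \<in> G3 ==> s ob i = t ob i" "\<And>ob. ob \<in> A ==> w ob = w' ob"
  shows "gf A s w = gf A t w'"
proof (rule fps3_eqI)
  fix \<mu>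
  have "{ob \<in> A. \<forall>i\<in>G3. s ob i = \<mu> i} = {ob \<in> A. \<forall>i\<in>G3. t ob i = \<mu> i}" using assms(1) by auto
  then show "coeff3 (gf A s w) \<mu> = coeff3 (gf A t w') \<mu>"
    unfolding coeff3_gf using assms(2) by (auto intro: sum.cong)
qed

lemma gf_image:
  assumes "inj_on h A"
  shows "gf (h ` A) s w = gf A (\<lambda>a. s (h a)) (\<lambda>a. w (h a))"
proof (rule fps3_eqI)
  fix \<mu>
  have "{ob \<in> h ` A. \<forall>i\<in>G3. s ob i = \<mu> i} = h ` {a \<in> A. \<forall>i\<in>G3. s (h a) i = \<mu> i}" by auto
  moreover have "inj_on h {a \<in> A. \<forall>i\<in>G3. s (h a) i = \<mu> i}" using assms by (rule inj_on_subset) auto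
  ultimately show "coeff3 (gf (h ` A) s w) \<mu> = coeff3 (gf A (\<lambda>a. s (h a)) (\<lambda>a. w (h a))) \<mu>"
    unfolding coeff3_gf by (simp add: sum.reindex)
qed

lemma finite_sizes_image:
  assumes "finite_sizes A (\<lambda>a. s (h a))" shows "finite_sizes (h ` A) s"
proof -
  have "{ob \<in> h ` A. \<forall>i\<in>G3. s ob i = \<mu> i} = h ` {a \<in> A. \<forall>i\<in>G3. s (h a) i = \<mu> i}" for \<mu> by auto
  then show ?thesis using assms by (simp add: finite_sizes_def)
qed

lemma finite_sizes_cong:
  assumes "\<And>ob i. ob \<in> A ==> i \<in> G3 ==> s ob i = t ob i" "finite_sizes A s"
  shows "finite_sizes A t"
proof -
  have "{ob \<in> A. \<forall>i\<in>G3. s ob i = \<mu> i} = {ob \<in> A. \<forall>i\<in>G3. t ob i = \<mu> i}" for \<mu> using assms(1) by auto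
  then show ?thesis using assms(2) by (simp add: finite_sizes_def)
qed

lemma finite_sizes_subset: assumes "finite_sizes A s" "B \<subseteq> A" shows "finite_sizes B s"
  unfolding finite_sizes_def
proof
  fix \<mu> :: "nat => nat"
  have "{ob \<in> B. \<forall>i\<in>G3. s ob i = \<mu> i} \<subseteq> {ob \<in> A. \<forall>i\<in>G3. s ob i = \<mu> i}" using assms(2) by blast
  then show "finite {ob \<in> B. \<forall>i\<in>G3. s ob i = \<mu> i}" using assms(1) unfolding finite_sizes_def using finite_subset by blast
qed

lemma finite_sizes_Un: "finite_sizes A s ==> finite_sizes B s ==> finite_sizes (A \<union> B) s"
proof -
  have "{ob \<in> A \<union> B. \<forall>i\<in>G3. s ob i = \<mu> i} = {ob \<in> A. \<forall>i\<in>G3. s ob i = \<mu> i} \<union> {ob \<in> B. \<forall>i\<in>G3. s ob i = \<mu> i}" for \<mu> by auto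
  then show "finite_sizes A s ==> finite_sizes B s ==> finite_sizes (A \<union> B) s" by (simp add: finite_sizes_def)
qed

lemma finite_sizes_finite: "finite A ==> finite_sizes A s"
  by (simp add: finite_sizes_def)

lemma gf_Un:
  assumes "finite_sizes A s" "finite_sizes B s" "A \<inter> B = {}"
  shows "gf (A \<union> B) s w = gf A s w + gf B s w"
proof (rule fps3_eqI)
  fix \<mu>
  have "{ob \<in> A \<union> B. \<forall>i\<in>G3. s ob i = \<mu> i} = {ob \<in> A. \<forall>i\<in>G3. s ob i = \<mu> i} \<union> {ob \<in> B. \<forall>i\<in>G3. s ob i = \<mu> i}" by auto
  then show "coeff3 (gf (A \<union> B) s w) \<mu> = coeff3 (gf A s w + gf B s w) \<mu>"
    using assms unfolding coeff3_gf coeff3_simps by (subst sum.union_disjoint[symmetric]) (auto simp: finite_sizes_def)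
qed

lemma gf_Diff:
  assumes "finite_sizes A s" "B \<subseteq> A"
  shows "gf (A - B) s w = gf A s w - gf B s w"
proof -
  have "gf (B \<union> (A - B)) s w = gf B s w + gf (A - B) s w"
    using assms finite_sizes_subset[OF assms(1)] by (intro gf_Un) auto
  moreover have "B \<union> (A - B) = A" using assms(2) by blast
  ultimately show ?thesis by simp
qed

lemma gf_empty_object:
  assumes "\<And>i. i \<in> G3 ==> s x i = 0" shows "gf {x} s w = fps_const (fps_const (fps_const (w x)))"
proof (rule fps3_eqI)
  fix \<mu>
  have "{ob \<in> {x}. \<forall>i\<in>G3. s ob i = \<mu> i} = (if \<forall>i\<in>G3. \<mu> i = 0 then {x} else {})" using assms by auto
  then show "coeff3 (gf {x} s w) \<mu> = coeff3 (fps_const (fps_const (fps_const (w x)))) \<mu>"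
    unfolding coeff3_gf by (simp add: coeff3_def G3_def)
qed

definition pair_size :: "nat => nat => nat \<times> nat => nat => nat" where
  "pair_size b c t i = (if i = b then fst t else 0) + (if i = c then snd t else 0)"

definition pairs_size :: "nat => nat => (nat \<times> nat) list => nat => nat" where
  "pairs_size b c u i = (\<Sum>t\<leftarrow>u. pair_size b c t i)"

definition gf2 :: "(nat => 'a::comm_ring_1) => nat => nat => 'a fps3" where
  "gf2 w b c = gf {t. pos2 t} (pair_size b c) (w \<circ> sum2)"

definition gf2_lists :: "(nat => 'a::comm_ring_1) => nat => nat => 'a fps3" where
  "gf2_lists w b c = gf ladders (pairs_size b c) (pairs_weight w)"

lemma pair_set:
  assumes "b \<in> G3" "c \<in> G3" "b \<noteq> c"
  shows "{t \<in> {t. pos2 t}. \<forall>i\<in>G3. pair_size b c t i = \<mu> i}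
    = (if 0 < \<mu> b \<and> 0 < \<mu> c \<and> (\<forall>i\<in>G3 - {b, c}. \<mu> i = 0) then {(\<mu> b, \<mu> c)} else {})"
proof -
  have "pos2 t \<and> (\<forall>i\<in>G3. pair_size b c t i = \<mu> i) \<longleftrightarrow>
     t = (\<mu> b, \<mu> c) \<and> 0 < \<mu> b \<and> 0 < \<mu> c \<and> (\<forall>i\<in>G3 - {b, c}. \<mu> i = 0)" for t
  proof
    assume t: "pos2 t \<and> (\<forall>i\<in>G3. pair_size b c t i = \<mu> i)"
    then have "pair_size b c t b = \<mu> b" "pair_size b c t c = \<mu> c" using assms by auto
    then have "fst t = \<mu> b" "snd t = \<mu> c" using assms by (simp_all add: pair_size_def)
    moreover have "\<mu> i = 0" if "i \<in> G3 - {b, c}" for i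
    proof -
      have "pair_size b c t i = \<mu> i" using t that by blast
      then show ?thesis using that by (simp add: pair_size_def)
    qed
    ultimately show "t = (\<mu> b, \<mu> c) \<and> 0 < \<mu> b \<and> 0 < \<mu> c \<and> (\<forall>i\<in>G3 - {b, c}. \<mu> i = 0)"
      using t by (auto simp: pos2_def prod_eq_iff)
  qed (use assms in \<open>auto simp: pair_size_def pos2_def\<close>)
  then show ?thesis by auto
qed

lemma finite_sizes_pair: "b \<in> G3 ==> c \<in> G3 ==> b \<noteq> c ==> finite_sizes {t. pos2 t} (pair_size b c)"
  unfolding finite_sizes_def using pair_set[of b c] by simp

lemma coeff3_gf2:
  assumes "b \<in> G3" "c \<in> G3" "b \<noteq> c"
  shows "coeff3 (gf2 w b c) \<mu> = (if 0 < \<mu> b \<and> 0 < \<mu> c \<and> (\<forall>i\<in>G3 - {b, c}. \<mu> i = 0) then w (\<mu> b + \<mu> c) else 0)"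
  unfolding gf2_def coeff3_gf pair_set[OF assms] by simp

lemma gf2_commute: "b \<in> G3 ==> c \<in> G3 ==> b \<noteq> c ==> gf2 w b c = gf2 w c b"
  by (rule fps3_eqI) (simp add: coeff3_gf2 insert_commute add.commute conj_ac)

text \<open>All entries are positive, so the total size bounds both the length of the list and its
  entries.\<close>

lemma finite_sizes_pairs:
  assumes "b \<in> G3" "c \<in> G3" "b \<noteq> c"
  shows "finite_sizes ladders (pairs_size b c)"
  unfolding finite_sizes_def
proof
  fix \<mu> :: "nat => nat"
  let ?N = "\<mu> b + \<mu> c"
  have "u \<in> {u. set u \<subseteq> {..?N} \<times> {..?N} \<and> length u \<le> ?N}" if "list_all pos2 u \<and> (\<forall>i\<in>G3. pairs_size b c u i = \<mu> i)" for u
  proof -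
    have b: "(\<Sum>t\<leftarrow>u. fst t) = \<mu> b" "(\<Sum>t\<leftarrow>u. snd t) = \<mu> c"
      using that assms by (auto simp: pairs_size_def pair_size_def)
    have "list_all pos2 u" using that by blast
    then have "length u \<le> (\<Sum>t\<leftarrow>u. fst t)" by (induction u) (auto simp: pos2_def)
    moreover have "fst t \<le> (\<Sum>t\<leftarrow>u. fst t)" "snd t \<le> (\<Sum>t\<leftarrow>u. snd t)" if "t \<in> set u" for t
      using that by (auto intro!: member_le_sum_list)
    ultimately show ?thesis using b by fastforce
  qed
  then have "{u \<in> ladders. \<forall>i\<in>G3. pairs_size b c u i = \<mu> i} \<subseteq> {u. set u \<subseteq> {..?N} \<times> {..?N} \<and> length u \<le> ?N}" by blast
  then show "finite {u \<in> ladders. \<forall>i\<in>G3. pairs_size b c u i = \<mu> i}"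
    by (rule finite_subset) (intro finite_lists_length_le finite_cartesian_product finite_atMost)
qed

text \<open>A ladder is empty or a rung followed by a ladder, which is the recursion of a geometric
  series.\<close>

lemma gf2_lists:
  assumes bc: "b \<in> G3" "c \<in> G3" "b \<noteq> c"
  shows "gf2_lists w b c = 1 + gf2 w b c * gf2_lists w b c"
    and "gf ladders1 (pairs_size b c) (pairs_weight w) = gf2 w b c * gf2_lists w b c"
proof -
  let ?X = "{t. pos2 t}" and ?L = "ladders" and ?C = "\<lambda>(t, u). t # u"
  have inj: "inj_on ?C (?X \<times> ?L)" by (auto simp: inj_on_def)
  have L: "ladders1 = ?C ` (?X \<times> ?L)"
  proof (intro equalityI subsetI)
    fix u assume "u \<in> ladders1"
    then show "u \<in> ?C ` (?X \<times> ?L)" by (cases u) auto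
  qed auto
  note fins = finite_sizes_pair[OF bc] finite_sizes_pairs[OF bc]
  have "gf (?C ` (?X \<times> ?L)) (pairs_size b c) (pairs_weight w)
      = gf (?X \<times> ?L) (\<lambda>(t, u) i. pair_size b c t i + pairs_size b c u i) (\<lambda>(t, u). (w \<circ> sum2) t * pairs_weight w u)"
    unfolding gf_image[OF inj] by (rule gf_cong) (auto simp: pairs_size_def pairs_weight_def)
  also have "\<dots> = gf2 w b c * gf2_lists w b c" unfolding gf2_def gf2_lists_def by (rule gf_Times[OF fins])
  finally show nonempty: "gf ladders1 (pairs_size b c) (pairs_weight w) = gf2 w b c * gf2_lists w b c"
    unfolding L .
  have "?L = {[]} \<union> ladders1" by auto
  then have "gf2_lists w b c = gf ({[]} \<union> ladders1) (pairs_size b c) (pairs_weight w)"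
    unfolding gf2_lists_def by simp
  also have "\<dots> = gf {[]} (pairs_size b c) (pairs_weight w) + gf2 w b c * gf2_lists w b c"
    unfolding nonempty[symmetric]
    by (rule gf_Un) (auto intro: finite_sizes_finite finite_sizes_subset[OF fins(2)])
  also have "gf {[]} (pairs_size b c) (pairs_weight w) = 1"
    by (subst gf_empty_object) (simp_all add: pairs_size_def pairs_weight_def)
  finally show "gf2_lists w b c = 1 + gf2 w b c * gf2_lists w b c" .
qed

section \<open>Divided differences\<close>

text \<open>The coefficients of \<open>F\<close> see the exponents of the two variables only through
  their sum. In the product with the difference of the variables neighbouring coefficients cancel,
  except at the boundary where one of the two exponents is used up.\<close>

lemma telescope:
  fixes F A A' :: "'a::comm_ring_1 fps3"
  assumes G: "G3 = {a, b, c}" and dist: "a \<noteq> b" "a \<noteq> c" "b \<noteq> c"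
    and F: "\<And>\<mu>. coeff3 F \<mu> = (if 0 < \<mu> b \<and> 0 < \<mu> c then w (\<mu> a) (\<mu> b + \<mu> c) else 0)"
    and A: "\<And>\<mu>. coeff3 A \<mu> = (if 0 < \<mu> b \<and> \<mu> c = 0 then w (\<mu> a) (\<mu> b) else 0)"
    and A': "\<And>\<mu>. coeff3 A' \<mu> = (if 0 < \<mu> c \<and> \<mu> b = 0 then w (\<mu> a) (\<mu> c) else 0)"
  shows "(var3 b - var3 c) * F = var3 c * A - var3 b * A'"
proof (rule fps3_eqI)
  fix \<mu>
  have bc: "b \<in> G3" "c \<in> G3" using G by auto
  \<comment> \<open>Exponents 0, 1 and at least 2 are distinguished, since the boundary terms sit at
    exponent 1.\<close>
  obtain m where m: "\<mu> b = 0 \<or> \<mu> b = Suc 0 \<or> \<mu> b = Suc (Suc m)" by (metis not0_implies_Suc)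
  obtain n where n: "\<mu> c = 0 \<or> \<mu> c = Suc 0 \<or> \<mu> c = Suc (Suc n)" by (metis not0_implies_Suc)
  show "coeff3 ((var3 b - var3 c) * F) \<mu> = coeff3 (var3 c * A - var3 b * A') \<mu>"
    unfolding left_diff_distrib coeff3_simps coeff3_var3_mult[OF bc(1)] coeff3_var3_mult[OF bc(2)] F A A'
    using m n dist by (elim disjE) simp_all
qed

lemma telescope_fract:
  fixes F A A' :: "'a::idom fps3"
  assumes "b \<in> G3" "c \<in> G3" "b \<noteq> c" "(var3 b - var3 c) * F = var3 c * A - var3 b * A'"
  shows "to_fract F = (Y c * to_fract A - Y b * to_fract A') / (Y b - Y c)" and "Y b - Y c \<noteq> (0 :: 'a fps3 fract)"
proof -
  have e: "Y b - Y c = to_fract (var3 b - var3 c :: 'a fps3)" by (simp add: Y_eq)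
  show ne: "Y b - Y c \<noteq> (0 :: 'a fps3 fract)" unfolding e using var3_inj[OF assms(1-3)] by (simp only: to_fract_eq_0_iff)
  have "(Y b - Y c) * to_fract F = Y c * to_fract A - Y b * to_fract A'"
    using arg_cong[OF assms(4), of to_fract] by (simp add: Y_eq)
  then show "to_fract F = (Y c * to_fract A - Y b * to_fract A') / (Y b - Y c)"
    using ne by (simp add: eq_divide_eq mult.commute)
qed

context
  fixes \<kappa> :: "nat multiset => 'a::idom"
begin

definition kap :: "nat => 'a" where "kap n = \<kappa> {#n#}"

text \<open>The series \<open>C1\<close> without its constant term 1.\<close>

definition mom1 :: "nat => 'a fps3" where
  "mom1 i = fps3 (\<lambda>\<mu>. if {j. \<mu> j \<noteq> 0} = {i} then kap (\<mu> i) else 0)"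

lemma coeff3_mom1:
  assumes "i \<in> G3"
  shows "coeff3 (mom1 i) \<mu> = (if 0 < \<mu> i \<and> (\<forall>j\<in>G3 - {i}. \<mu> j = 0) then kap (\<mu> i) else 0)"
proof -
  let ?m = "\<lambda>j. if j \<in> G3 then \<mu> j else 0"
  have s: "supp3 ?m" by (simp add: supp3_def)
  have "coeff3 (mom1 i) \<mu> = coeff3 (mom1 i) ?m" by (rule coeff3_cong) simp
  also have "\<dots> = (if {j \<in> G3. \<mu> j \<noteq> 0} = {i} then kap (\<mu> i) else 0)"
  proof -
    have "{j. ?m j \<noteq> 0} = {j \<in> G3. \<mu> j \<noteq> 0}" by auto
    then show ?thesis unfolding mom1_def coeff3_fps3[OF s] using assms by simp
  qed
  also have "{j \<in> G3. \<mu> j \<noteq> 0} = {i} \<longleftrightarrow> 0 < \<mu> i \<and> (\<forall>j\<in>G3 - {i}. \<mu> j = 0)"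
  proof
    assume r: "0 < \<mu> i \<and> (\<forall>j\<in>G3 - {i}. \<mu> j = 0)"
    have ji: "j = i" if "j \<in> G3" "\<mu> j \<noteq> 0" for j using r that by (cases "j = i") auto
    show "{j \<in> G3. \<mu> j \<noteq> 0} = {i}"
    proof (intro set_eqI iffI)
      fix j assume "j \<in> {j \<in> G3. \<mu> j \<noteq> 0}" then show "j \<in> {i}" using ji by simp
    next
      fix j assume "j \<in> {i}" then show "j \<in> {j \<in> G3. \<mu> j \<noteq> 0}" using r assms by simp
    qed
  next
    assume l: "{j \<in> G3. \<mu> j \<noteq> 0} = {i}"
    have "i \<in> {j \<in> G3. \<mu> j \<noteq> 0}" unfolding l by simp
    moreover have "\<mu> j = 0" if "j \<in> G3 - {i}" for j
    proof (rule ccontr)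
      assume "\<mu> j \<noteq> 0"
      then have "j \<in> {j \<in> G3. \<mu> j \<noteq> 0}" using that by simp
      then show False using that unfolding l by simp
    qed
    ultimately show "0 < \<mu> i \<and> (\<forall>j\<in>G3 - {i}. \<mu> j = 0)" by simp
  qed
  finally show ?thesis .
qed

lemma C1_eq: assumes "i \<in> G3" shows "C1 \<kappa> i = 1 + to_fract (mom1 i)"
proof -
  have "fps3 (C_coeff \<kappa> {i}) = 1 + mom1 i"
  proof (rule fps3_eqI)
    fix \<mu> assume s: "supp3 \<mu>"
    have z: "(\<forall>j\<in>G3. \<mu> j = 0) \<longleftrightarrow> \<mu> = (\<lambda>_. 0)" using s by (auto simp: supp3_def fun_eq_iff)
    show "coeff3 (fps3 (C_coeff \<kappa> {i})) \<mu> = coeff3 (1 + mom1 i) \<mu>"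
      unfolding coeff3_simps coeff3_1 z mom1_def coeff3_fps3[OF s]
      by (auto simp: C_coeff_def kap_def)
  qed
  then show ?thesis unfolding C1_def ser_eq by simp
qed

abbreviation "g2 \<equiv> gf2 kap"

text \<open>By \<open>telescope\<close> the fraction \<open>Chat2\<close> is the power series of a
  single 2-cycle between \<open>b\<close> and \<open>c\<close>. The second form exhibits the
  denominator that appears in the formula for two blocks.\<close>

lemma Chat2_eq:
  assumes "b \<in> G3" "c \<in> G3" "b \<noteq> c"
  shows "Chat2 \<kappa> b c = to_fract (g2 b c)"
    and "1 - Chat2 \<kappa> b c = (Y b * C1 \<kappa> c - Y c * C1 \<kappa> b) / (Y b - Y c)"
proof -
  obtain a where a: "G3 = {a, b, c}" "a \<noteq> b" "a \<noteq> c"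
  proof (rule that)
    let ?a = "if 1 \<notin> {b, c} then 1 else if 2 \<notin> {b, c} then 2 else 3 :: nat"
    show "G3 = {?a, b, c}" "?a \<noteq> b" "?a \<noteq> c" using assms unfolding G3_def by auto
  qed
  have D: "G3 - {b, c} = {a}" "G3 - {b} = {a, c}" "G3 - {c} = {a, b}" using a assms(3) by auto
  \<comment> \<open>The weight vanishes unless the exponent \<open>n\<close> of the third variable
    is 0.\<close>
  have t: "(var3 b - var3 c) * g2 b c = var3 c * mom1 b - var3 b * mom1 c"
    by (rule telescope[OF a(1) a(2) a(3) assms(3), where w = "\<lambda>n m. if n = 0 then kap m else 0"])
      (simp_all add: coeff3_gf2[OF assms] coeff3_mom1[OF assms(1)] coeff3_mom1[OF assms(2)] D conj_ac)
  note fr = telescope_fract[OF assms t]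
  have ne: "Y b - Y c \<noteq> (0 :: 'a fps3 fract)" by (rule fr(2))
  have ne': "Y c - Y b = - (Y b - Y c :: 'a fps3 fract)" by simp
  have alg: "1 + B / (- D) * (1 + M) + C / D * (1 + N) = (C * N - B * M) / D"
    if "D = B - C" "D \<noteq> 0" for B C D M N :: "'a fps3 fract"
  proof -
    have "1 + B / (- D) * (1 + M) + C / D * (1 + N) = (D - B * (1 + M) + C * (1 + N)) / D"
      using that(2) by (simp add: field_simps)
    moreover have "D - B * (1 + M) + C * (1 + N) = C * N - B * M" using that(1) by (simp add: algebra_simps)
    ultimately show ?thesis by simp
  qed
  show 1: "Chat2 \<kappa> b c = to_fract (g2 b c)"
    unfolding Chat2_def ne' C1_eq[OF assms(1)] C1_eq[OF assms(2)] fr(1) by (rule alg[OF refl ne])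
  have alg': "1 - (1 + B / (- D) * M + C / D * N) = (B * M - C * N) / D" for B C D M N :: "'a fps3 fract"
    by (simp add: diff_divide_distrib)
  show "1 - Chat2 \<kappa> b c = (Y b * C1 \<kappa> c - Y c * C1 \<kappa> b) / (Y b - Y c)"
    unfolding Chat2_def ne' by (rule alg')
qed

text \<open>The series of ladders is an inverse of \<open>1 - Chat2\<close>, which settles the
  nonvanishing at the same time.\<close>

lemma one_minus_Chat2:
  assumes "b \<in> G3" "c \<in> G3" "b \<noteq> c"
  shows "1 - Chat2 \<kappa> b c \<noteq> 0" and "to_fract (gf2_lists kap b c) = 1 / (1 - Chat2 \<kappa> b c)"
proof -
  have "gf2_lists kap b c * (1 - g2 b c) = 1"
    using gf2_lists(1)[OF assms, of kap] by (simp add: algebra_simps)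
  from arg_cong[OF this, of to_fract] have e: "to_fract (gf2_lists kap b c) * (1 - Chat2 \<kappa> b c) = 1"
    by (simp add: Chat2_eq[OF assms])
  then show "1 - Chat2 \<kappa> b c \<noteq> 0" by auto
  then show "to_fract (gf2_lists kap b c) = 1 / (1 - Chat2 \<kappa> b c)" using e by (simp add: eq_divide_eq)
qed

definition g3 :: "'a fps3" where
  "g3 = gf {t. pos3 t} (\<lambda>t i. sel3 i t) (kap \<circ> sum3)"

lemma triple_set: "{t \<in> {t. pos3 t}. \<forall>i\<in>G3. sel3 i t = \<mu> i}
    = (if \<forall>i\<in>G3. 0 < \<mu> i then {(\<mu> 1, \<mu> 2, \<mu> 3)} else {})"
  by (auto simp: G3_def sel3_def pick3_def pos3_def split: if_splits)

lemma finite_sizes_triple: "finite_sizes {t. pos3 t} (\<lambda>t i. sel3 i t)"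
  unfolding finite_sizes_def triple_set by simp

lemma coeff3_g3: "coeff3 g3 \<mu> = (if \<forall>i\<in>G3. 0 < \<mu> i then kap (\<mu> 1 + \<mu> 2 + \<mu> 3) else 0)"
proof (cases "\<forall>i\<in>G3. 0 < \<mu> i")
  case True
  then show ?thesis unfolding g3_def coeff3_gf triple_set by simp
next
  case False
  show ?thesis unfolding g3_def coeff3_gf triple_set using False by (simp only: if_False sum.empty)
qed

text \<open>\<open>telescope\<close> in the second and third variable, with the first one as a
  spectator: the series of a 3-cycle is the divided difference of the series of 2-cycles.\<close>

lemma Chat3_eq: "Chat3 \<kappa> 1 2 3 = to_fract g3"
proof -
  have G: "1 \<in> G3" "2 \<in> G3" "3 \<in> G3" by (simp_all add: G3_def)
  have D: "G3 - {1, 2} = {3}" "G3 - {1, 3} = {2}" by (auto simp: G3_def)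
  have t: "(var3 2 - var3 3) * g3 = var3 3 * g2 1 2 - var3 2 * g2 1 3"
  proof (rule telescope[where w = "\<lambda>n m. if n = 0 then 0 else kap (n + m)"])
    show "G3 = {1, 2, 3}" by (simp add: G3_def)
    show "coeff3 g3 \<mu> = (if 0 < \<mu> 2 \<and> 0 < \<mu> 3 then if \<mu> 1 = 0 then 0 else kap (\<mu> 1 + (\<mu> 2 + \<mu> 3)) else 0)" for \<mu>
      unfolding coeff3_g3 by (simp add: G3_def add.assoc)
    show "coeff3 (g2 1 2) \<mu> = (if 0 < \<mu> 2 \<and> \<mu> 3 = 0 then if \<mu> 1 = 0 then 0 else kap (\<mu> 1 + \<mu> 2) else 0)" for \<mu>
      by (subst coeff3_gf2) (use G D in simp_all)
    show "coeff3 (g2 1 3) \<mu> = (if 0 < \<mu> 3 \<and> \<mu> 2 = 0 then if \<mu> 1 = 0 then 0 else kap (\<mu> 1 + \<mu> 3) else 0)" for \<mu>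
      by (subst coeff3_gf2) (use G D in simp_all)
  qed simp_all
  have n: "(2::nat) \<noteq> 3" "(1::nat) \<noteq> 2" "(1::nat) \<noteq> 3" by simp_all
  note fr = telescope_fract[OF G(2,3) n(1) t]
  have ne': "Y 3 - Y 2 = - (Y 2 - Y 3 :: 'a fps3 fract)" by simp
  have alg: "C / D * N + B / (- D) * M = (C * N - B * M) / D" for B C D M N :: "'a fps3 fract"
    by (simp add: diff_divide_distrib)
  show ?thesis
    unfolding Chat3_def Chat2_eq(1)[OF G(1,2) n(2)] Chat2_eq(1)[OF G(1,3) n(3)] ne' fr(1) by (rule alg)
qed

text \<open>The marked rung: a cumulant of order 2 whose first index is the size on \<open>a\<close>
  and whose second index is the size of a 2-cycle between \<open>b\<close> and \<open>c\<close>. It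
  is a divided difference of \<open>C2\<close>.\<close>

definition c2_hat :: "nat => nat => nat => 'a fps3" where
  "c2_hat a b c = gf ({n. 0 < n} \<times> {t. pos2 t}) (\<lambda>(n, t) i. (if i = a then n else 0) + pair_size b c t i)
     (\<lambda>(n, t). \<kappa> {#n, sum2 t#})"

lemma C2_eq: assumes "a \<in> G3" "b \<in> G3" "a \<noteq> b"
  shows "C2 \<kappa> a b = to_fract (fps3 (\<lambda>\<mu>. if {j. \<mu> j \<noteq> 0} = {a, b} then \<kappa> {#\<mu> a, \<mu> b#} else 0))"
  unfolding C2_def ser_eq using assms
  by (intro arg_cong[of _ _ "\<lambda>f. to_fract (fps3 f)"] ext) (simp add: C_coeff_def)

lemma c2_hat_fract:
  assumes G: "G3 = {a, b, c}" and dist: "a \<noteq> b" "a \<noteq> c" "b \<noteq> c"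
  shows "to_fract (c2_hat a b c) = (Y c * C2 \<kappa> a b - Y b * C2 \<kappa> a c) / (Y b - Y c)"
proof -
  have abc: "a \<in> G3" "b \<in> G3" "c \<in> G3" using G by auto
  let ?A = "\<lambda>b. fps3 (\<lambda>\<mu>. if {j. \<mu> j \<noteq> 0} = {a, b} then \<kappa> {#\<mu> a, \<mu> b#} else 0)"
  have A: "coeff3 (?A x) \<mu> = (if 0 < \<mu> x \<and> \<mu> y = 0 then if \<mu> a = 0 then 0 else \<kappa> {#\<mu> a, \<mu> x#} else 0)"
    if xy: "G3 = {a, x, y}" "a \<noteq> x" "a \<noteq> y" "x \<noteq> y" for x y \<mu>
  proof -
    let ?m = "\<lambda>j. if j \<in> G3 then \<mu> j else 0"
    have s: "supp3 ?m" by (simp add: supp3_def)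
    have "coeff3 (?A x) \<mu> = coeff3 (?A x) ?m" by (rule coeff3_cong) simp
    also have "\<dots> = (if {j. ?m j \<noteq> 0} = {a, x} then \<kappa> {#?m a, ?m x#} else 0)" by (rule coeff3_fps3[OF s])
    also have "{j. ?m j \<noteq> 0} = {a, x} \<longleftrightarrow> 0 < \<mu> x \<and> \<mu> y = 0 \<and> 0 < \<mu> a"
    proof -
      have "{j. ?m j \<noteq> 0} = {j \<in> {a, x, y}. \<mu> j \<noteq> 0}" unfolding xy(1)[symmetric] by auto
      then show ?thesis using xy(2-4) by auto
    qed
    finally show ?thesis unfolding xy(1) by auto
  qed
  have t: "(var3 b - var3 c) * c2_hat a b c = var3 c * ?A b - var3 b * ?A c"
  proof (rule telescope[where w = "\<lambda>n m. if n = 0 then 0 else \<kappa> {#n, m#}", OF G dist])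
    fix \<mu>
    have "{ob \<in> {n. 0 < n} \<times> {t. pos2 t}. \<forall>i\<in>G3. (case ob of (n, t) => \<lambda>i. (if i = a then n else 0) + pair_size b c t i) i = \<mu> i}
       = (if 0 < \<mu> a \<and> 0 < \<mu> b \<and> 0 < \<mu> c then {(\<mu> a, \<mu> b, \<mu> c)} else {})"
      unfolding G using dist by (auto simp: pair_size_def pos2_def)
    then show "coeff3 (c2_hat a b c) \<mu> = (if 0 < \<mu> b \<and> 0 < \<mu> c then if \<mu> a = 0 then 0 else \<kappa> {#\<mu> a, \<mu> b + \<mu> c#} else 0)"
      unfolding c2_hat_def coeff3_gf by simp
    show "coeff3 (?A b) \<mu> = (if 0 < \<mu> b \<and> \<mu> c = 0 then if \<mu> a = 0 then 0 else \<kappa> {#\<mu> a, \<mu> b#} else 0)"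
      by (rule A[OF G dist])
    show "coeff3 (?A c) \<mu> = (if 0 < \<mu> c \<and> \<mu> b = 0 then if \<mu> a = 0 then 0 else \<kappa> {#\<mu> a, \<mu> c#} else 0)"
      by (rule A) (use G dist in auto)
  qed
  show ?thesis
    unfolding C2_eq[OF abc(1,2) dist(1)] C2_eq[OF abc(1,3) dist(2)] by (rule telescope_fract(1)[OF abc(2,3) dist(3) t])
qed

definition annular_size :: "nat => nat => nat => nat \<times> (nat \<times> nat) list => nat => nat" where
  "annular_size a b c = (\<lambda>(n, u) i. (if i = a then n else 0) + pairs_size b c u i)"

definition annular_weight :: "nat \<times> (nat \<times> nat) list => 'a" where
  "annular_weight = (\<lambda>(n, u). \<kappa> {#n, sum2 (hd u)#} * pairs_weight kap (tl u))"

definition annular_gf :: "nat => nat => nat => 'a fps3" where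
  "annular_gf a b c = gf ({n. 0 < n} \<times> ladders1) (annular_size a b c) annular_weight"

text \<open>A cyclic ladder is its marked rung followed by an arbitrary ladder. The factor
  \<open>Y b - Y c\<close> occurs in both series and cancels.\<close>

lemma annular_gf_fract:
  assumes G: "G3 = {a, b, c}" and dist: "a \<noteq> b" "a \<noteq> c" "b \<noteq> c"
  shows "to_fract (annular_gf a b c) = (Y c * C2 \<kappa> a b - Y b * C2 \<kappa> a c) / (Y b * C1 \<kappa> c - Y c * C1 \<kappa> b)"
proof -
  have abc: "a \<in> G3" "b \<in> G3" "c \<in> G3" using G by auto
  let ?N = "{n. 0 < (n::nat)} \<times> {t. pos2 t}" and ?L = "ladders"
  let ?h = "\<lambda>((n, t), u). (n, t # u)"
  let ?s = "\<lambda>(n, t) i. (if i = a then n else 0) + pair_size b c t i"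
  have inj: "inj_on ?h (?N \<times> ?L)" by (auto simp: inj_on_def)
  have im: "{n. 0 < n} \<times> ladders1 = ?h ` (?N \<times> ?L)"
  proof (intro equalityI subsetI)
    fix z assume z: "z \<in> {n. 0 < (n::nat)} \<times> ladders1"
    obtain n t u where "z = (n, t # u)" using z by (metis (mono_tags, lifting) SigmaE mem_Collect_eq neq_Nil_conv)
    then show "z \<in> ?h ` (?N \<times> ?L)" using z by (intro image_eqI[of _ _ "((n, t), u)"]) auto
  qed auto
  have "finite_sizes {n. 0 < n} (\<lambda>n i. if i = a then n else 0)"
    unfolding finite_sizes_def
  proof
    fix \<mu> :: "nat => nat"
    have "{n \<in> {n. 0 < n}. \<forall>i\<in>G3. (if i = a then n else 0) = \<mu> i} \<subseteq> {\<mu> a}" using abc(1) by auto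
    then show "finite {n \<in> {n. 0 < n}. \<forall>i\<in>G3. (if i = a then n else 0) = \<mu> i}" by (rule finite_subset) simp
  qed
  from finite_sizes_Times[OF this finite_sizes_pair[OF abc(2,3) dist(3)]]
  have fN: "finite_sizes ?N ?s" .
  have "annular_gf a b c = gf (?N \<times> ?L) (\<lambda>(x, u) i. ?s x i + pairs_size b c u i) (\<lambda>(x, u). (case x of (n, t) => \<kappa> {#n, sum2 t#}) * pairs_weight kap u)"
    unfolding annular_gf_def im gf_image[OF inj] by (rule gf_cong) (auto simp: annular_size_def annular_weight_def pairs_size_def)
  also have "\<dots> = c2_hat a b c * gf2_lists kap b c"
    unfolding c2_hat_def gf2_lists_def by (rule gf_Times[OF fN finite_sizes_pairs[OF abc(2,3) dist(3)]])
  finally have "to_fract (annular_gf a b c) = to_fract (c2_hat a b c) / (1 - Chat2 \<kappa> b c)"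
    by (simp add: one_minus_Chat2(2)[OF abc(2,3) dist(3)])
  moreover have "Y b - Y c \<noteq> (0 :: 'a fps3 fract)"
    using var3_inj[OF abc(2,3) dist(3), where 'a = 'a] by (simp add: Y_eq flip: to_fract_diff)
  ultimately show ?thesis
    unfolding c2_hat_fract[OF assms] Chat2_eq(2)[OF abc(2,3) dist(3)] by simp
qed

definition double_core :: "nat => 'a fps3" where
  "double_core a = gf {(x, y, j, k). 0 < x \<and> 0 < y \<and> 0 < j \<and> 0 < k}
     (\<lambda>(x, y, j, k) i. if i = a then x + y else if i = nx3 a then j else k) (\<lambda>(x, y, j, k). kap (x + y + j + k))"

text \<open>The two runs on \<open>a\<close> split the exponent of \<open>Y a\<close> into two
  positive parts, in \<open>\<mu> a - 1\<close> ways. So the series is that of a 3-cycle with every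
  coefficient multiplied by \<open>\<mu> a - 1\<close>, which is what the operator with
  \<open>1 / Y a\<close> under the derivative does.\<close>

lemma double_core:
  assumes a: "a \<in> G3"
  shows "finite_sizes {(x, y, j, k). 0 < x \<and> 0 < y \<and> 0 < j \<and> (0::nat) < k}
     (\<lambda>(x, y, j, k) i. if i = a then x + y else if i = nx3 a then j else k)" (is "finite_sizes ?Q ?s")
    and "to_fract (double_core a) = (Y a)\<^sup>2 * partial a (1 / Y a * Chat3 \<kappa> 1 2 3)"
proof -
  note T = triD[OF tri3 a]
  have S: "{z \<in> ?Q. \<forall>i\<in>G3. ?s z i = \<mu> i} =
     (if \<forall>i\<in>G3. 0 < \<mu> i then (\<lambda>x. (x, \<mu> a - x, \<mu> (nx3 a), \<mu> (pv3 a))) ` {0<..<\<mu> a} else {})" (is "?L = ?R") for \<mu>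
  proof (intro equalityI subsetI)
    fix z assume z: "z \<in> ?L"
    obtain x y j k where e: "z = (x, y, j, k)" by (cases z)
    have "x + y = \<mu> a" "j = \<mu> (nx3 a)" "k = \<mu> (pv3 a)" "0 < x" "0 < y" "0 < j" "0 < k" 
      using z e a T(1,2,5,6,7) by auto
    moreover have "\<forall>i\<in>G3. 0 < \<mu> i" unfolding T(10) using calculation by auto
    ultimately show "z \<in> ?R" using e by auto
  next
    fix z assume "z \<in> ?R"
    then obtain x where x: "\<forall>i\<in>G3. 0 < \<mu> i" "0 < x" "x < \<mu> a" "z = (x, \<mu> a - x, \<mu> (nx3 a), \<mu> (pv3 a))"
      by (auto split: if_splits)
    then have "z \<in> ?Q" using T(1,2) by auto
    moreover have "\<forall>i\<in>{a, nx3 a, pv3 a}. ?s z i = \<mu> i" using x(2-4) T(5,6,7) by auto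
    ultimately show "z \<in> ?L" using T(10) by auto
  qed
  show "finite_sizes ?Q ?s" unfolding finite_sizes_def S by simp
  have sum: "\<mu> a + (\<mu> (nx3 a) + \<mu> (pv3 a)) = \<mu> 1 + \<mu> 2 + \<mu> 3" for \<mu> :: "nat => nat"
    using a by (auto simp: G3_def nx3_def pv3_def)
  have "double_core a = var3 a * fps3_deriv a g3 - g3"
  proof (rule fps3_eqI)
    fix \<mu>
    have "coeff3 (double_core a) \<mu> = (if \<forall>i\<in>G3. 0 < \<mu> i then of_nat (\<mu> a - 1) * kap (\<mu> 1 + \<mu> 2 + \<mu> 3) else 0)"
    proof (cases "\<forall>i\<in>G3. 0 < \<mu> i")
      case True
      have "coeff3 (double_core a) \<mu> = (\<Sum>x\<in>{0<..<\<mu> a}. kap (x + (\<mu> a - x) + \<mu> (nx3 a) + \<mu> (pv3 a)))"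
        unfolding double_core_def coeff3_gf S using True by (simp add: sum.reindex inj_on_def)
      also have "\<dots> = (\<Sum>x\<in>{0<..<\<mu> a}. kap (\<mu> 1 + \<mu> 2 + \<mu> 3))"
        using sum[of \<mu>] by (intro sum.cong) (auto simp: add.assoc)
      finally show ?thesis using True by simp
    next
      case False
      show ?thesis unfolding double_core_def coeff3_gf S using False by (simp only: if_False sum.empty)
    qed
    also have "\<dots> = of_nat (\<mu> a) * coeff3 g3 \<mu> - coeff3 g3 \<mu>"
    proof (cases "\<forall>i\<in>G3. 0 < \<mu> i")
      case True
      then have "0 < \<mu> a" using a by blast
      then have "(of_nat (\<mu> a - 1) :: 'a) = of_nat (\<mu> a) - 1" by (simp add: of_nat_diff Suc_le_eq)
      then show ?thesis unfolding coeff3_g3 using True by (simp add: left_diff_distrib)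
    next
      case False
      show ?thesis unfolding coeff3_g3 using False by (simp only: if_False mult_zero_right diff_self)
    qed
    also have "\<dots> = coeff3 (var3 a * fps3_deriv a g3 - g3) \<mu>"
      unfolding coeff3_simps coeff3_var3_mult[OF a] coeff3_deriv[OF a] by simp
    finally show "coeff3 (double_core a) \<mu> = coeff3 (var3 a * fps3_deriv a g3 - g3) \<mu>" .
  qed
  moreover have "1 / Y a * Chat3 \<kappa> 1 2 3 = Fraction_Field.Fract g3 (var3 a)"
    unfolding Chat3_eq Y_eq by (simp add: Fract_conv_to_fract)
  moreover have "partial a (Fraction_Field.Fract g3 (var3 a)) = to_fract (fps3_deriv a g3 * var3 a - g3) / (Y a * Y a)"
    unfolding partial_Fract[OF var3_nonzero[OF a]] deriv_var3[OF a] by (simp add: Fract_conv_to_fract Y_eq)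
  moreover have "Y a \<noteq> (0 :: 'a fps3 fract)" using var3_nonzero[OF a, where 'a = 'a] by (simp add: Y_eq)
  ultimately show "to_fract (double_core a) = (Y a)\<^sup>2 * partial a (1 / Y a * Chat3 \<kappa> 1 2 3)"
    by (simp add: power2_eq_square mult.commute)
qed

end

section \<open>The series of the shapes\<close>

context
  fixes \<kappa> :: "nat multiset => 'a::idom"
begin

abbreviation (input) "k1 \<equiv> kap \<kappa>"
abbreviation (input) "lst \<equiv> gf2_lists (kap \<kappa>)"

definition shape_size :: "shape => nat => nat" where "shape_size ob i = sum_list (shape_gaps ob i)"

abbreviation "shape_gf A \<equiv> gf A shape_size (shape_weight (kap \<kappa>))"

definition cap_size :: "(nat \<times> nat \<times> nat) list => nat => nat" where
  "cap_size P i = (\<Sum>t\<leftarrow>P. sel3 i t)"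

definition cap_weight :: "(nat \<times> nat \<times> nat) list => 'a" where
  "cap_weight P = prod_list (map (k1 \<circ> sum3) P)"

text \<open>An optional exceptional 3-cycle of \<psi>, encoded as a list of length at most one.
  There is one such option at each end, which is the origin of the square of
  \<open>1 + Chat3\<close>.\<close>

definition caps :: "(nat \<times> nat \<times> nat) list set" where "caps = {P. length P \<le> 1 \<and> list_all pos3 P}"

lemma caps_eq: "caps = {[]} \<union> (\<lambda>t. [t]) ` {t. pos3 t}"
proof (intro equalityI subsetI)
  fix P assume "P \<in> caps"
  then show "P \<in> {[]} \<union> (\<lambda>t. [t]) ` {t. pos3 t}" by (cases P) (auto simp: caps_def)
qed (auto simp: caps_def)

lemma finite_sizes_caps: "finite_sizes caps cap_size"
  unfolding caps_eq
proof (rule finite_sizes_Un)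
  show "finite_sizes {[]} cap_size" by (simp add: finite_sizes_finite)
  show "finite_sizes ((\<lambda>t. [t]) ` {t. pos3 t}) cap_size"
    by (rule finite_sizes_image, rule finite_sizes_cong[OF _ finite_sizes_triple]) (simp add: cap_size_def)
qed

lemma gf_caps: "gf caps cap_size cap_weight = 1 + g3 \<kappa>"
proof -
  have "gf caps cap_size cap_weight = gf {[]} cap_size cap_weight + gf ((\<lambda>t. [t]) ` {t. pos3 t}) cap_size cap_weight"
    unfolding caps_eq by (rule gf_Un) (auto intro: finite_sizes_subset[OF finite_sizes_caps] simp: caps_def)
  also have "gf {[]} cap_size cap_weight = 1"
    by (subst gf_empty_object) (simp_all add: cap_size_def cap_weight_def)
  also have "gf ((\<lambda>t. [t]) ` {t. pos3 t}) cap_size cap_weight = g3 \<kappa>"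
    unfolding g3_def by (subst gf_image) (auto simp: inj_on_def cap_size_def cap_weight_def intro!: gf_cong)
  finally show ?thesis .
qed

definition mk_triangle :: "((nat \<times> nat \<times> nat) list \<times> (nat \<times> nat \<times> nat) list) \<times> (nat \<times> nat) list \<times> (nat \<times> nat) list \<times> (nat \<times> nat) list => shape" where
  "mk_triangle = (\<lambda>((P, Q), t, u, v). Triangle P Q t u v)"

lemma inj_mk_triangle: "inj_on mk_triangle A"
  by (auto simp: inj_on_def mk_triangle_def)

text \<open>Stated for a set \<open>W\<close> of pairs of ends and a set \<open>U\<close> of
  admissible ladders, because it is applied with all ends or with none, and with all ladders or with
  the nonempty ones.\<close>

lemma triangle_gf:
  assumes W: "finite_sizes W (\<lambda>(P, Q) i. cap_size P i + cap_size Q i)" and U: "U \<subseteq> ladders"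
  shows "shape_gf (mk_triangle ` (W \<times> (U \<times> (U \<times> U))))
     = gf W (\<lambda>(P, Q) i. cap_size P i + cap_size Q i) (\<lambda>(P, Q). cap_weight P * cap_weight Q)
       * (gf U (pairs_size 1 2) (pairs_weight k1) * (gf U (pairs_size 2 3) (pairs_weight k1) * gf U (pairs_size 3 1) (pairs_weight k1)))"
    and "finite_sizes (mk_triangle ` (W \<times> (U \<times> (U \<times> U)))) shape_size"
proof -
  let ?o = "\<lambda>(P, Q) i. cap_size P i + cap_size Q i"
  let ?s2 = "\<lambda>(u, v) i. pairs_size 2 3 u i + pairs_size 3 1 v i"
  let ?s3 = "\<lambda>(t, uv) i. pairs_size 1 2 t i + ?s2 uv i"
  let ?s4 = "\<lambda>(p, tuv) i. ?o p i + ?s3 tuv i"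
  have f: "finite_sizes U (pairs_size b c)" if "b \<in> G3" "c \<in> G3" "b \<noteq> c" for b c
    using finite_sizes_subset[OF finite_sizes_pairs[OF that] U] .
  have f12: "finite_sizes U (pairs_size 1 2)" and f23: "finite_sizes U (pairs_size 2 3)" and f31: "finite_sizes U (pairs_size 3 1)"
    by (rule f; simp add: G3_def)+
  note F2 = finite_sizes_Times[OF f23 f31]
  note F3 = finite_sizes_Times[OF f12 F2]
  note F4 = finite_sizes_Times[OF W F3]
  have sz: "?s4 x i = shape_size (mk_triangle x) i" if "i \<in> G3" for x i
  proof -
    obtain P Q t u v where x: "x = ((P, Q), t, u, v)" by (metis surj_pair)
    have "i = 1 \<or> i = 2 \<or> i = 3" using that by (auto simp: G3_def)
    then show ?thesis
      unfolding x by (elim disjE) (simp_all add: mk_triangle_def shape_size_def cap_size_def pairs_size_def pair_size_def pick3_def pv3_def)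
  qed
  show "finite_sizes (mk_triangle ` (W \<times> (U \<times> (U \<times> U)))) shape_size"
    by (rule finite_sizes_image, rule finite_sizes_cong[OF _ F4]) (rule sz)
  have "shape_gf (mk_triangle ` (W \<times> (U \<times> (U \<times> U))))
     = gf (W \<times> (U \<times> (U \<times> U))) ?s4 (\<lambda>(p, tuv). (case p of (P, Q) => cap_weight P * cap_weight Q) *
        (case tuv of (t, uv) => pairs_weight k1 t * (case uv of (u, v) => pairs_weight k1 u * pairs_weight k1 v)))"
    unfolding gf_image[OF inj_mk_triangle]
    by (rule gf_cong) (use sz in \<open>auto simp: mk_triangle_def cap_weight_def mult_ac\<close>)
  also have "\<dots> = gf W ?o (\<lambda>(P, Q). cap_weight P * cap_weight Q)
       * (gf U (pairs_size 1 2) (pairs_weight k1) * (gf U (pairs_size 2 3) (pairs_weight k1) * gf U (pairs_size 3 1) (pairs_weight k1)))"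
    unfolding gf_Times[OF W F3] gf_Times[OF f12 F2] gf_Times[OF f23 f31] ..
  finally show "shape_gf (mk_triangle ` (W \<times> (U \<times> (U \<times> U))))
     = gf W ?o (\<lambda>(P, Q). cap_weight P * cap_weight Q)
       * (gf U (pairs_size 1 2) (pairs_weight k1) * (gf U (pairs_size 2 3) (pairs_weight k1) * gf U (pairs_size 3 1) (pairs_weight k1)))" .
qed

text \<open>The triangles without a 3-cycle of \<psi> are taken out and put back with nonempty
  ladders only. In the numerator of the series this is the term -1 and the product of the three
  \<open>Chat2\<close>.\<close>

definition triangles :: "shape set" where
  "triangles = mk_triangle ` ((caps \<times> caps) \<times> (ladders \<times> (ladders \<times> ladders))) - mk_triangle ` ({([], [])} \<times> (ladders \<times> (ladders \<times> ladders)))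
     \<union> mk_triangle ` ({([], [])} \<times> (ladders1 \<times> (ladders1 \<times> ladders1)))"

definition doubles :: "nat => shape set" where
  "doubles a = (\<lambda>((x, y, j, k), u, v). Double a x y j k u v) ` ({(x, y, j, k). 0 < x \<and> 0 < y \<and> 0 < j \<and> 0 < k} \<times> (ladders \<times> ladders))"

lemma shapes_eq: "Collect shape_ok = triangles \<union> (doubles 1 \<union> (doubles 2 \<union> doubles 3))"
proof (intro set_eqI iffI)
  fix ob assume ok: "ob \<in> Collect shape_ok"
  show "ob \<in> triangles \<union> (doubles 1 \<union> (doubles 2 \<union> doubles 3))"
  proof (cases ob)
    case (Triangle P Q t u v)
    have e: "ob = mk_triangle ((P, Q), t, u, v)" by (simp add: Triangle mk_triangle_def)
    have c: "P \<in> caps" "Q \<in> caps" "t \<in> ladders" "u \<in> ladders" "v \<in> ladders" using ok by (simp_all add: Triangle caps_def)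
    have "ob \<in> triangles"
    proof (cases "P = [] \<and> Q = []")
      case True
      then show ?thesis unfolding triangles_def e
        using ok c by (intro UnI2 imageI) (simp add: Triangle)
    next
      case False
      then have "mk_triangle ((P, Q), t, u, v) \<notin> mk_triangle ` ({([], [])} \<times> (ladders \<times> (ladders \<times> ladders)))"
        by (auto simp: mk_triangle_def)
      then show ?thesis unfolding triangles_def e using c by (intro UnI1 DiffI imageI) auto
    qed
    then show ?thesis by blast
  next
    case (Double a x y j k u v)
    have "ob \<in> doubles a" unfolding doubles_def Double
      by (rule image_eqI[of _ _ "((x, y, j, k), u, v)"]) (use ok in \<open>simp_all add: Double\<close>)
    moreover have "a = 1 \<or> a = 2 \<or> a = 3" using ok by (auto simp: Double G3_def)
    ultimately show ?thesis by blast
  qed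
next
  fix ob assume "ob \<in> triangles \<union> (doubles 1 \<union> (doubles 2 \<union> doubles 3))"
  then consider "ob \<in> triangles" | a where "a \<in> G3" "ob \<in> doubles a" by (auto simp: G3_def)
  then show "ob \<in> Collect shape_ok"
  proof cases
    case 1
    then consider P Q t u v where "ob = Triangle P Q t u v" "P \<in> caps" "Q \<in> caps" "t \<in> ladders" "u \<in> ladders" "v \<in> ladders" "\<not> (P = [] \<and> Q = [])"
      | t u v where "ob = Triangle [] [] t u v" "t \<in> ladders" "u \<in> ladders" "v \<in> ladders" "t \<noteq> []" "u \<noteq> []" "v \<noteq> []"
    proof (cases "ob \<in> mk_triangle ` ({([], [])} \<times> (ladders1 \<times> (ladders1 \<times> ladders1)))")
      case True
      then show ?thesis using that(2) by (auto simp: mk_triangle_def)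
    next
      case False
      then have ob: "ob \<in> mk_triangle ` ((caps \<times> caps) \<times> (ladders \<times> (ladders \<times> ladders)))"
        "ob \<notin> mk_triangle ` ({([], [])} \<times> (ladders \<times> (ladders \<times> ladders)))" using 1 unfolding triangles_def by blast+
      from ob(1) obtain P Q t u v where e: "ob = mk_triangle ((P, Q), t, u, v)" "P \<in> caps" "Q \<in> caps" "t \<in> ladders" "u \<in> ladders" "v \<in> ladders"
        by blast
      have "\<not> (P = [] \<and> Q = [])" using ob(2) e by blast
      then show ?thesis using that(1)[of P Q t u v] e by (simp add: mk_triangle_def)
    qed
    then show ?thesis by cases (auto simp: caps_def)
  next
    case 2
    then show ?thesis unfolding doubles_def by auto
  qed
qed

lemma gf_triangles:
  shows "shape_gf triangles
     = ((1 + g3 \<kappa>)^2 + g2 \<kappa> 1 2 * g2 \<kappa> 1 3 * g2 \<kappa> 2 3 - 1) * (lst 1 2 * lst 1 3 * lst 2 3)"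
  and "finite_sizes triangles shape_size"
proof -
  let ?M = "ladders1"
  let ?A = "mk_triangle ` ((caps \<times> caps) \<times> (ladders \<times> (ladders \<times> ladders)))" and ?B = "mk_triangle ` ({([], [])} \<times> (ladders \<times> (ladders \<times> ladders)))"
    and ?C = "mk_triangle ` ({([], [])} \<times> (?M \<times> (?M \<times> ?M)))"
  let ?o = "\<lambda>(P, Q) i. cap_size P i + cap_size Q i" and ?ow = "\<lambda>(P, Q). cap_weight P * cap_weight Q"
  note fO = finite_sizes_Times[OF finite_sizes_caps finite_sizes_caps]
  have f1: "finite_sizes {([], [])} ?o" by (simp add: finite_sizes_finite)
  have g1: "gf {([], [])} ?o ?ow = 1"
    by (subst gf_empty_object) (simp_all add: cap_size_def cap_weight_def)
  have M: "?M \<subseteq> ladders" by blast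
  have G: "1 \<in> G3" "2 \<in> G3" "3 \<in> G3" by (simp_all add: G3_def)
  have n: "(2::nat) \<noteq> 3" "(1::nat) \<noteq> 2" "(1::nat) \<noteq> 3" "(3::nat) \<noteq> 1" by simp_all
  have c31: "g2 \<kappa> 3 1 = g2 \<kappa> 1 3" by (rule gf2_commute[OF G(3,1) n(4)])
  \<comment> \<open>Both series are inverses of the same series, and inverses are unique.\<close>
  have l31: "lst 3 1 = lst 1 3"
  proof -
    have a: "lst 3 1 * (1 - g2 \<kappa> 1 3) = 1" and b: "lst 1 3 * (1 - g2 \<kappa> 1 3) = 1"
      using gf2_lists(1)[OF G(3,1) n(4), of k1] gf2_lists(1)[OF G(1,3) n(3), of k1] c31 by (simp_all add: algebra_simps)
    have "lst 3 1 = lst 3 1 * (lst 1 3 * (1 - g2 \<kappa> 1 3))" unfolding b by simp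
    also have "\<dots> = lst 1 3 * (lst 3 1 * (1 - g2 \<kappa> 1 3))" by (rule mult.left_commute)
    also have "\<dots> = lst 1 3" unfolding a by simp
    finally show ?thesis .
  qed
  have A: "shape_gf ?A = ((1 + g3 \<kappa>) * (1 + g3 \<kappa>)) * (lst 1 2 * (lst 2 3 * lst 1 3))"
    unfolding triangle_gf(1)[OF fO order_refl] gf_Times[OF finite_sizes_caps finite_sizes_caps] gf_caps
      gf2_lists_def l31[unfolded gf2_lists_def] ..
  have B: "shape_gf ?B = lst 1 2 * (lst 2 3 * lst 1 3)"
    unfolding triangle_gf(1)[OF f1 order_refl] g1 gf2_lists_def l31[unfolded gf2_lists_def] by simp
  have C: "shape_gf ?C
     = (g2 \<kappa> 1 2 * lst 1 2) * ((g2 \<kappa> 2 3 * lst 2 3) * (g2 \<kappa> 1 3 * lst 1 3))"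
    unfolding triangle_gf(1)[OF f1 M] g1 gf2_lists(2)[OF G(1,2) n(2)] gf2_lists(2)[OF G(2,3) n(1)] gf2_lists(2)[OF G(3,1) n(4)] l31 c31 by simp
  have BA: "?B \<subseteq> ?A" by (rule image_mono) (auto simp: caps_def)
  have CB: "?C \<subseteq> ?B" by (rule image_mono) auto
  note fA = triangle_gf(2)[OF fO order_refl] and fC = triangle_gf(2)[OF f1 M]
  note fAB = finite_sizes_subset[OF fA Diff_subset]
  show "finite_sizes triangles shape_size"
    unfolding triangles_def by (rule finite_sizes_Un[OF fAB fC])
  have "shape_gf triangles = shape_gf ?A - shape_gf ?B + shape_gf ?C"
    unfolding triangles_def gf_Diff[OF fA BA, symmetric] by (rule gf_Un[OF fAB fC]) (use CB in blast)
  then show "shape_gf triangles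
     = ((1 + g3 \<kappa>)^2 + g2 \<kappa> 1 2 * g2 \<kappa> 1 3 * g2 \<kappa> 2 3 - 1) * (lst 1 2 * lst 1 3 * lst 2 3)"
    unfolding A B C by (simp add: power2_eq_square algebra_simps)
qed

lemma gf_doubles:
  assumes a: "a \<in> G3"
  shows "shape_gf (doubles a) = double_core \<kappa> a * (lst a (nx3 a) * lst a (pv3 a))"
    and "finite_sizes (doubles a) shape_size"
proof -
  note T = triD[OF tri3 a]
  let ?Q = "{(x, y, j, k). 0 < x \<and> 0 < y \<and> 0 < j \<and> (0::nat) < k}"
  let ?q = "\<lambda>(x, y, j, k) i. if i = a then x + y else if i = nx3 a then j else k"
  let ?h = "\<lambda>((x, y, j, k), u, v). Double a x y j k u v"
  let ?s2 = "\<lambda>(u, v) i. pairs_size a (nx3 a) u i + pairs_size a (pv3 a) v i"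
  let ?s3 = "\<lambda>(q, uv) i. ?q q i + ?s2 uv i"
  note fQ = double_core(1)[OF a]
  note fb = finite_sizes_pairs[OF a T(1) T(5)[symmetric]] and fc = finite_sizes_pairs[OF a T(2) T(6)[symmetric]]
  note F2 = finite_sizes_Times[OF fb fc]
  note F3 = finite_sizes_Times[OF fQ F2]
  have sz: "?s3 z i = shape_size (?h z) i" if "i \<in> G3" for z i
  proof -
    obtain x y j k u v where z: "z = ((x, y, j, k), u, v)" by (metis surj_pair)
    have "i = a \<or> i = nx3 a \<or> i = pv3 a" using that unfolding T(10) by blast
    then show ?thesis
      unfolding z using T(5,6,7) by (elim disjE) (auto simp: shape_size_def pairs_size_def pair_size_def)
  qed
  show "finite_sizes (doubles a) shape_size"
    unfolding doubles_def by (rule finite_sizes_image, rule finite_sizes_cong[OF _ F3]) (rule sz)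
  have inj: "inj_on ?h (?Q \<times> (ladders \<times> ladders))" by (auto simp: inj_on_def)
  have "shape_gf (doubles a)
     = gf (?Q \<times> (ladders \<times> ladders)) ?s3 (\<lambda>(q, uv). (case q of (x, y, j, k) => k1 (x + y + j + k)) * (case uv of (u, v) => pairs_weight k1 u * pairs_weight k1 v))"
    unfolding doubles_def gf_image[OF inj]
    by (rule gf_cong) (use sz in \<open>auto simp: mult_ac\<close>)
  also have "\<dots> = double_core \<kappa> a * (lst a (nx3 a) * lst a (pv3 a))"
    unfolding gf_Times[OF fQ F2] gf_Times[OF fb fc] double_core_def gf2_lists_def ..
  finally show "shape_gf (doubles a) = double_core \<kappa> a * (lst a (nx3 a) * lst a (pv3 a))" .
qed

lemma gf_shapes:
  "to_fract (shape_gf (Collect shape_ok)) =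
     ((1 + Chat3 \<kappa> 1 2 3)\<^sup>2 + Chat2 \<kappa> 1 2 * Chat2 \<kappa> 1 3 * Chat2 \<kappa> 2 3 - 1)
       / ((1 - Chat2 \<kappa> 1 2) * (1 - Chat2 \<kappa> 1 3) * (1 - Chat2 \<kappa> 2 3))
     + (\<Sum>(a, b, c) \<in> {(1, 2, 3), (2, 1, 3), (3, 2, 1)}.
          ((Y a)\<^sup>2 * partial a (1 / Y a * Chat3 \<kappa> 1 2 3)) / ((1 - Chat2 \<kappa> a b) * (1 - Chat2 \<kappa> a c)))"
proof -
  have G: "1 \<in> G3" "2 \<in> G3" "3 \<in> G3" by (simp_all add: G3_def)
  have d: "doubles a \<inter> doubles b = {}" if "a \<noteq> b" for a b using that by (auto simp: doubles_def)
  have td: "triangles \<inter> doubles a = {}" for a by (auto simp: triangles_def doubles_def mk_triangle_def)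
  note f = gf_triangles(2) gf_doubles(2)[OF G(1)] gf_doubles(2)[OF G(2)] gf_doubles(2)[OF G(3)]
  have e: "shape_gf (Collect shape_ok) = shape_gf triangles
     + (shape_gf (doubles 1) + (shape_gf (doubles 2) + shape_gf (doubles 3)))"
  proof -
    have f23: "finite_sizes (doubles 2 \<union> doubles 3) shape_size" by (rule finite_sizes_Un[OF f(3,4)])
    have "doubles 2 \<inter> doubles 3 = {}" "doubles 1 \<inter> (doubles 2 \<union> doubles 3) = {}"
      "triangles \<inter> (doubles 1 \<union> (doubles 2 \<union> doubles 3)) = {}"
      using d[of 1 2] d[of 1 3] d[of 2 3] td by (auto simp: Int_Un_distrib)
    then show ?thesis
      unfolding shapes_eq using gf_Un[OF f(3,4)] gf_Un[OF f(2) f23] gf_Un[OF f(1) finite_sizes_Un[OF f(2) f23]] by metis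
  qed
  have nx: "nx3 1 = 2" "nx3 2 = 3" "nx3 3 = 1" "pv3 1 = 3" "pv3 2 = 1" "pv3 3 = 2" by (simp_all add: nx3_def pv3_def)
  have lf: "to_fract (lst b c) = 1 / (1 - Chat2 \<kappa> b c)" and c2: "to_fract (g2 \<kappa> b c) = Chat2 \<kappa> b c"
    if "b \<in> G3" "c \<in> G3" "b \<noteq> c" for b c
    using one_minus_Chat2(2)[OF that, of \<kappa>] Chat2_eq(1)[OF that, of \<kappa>] by simp_all
  have n: "(2::nat) \<noteq> 3" "(1::nat) \<noteq> 2" "(1::nat) \<noteq> 3" "(3::nat) \<noteq> 1" "(3::nat) \<noteq> 2" "(2::nat) \<noteq> 1" by simp_all
  have sum3: "(\<Sum>(a, b, c) \<in> {(1, 2, 3), (2, 1, 3), (3, 2, 1)}. F a b c) = F 1 2 3 + (F 2 1 3 + F 3 2 1)"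
    for F :: "nat => nat => nat => 'a fps3 fract" by simp
  note dc = double_core(2)[OF G(1), of \<kappa>] double_core(2)[OF G(2), of \<kappa>] double_core(2)[OF G(3), of \<kappa>]
  have tri: "to_fract (shape_gf triangles) =
     ((1 + Chat3 \<kappa> 1 2 3)\<^sup>2 + Chat2 \<kappa> 1 2 * Chat2 \<kappa> 1 3 * Chat2 \<kappa> 2 3 - 1)
       / ((1 - Chat2 \<kappa> 1 2) * (1 - Chat2 \<kappa> 1 3) * (1 - Chat2 \<kappa> 2 3))"
    unfolding gf_triangles(1) Chat3_eq c2[OF G(1,2) n(2), symmetric] c2[OF G(1,3) n(3), symmetric] c2[OF G(2,3) n(1), symmetric]
    by (simp add: power2_eq_square lf[OF G(1,2) n(2)] lf[OF G(1,3) n(3)] lf[OF G(2,3) n(1)]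
        c2[OF G(1,2) n(2)] c2[OF G(1,3) n(3)] c2[OF G(2,3) n(1)] del: One_nat_def)
  have dbl: "to_fract (shape_gf (doubles 1)) = ((Y 1)\<^sup>2 * partial 1 (1 / Y 1 * Chat3 \<kappa> 1 2 3)) / ((1 - Chat2 \<kappa> 1 2) * (1 - Chat2 \<kappa> 1 3))"
    "to_fract (shape_gf (doubles 2)) = ((Y 2)\<^sup>2 * partial 2 (1 / Y 2 * Chat3 \<kappa> 1 2 3)) / ((1 - Chat2 \<kappa> 2 1) * (1 - Chat2 \<kappa> 2 3))"
    "to_fract (shape_gf (doubles 3)) = ((Y 3)\<^sup>2 * partial 3 (1 / Y 3 * Chat3 \<kappa> 1 2 3)) / ((1 - Chat2 \<kappa> 3 2) * (1 - Chat2 \<kappa> 3 1))"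
    unfolding gf_doubles(1)[OF G(1)] gf_doubles(1)[OF G(2)] gf_doubles(1)[OF G(3)] nx to_fract_mult dc
      lf[OF G(1,2) n(2)] lf[OF G(1,3) n(3)] lf[OF G(2,3) n(1)] lf[OF G(2,1) n(6)] lf[OF G(3,1) n(4)] lf[OF G(3,2) n(5)]
    by (simp_all add: mult.commute del: One_nat_def)
  show ?thesis
    unfolding e to_fract_add tri dbl sum3 ..
qed

end

section \<open>Assembling the coefficients\<close>

text \<open>Multiplication by \<open>Y i\<close> after differentiation multiplies a coefficient by
  its exponent: this is how the number of base points enters the series.\<close>

lemma euler2:
  fixes F :: "'a::idom fps3"
  assumes bc: "b \<in> G3" "c \<in> G3" "b \<noteq> c"
  shows "Y b * Y c * partial b (partial c (to_fract F)) = to_fract (fps3 (\<lambda>\<mu>. of_nat (\<mu> b * \<mu> c) * coeff3 F \<mu>))"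
proof -
  have "var3 b * (var3 c * fps3_deriv b (fps3_deriv c F)) = fps3 (\<lambda>\<mu>. of_nat (\<mu> b * \<mu> c) * coeff3 F \<mu>)"
  proof (rule fps3_eqI)
    fix \<mu> assume s: "supp3 \<mu>"
    show "coeff3 (var3 b * (var3 c * fps3_deriv b (fps3_deriv c F))) \<mu> = coeff3 (fps3 (\<lambda>\<mu>. of_nat (\<mu> b * \<mu> c) * coeff3 F \<mu>)) \<mu>"
      unfolding coeff3_fps3[OF s] coeff3_var3_mult[OF bc(1)] coeff3_var3_mult[OF bc(2)] coeff3_deriv[OF bc(1)] coeff3_deriv[OF bc(2)]
      using bc(3) by (simp add: fun_upd_twist mult.assoc del: of_nat_Suc)
  qed
  then show ?thesis by (simp add: Y_eq partial_to_fract flip: to_fract_mult add: mult.assoc)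
qed

lemma euler3:
  fixes F :: "'a::idom fps3"
  shows "Y 1 * Y 2 * Y 3 * partial 1 (partial 2 (partial 3 (to_fract F)))
    = to_fract (fps3 (\<lambda>\<mu>. of_nat (\<Prod>i\<in>G3. \<mu> i) * coeff3 F \<mu>))"
proof -
  have G: "1 \<in> G3" "2 \<in> G3" "3 \<in> G3" by (simp_all add: G3_def)
  have "var3 1 * (var3 2 * (var3 3 * fps3_deriv 1 (fps3_deriv 2 (fps3_deriv 3 F)))) = fps3 (\<lambda>\<mu>. of_nat (\<Prod>i\<in>G3. \<mu> i) * coeff3 F \<mu>)"
  proof (rule fps3_eqI)
    fix \<mu> assume s: "supp3 \<mu>"
    have p: "(\<Prod>i\<in>G3. \<mu> i) = \<mu> 1 * (\<mu> 2 * \<mu> 3)" by (simp add: G3_def)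
    have c: "coeff3 F (\<mu>(1 := \<mu> 1, 2 := \<mu> 2, 3 := \<mu> 3)) = coeff3 F \<mu>" by simp
    show "coeff3 (var3 1 * (var3 2 * (var3 3 * fps3_deriv 1 (fps3_deriv 2 (fps3_deriv 3 F))))) \<mu>
       = coeff3 (fps3 (\<lambda>\<mu>. of_nat (\<Prod>i\<in>G3. \<mu> i) * coeff3 F \<mu>)) \<mu>"
      unfolding coeff3_fps3[OF s] coeff3_var3_mult[OF G(1)] coeff3_var3_mult[OF G(2)] coeff3_var3_mult[OF G(3)]
        coeff3_deriv[OF G(1)] coeff3_deriv[OF G(2)] coeff3_deriv[OF G(3)] p
      by (simp add: fun_upd_twist mult.assoc del: of_nat_Suc)
  qed
  then show ?thesis by (simp add: Y_eq partial_to_fract flip: to_fract_mult add: mult.assoc)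
qed

lemma sum_PiE_single:
  "(\<Sum>f\<in>(\<Pi>\<^sub>E x\<in>{g}. A x). F (f g)) = (\<Sum>a\<in>A g. F a)"
  by (rule sum.reindex_bij_witness[where i = "\<lambda>a. \<lambda>x\<in>{g}. a" and j = "\<lambda>f. f g"])
    (auto simp: PiE_def extensional_def restrict_def fun_eq_iff)

lemma sum_PiE_double:
  assumes "g \<noteq> h"
  shows "(\<Sum>f\<in>(\<Pi>\<^sub>E x\<in>{g, h}. A x). F (f g) (f h)) = (\<Sum>a\<in>A g. \<Sum>b\<in>A h. F a b)"
  unfolding sum.cartesian_product
  by (rule sum.reindex_bij_witness[where i = "\<lambda>(a, b). \<lambda>x\<in>{g, h}. if x = g then a else b" and j = "\<lambda>f. (f g, f h)"])
    (use assms in \<open>auto simp: PiE_def extensional_def restrict_def fun_eq_iff\<close>)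

lemma cycle_partition_nonempty: "{} \<notin> cyc E f"
proof -
  have "orbit f x \<noteq> {}" for x using orbit.base[of f x] by blast
  then show ?thesis by (auto simp: cycle_partition_def)
qed

lemma G3_eq: "G3 = {1..3}"
  by (auto simp: G3_def)

lemma supp3_full: "supp3 \<mu> ==> {i. \<mu> i \<noteq> 0} = {1..3} \<longleftrightarrow> (\<forall>i\<in>G3. 0 < \<mu> i)"
  unfolding G3_eq[symmetric] by (auto simp: supp3_def)

context
  fixes \<kappa> :: "nat multiset => 'a::idom"
begin

lemma sum_NS_triple:
  assumes pos: "\<And>i. i \<in> G3 ==> 0 < \<mu> i"
  shows "(\<Sum>\<nu>\<in>NS_mu G3 \<mu>. \<Prod>V\<in>cycles_of G3 \<mu> \<nu>. \<kappa> {#card V#})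
    = of_nat (\<Prod>i\<in>G3. \<mu> i) * coeff3 (shape_gf \<kappa> (Collect shape_ok)) \<mu>"
proof -
  let ?E = "ground G3 \<mu>"
  have fE: "finite ?E" and perm: "gamma_perm G3 \<mu> permutes ?E"
    by (rule finite_ground[OF card_G3(2)], rule gamma_perm_permutes[OF card_G3(2)])
  have m0: "P - {{}} = P" if "{} \<notin> P" for P :: "(nat \<times> nat) set set" using that by simp
  have "(\<Sum>\<nu>\<in>NS_mu G3 \<mu>. \<Prod>V\<in>cycles_of G3 \<mu> \<nu>. \<kappa> {#card V#})
     = (\<Sum>\<psi>\<in>dual_NS ?E (gamma_perm G3 \<mu>). \<Prod>V\<in>cyc ?E \<psi>. kap \<kappa> (card V))"
    unfolding NS_mu_def kap_def by (rule sum_NS_dual[OF fE perm])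
  also have "\<dots> = (\<Sum>\<psi>\<in>dual_NS ?E (gamma_perm G3 \<mu>). \<Sum>m\<in>markings False ?E \<psi>.
      (\<lambda>_. 1) (card m) * (\<Prod>V\<in>cyc ?E \<psi> - {m}. kap \<kappa> (card V)))"
    by (simp add: markings_def m0[OF cycle_partition_nonempty])
  also have "\<dots> = of_nat (\<Prod>i\<in>G3. \<mu> i) * (\<Sum>ob\<in>shapes.objects \<mu>. (\<lambda>_. 1) (\<Sum>b\<in>{}. shape_gaps ob (fst b) ! snd b)
           * (\<Prod>V\<in>cyc (ground G3 (\<lambda>i. length (shape_gaps ob i))) (shape_map ob) - {{}}. kap \<kappa> (\<Sum>b\<in>V. shape_gaps ob (fst b) ! snd b)))"
    by (rule shapes.sum_marked_NS(2)[where \<mu> = \<mu> and f = "\<lambda>_. 1" and w = "kap \<kappa>"]) (rule pos)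
  also have "(\<Sum>ob\<in>shapes.objects \<mu>. (\<lambda>_. 1) (\<Sum>b\<in>{}. shape_gaps ob (fst b) ! snd b)
           * (\<Prod>V\<in>cyc (ground G3 (\<lambda>i. length (shape_gaps ob i))) (shape_map ob) - {{}}. kap \<kappa> (\<Sum>b\<in>V. shape_gaps ob (fst b) ! snd b)))
     = (\<Sum>ob\<in>shapes.objects \<mu>. shape_weight (kap \<kappa>) ob)"
    by (rule sum.cong[OF refl])
      (simp add: m0[OF cycle_partition_nonempty] prod_shape shapes.objects_def)
  also have "shapes.objects \<mu> = {ob \<in> Collect shape_ok. \<forall>i\<in>G3. shape_size ob i = \<mu> i}"
    by (simp add: shapes.objects_def shape_size_def)
  finally show ?thesis unfolding coeff3_gf .
qed

lemma Ctilde_ser: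
  "ser (Ctilde_coeff \<kappa> 3) = to_fract (fps3 (\<lambda>\<mu>. of_nat (\<Prod>i\<in>G3. \<mu> i) * coeff3 (shape_gf \<kappa> (Collect shape_ok)) \<mu>))"
proof -
  have "fps3 (Ctilde_coeff \<kappa> 3) = fps3 (\<lambda>\<mu>. of_nat (\<Prod>i\<in>G3. \<mu> i) * coeff3 (shape_gf \<kappa> (Collect shape_ok)) \<mu>)"
  proof (rule fps3_eqI)
    fix \<mu> assume s: "supp3 \<mu>"
    show "coeff3 (fps3 (Ctilde_coeff \<kappa> 3)) \<mu>
      = coeff3 (fps3 (\<lambda>\<mu>. of_nat (\<Prod>i\<in>G3. \<mu> i) * coeff3 (shape_gf \<kappa> (Collect shape_ok)) \<mu>)) \<mu>"
    proof (cases "\<forall>i\<in>G3. 0 < \<mu> i")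
      case True
      \<comment> \<open>Without blue vertices the only choice map is the function that is undefined
        everywhere.\<close>
      have L: "{l \<in> {} \<rightarrow>\<^sub>E C. inj_on l {}} = {\<lambda>_. undefined}" for C :: "(nat \<times> nat) set set" by auto
      have "Ctilde_coeff \<kappa> 3 \<mu> = (\<Sum>\<nu>\<in>(\<Pi>\<^sub>E G\<in>{G3}. NS_mu G \<mu>). \<Prod>V\<in>cycles_of G3 \<mu> (\<nu> G3). \<kappa> {#card V#})"
      proof -
        have supp: "{i. \<mu> i \<noteq> 0} = G3" using supp3_full[OF s] True unfolding G3_eq by blast
        have b0: "blues_at G {} = {}" for G by (simp add: blues_at_def)
        have P1: "(\<Prod>G\<in>{g}. Fg G) = Fg g" for g :: "nat set" and Fg :: "nat set => 'a" by simp
        have c: "(\<Sum>L\<in>(\<Pi>\<^sub>E G\<in>{G3}. {\<lambda>_. undefined}). x) = x" for x :: 'a by (simp add: card_PiE)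
        show ?thesis unfolding Ctilde_coeff_def Cbar_coeff_def G3_eq[symmetric] if_P[OF supp] b0 L P1 image_empty Diff_empty prod.empty mult_1 c ..
      qed
      also have "\<dots> = (\<Sum>\<nu>\<in>NS_mu G3 \<mu>. \<Prod>V\<in>cycles_of G3 \<mu> \<nu>. \<kappa> {#card V#})"
        by (rule sum_PiE_single)
      finally show ?thesis unfolding coeff3_fps3[OF s] using sum_NS_triple[of \<mu>] True by simp
    next
      case False
      then have "(\<Prod>i\<in>G3. \<mu> i) = 0" using card_G3(2) by (simp add: prod_zero_iff)
      moreover have n: "{i. \<mu> i \<noteq> 0} \<noteq> {1..3}" using False supp3_full[OF s] by blast
      have "Ctilde_coeff \<kappa> 3 \<mu> = 0" unfolding Ctilde_coeff_def Cbar_coeff_def by (rule if_not_P[OF n])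
      ultimately show ?thesis unfolding coeff3_fps3[OF s] by simp
    qed
  qed
  then show ?thesis unfolding ser_eq by simp
qed

text \<open>On a single white vertex a cycle of \<alpha> may contain only one point, so \<alpha> is
  the identity and \<psi> equals \<tau>.\<close>

lemma dual_NS_single:
  assumes "0 < \<mu> a"
  shows "dual_NS (ground {a} \<mu>) (gamma_perm {a} \<mu>) = {gamma_perm {a} \<mu>}"
proof -
  let ?E = "ground {a} \<mu>" and ?t = "gamma_perm {a} \<mu>"
  have perm: "?t permutes ?E" by (rule gamma_perm_permutes) simp
  have pos: "\<And>i. i \<in> {a} ==> 0 < \<mu> i" using assms by simp
  have fE: "finite ?E" by (rule finite_ground) simp
  have E: "?E = {a} \<times> {..<\<mu> a}" by (auto simp: ground_def)
  have orb: "orbit ?t b = ?E" if "b \<in> ?E" for b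
    using orbit_gamma_perm[of "{a}" "fst b" "snd b" \<mu>] that unfolding E by auto
  have c1: "ncyc ?E ?t = 1" using card_cycle_gamma_perm[where G = "{a}" and \<mu> = \<mu>, OF _ pos] by simp
  have ii: "inv ?t \<circ> ?t = id" using permutes_inv_o(2)[OF perm] .
  have orbid: "orbit id b = {b}" for b :: "nat \<times> nat"
  proof -
    have "x = b" if "x \<in> orbit id b" for x using that by induction auto
    then show ?thesis using orbit.base[of id b] by auto
  qed
  have "\<psi> = ?t" if psi: "\<psi> \<in> dual_NS ?E ?t" for \<psi>
  proof -
    have p: "\<psi> permutes ?E" using psi by (simp add: dual_NS_def)
    have "inv ?t (\<psi> b) = b" if b: "b \<in> ?E" for b
    proof (rule ccontr)
      assume ne: "inv ?t (\<psi> b) \<noteq> b"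
      have "inv ?t (\<psi> b) \<in> ?E" using b p permutes_inv[OF perm] by (simp add: permutes_in_image)
      then have "inv ?t (\<psi> b) \<in> orbit ?t b" using orb[OF b] by simp
      moreover have "(inv ?t \<circ> \<psi>) b \<in> orbit (inv ?t \<circ> \<psi>) b" by (rule orbit.base)
      ultimately show False using psi b ne by (auto simp: dual_NS_def)
    qed
    then have "\<psi> b = ?t b" if "b \<in> ?E" for b using that permutes_inverses(1)[OF perm] by metis
    moreover have "\<psi> b = ?t b" if "b \<notin> ?E" for b using that permutes_not_in[OF p] permutes_not_in[OF perm] by simp
    ultimately show ?thesis by blast
  qed
  moreover have "?t \<in> dual_NS ?E ?t"
    unfolding dual_NS_def mem_Collect_eq ii c1
  proof (intro conjI ballI impI perm)
    show "transitive_pair ?E ?t ?t"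
      unfolding transitive_pair_def
    proof (intro conjI allI impI)
      show "?E \<noteq> {}" using assms unfolding E by auto
      fix A assume A: "A \<subseteq> ?E" "A \<noteq> {}" "?t ` A \<subseteq> A"
      then obtain x where x: "x \<in> A" by blast
      have "y \<in> A" if "y \<in> orbit ?t x" for y using that by induction (use x A(3) in auto)
      then show "A = ?E" using orb[of x] x A(1) by blast
    qed
    have "cyc ?E id = (\<lambda>b. {b}) ` ?E" by (simp add: cycle_partition_def orbid)
    then have "ncyc ?E id = card ?E" by (simp add: card_image)
    then show "1 + 1 + ncyc ?E id = card ?E + 2" by simp
  qed (auto simp: orbid)
  ultimately show ?thesis by blast
qed

text \<open>The only permutation has one cycle, of size \<open>\<mu> a\<close>; it is the chosen
  one, and no cycle is left for the product.\<close>

lemma sum_NS_single: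
  assumes "0 < \<mu> a"
  shows "(\<Sum>\<nu>\<in>NS_mu {a} \<mu>. \<Sum>V\<in>cycles_of {a} \<mu> \<nu>. F (card V) * (\<Prod>V\<in>cycles_of {a} \<mu> \<nu> - {V}. h V)) = F (\<mu> a)"
proof -
  have "cyc (ground {a} \<mu>) (gamma_perm {a} \<mu>) = {{a} \<times> {..<\<mu> a}}"
    using cycle_partition_gamma_perm[where G = "{a}" and \<mu> = \<mu>] assms by simp
  moreover have "(\<Sum>\<nu>\<in>NS_mu {a} \<mu>. \<Sum>V\<in>cycles_of {a} \<mu> \<nu>. F (card V) * (\<Prod>V\<in>cycles_of {a} \<mu> \<nu> - {V}. h V))
     = (\<Sum>\<psi>\<in>dual_NS (ground {a} \<mu>) (gamma_perm {a} \<mu>). \<Sum>V\<in>cycles_of {a} \<mu> \<psi>. F (card V) * (\<Prod>V\<in>cycles_of {a} \<mu> \<psi> - {V}. h V))"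
    unfolding NS_mu_def by (rule sum_NS_dual) (simp_all add: finite_ground gamma_perm_permutes)
  ultimately show ?thesis unfolding dual_NS_single[of \<mu> a, OF assms] by simp
qed

lemma sum_NS_double:
  assumes bc: "b \<noteq> c" and pos: "0 < \<mu> b" "0 < \<mu> c"
  shows "(\<Sum>\<nu>\<in>NS_mu {b, c} \<mu>. \<Sum>V\<in>cycles_of {b, c} \<mu> \<nu>. f (card V) * (\<Prod>V\<in>cycles_of {b, c} \<mu> \<nu> - {V}. kap \<kappa> (card V)))
    = of_nat (\<mu> b * \<mu> c) * (\<Sum>u\<in>{u. u \<noteq> [] \<and> list_all pos2 u \<and> pairs_size b c u b = \<mu> b \<and> pairs_size b c u c = \<mu> c}.
        f (sum2 (hd u)) * pairs_weight (kap \<kappa>) (tl u))"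
proof -
  let ?G = "{b, c}"
  let ?E = "ground ?G \<mu>"
  interpret A: structures ?G "ladders1" "annular_gaps b" "annular_map b c" "\<lambda>_. {(b, 0), (c, 0)}" True
    by (rule annular_structures[OF bc])
  have pos': "\<And>i. i \<in> ?G ==> 0 < \<mu> i" using pos by auto
  have "(\<Sum>\<nu>\<in>NS_mu ?G \<mu>. \<Sum>V\<in>cycles_of ?G \<mu> \<nu>. f (card V) * (\<Prod>V\<in>cycles_of ?G \<mu> \<nu> - {V}. kap \<kappa> (card V)))
     = (\<Sum>\<psi>\<in>dual_NS ?E (gamma_perm ?G \<mu>). \<Sum>V\<in>cycles_of ?G \<mu> \<psi>. f (card V) * (\<Prod>V\<in>cycles_of ?G \<mu> \<psi> - {V}. kap \<kappa> (card V)))"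
    unfolding NS_mu_def by (rule sum_NS_dual) (simp_all add: finite_ground gamma_perm_permutes)
  also have "\<dots> = (\<Sum>\<psi>\<in>dual_NS ?E (gamma_perm ?G \<mu>). \<Sum>m\<in>markings True ?E \<psi>. f (card m) * (\<Prod>V\<in>cyc ?E \<psi> - {m}. kap \<kappa> (card V)))"
    by (simp add: markings_def)
  also have "\<dots> = of_nat (\<Prod>i\<in>?G. \<mu> i) * (\<Sum>u\<in>A.objects \<mu>. f (\<Sum>y\<in>{(b, 0), (c, 0)}. annular_gaps b u (fst y) ! snd y)
      * (\<Prod>V\<in>cyc (ground ?G (\<lambda>i. length (annular_gaps b u i))) (annular_map b c u) - {{(b, 0), (c, 0)}}.
          kap \<kappa> (\<Sum>y\<in>V. annular_gaps b u (fst y) ! snd y)))"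
    by (rule A.sum_marked_NS(2)[where \<mu> = \<mu>]) (rule pos')
  also have "(\<Sum>u\<in>A.objects \<mu>. f (\<Sum>y\<in>{(b, 0), (c, 0)}. annular_gaps b u (fst y) ! snd y)
      * (\<Prod>V\<in>cyc (ground ?G (\<lambda>i. length (annular_gaps b u i))) (annular_map b c u) - {{(b, 0), (c, 0)}}.
          kap \<kappa> (\<Sum>y\<in>V. annular_gaps b u (fst y) ! snd y)))
     = (\<Sum>u\<in>A.objects \<mu>. f (sum2 (hd u)) * pairs_weight (kap \<kappa>) (tl u))"
  proof (rule sum.cong[OF refl])
    fix u assume "u \<in> A.objects \<mu>"
    then have u: "u \<noteq> []" by (simp add: A.objects_def)
    show "f (\<Sum>y\<in>{(b, 0), (c, 0)}. annular_gaps b u (fst y) ! snd y)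
      * (\<Prod>V\<in>cyc (ground ?G (\<lambda>i. length (annular_gaps b u i))) (annular_map b c u) - {{(b, 0), (c, 0)}}.
          kap \<kappa> (\<Sum>y\<in>V. annular_gaps b u (fst y) ! snd y)) = f (sum2 (hd u)) * pairs_weight (kap \<kappa>) (tl u)"
      unfolding annular_weights(1)[OF bc u] annular_weights(2)[OF bc u] ..
  qed
  also have "A.objects \<mu> = {u. u \<noteq> [] \<and> list_all pos2 u \<and> pairs_size b c u b = \<mu> b \<and> pairs_size b c u c = \<mu> c}"
  proof -
    have "sum_list (annular_gaps b u b) = pairs_size b c u b" "sum_list (annular_gaps b u c) = pairs_size b c u c" if "u \<noteq> []" for u
      using that bc by (cases u; simp add: annular_gaps_def pairs_size_def pair_size_def)+
    then show ?thesis unfolding A.objects_def by auto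
  qed
  also have "(\<Prod>i\<in>?G. \<mu> i) = \<mu> b * \<mu> c" using bc by simp
  finally show ?thesis .
qed

text \<open>The blue vertex picks the unique cycle at the block of \<open>a\<close>, of size
  \<open>\<mu> a\<close>, and one cycle at the other block, which is the mark of a cyclic
  ladder.\<close>

lemma Cbar1_ser:
  assumes G: "G3 = {a, b, c}" and dist: "a \<noteq> b" "a \<noteq> c" "b \<noteq> c"
  shows "ser (Cbar1_coeff \<kappa> 3 {{a}, {b, c}}) = to_fract (fps3 (\<lambda>\<mu>. of_nat (\<mu> b * \<mu> c) * coeff3 (annular_gf \<kappa> a b c) \<mu>))"
proof -
  let ?\<pi> = "{{a}, {b, c}}"
  have ne: "{a} \<noteq> {b, c}" using dist by auto
  have bl: "blues_at g {?\<pi>} = {?\<pi>}" if "g \<in> ?\<pi>" for g using that by (auto simp: blues_at_def)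
  have cf: "coeff3 (annular_gf \<kappa> a b c) \<mu> = (\<Sum>u\<in>{u. u \<noteq> [] \<and> list_all pos2 u \<and> pairs_size b c u b = \<mu> b \<and> pairs_size b c u c = \<mu> c}.
      \<kappa> {#\<mu> a, sum2 (hd u)#} * pairs_weight (kap \<kappa>) (tl u))" (is "_ = sum _ ?U") if pa: "0 < \<mu> a" for \<mu>
  proof -
    have pa0: "pairs_size b c u a = 0" for u using dist by (simp add: pairs_size_def pair_size_def)
    have pb0: "(if b = a then n else 0) = 0" "(if c = a then n else 0) = 0" for n :: nat using dist by auto
    have "{ob \<in> {n. 0 < n} \<times> ladders1. \<forall>i\<in>G3. annular_size a b c ob i = \<mu> i} = Pair (\<mu> a) ` ?U"
      unfolding G annular_size_def using pa by (auto simp: pa0 pb0)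
    then show ?thesis unfolding annular_gf_def coeff3_gf by (simp add: sum.reindex inj_on_def annular_weight_def)
  qed
  have "fps3 (Cbar1_coeff \<kappa> 3 ?\<pi>) = fps3 (\<lambda>\<mu>. of_nat (\<mu> b * \<mu> c) * coeff3 (annular_gf \<kappa> a b c) \<mu>)"
  proof (rule fps3_eqI)
    fix \<mu> assume s: "supp3 \<mu>"
    show "coeff3 (fps3 (Cbar1_coeff \<kappa> 3 ?\<pi>)) \<mu> = coeff3 (fps3 (\<lambda>\<mu>. of_nat (\<mu> b * \<mu> c) * coeff3 (annular_gf \<kappa> a b c) \<mu>)) \<mu>"
    proof (cases "\<forall>i\<in>G3. 0 < \<mu> i")
      case True
      then have pos: "0 < \<mu> a" "0 < \<mu> b" "0 < \<mu> c" unfolding G by simp_all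
      let ?h = "\<lambda>V. \<kappa> {#card V#}"
      let ?C1 = "cycles_of {a} \<mu>" and ?C2 = "cycles_of {b, c} \<mu>"
      let ?K = "\<lambda>\<nu>1 \<nu>2 V1 V2. \<kappa> {#card V1, card V2#} * (prod ?h (?C1 \<nu>1 - {V1}) * prod ?h (?C2 \<nu>2 - {V2}))"
      let ?LL = "\<lambda>\<nu> G. {l \<in> {?\<pi>} \<rightarrow>\<^sub>E cycles_of G \<mu> (\<nu> G). inj_on l {?\<pi>}}"
      \<comment> \<open>With one blue vertex an injective choice map amounts to the choice of a
        single cycle.\<close>
      have sumL: "(\<Sum>l\<in>{l \<in> {?\<pi>} \<rightarrow>\<^sub>E C. inj_on l {?\<pi>}}. F (l ?\<pi>)) = (\<Sum>V\<in>C. F V)"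
        for C :: "(nat \<times> nat) set set" and F :: "(nat \<times> nat) set => 'a"
        using sum_PiE_single[of F ?\<pi> "\<lambda>_. C"] by simp
      have ms: "image_mset (\<lambda>G. card (L G ?\<pi>)) (mset_set ?\<pi>) = {#card (L {a} ?\<pi>), card (L {b, c} ?\<pi>)#}"
        for L :: "nat set => nat set set => (nat \<times> nat) set" using ne by simp
      have PE: "(\<Pi>\<^sub>E G\<in>?\<pi>. {l \<in> blues_at G {?\<pi>} \<rightarrow>\<^sub>E cycles_of G \<mu> (\<nu> G). inj_on l (blues_at G {?\<pi>})}) = (\<Pi>\<^sub>E G\<in>?\<pi>. ?LL \<nu> G)" for \<nu>
        by (rule PiE_cong) (simp add: bl)
      have pr: "(\<Prod>G\<in>?\<pi>. \<Prod>V\<in>cycles_of G \<mu> (\<nu> G) - L G ` blues_at G {?\<pi>}. ?h V)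
         = prod ?h (?C1 (\<nu> {a}) - {L {a} ?\<pi>}) * prod ?h (?C2 (\<nu> {b, c}) - {L {b, c} ?\<pi>})" for \<nu> L
        using ne bl[of "{a}"] bl[of "{b, c}"] by simp
      have "Cbar1_coeff \<kappa> 3 ?\<pi> \<mu> = (\<Sum>\<nu>\<in>(\<Pi>\<^sub>E G\<in>?\<pi>. NS_mu G \<mu>). \<Sum>L\<in>(\<Pi>\<^sub>E G\<in>?\<pi>. ?LL \<nu> G).
          ?K (\<nu> {a}) (\<nu> {b, c}) (L {a} ?\<pi>) (L {b, c} ?\<pi>))"
      proof -
        have "{i. \<mu> i \<noteq> 0} = {1..3}" using supp3_full[OF s] True by blast
        note supp = this
        have P1: "(\<Prod>K\<in>{?\<pi>}. Fk K) = Fk ?\<pi>" for Fk :: "nat set set => 'a" by simp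
        show ?thesis unfolding Cbar1_coeff_def Cbar_coeff_def if_P[OF supp] PE pr P1 ms ..
      qed
      also have "\<dots> = (\<Sum>\<nu>\<in>(\<Pi>\<^sub>E G\<in>?\<pi>. NS_mu G \<mu>). \<Sum>V1\<in>?C1 (\<nu> {a}). \<Sum>V2\<in>?C2 (\<nu> {b, c}). ?K (\<nu> {a}) (\<nu> {b, c}) V1 V2)"
      proof (rule sum.cong[OF refl])
        fix \<nu>
        have "(\<Sum>L\<in>(\<Pi>\<^sub>E G\<in>?\<pi>. ?LL \<nu> G). ?K (\<nu> {a}) (\<nu> {b, c}) (L {a} ?\<pi>) (L {b, c} ?\<pi>))
           = (\<Sum>l1\<in>?LL \<nu> {a}. \<Sum>l2\<in>?LL \<nu> {b, c}. ?K (\<nu> {a}) (\<nu> {b, c}) (l1 ?\<pi>) (l2 ?\<pi>))"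
          by (rule sum_PiE_double[OF ne])
        also have "\<dots> = (\<Sum>V1\<in>?C1 (\<nu> {a}). \<Sum>V2\<in>?C2 (\<nu> {b, c}). ?K (\<nu> {a}) (\<nu> {b, c}) V1 V2)"
        proof -
          have "(\<Sum>l1\<in>?LL \<nu> {a}. \<Sum>l2\<in>?LL \<nu> {b, c}. ?K (\<nu> {a}) (\<nu> {b, c}) (l1 ?\<pi>) (l2 ?\<pi>))
             = (\<Sum>l1\<in>?LL \<nu> {a}. \<Sum>V2\<in>?C2 (\<nu> {b, c}). ?K (\<nu> {a}) (\<nu> {b, c}) (l1 ?\<pi>) V2)"
            by (rule sum.cong[OF refl]) (rule sumL)
          also have "\<dots> = (\<Sum>V1\<in>?C1 (\<nu> {a}). \<Sum>V2\<in>?C2 (\<nu> {b, c}). ?K (\<nu> {a}) (\<nu> {b, c}) V1 V2)"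
            by (rule sumL)
          finally show ?thesis .
        qed
        finally show "(\<Sum>L\<in>(\<Pi>\<^sub>E G\<in>?\<pi>. ?LL \<nu> G). ?K (\<nu> {a}) (\<nu> {b, c}) (L {a} ?\<pi>) (L {b, c} ?\<pi>))
           = (\<Sum>V1\<in>?C1 (\<nu> {a}). \<Sum>V2\<in>?C2 (\<nu> {b, c}). ?K (\<nu> {a}) (\<nu> {b, c}) V1 V2)" .
      qed
      also have "\<dots> = (\<Sum>\<nu>1\<in>NS_mu {a} \<mu>. \<Sum>\<nu>2\<in>NS_mu {b, c} \<mu>. \<Sum>V1\<in>?C1 \<nu>1. \<Sum>V2\<in>?C2 \<nu>2. ?K \<nu>1 \<nu>2 V1 V2)"
        by (rule sum_PiE_double[OF ne])
      also have "\<dots> = (\<Sum>\<nu>1\<in>NS_mu {a} \<mu>. \<Sum>V1\<in>?C1 \<nu>1. \<Sum>\<nu>2\<in>NS_mu {b, c} \<mu>. \<Sum>V2\<in>?C2 \<nu>2. ?K \<nu>1 \<nu>2 V1 V2)"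
        by (rule sum.cong[OF refl]) (rule sum.swap)
      also have "\<dots> = (\<Sum>\<nu>1\<in>NS_mu {a} \<mu>. \<Sum>V1\<in>?C1 \<nu>1.
          (\<Sum>\<nu>2\<in>NS_mu {b, c} \<mu>. \<Sum>V2\<in>?C2 \<nu>2. \<kappa> {#card V1, card V2#} * prod ?h (?C2 \<nu>2 - {V2})) * prod ?h (?C1 \<nu>1 - {V1}))"
        unfolding sum_distrib_right by (intro sum.cong refl) (simp only: mult_ac)
      also have "\<dots> = (\<Sum>\<nu>2\<in>NS_mu {b, c} \<mu>. \<Sum>V2\<in>?C2 \<nu>2. \<kappa> {#\<mu> a, card V2#} * prod ?h (?C2 \<nu>2 - {V2}))"
        \<comment> \<open>The whole sum over the second block plays the part of \<open>F\<close>: it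
          depends on the cycle chosen in the first block only through its size.\<close>
        by (rule sum_NS_single[where \<mu> = \<mu> and a = a and F = "\<lambda>n. \<Sum>\<nu>2\<in>NS_mu {b, c} \<mu>. \<Sum>V2\<in>?C2 \<nu>2. \<kappa> {#n, card V2#} * prod ?h (?C2 \<nu>2 - {V2})", OF pos(1)])
      also have "\<dots> = of_nat (\<mu> b * \<mu> c) * coeff3 (annular_gf \<kappa> a b c) \<mu>"
        unfolding cf[where \<mu> = \<mu>, OF pos(1)]
        using sum_NS_double[where \<mu> = \<mu> and f = "\<lambda>n. \<kappa> {#\<mu> a, n#}", OF dist(3) pos(2,3)] unfolding kap_def .
      finally show ?thesis unfolding coeff3_fps3[OF s] .
    next
      case False
      have "\<mu> b * \<mu> c = 0 \<or> \<mu> a = 0" using False unfolding G by auto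
      moreover have "coeff3 (annular_gf \<kappa> a b c) \<mu> = 0" if "\<mu> a = 0"
      proof -
        have "annular_size a b c (n, u) a = n" for n u using dist by (simp add: annular_size_def pairs_size_def pair_size_def)
        then have "{ob \<in> {n. 0 < n} \<times> ladders1. \<forall>i\<in>G3. annular_size a b c ob i = \<mu> i} = {}"
          unfolding G using that by auto
        then show ?thesis unfolding annular_gf_def coeff3_gf by (simp only: sum.empty)
      qed
      ultimately have "of_nat (\<mu> b * \<mu> c) * coeff3 (annular_gf \<kappa> a b c) \<mu> = 0" by auto
      moreover have "Cbar1_coeff \<kappa> 3 ?\<pi> \<mu> = 0"
        using False supp3_full[OF s] unfolding Cbar1_coeff_def Cbar_coeff_def by (simp only: if_False)
      ultimately show ?thesis unfolding coeff3_fps3[OF s] by simp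
    qed
  qed
  then show ?thesis unfolding ser_eq by simp
qed

end

section \<open>Trees and partitions for three indices\<close>

lemma bip_trees_single:
  fixes g :: 'b shows "bip_trees {g} = {{}}"
proof -
  have "T = {}" if "\<forall>K\<in>T. K \<subseteq> {g} \<and> 2 \<le> card K" for T :: "'b set set"
  proof (rule ccontr)
    assume "T \<noteq> {}"
    then obtain K where "K \<in> T" by blast
    then have "K \<subseteq> {g}" "2 \<le> card K" using that by auto
    moreover from this(1) have "card K \<le> card {g}" by (intro card_mono) auto
    ultimately show False by simp
  qed
  moreover have "is_tree (bip_vertices {g} {}) (bip_edges {})"
  proof -
    have "\<not> (3 \<le> length xs \<and> {last xs, hd xs} \<in> bip_edges {})" for xs :: "('b + 'b set) list"
      by (simp add: bip_edges_def)
    then show ?thesis unfolding is_tree_def by (auto simp: bip_vertices_def)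
  qed
  ultimately show ?thesis unfolding bip_trees_def by blast
qed

text \<open>A blue vertex is a set of at least two of the two blocks, so there is at most one, and
  without it the two blocks are not connected.\<close>

lemma bip_trees_double:
  assumes gh: "g \<noteq> h" shows "bip_trees {g, h} = {{{g, h}}}"
proof -
  let ?\<pi> = "{g, h}"
  have sub: "T = {} \<or> T = {?\<pi>}" if "\<forall>K\<in>T. K \<subseteq> ?\<pi> \<and> 2 \<le> card K" for T
  proof -
    have "K = ?\<pi>" if "K \<in> T" for K
    proof -
      have "K \<subseteq> ?\<pi>" "card ?\<pi> \<le> card K" using \<open>\<forall>K\<in>T. K \<subseteq> ?\<pi> \<and> 2 \<le> card K\<close> that gh by auto
      then show ?thesis by (intro card_seteq) auto
    qed
    then show ?thesis by blast
  qed
  have no: "\<not> is_tree (bip_vertices ?\<pi> {}) (bip_edges {})"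
  proof
    assume "is_tree (bip_vertices ?\<pi> {}) (bip_edges {})"
    then have "(Inl g, Inl h) \<in> {(x, y). {x, y} \<in> bip_edges ({} :: 'a set set)}\<^sup>*"
      unfolding is_tree_def bip_vertices_def by simp
    moreover have "{(x, y). {x, y} \<in> bip_edges ({} :: 'a set set)} = {}" by (simp add: bip_edges_def)
    ultimately show False using gh by simp
  qed
  let ?E = "bip_edges {?\<pi>}" and ?z = "Inr ?\<pi> :: 'a + 'a set"
  have E: "?E = {{Inl g, ?z}, {Inl h, ?z}}" by (auto simp: bip_edges_def)
  let ?R = "{(x, y). {x, y} \<in> ?E}"
  have yes: "is_tree (bip_vertices ?\<pi> {?\<pi>}) ?E"
    unfolding is_tree_def
  proof (intro conjI ballI)
    show "bip_vertices ?\<pi> {?\<pi>} \<noteq> {}" by (simp add: bip_vertices_def)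
    fix u v assume uv: "u \<in> bip_vertices ?\<pi> {?\<pi>}" "v \<in> bip_vertices ?\<pi> {?\<pi>}"
    have "(u, ?z) \<in> ?R\<^sup>*" using uv(1) by (auto simp: bip_vertices_def E)
    moreover have "(?z, v) \<in> ?R\<^sup>*" using uv(2) by (auto simp: bip_vertices_def E insert_commute)
    ultimately show "(u, v) \<in> ?R\<^sup>*" by (rule rtrancl_trans)
  next
    show "\<nexists>xs. 3 \<le> length xs \<and> distinct xs \<and> successively (\<lambda>x y. {x, y} \<in> ?E) xs \<and> {last xs, hd xs} \<in> ?E"
    proof
    assume "\<exists>xs. 3 \<le> length xs \<and> distinct xs \<and> successively (\<lambda>x y. {x, y} \<in> ?E) xs \<and> {last xs, hd xs} \<in> ?E"
    then obtain xs where xs: "3 \<le> length xs" "distinct xs" "successively (\<lambda>x y. {x, y} \<in> ?E) xs" "{last xs, hd xs} \<in> ?E" by blast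
    obtain x1 x2 x3 ys where e: "xs = x1 # x2 # x3 # ys"
      using xs(1) by (cases xs; cases "tl xs"; cases "tl (tl xs)") auto
    \<comment> \<open>All edges contain the blue vertex, so three edges of a cycle would make it
      occur at two different places.\<close>
    have z: "?z \<in> A" if "A \<in> ?E" for A using that unfolding E by blast
    have "{x1, x2} \<in> ?E" "{x2, x3} \<in> ?E" "{last xs, x1} \<in> ?E" using xs(3,4) unfolding e by simp_all
    from this[THEN z] have "?z \<in> {x1, x2}" "?z \<in> {x2, x3}" "?z \<in> {last xs, x1}" .
    moreover have "last xs \<in> set (x3 # ys)" unfolding e by simp
    ultimately show False using xs(2) unfolding e by auto
    qed
  qed
  show ?thesis unfolding bip_trees_def
  proof (intro set_eqI iffI)
    fix T assume "T \<in> {T. (\<forall>K\<in>T. K \<subseteq> ?\<pi> \<and> 2 \<le> card K) \<and> is_tree (bip_vertices ?\<pi> T) (bip_edges T)}"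
    then show "T \<in> {{?\<pi>}}" using sub[of T] no by blast
  next
    fix T assume "T \<in> {{?\<pi>}}"
    then show "T \<in> {T. (\<forall>K\<in>T. K \<subseteq> ?\<pi> \<and> 2 \<le> card K) \<and> is_tree (bip_vertices ?\<pi> T) (bip_edges T)}" using yes gh by auto
  qed
qed

lemma partition_on_eqI:
  assumes "partition_on A P" "X \<subseteq> P" "A \<subseteq> \<Union>X" shows "P = X"
proof (rule ccontr)
  assume "P \<noteq> X"
  then obtain B where B: "B \<in> P" "B \<notin> X" using assms(2) by blast
  obtain x where x: "x \<in> B" using partition_onD3[OF assms(1)] B(1) by (cases "B = {}") auto
  then have "x \<in> A" using partition_onD1[OF assms(1)] B(1) by blast
  then obtain C where C: "C \<in> X" "x \<in> C" using assms(3) by blast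
  then have "B \<inter> C = {}" using disjointD[OF partition_onD2[OF assms(1)] B(1), of C] B(2) assms(2) by blast
  then show False using x C by blast
qed

text \<open>A partition consists of the blocks of the points 1, 2 and 3, and which of these coincide
  determines it.\<close>

lemma nontrivial_partitions_3:
  "nontrivial_partitions 3 = {{{1, 2, 3}}, {{1}, {2, 3}}, {{2}, {1, 3}}, {{3}, {1, 2}}}"
proof -
  have I: "{1..3} = {1, 2, 3::nat}" by auto
  have ex: "\<exists>B\<in>P. x \<in> B" if "partition_on {1..3} P" "x \<in> {1, 2, 3}" for P and x :: nat
    using partition_onD1[OF that(1)] that(2) unfolding I by blast
  have dj: "B = C" if "partition_on {1..3} P" "B \<in> P" "C \<in> P" "x \<in> B" "x \<in> C" for P B C and x :: nat
    using partition_onD2[OF that(1)] that(2-) unfolding disjoint_def by blast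
  have blk: "B \<subseteq> {1, 2, 3}" if "partition_on {1..3} P" "B \<in> P" for P and B :: "nat set"
    using partition_onD1[OF that(1)] that(2) unfolding I by blast
  have cls: "P \<in> {{{1, 2, 3}}, {{1}, {2, 3}}, {{2}, {1, 3}}, {{3}, {1, 2}}} \<or> P = {{1}, {2}, {3}}" if P: "partition_on {1..3} P" for P :: "nat set set"
  proof -
    obtain B1 B2 B3 where B: "B1 \<in> P" "1 \<in> B1" "B2 \<in> P" "2 \<in> B2" "B3 \<in> P" "3 \<in> B3"
      using ex[OF P, of 1] ex[OF P, of 2] ex[OF P, of 3] by auto
    have "{1..3} \<subseteq> \<Union>{B1, B2, B3}" unfolding I using B by simp
    then have PB: "P = {B1, B2, B3}" by (intro partition_on_eqI[OF P]) (use B in auto)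
    have s: "B1 \<subseteq> {1, 2, 3}" "B2 \<subseteq> {1, 2, 3}" "B3 \<subseteq> {1, 2, 3}" using blk[OF P] B by blast+
    have d12: "B1 = B2 \<longleftrightarrow> 2 \<in> B1" "B1 = B2 \<longleftrightarrow> 1 \<in> B2" using dj[OF P B(1,3)] B by blast+
    have d13: "B1 = B3 \<longleftrightarrow> 3 \<in> B1" "B1 = B3 \<longleftrightarrow> 1 \<in> B3" using dj[OF P B(1,5)] B by blast+
    have d23: "B2 = B3 \<longleftrightarrow> 3 \<in> B2" "B2 = B3 \<longleftrightarrow> 2 \<in> B3" using dj[OF P B(3,5)] B by blast+
    have e: "X = (if 1 \<in> X then {1} else {}) \<union> (if 2 \<in> X then {2} else {}) \<union> (if 3 \<in> X then {3} else {})"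
      if "X \<subseteq> {1, 2, 3}" for X :: "nat set" using that by auto
    have b1: "B1 = {1} \<union> (if B1 = B2 then {2} else {}) \<union> (if B1 = B3 then {3} else {})"
      using e[OF s(1)] B(2) d12(1) d13(1) by simp
    have b2: "B2 = (if B1 = B2 then {1} else {}) \<union> {2} \<union> (if B2 = B3 then {3} else {})"
      using e[OF s(2)] B(4) d12(2) d23(1) by simp
    have b3: "B3 = (if B1 = B3 then {1} else {}) \<union> (if B2 = B3 then {2} else {}) \<union> {3}"
      using e[OF s(3)] B(6) d13(2) d23(2) by simp
    show ?thesis
    proof (cases "B1 = B2")
      case True
      show ?thesis
      proof (cases "B1 = B3")
        case t: True
        have "B1 = {1, 2, 3}" using b1 True t by auto
        then show ?thesis unfolding PB using True t by auto
      next
        case f: False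
        have "B1 = {1, 2}" "B3 = {3}" using b1 b3 True f by auto
        then show ?thesis unfolding PB using True by auto
      qed
    next
      case f12: False
      show ?thesis
      proof (cases "B1 = B3")
        case t: True
        have "B1 = {1, 3}" "B2 = {2}" using b1 b2 f12 t by auto
        then show ?thesis unfolding PB using t by auto
      next
        case f13: False
        then have b1': "B1 = {1}" using b1 f12 by auto
        show ?thesis
        proof (cases "B2 = B3")
          case t: True
          have "B2 = {2, 3}" using b2 f12 t by auto
          then show ?thesis unfolding PB b1' using t by auto
        next
          case f23: False
          have "B2 = {2}" "B3 = {3}" using b2 b3 f12 f13 f23 by auto
          then show ?thesis unfolding PB b1' by auto
        qed
      qed
    qed
  qed
  have prt: "partition_on {1..3} P" if "P \<in> {{{1, 2, 3}}, {{1}, {2, 3}}, {{2}, {1, 3}}, {{3}, {1, 2}}}" for P :: "nat set set"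
    using that unfolding I partition_on_def disjoint_def by auto
  have ns: "{{1}, {2}, {3}} \<notin> {{{1, 2, 3}}, {{1}, {2, 3}}, {{2}, {1, 3}}, {{3 :: nat}, {1, 2}}}" by (auto simp: insert_eq_iff)
  have im: "(\<lambda>i. {i}) ` {1..3} = {{1}, {2}, {3 :: nat}}" unfolding I by simp
  show ?thesis unfolding nontrivial_partitions_def im
  proof (intro set_eqI iffI)
    fix P assume "P \<in> {\<pi>. partition_on {1..3} \<pi> \<and> \<pi> \<noteq> {{1}, {2}, {3 :: nat}}}"
    then have "partition_on {1..3} P \<and> P \<noteq> {{1}, {2}, {3}}" by (rule CollectD)
    then have p: "partition_on {1..3} P" "P \<noteq> {{1}, {2}, {3}}" by iprover+
    from cls[OF p(1)] show "P \<in> {{{1, 2, 3}}, {{1}, {2, 3}}, {{2}, {1, 3}}, {{3}, {1, 2}}}"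
      by (rule disjE) (assumption, rule notE[OF p(2)])
  next
    fix P :: "nat set set" assume P: "P \<in> {{{1, 2, 3}}, {{1}, {2, 3}}, {{2}, {1, 3}}, {{3}, {1, 2}}}"
    have "P \<noteq> {{1}, {2}, {3}}"
    proof
      assume "P = {{1}, {2}, {3}}"
      then show False using ns P by (simp only: simp_thms)
    qed
    then show "P \<in> {\<pi>. partition_on {1..3} \<pi> \<and> \<pi> \<noteq> {{1}, {2}, {3 :: nat}}}" using prt[OF P] by (simp only: mem_Collect_eq simp_thms)
  qed
qed

lemma ser_add: "ser (\<lambda>\<mu>. f \<mu> + g \<mu>) = ser f + (ser g :: 'a::idom fps3 fract)"
proof -
  have "fps3 (\<lambda>\<mu>. f \<mu> + g \<mu>) = fps3 f + (fps3 g :: 'a fps3)"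
    by (rule fps3_eqI) (simp add: coeff3_fps3)
  then show ?thesis by (simp add: ser_eq)
qed

theorem proposition4p3:
  fixes \<kappa> :: "nat multiset \<Rightarrow> 'a::idom"
  shows
    "ser (H_coeff \<kappa> 3) =
       ser (C_coeff \<kappa> {1, 2, 3}) + ser (Ctilde_coeff \<kappa> 3)
       + ser (Cbar1_coeff \<kappa> 3 {{1}, {2, 3}})
       + ser (Cbar1_coeff \<kappa> 3 {{2}, {1, 3}})
       + ser (Cbar1_coeff \<kappa> 3 {{3}, {1, 2}})
     \<and> (\<forall>(a, b, c) \<in> {(1, 2, 3), (2, 1, 3), (3, 1, 2)}.
         ser (Cbar1_coeff \<kappa> 3 {{a}, {b, c}}) =
           Y b * Y c * partial b (partial c
             ((Y c * C2 \<kappa> a b - Y b * C2 \<kappa> a c) / (Y b * C1 \<kappa> c - Y c * C1 \<kappa> b))))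
     \<and> ser (Ctilde_coeff \<kappa> 3) =
         Y 1 * Y 2 * Y 3 * partial 1 (partial 2 (partial 3
           (((1 + Chat3 \<kappa> 1 2 3)\<^sup>2 + Chat2 \<kappa> 1 2 * Chat2 \<kappa> 1 3 * Chat2 \<kappa> 2 3 - 1)
              / ((1 - Chat2 \<kappa> 1 2) * (1 - Chat2 \<kappa> 1 3) * (1 - Chat2 \<kappa> 2 3))
            + (\<Sum>(a, b, c) \<in> {(1, 2, 3), (2, 1, 3), (3, 2, 1)}.
                 ((Y a)\<^sup>2 * partial a (1 / Y a * Chat3 \<kappa> 1 2 3))
                 / ((1 - Chat2 \<kappa> a b) * (1 - Chat2 \<kappa> a c))))))"
proof (intro conjI)
  have I: "{1..3} = {1, 2, 3::nat}" by auto
  have d: "{{1}, {2, 3}} \<noteq> {{2}, {1, 3::nat}}" "{{1}, {2, 3}} \<noteq> {{3}, {1, 2::nat}}" "{{2}, {1, 3}} \<noteq> {{3}, {1, 2::nat}}"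
    "{{1, 2, 3}} \<noteq> {{1}, {2, 3::nat}}" "{{1, 2, 3}} \<noteq> {{2}, {1, 3::nat}}" "{{1, 2, 3}} \<noteq> {{3}, {1, 2::nat}}"
    by (auto simp: insert_eq_iff)
  have b: "bip_trees {{1}, {2, 3::nat}} = {{{{1}, {2, 3}}}}" "bip_trees {{2}, {1, 3::nat}} = {{{{2}, {1, 3}}}}"
    "bip_trees {{3}, {1, 2::nat}} = {{{{3}, {1, 2}}}}"
    by (rule bip_trees_double; auto)+
  have "H_coeff \<kappa> 3 \<mu> = C_coeff \<kappa> {1, 2, 3} \<mu> + Ctilde_coeff \<kappa> 3 \<mu> + Cbar1_coeff \<kappa> 3 {{1}, {2, 3}} \<mu>
      + Cbar1_coeff \<kappa> 3 {{2}, {1, 3}} \<mu> + Cbar1_coeff \<kappa> 3 {{3}, {1, 2}} \<mu>" for \<mu>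
  proof -
    have four: "(\<Sum>\<pi>\<in>{p1, p2, p3, p4}. F \<pi>) = F p1 + F p2 + F p3 + F p4"
      if "p1 \<noteq> p2" "p1 \<noteq> p3" "p1 \<noteq> p4" "p2 \<noteq> p3" "p2 \<noteq> p4" "p3 \<noteq> p4" for p1 p2 p3 p4 :: "nat set set" and F :: "_ => 'a"
      using that by (simp add: add.assoc)
    show ?thesis
      unfolding H_coeff_def nontrivial_partitions_3 four[OF d(4-6) d(1-3)] bip_trees_single b
      unfolding I Ctilde_coeff_def Cbar1_coeff_def by (simp add: add.assoc)
  qed
  then have H: "H_coeff \<kappa> 3 = (\<lambda>\<mu>. C_coeff \<kappa> {1, 2, 3} \<mu> + Ctilde_coeff \<kappa> 3 \<mu> + Cbar1_coeff \<kappa> 3 {{1}, {2, 3}} \<mu>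
      + Cbar1_coeff \<kappa> 3 {{2}, {1, 3}} \<mu> + Cbar1_coeff \<kappa> 3 {{3}, {1, 2}} \<mu>)" by (rule ext)
  show "ser (H_coeff \<kappa> 3) =
       ser (C_coeff \<kappa> {1, 2, 3}) + ser (Ctilde_coeff \<kappa> 3)
       + ser (Cbar1_coeff \<kappa> 3 {{1}, {2, 3}})
       + ser (Cbar1_coeff \<kappa> 3 {{2}, {1, 3}})
       + ser (Cbar1_coeff \<kappa> 3 {{3}, {1, 2}})"
    unfolding H ser_add ..
  show "\<forall>(a, b, c) \<in> {(1, 2, 3), (2, 1, 3), (3, 1, 2)}.
         ser (Cbar1_coeff \<kappa> 3 {{a}, {b, c}}) =
           Y b * Y c * partial b (partial c
             ((Y c * C2 \<kappa> a b - Y b * C2 \<kappa> a c) / (Y b * C1 \<kappa> c - Y c * C1 \<kappa> b)))"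
  proof -
    \<comment> \<open>The argument is uniform in the names of the three variables, so it covers the
      permuted formulas as well.\<close>
    have "ser (Cbar1_coeff \<kappa> 3 {{a}, {b, c}}) = Y b * Y c * partial b (partial c
        ((Y c * C2 \<kappa> a b - Y b * C2 \<kappa> a c) / (Y b * C1 \<kappa> c - Y c * C1 \<kappa> b)))"
      if "G3 = {a, b, c}" "a \<noteq> b" "a \<noteq> c" "b \<noteq> c" for a b c
    proof -
      have "b \<in> G3" "c \<in> G3" unfolding that(1) by simp_all
      then show ?thesis
        unfolding annular_gf_fract[OF that, symmetric] Cbar1_ser[OF that] by (rule euler2[OF _ _ that(4), symmetric])
    qed
    moreover have "G3 = {1, 2, 3}" "G3 = {2, 1, 3}" "G3 = {3, 1, 2}" by (auto simp: G3_def)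
    ultimately show ?thesis by simp
  qed
  show "ser (Ctilde_coeff \<kappa> 3) =
         Y 1 * Y 2 * Y 3 * partial 1 (partial 2 (partial 3
           (((1 + Chat3 \<kappa> 1 2 3)\<^sup>2 + Chat2 \<kappa> 1 2 * Chat2 \<kappa> 1 3 * Chat2 \<kappa> 2 3 - 1)
              / ((1 - Chat2 \<kappa> 1 2) * (1 - Chat2 \<kappa> 1 3) * (1 - Chat2 \<kappa> 2 3))
            + (\<Sum>(a, b, c) \<in> {(1, 2, 3), (2, 1, 3), (3, 2, 1)}.
                 ((Y a)\<^sup>2 * partial a (1 / Y a * Chat3 \<kappa> 1 2 3))
                 / ((1 - Chat2 \<kappa> a b) * (1 - Chat2 \<kappa> a c))))))"
    unfolding gf_shapes[symmetric] euler3 by (rule Ctilde_ser)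
qed

end
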